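(* Let $d\in\{1,2\}$, $q\ge1$, $T>0$, $\mu\ge0$. Suppose that $\sigma\mapsto f(\sigma)/\sigma$ is a smooth bounded function satisfying $0<f(\sigma)/\sigma<L$ for some constant $L$, that $f$ and $df/d\sigma$ are bounded, and that the quadrature assumption stated in the context holds. Assume periodic boundary conditions, and let $u$ be a sufficiently smooth solution on $[0,T]$ of $$u_{tt}+\Delta^2u+u+\mu u_t+f(u)=0\quad\text{in }\Omega,$$ with $v=u_t$, $w=\Delta u$. Let $(u_h,v_h,w_h)$ be the solution of the semi-discrete scheme described in the context, with the alternating fluxes $$v_h^*=v_h^+,\quad(\nabla w_h)^*=\nabla w_h^-,\quad(\nabla v_h)^*=\nabla v_h^+,\quad w_h^*=w_h^-,$$ and with the initial data $$u_h(\cdot,0)=P_hu(\cdot,0),\quad v_h(\cdot,0)=\mathbb{P}_1u_t(\cdot,0),\quad w_h(\cdot,0)=\mathbb{P}_2\Delta u(\cdot,0).$$ Set $e_u=u-u_h$, $e_v=v-v_h$, $e_w=w-w_h$. Then there exist numbers $C_0,C_1$, independent of $h$ and depending only on $q$, the bounds of $\frac{df}{d\sigma}(\sigma)$ and $\frac{f(\sigma)}{\sigma}$, the norms $\|u\|$, $\|v\|$, $\|u_t\|$, $\|v_t\|$, $\|w_t\|$ in $L^\infty([0,T],H^{q+1}(\Omega_h))$, the norms $\|v\|$, $\|w\|$ in $L^\infty([0,T],W^{2q+4,\infty}(\Omega_h))$, and the shape regularity of the mesh (the problem data $d,\Omega,\mu$ and the constant in the quadrature assumption being fixed), such that $$\|e_u(\cdot,t)\|_{L^2(\Omega_h)}^2+\|e_v(\cdot,t)\|_{L^2(\Omega_h)}^2+\|e_w(\cdot,t)\|_{L^2(\Omega_h)}^2\le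 C_0e^{C_1t}h^{2(q+1)},\qquad\forall\,0\le t\le T.$$
   Context: **Nonlinearity.** $f:\mathbb{R}\to\mathbb{R}$ is smooth with $f(0)=0$; the quotient $f(\sigma)/\sigma$ is understood at $\sigma=0$ as its limit. **Mesh and spaces.** $\Omega\subset\mathbb{R}^d$ is an interval ($d=1$) or a rectangle ($d=2$), with opposite sides identified by periodicity, tessellated by a mesh $\Omega_h$ of shape-regular elements $K$: for $d=1$, intervals $K=(x_{j-1/2},x_{j+1/2})$; for $d=2$, rectangles $K=(x_{k-1/2},x_{k+1/2})\times(y_{j-1/2},y_{j+1/2})$ of a Cartesian grid. $h=\max_Kh_K$, $h_K$ the diameter of $K$. $V_h^q$ is the space of functions whose restriction to every $K$ belongs to $\mathcal{Q}^q(K)$, the tensor-product polynomials of degree at most $q$ in each variable (no continuity across elements). $H^l(\Omega_h)$, $W^{l,k}(\Omega_h)$ are broken (elementwise) Sobolev spaces with the corresponding norms. $\mathbf{n}$ is the outward unit normal of $\partial K$; for $d=1$, $\nabla$ is $d/dx$, $\mathbf n=\pm1$, and face integrals are point evaluations. **Traces.** Each face is shared (taking periodicity into account) by a "left" and a "right" element (left/bottom is "left", right/top is "right"). $\eta^-$ and $\eta^+$ denote the traces from the left and right element, respectively. **Quadrature assumption.** On each $K$ there is a quadrature rule with nodes $\mathbf{x}_{\mathbf{j},K}$ in $K$ and weights $\omega_{\mathbf{j},K}>0$ such that, for all $K$ and $\phi\in\mathcal{Q}^q(K)$, $\sum_{\mathbf{j}}\omega_{\mathbf{j},K}\phi^2(\mathbf{x}_{\mathbf{j},K})=\int_K\phi^2\,d\mathbf{x}$,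 and, for all $\phi\in V_h^q$ and $g\in H^{q+1}(\Omega_h)$, $\sum_K\big|\sum_{\mathbf{j}}\omega_{\mathbf{j},K}\phi(\mathbf{x}_{\mathbf{j},K})g(\mathbf{x}_{\mathbf{j},K})-\int_K\phi g\,d\mathbf{x}\big|\le Ch^{q+1}\|\phi\|_{L^2(\Omega_h)}|g|_{H^{q+1}(\Omega_h)}$ with $C$ independent of $h$. **Scheme.** Find $u_h(\cdot,t),v_h(\cdot,t),w_h(\cdot,t)\in V_h^q$ such that, for every $K$, every $\phi_u,\phi_v,\phi_w\in V_h^q$ and every $t$: $$\int_K\phi_u(u_{ht}-v_h)\,d\mathbf{x}+\sum_{\mathbf{j}}\omega_{\mathbf{j},K}\frac{f(u_h(\mathbf{x}_{\mathbf{j},K}))}{u_h(\mathbf{x}_{\mathbf{j},K})}\phi_u(\mathbf{x}_{\mathbf{j},K})\big(u_{ht}(\mathbf{x}_{\mathbf{j},K})-v_h(\mathbf{x}_{\mathbf{j},K})\big)=0,$$ $$\int_Kw_{ht}\phi_w\,d\mathbf{x}+\mathcal{B}^1_K(v_h,\phi_w)=0,$$ $$\int_Kv_{ht}\phi_v+u_h\phi_v+\mu v_h\phi_v\,d\mathbf{x}+\sum_{\mathbf{j}}\omega_{\mathbf{j},K}\phi_v(\mathbf{x}_{\mathbf{j},K})f(u_h(\mathbf{x}_{\mathbf{j},K}))+\mathcal{B}^2_K(w_h,\phi_v)=0,$$ with $$\mathcal{B}^1_K(v_h,\phi_w)=\int_K-v_h\Delta\phi_w\,d\mathbf{x}-\int_{\partial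 K}\phi_w(\nabla v_h)^*\cdot\mathbf{n}-\nabla\phi_w\cdot\mathbf{n}\,v_h^*\,dS,$$ $$\mathcal{B}^2_K(w_h,\phi_v)=\int_Kw_h\Delta\phi_v\,d\mathbf{x}-\int_{\partial K}\nabla\phi_v\cdot\mathbf{n}\,w_h^*-\phi_v(\nabla w_h)^*\cdot\mathbf{n}\,dS.$$ **Projections.** $P_h$ is the $L^2$-projection onto $V_h^q$. For $d=1$, the Gauss–Radau projections $P_h^\pm$ into $V_h^q$ are defined on each $K=(x_{j-1/2},x_{j+1/2})$ by $\int_K(P_h^\pm u-u)\phi\,dx=0$ for all $\phi\in\mathcal{P}^{q-2}(K)$ (polynomials of degree at most $q-2$; this condition is void if $q=1$), together with $P_h^+u(x_{j-1/2}^+)=u(x_{j-1/2})$, $(P_h^+u)_x(x_{j-1/2}^+)=u_x(x_{j-1/2})$ for $P_h^+$, and $P_h^-u(x_{j+1/2}^-)=u(x_{j+1/2})$, $(P_h^-u)_x(x_{j+1/2}^-)=u_x(x_{j+1/2})$ for $P_h^-$. For $d=2$, $\Pi_h^\pm=P_{hx}^\pm\otimes P_{hy}^\pm$ is the tensor product of the one-dimensional projections in $x$ and $y$. Finally $(\mathbb{P}_1,\mathbb{P}_2)=(P_h^+,P_h^-)$ if $d=1$ and $(\mathbb{P}_1,\mathbb{P}_2)=(\Pi_h^+,\Pi_h^-)$ if $d=2$. "Sufficiently smooth" means in particular that all the norms of $u,v,w$ and their time derivatives listed in the claim are finite. *)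

theory Defs
  imports
    "HOL-Analysis.Analysis"
    "HOL-Probability.Essential_Supremum"
    "HOL-Computational_Algebra.Polynomial"
begin

text \<open>
  The space is \<^typ>\<open>real ^ 'n\<close>; the one- and the two-dimensional setting are the cases
  \<open>CARD('n) = 1\<close> and \<open>CARD('n) = 2\<close>.  The domain is \<open>box a b\<close> with opposite sides identified, so
  functions on it are functions on the whole space that are periodic with the side lengths of the
  box as periods.
\<close>

section \<open>Derivatives\<close>

definition pd :: "'n::finite \<Rightarrow> (real ^ 'n \<Rightarrow> real) \<Rightarrow> real ^ 'n \<Rightarrow> real" where
  "pd i g x = deriv (\<lambda>s. g (x + s *\<^sub>R axis i 1)) 0"

text \<open>An enumeration of the coordinates.  It fixes an order of differentiations and of
  one-dimensional projections that commute on the smooth functions they are applied to.\<close>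

definition coords :: "'n::finite list" where
  "coords = (SOME is. distinct is \<and> set is = UNIV)"

primrec pds :: "'n::finite list \<Rightarrow> (real ^ 'n \<Rightarrow> real) \<Rightarrow> real ^ 'n \<Rightarrow> real" where
  "pds [] g = g"
| "pds (i # is) g = pd i (pds is g)"

definition lap :: "(real ^ 'n::finite \<Rightarrow> real) \<Rightarrow> real ^ 'n \<Rightarrow> real" where
  "lap g x = (\<Sum>i\<in>UNIV. pd i (pd i g) x)"

text \<open>The time derivative on \<open>[0,T]\<close> is one-sided at the end points.\<close>

definition dt :: "real \<Rightarrow> (real \<Rightarrow> 'a \<Rightarrow> real) \<Rightarrow> real \<Rightarrow> 'a \<Rightarrow> real" where
  "dt T g t x = vector_derivative (\<lambda>s. g s x) (at t within {0..T})"

definition t_differentiable :: "real \<Rightarrow> 'a set \<Rightarrow> (real \<Rightarrow> 'a \<Rightarrow> real) \<Rightarrow> bool" where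
  "t_differentiable T S g \<longleftrightarrow>
     (\<forall>t\<in>{0..T}. \<forall>x\<in>S. (\<lambda>s. g s x) differentiable (at t within {0..T}))"

text \<open>All spatial partial derivatives of order at most \<open>k\<close> exist and are jointly continuous in
  \<open>(t,x)\<close>.\<close>

definition spatial_C :: "real \<Rightarrow> nat \<Rightarrow> (real \<Rightarrow> real ^ 'n::finite \<Rightarrow> real) \<Rightarrow> bool" where
  "spatial_C T k g \<longleftrightarrow>
     (\<forall>is. length is \<le> k \<longrightarrow>
        continuous_on ({0..T} \<times> UNIV) (\<lambda>(t, x). pds is (g t) x)) \<and>
     (\<forall>is. length is < k \<longrightarrow>
        (\<forall>t\<in>{0..T}. \<forall>x i. (\<lambda>s. pds is (g t) (x + s *\<^sub>R axis i 1)) differentiable (at 0)))"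

definition smooth_real :: "(real \<Rightarrow> real) \<Rightarrow> bool" where
  "smooth_real g \<longleftrightarrow> (\<forall>n x. (deriv ^^ n) g differentiable (at x))"

definition fquot :: "(real \<Rightarrow> real) \<Rightarrow> real \<Rightarrow> real" where
  "fquot f s = (if s = 0 then Lim (at 0) (\<lambda>r. f r / r) else f s / s)"

section \<open>Meshes and discrete spaces\<close>

text \<open>An element is represented by its lower and its upper corner.\<close>

type_synonym 'n elem = "(real ^ 'n) \<times> (real ^ 'n)"

definition cell :: "'n::finite elem \<Rightarrow> (real ^ 'n) set" where
  "cell K = box (fst K) (snd K)"

definition cartesian_mesh ::
    "real ^ 'n::finite \<Rightarrow> real ^ 'n \<Rightarrow> 'n elem set \<Rightarrow> bool" where
  "cartesian_mesh a b \<T> \<longleftrightarrow>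
     (\<exists>(N :: 'n \<Rightarrow> nat) (X :: 'n \<Rightarrow> nat \<Rightarrow> real).
        (\<forall>i. N i > 0 \<and> X i 0 = a $ i \<and> X i (N i) = b $ i \<and> (\<forall>j < N i. X i j < X i (Suc j))) \<and>
        \<T> = {(\<chi> i. X i (k i), \<chi> i. X i (Suc (k i))) | k. \<forall>i. k i < N i})"

definition mesh_size :: "'n::finite elem set \<Rightarrow> real" where
  "mesh_size \<T> = Max ((\<lambda>K. diameter (cell K)) ` \<T>)"

text \<open>The largest ball inside a box has the smallest side length as its diameter.\<close>

definition shape_regular :: "real \<Rightarrow> 'n::finite elem set \<Rightarrow> bool" where
  "shape_regular \<rho> \<T> \<longleftrightarrow> (\<forall>K\<in>\<T>. \<forall>i. diameter (cell K) \<le> \<rho> * (snd K $ i - fst K $ i))"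

definition periodic ::
    "real ^ 'n::finite \<Rightarrow> real ^ 'n \<Rightarrow> (real ^ 'n \<Rightarrow> real) \<Rightarrow> bool" where
  "periodic a b g \<longleftrightarrow> (\<forall>x i. g (x + (b $ i - a $ i) *\<^sub>R axis i 1) = g x)"

definition Qpoly :: "nat \<Rightarrow> (real ^ 'n::finite \<Rightarrow> real) set" where
  "Qpoly q = {p. \<exists>c :: ('n \<Rightarrow> nat) \<Rightarrow> real.
     \<forall>x. p x = (\<Sum>\<alpha> | \<forall>i. \<alpha> i \<le> q. c \<alpha> * (\<Prod>i\<in>UNIV. x $ i ^ \<alpha> i))}"

text \<open>The values of a discrete function on the mesh skeleton are irrelevant and left arbitrary.\<close>

definition Vh ::
    "real ^ 'n::finite \<Rightarrow> real ^ 'n \<Rightarrow> 'n elem set \<Rightarrow> nat \<Rightarrow> (real ^ 'n \<Rightarrow> real) set" where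
  "Vh a b \<T> q = {\<phi>. periodic a b \<phi> \<and> (\<forall>K\<in>\<T>. \<exists>p\<in>Qpoly q. \<forall>x\<in>cell K. \<phi> x = p x)}"

section \<open>Broken Sobolev spaces\<close>

definition mi_order :: "('n::finite \<Rightarrow> nat) \<Rightarrow> nat" where
  "mi_order \<alpha> = (\<Sum>i\<in>UNIV. \<alpha> i)"

definition mi_deriv ::
    "('n::finite \<Rightarrow> nat) \<Rightarrow> (real ^ 'n \<Rightarrow> real) \<Rightarrow> real ^ 'n \<Rightarrow> real" where
  "mi_deriv \<alpha> = pds (concat (map (\<lambda>i. replicate (\<alpha> i) i) coords))"

definition test_function :: "(real ^ 'n::finite) set \<Rightarrow> (real ^ 'n \<Rightarrow> real) \<Rightarrow> bool" where
  "test_function S \<phi> \<longleftrightarrow>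
     (\<forall>is x. pds is \<phi> differentiable (at x)) \<and>
     (\<exists>C. compact C \<and> C \<subseteq> S \<and> (\<forall>x. x \<notin> C \<longrightarrow> \<phi> x = 0))"

definition locally_integrable :: "(real ^ 'n::finite) set \<Rightarrow> (real ^ 'n \<Rightarrow> real) \<Rightarrow> bool" where
  "locally_integrable S g \<longleftrightarrow> (\<forall>C. compact C \<and> C \<subseteq> S \<longrightarrow> set_integrable lebesgue C g)"

definition has_weak_deriv :: "(real ^ 'n::finite) set \<Rightarrow> ('n \<Rightarrow> nat) \<Rightarrow>
    (real ^ 'n \<Rightarrow> real) \<Rightarrow> (real ^ 'n \<Rightarrow> real) \<Rightarrow> bool" where
  "has_weak_deriv S \<alpha> g g' \<longleftrightarrow>
     locally_integrable S g \<and> locally_integrable S g' \<and>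
     (\<forall>\<phi>. test_function S \<phi> \<longrightarrow>
        (LINT x:S|lebesgue. g x * mi_deriv \<alpha> \<phi> x) =
          (- 1) ^ mi_order \<alpha> * (LINT x:S|lebesgue. g' x * \<phi> x))"

text \<open>Weak derivatives are unique almost everywhere; the norms do not depend on the choice made
  here.\<close>

definition wderiv :: "(real ^ 'n::finite) set \<Rightarrow> ('n \<Rightarrow> nat) \<Rightarrow>
    (real ^ 'n \<Rightarrow> real) \<Rightarrow> real ^ 'n \<Rightarrow> real" where
  "wderiv S \<alpha> g = (SOME g'. has_weak_deriv S \<alpha> g g')"

definition broken_H :: "'n::finite elem set \<Rightarrow> nat \<Rightarrow> (real ^ 'n \<Rightarrow> real) set" where
  "broken_H \<T> l = {g. \<forall>K\<in>\<T>. \<forall>\<alpha>. mi_order \<alpha> \<le> l \<longrightarrow>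
     (\<exists>g'. has_weak_deriv (cell K) \<alpha> g g' \<and> set_integrable lebesgue (cell K) (\<lambda>x. (g' x)\<^sup>2))}"

definition H_norm :: "'n::finite elem set \<Rightarrow> nat \<Rightarrow> (real ^ 'n \<Rightarrow> real) \<Rightarrow> real" where
  "H_norm \<T> l g = sqrt (\<Sum>K\<in>\<T>. \<Sum>\<alpha> | mi_order \<alpha> \<le> l.
     (LINT x:cell K|lebesgue. (wderiv (cell K) \<alpha> g x)\<^sup>2))"

definition H_seminorm :: "'n::finite elem set \<Rightarrow> nat \<Rightarrow> (real ^ 'n \<Rightarrow> real) \<Rightarrow> real" where
  "H_seminorm \<T> l g = sqrt (\<Sum>K\<in>\<T>. \<Sum>\<alpha> | mi_order \<alpha> = l.
     (LINT x:cell K|lebesgue. (wderiv (cell K) \<alpha> g x)\<^sup>2))"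

definition broken_Winf :: "'n::finite elem set \<Rightarrow> nat \<Rightarrow> (real ^ 'n \<Rightarrow> real) set" where
  "broken_Winf \<T> l = {g. \<forall>K\<in>\<T>. \<forall>\<alpha>. mi_order \<alpha> \<le> l \<longrightarrow>
     (\<exists>g' c. has_weak_deriv (cell K) \<alpha> g g' \<and> (AE x in lebesgue_on (cell K). \<bar>g' x\<bar> \<le> c))}"

definition Winf_norm :: "'n::finite elem set \<Rightarrow> nat \<Rightarrow> (real ^ 'n \<Rightarrow> real) \<Rightarrow> real" where
  "Winf_norm \<T> l g = (MAX K\<in>\<T>. MAX \<alpha>\<in>{\<alpha>. mi_order \<alpha> \<le> l}.
     real_of_ereal (esssup (lebesgue_on (cell K)) (\<lambda>x. ereal \<bar>wderiv (cell K) \<alpha> g x\<bar>)))"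

definition L2_norm_h :: "'n::finite elem set \<Rightarrow> (real ^ 'n \<Rightarrow> real) \<Rightarrow> real" where
  "L2_norm_h \<T> g = sqrt (\<Sum>K\<in>\<T>. (LINT x:cell K|lebesgue. (g x)\<^sup>2))"

text \<open>The norm of \<open>g\<close> in \<open>L\<^sup>\<infinity>([0,T], S)\<close>, where \<open>nrm\<close> is the norm of \<open>S\<close>, is finite and at most
  \<open>B\<close>.\<close>

definition Linf_le ::
    "real \<Rightarrow> ('a \<Rightarrow> real) set \<Rightarrow> (('a \<Rightarrow> real) \<Rightarrow> real) \<Rightarrow> (real \<Rightarrow> 'a \<Rightarrow> real) \<Rightarrow> real \<Rightarrow> bool" where
  "Linf_le T S nrm g B \<longleftrightarrow>
     (\<forall>t\<in>{0..T}. g t \<in> S) \<and> (AE t in lebesgue_on {0..T}. nrm (g t) \<le> B)"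

section \<open>Quadrature\<close>

text \<open>The rule on the element \<open>K\<close> has \<open>m K\<close> nodes \<open>X K j\<close> with weights \<open>\<omega> K j\<close>.  As \<open>q + 1\<close>
  exceeds half the dimension, the members of \<open>broken_H \<T> (q + 1)\<close> have representatives that are
  continuous on each element; point values refer to these representatives.\<close>

definition quad :: "('e \<Rightarrow> nat) \<Rightarrow> ('e \<Rightarrow> nat \<Rightarrow> 'a) \<Rightarrow> ('e \<Rightarrow> nat \<Rightarrow> real) \<Rightarrow>
    'e \<Rightarrow> ('a \<Rightarrow> real) \<Rightarrow> real" where
  "quad m X \<omega> K g = (\<Sum>j<m K. \<omega> K j * g (X K j))"

definition quadrature_assumption ::
    "real ^ 'n::finite \<Rightarrow> real ^ 'n \<Rightarrow> 'n elem set \<Rightarrow> nat \<Rightarrow> real \<Rightarrow>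
     ('n elem \<Rightarrow> nat) \<Rightarrow> ('n elem \<Rightarrow> nat \<Rightarrow> real ^ 'n) \<Rightarrow> ('n elem \<Rightarrow> nat \<Rightarrow> real) \<Rightarrow> bool" where
  "quadrature_assumption a b \<T> q C m X \<omega> \<longleftrightarrow>
     (\<forall>K\<in>\<T>. \<forall>j<m K. X K j \<in> cell K \<and> \<omega> K j > 0) \<and>
     (\<forall>K\<in>\<T>. \<forall>\<phi>\<in>Qpoly q.
        quad m X \<omega> K (\<lambda>x. (\<phi> x)\<^sup>2) = (LINT x:cell K|lebesgue. (\<phi> x)\<^sup>2)) \<and>
     (\<forall>\<phi>\<in>Vh a b \<T> q. \<forall>g\<in>broken_H \<T> (q + 1). (\<forall>K\<in>\<T>. continuous_on (cell K) g) \<longrightarrow>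
        (\<Sum>K\<in>\<T>. \<bar>quad m X \<omega> K (\<lambda>x. \<phi> x * g x) - (LINT x:cell K|lebesgue. \<phi> x * g x)\<bar>)
          \<le> C * mesh_size \<T> ^ (q + 1) * L2_norm_h \<T> \<phi> * H_seminorm \<T> (q + 1) g)"

section \<open>The scheme\<close>

text \<open>At a point of a face orthogonal to the \<open>i\<close>-th axis, \<open>tr 1 i\<close> is the trace from the right
  (upper) and \<open>tr (-1) i\<close> the trace from the left (lower) element.  If \<open>n = 1\<close> or \<open>n = -1\<close> and the
  outward normal of an element is \<open>n\<close> times the \<open>i\<close>-th unit vector, then \<open>tr (-n) i\<close> is the trace
  from inside this element.\<close>

definition tr :: "real \<Rightarrow> 'n::finite \<Rightarrow> (real ^ 'n \<Rightarrow> real) \<Rightarrow> real ^ 'n \<Rightarrow> real" where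
  "tr s i \<eta> x = Lim (at_right 0) (\<lambda>\<epsilon>. \<eta> (x + (s * \<epsilon>) *\<^sub>R axis i 1))"

text \<open>Integral over the face of \<open>K\<close> with outward normal \<open>n\<close> times the \<open>i\<close>-th unit vector, with
  respect to Lebesgue measure in the remaining coordinates; in dimension one no coordinate remains
  and this is the evaluation at the end point.\<close>

definition face_int :: "'n elem \<Rightarrow> 'n::finite \<Rightarrow> real \<Rightarrow> (real ^ 'n \<Rightarrow> real) \<Rightarrow> real" where
  "face_int K i n g =
     (LINT y:(\<Pi>\<^sub>E j\<in>UNIV - {i}. {fst K $ j <..< snd K $ j})|(\<Pi>\<^sub>M j\<in>UNIV - {i}. lborel).
        g (\<chi> j. if j = i then (if n = 1 then snd K $ i else fst K $ i) else y j))"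

definition bdry_int ::
    "'n::finite elem \<Rightarrow> ('n \<Rightarrow> real \<Rightarrow> real ^ 'n \<Rightarrow> real) \<Rightarrow> real" where
  "bdry_int K F = (\<Sum>i\<in>UNIV. \<Sum>n\<in>{-1, 1}. face_int K i n (F i n))"

text \<open>The fluxes \<open>vs\<close>, \<open>ws\<close> and \<open>gs\<close> are given separately for each face direction \<open>i\<close>, and
  \<open>gs i\<close> is the \<open>i\<close>-th component of the gradient flux.\<close>

definition B1 :: "'n::finite elem \<Rightarrow> (real ^ 'n \<Rightarrow> real) \<Rightarrow> (real ^ 'n \<Rightarrow> real) \<Rightarrow>
    ('n \<Rightarrow> real ^ 'n \<Rightarrow> real) \<Rightarrow> ('n \<Rightarrow> real ^ 'n \<Rightarrow> real) \<Rightarrow> real" where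
  "B1 K v \<phi> vs gs =
     (LINT x:cell K|lebesgue. - v x * lap \<phi> x)
     - bdry_int K (\<lambda>i n x. tr (- n) i \<phi> x * (gs i x * n) - tr (- n) i (pd i \<phi>) x * n * vs i x)"

definition B2 :: "'n::finite elem \<Rightarrow> (real ^ 'n \<Rightarrow> real) \<Rightarrow> (real ^ 'n \<Rightarrow> real) \<Rightarrow>
    ('n \<Rightarrow> real ^ 'n \<Rightarrow> real) \<Rightarrow> ('n \<Rightarrow> real ^ 'n \<Rightarrow> real) \<Rightarrow> real" where
  "B2 K w \<phi> ws gs =
     (LINT x:cell K|lebesgue. w x * lap \<phi> x)
     - bdry_int K (\<lambda>i n x. tr (- n) i (pd i \<phi>) x * n * ws i x - tr (- n) i \<phi> x * (gs i x * n))"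

definition dg_scheme ::
    "real ^ 'n::finite \<Rightarrow> real ^ 'n \<Rightarrow> real \<Rightarrow> real \<Rightarrow> (real \<Rightarrow> real) \<Rightarrow> 'n elem set \<Rightarrow> nat \<Rightarrow>
     ('n elem \<Rightarrow> nat) \<Rightarrow> ('n elem \<Rightarrow> nat \<Rightarrow> real ^ 'n) \<Rightarrow> ('n elem \<Rightarrow> nat \<Rightarrow> real) \<Rightarrow>
     (real \<Rightarrow> real ^ 'n \<Rightarrow> real) \<Rightarrow> (real \<Rightarrow> real ^ 'n \<Rightarrow> real) \<Rightarrow> (real \<Rightarrow> real ^ 'n \<Rightarrow> real) \<Rightarrow> bool"
  where
  "dg_scheme a b T \<mu> f \<T> q m X \<omega> uh vh wh \<longleftrightarrow>
     (\<forall>t\<in>{0..T}. uh t \<in> Vh a b \<T> q \<and> vh t \<in> Vh a b \<T> q \<and> wh t \<in> Vh a b \<T> q) \<and>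
     t_differentiable T (\<Union>K\<in>\<T>. cell K) uh \<and>
     t_differentiable T (\<Union>K\<in>\<T>. cell K) vh \<and>
     t_differentiable T (\<Union>K\<in>\<T>. cell K) wh \<and>
     (\<forall>t\<in>{0..T}. \<forall>K\<in>\<T>. \<forall>\<phi>u\<in>Vh a b \<T> q. \<forall>\<phi>v\<in>Vh a b \<T> q. \<forall>\<phi>w\<in>Vh a b \<T> q.
        (LINT x:cell K|lebesgue. \<phi>u x * (dt T uh t x - vh t x))
          + quad m X \<omega> K (\<lambda>x. fquot f (uh t x) * \<phi>u x * (dt T uh t x - vh t x)) = 0 \<and>
        (LINT x:cell K|lebesgue. dt T wh t x * \<phi>w x)
          + B1 K (vh t) \<phi>w (\<lambda>i. tr 1 i (vh t)) (\<lambda>i. tr 1 i (pd i (vh t))) = 0 \<and>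
        (LINT x:cell K|lebesgue. dt T vh t x * \<phi>v x + uh t x * \<phi>v x + \<mu> * vh t x * \<phi>v x)
          + quad m X \<omega> K (\<lambda>x. \<phi>v x * f (uh t x))
          + B2 K (wh t) \<phi>v (\<lambda>i. tr (- 1) i (wh t)) (\<lambda>i. tr (- 1) i (pd i (wh t))) = 0)"

section \<open>Projections\<close>

definition is_L2_projection ::
    "real ^ 'n::finite \<Rightarrow> real ^ 'n \<Rightarrow> 'n elem set \<Rightarrow> nat \<Rightarrow>
     (real ^ 'n \<Rightarrow> real) \<Rightarrow> (real ^ 'n \<Rightarrow> real) \<Rightarrow> bool" where
  "is_L2_projection a b \<T> q g p \<longleftrightarrow>
     p \<in> Vh a b \<T> q \<and>
     (\<forall>\<phi>\<in>Vh a b \<T> q. (\<Sum>K\<in>\<T>. (LINT x:cell K|lebesgue. (p x - g x) * \<phi> x)) = 0)"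

text \<open>The one-dimensional Gauss--Radau projection on \<open>(lo,hi)\<close>, with the point conditions at
  \<open>e = lo\<close> for \<open>P\<^sub>h\<^sup>+\<close> and at \<open>e = hi\<close> for \<open>P\<^sub>h\<^sup>-\<close>.  The bound \<open>degree r + 2 \<le> q\<close> makes the
  orthogonality condition void for \<open>q = 1\<close>, which \<open>degree r \<le> q - 2\<close> on the naturals would not.\<close>

definition radau :: "nat \<Rightarrow> real \<Rightarrow> real \<Rightarrow> real \<Rightarrow> (real \<Rightarrow> real) \<Rightarrow> real poly" where
  "radau q lo hi e g = (THE p. degree p \<le> q \<and>
     (\<forall>r. degree r + 2 \<le> q \<longrightarrow> (LINT s:{lo<..<hi}|lebesgue. (poly p s - g s) * poly r s) = 0) \<and>
     poly p e = g e \<and> poly (pderiv p) e = deriv g e)"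

text \<open>The projection on the element \<open>K\<close> acting in the \<open>i\<close>-th coordinate only; it is \<open>P\<^sub>h\<^sup>+\<close> if
  \<open>lower\<close> holds and \<open>P\<^sub>h\<^sup>-\<close> otherwise.\<close>

definition radau_dir ::
    "bool \<Rightarrow> nat \<Rightarrow> 'n elem \<Rightarrow> 'n::finite \<Rightarrow> (real ^ 'n \<Rightarrow> real) \<Rightarrow> real ^ 'n \<Rightarrow> real" where
  "radau_dir lower q K i g x =
     poly (radau q (fst K $ i) (snd K $ i) (if lower then fst K $ i else snd K $ i)
       (\<lambda>s. g (\<chi> j. if j = i then s else x $ j))) (x $ i)"

definition tensor_radau ::
    "bool \<Rightarrow> nat \<Rightarrow> 'n::finite elem \<Rightarrow> (real ^ 'n \<Rightarrow> real) \<Rightarrow> real ^ 'n \<Rightarrow> real" where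
  "tensor_radau lower q K g = foldr (radau_dir lower q K) coords g"

section \<open>The problem\<close>

text \<open>\<open>M\<close> bounds the derivative of the nonlinearity and \<open>L\<close> its quotient.\<close>

definition nonlinearity :: "real \<Rightarrow> real \<Rightarrow> (real \<Rightarrow> real) \<Rightarrow> bool" where
  "nonlinearity L M f \<longleftrightarrow>
     smooth_real f \<and> f 0 = 0 \<and> smooth_real (fquot f) \<and>
     (\<forall>\<sigma>. 0 < fquot f \<sigma> \<and> fquot f \<sigma> < L) \<and>
     bounded (range f) \<and> (\<forall>\<sigma>. \<bar>deriv f \<sigma>\<bar> \<le> M)"

text \<open>Classical periodic solutions.  The required orders of differentiability of \<open>u\<close>, \<open>u\<^sub>t\<close> and
  \<open>u\<^sub>t\<^sub>t\<close> are those that make \<open>u\<close>, \<open>u\<^sub>t\<close>, \<open>u\<^sub>t\<^sub>t\<close> and \<open>\<Delta>u\<^sub>t\<close> members of \<open>H\<close> of order \<open>q + 1\<close> and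
  \<open>u\<^sub>t\<close>, \<open>\<Delta>u\<close> members of \<open>W\<close> of order \<open>2q + 4\<close> with exponent infinity.\<close>

definition smooth_solution ::
    "real ^ 'n::finite \<Rightarrow> real ^ 'n \<Rightarrow> real \<Rightarrow> real \<Rightarrow> (real \<Rightarrow> real) \<Rightarrow> nat \<Rightarrow>
     (real \<Rightarrow> real ^ 'n \<Rightarrow> real) \<Rightarrow> bool" where
  "smooth_solution a b T \<mu> f q u \<longleftrightarrow>
     (\<forall>t\<in>{0..T}. periodic a b (u t)) \<and>
     t_differentiable T UNIV u \<and> t_differentiable T UNIV (dt T u) \<and>
     spatial_C T (2 * q + 6) u \<and> spatial_C T (2 * q + 4) (dt T u) \<and>
     spatial_C T (q + 1) (dt T (dt T u)) \<and>
     (\<forall>t\<in>{0..T}. \<forall>x.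
        dt T (dt T u) t x + lap (lap (u t)) x + u t x + \<mu> * dt T u t x + f (u t x) = 0)"

end

theory Submission
  imports Defs
begin

text \<open>
  At the quadrature nodes the first equation of the scheme reduces to \<open>u\<^sub>h\<^sub>t = v\<^sub>h\<close>.  Hence the energy
  that measures \<open>u - u\<^sub>h\<close> by quadrature, together with the squared norms of \<open>\<Pi>\<^sup>+ z - v\<^sub>h\<close> and
  \<open>\<Pi>\<^sup>- w - w\<^sub>h\<close>, can be differentiated in time.  With the alternating fluxes the form of the second
  equation is skew to that of the third one, so the discrete parts cancel, and on a Cartesian mesh the
  forms applied to \<open>\<Pi>\<^sup>\<plusminus>\<close> are the second derivatives projected in the other direction only, which is
  a consistency error of order \<open>h\<^sup>q\<^sup>+\<^sup>1\<close>.

  Here \<open>z\<close> is not \<open>v\<close>: the norm of \<open>v\<^sub>t\<close> in \<open>H\<close> of order \<open>q + 1\<close> does not control \<open>\<Pi>\<^sup>+ v\<^sub>t - v\<^sub>t\<close>.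
  Instead \<open>z = (u(t + \<tau>) - u(t)) / \<tau>\<close> with \<open>\<tau> = h\<^sup>q\<^sup>+\<^sup>1\<close>.  The only contribution to \<open>\<Pi>\<^sup>+ z\<^sub>t - z\<^sub>t\<close> that
  needs more derivatives of \<open>v\<close> is the product of the two one-dimensional projection errors, of order
  \<open>h\<^sup>2\<^sup>q\<^sup>+\<^sup>2 / \<tau>\<close>.  On the last window of length \<open>\<tau>\<close>, where the quotient is not defined, \<open>z\<close> is frozen in
  time; the residual is then only bounded, but Gronwall's inequality with the rate \<open>1 / \<tau>\<close> turns it
  into an error of order \<open>\<tau>\<close>.  The bounds of \<open>u\<close> needed for its Taylor approximation, of order
  \<open>q + 1\<close> and higher, follow from those of \<open>\<Delta>u\<close>.
\<close>

text \<open>Two restrictions on the constants shape the argument. They may depend on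
  \<open>f\<close> only through the bounds of its derivative and of its quotient, so the seminorm of
  f(u) of order q + 1, which the quadrature error asks for, is out of reach; the equation expresses
  u + f(u) as - u_tt - \<Delta>w - \<mu> u_t, whose derivatives are controlled. Likewise, increments
  of u_tt in time are read off from the equation. Moreover the constants are chosen before
  \<open>T\<close>, so time may enter only through the exponential.

  The choice \<tau> = h^(q+1) balances two errors: z differs from v by O(\<tau>), and the mixed
  projection error of z_t is O(h^(2q+2) / \<tau>). The rate 1 / \<tau> on the last window costs only
  a factor e, as the window has length at most \<tau>.

  The error of u is measured at the nodes because \<open>f\<close> enters the scheme only there and
  its Lipschitz bound is applied pointwise. Since u is no polynomial, the passage between nodal sums
  and integrals goes through a Taylor polynomial on each element: differences of polynomials are
  integrated exactly.\<close>

definition pt :: "'n::finite \<Rightarrow> ('n \<Rightarrow> real) \<Rightarrow> real \<Rightarrow> real ^ 'n" where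
  "pt i y s = (\<chi> j. if j = i then s else y j)"

text \<open>Lines parallel to an axis occur in two forms. Faces are integrated over a product
  measure whose points are functions on the remaining coordinates, which is the form
  \<open>pt\<close>; lines through a given point of the space use \<open>upd\<close>.\<close>

definition upd :: "real ^ 'n::finite \<Rightarrow> 'n \<Rightarrow> real \<Rightarrow> real ^ 'n" where
  "upd x i s = (\<chi> j. if j = i then s else x $ j)"

lemma pt_nth [simp]: "pt i y s $ j = (if j = i then s else y j)"
  by (simp add: pt_def)

lemma upd_nth [simp]: "upd x i s $ j = (if j = i then s else x $ j)"
  by (simp add: upd_def)

lemma upd_pt [simp]: "upd (pt i y s) i r = pt i y r"
  by (simp add: vec_eq_iff)

lemma upd_upd [simp]: "upd (upd x i s) i r = upd x i r"
  by (simp add: vec_eq_iff)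

lemma upd_same [simp]: "upd x i (x $ i) = x"
  by (simp add: vec_eq_iff)

lemma upd_commute: "i \<noteq> j \<Longrightarrow> upd (upd x i s) j r = upd (upd x j r) i s"
  by (auto simp: vec_eq_iff)

lemma upd_add_axis_same [simp]: "upd (x + h *\<^sub>R axis i 1) i s = upd x i s"
  by (simp add: vec_eq_iff axis_def)

lemma add_axis_upd: "x + h *\<^sub>R axis i 1 = upd x i (x $ i + h)"
  by (simp add: vec_eq_iff axis_def)

lemma axis_nth' [simp]: "(x + h *\<^sub>R axis i 1) $ j = (if j = i then x $ i + h else x $ j)"
  by (simp add: axis_def)

lemma pt_add_axis: "pt i y s + h *\<^sub>R axis i 1 = pt i y (s + h)"
  by (simp add: vec_eq_iff axis_def)

lemma mem_box_vec: "x \<in> box l u \<longleftrightarrow> (\<forall>i. l $ i < x $ i \<and> x $ i < u $ i)"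
  for x :: "real ^ 'n::finite"
  by (auto simp: mem_box_cart)

lemma mem_cbox_vec: "x \<in> cbox l u \<longleftrightarrow> (\<forall>i. l $ i \<le> x $ i \<and> x $ i \<le> u $ i)"
  for x :: "real ^ 'n::finite"
  by (auto simp: mem_box_cart)

lemma continuous_on_upd [continuous_intros]:
  fixes f :: "'a::topological_space \<Rightarrow> real ^ 'n::finite"
  assumes "continuous_on S f" "continuous_on S g"
  shows "continuous_on S (\<lambda>z. upd (f z) i (g z))"
  unfolding upd_def
  apply (rule continuous_on_vec_lambda)
  subgoal for j by (cases "j = i") (use assms in \<open>auto intro!: continuous_intros\<close>)
  done

lemma continuous_on_pt [continuous_intros]:
  assumes "continuous_on S g"
  shows "continuous_on S (\<lambda>z. pt i y (g z))"
  unfolding pt_def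
  apply (rule continuous_on_vec_lambda)
  subgoal for j by (cases "j = i") (use assms in \<open>auto intro!: continuous_intros\<close>)
  done

section \<open>Lebesgue measure as a product measure; Fubini's theorem for lines and faces\<close>

interpretation lborel_prod: product_sigma_finite "\<lambda>_::'n::finite. lborel :: real measure"
  by standard

lemma measurable_vec_lambda_borel [measurable]:
  "(\<lambda>f. \<chi> i. f i) \<in> (\<Pi>\<^sub>M i\<in>(UNIV::'n::finite set). lborel) \<rightarrow>\<^sub>M (borel :: (real ^ 'n) measure)"
proof (subst borel_measurable_euclidean_space, intro ballI)
  fix b :: "real ^ 'n" assume "b \<in> Basis"
  then obtain j where b: "b = axis j 1" by (auto simp: Basis_vec_def)
  have "(\<lambda>f. f j) \<in> (\<Pi>\<^sub>M i\<in>(UNIV::'n set). lborel) \<rightarrow>\<^sub>M (lborel :: real measure)"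
    by (rule measurable_component_singleton) simp
  then show "(\<lambda>f. (\<chi> i. f i) \<bullet> b) \<in> borel_measurable (\<Pi>\<^sub>M i\<in>(UNIV::'n set). (lborel::real measure))"
    by (simp add: b inner_axis)
qed

text \<open>Both measures give every box the product of its side lengths, and this determines
  Lebesgue measure. It is the bridge between \<open>face_int\<close>, defined by a product measure
  on functions, and volume integrals over vectors.\<close>

lemma lborel_vec:
  "distr (\<Pi>\<^sub>M i\<in>(UNIV::'n::finite set). lborel) borel (\<lambda>f. \<chi> i. f i) = (lborel :: (real ^ 'n) measure)"
proof (rule lborel_eqI[symmetric])
  fix l u :: "real ^ 'n" assume le: "\<And>b. b \<in> Basis \<Longrightarrow> l \<bullet> b \<le> u \<bullet> b"
  have le': "l $ i \<le> u $ i" for i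
    using le[of "axis i 1"] by (simp add: inner_axis axis_in_Basis_iff)
  have "emeasure (distr (\<Pi>\<^sub>M i\<in>(UNIV::'n set). lborel) borel (\<lambda>f. \<chi> i. f i)) (box l u)
     = emeasure (\<Pi>\<^sub>M i\<in>(UNIV::'n set). lborel) (Pi\<^sub>E UNIV (\<lambda>i. {l $ i <..< u $ i}))"
    by (subst emeasure_distr) (auto intro!: arg_cong2[where f=emeasure]
       simp: space_PiM mem_box_vec PiE_def Pi_def)
  also have "\<dots> = (\<Prod>i\<in>UNIV. emeasure lborel {l $ i <..< u $ i})"
    by (rule lborel_prod.emeasure_PiM) auto
  also have "\<dots> = ennreal (\<Prod>i\<in>UNIV. u $ i - l $ i)"
    using le' by (simp add: prod_ennreal)
  also have "(\<Prod>i\<in>UNIV. u $ i - l $ i) = (\<Prod>b\<in>Basis. (u - l) \<bullet> b)"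
    unfolding Basis_vec_def
    by (subst prod.UNION_disjoint) (auto simp: axis_eq_axis inner_axis)
  finally show "emeasure (distr (\<Pi>\<^sub>M i\<in>(UNIV::'n set). lborel) borel (\<lambda>f. \<chi> i. f i)) (box l u)
    = ennreal (\<Prod>b\<in>Basis. (u - l) \<bullet> b)" .
qed simp

abbreviation face_box :: "'n::finite elem \<Rightarrow> 'n \<Rightarrow> ('n \<Rightarrow> real) set" where
  "face_box K i \<equiv> (\<Pi>\<^sub>E j\<in>UNIV - {i}. {fst K $ j <..< snd K $ j})"

abbreviation face_measure :: "'n::finite \<Rightarrow> ('n \<Rightarrow> real) measure" where
  "face_measure i \<equiv> (\<Pi>\<^sub>M j\<in>UNIV - {i}. lborel)"

lemma continuous_integrable_box:
  fixes g :: "real ^ 'n::finite \<Rightarrow> real"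
  assumes "continuous_on (cbox l u) g"
  shows "set_integrable lborel (box l u) g"
  by (rule set_integrable_subset[OF borel_integrable_compact[OF compact_cbox assms, folded set_integrable_def]])
     (auto intro: box_subset_cbox[THEN subsetD])

lemma face_box_emeasure: "emeasure (face_measure i) (face_box K i) < \<infinity>"
proof -
  have "emeasure (face_measure i) (face_box K i) = (\<Prod>j\<in>UNIV - {i}. emeasure lborel {fst K $ j <..< snd K $ j})"
    by (rule lborel_prod.emeasure_PiM) auto
  also have "\<dots> < \<infinity>"
    using emeasure_lborel_box_finite[of "_ :: real"]
    by (auto simp: ennreal_prod_eq_top less_top[symmetric] box_real[symmetric] simp del: box_real)
  finally show ?thesis .
qed

text \<open>The face has finite measure and \<open>k\<close> is bounded on the compact slice at
  \<open>c\<close>. In dimension one the product over no coordinates has total mass 1, and the same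
  argument covers evaluation at a point.\<close>

lemma face_integrable:
  fixes k :: "real ^ 'n::finite \<Rightarrow> real"
  assumes k: "continuous_on UNIV k"
  shows "set_integrable (face_measure i) (face_box K i) (\<lambda>y. k (pt i y c))"
proof -
  have m: "(\<lambda>y. pt i y c) \<in> face_measure i \<rightarrow>\<^sub>M borel"
  proof (subst borel_measurable_euclidean_space, intro ballI)
    fix b :: "real ^ 'n" assume "b \<in> Basis"
    then obtain j where b: "b = axis j 1" by (auto simp: Basis_vec_def)
    show "(\<lambda>y. pt i y c \<bullet> b) \<in> borel_measurable (face_measure i)"
    proof (cases "j = i")
      case False
      then have "(\<lambda>f. f j) \<in> face_measure i \<rightarrow>\<^sub>M (lborel :: real measure)"
        by (intro measurable_component_singleton) auto
      with False show ?thesis by (simp add: b inner_axis)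
    qed (simp add: b inner_axis)
  qed
  have mk: "(\<lambda>y. k (pt i y c)) \<in> borel_measurable (face_measure i)"
    by (rule measurable_compose[OF m borel_measurable_continuous_onI[OF k]])
  have S: "face_box K i \<in> sets (face_measure i)"
    by (rule sets_PiM_I_finite) auto
  have "compact (k ` cbox (upd (fst K) i c) (upd (snd K) i c))"
    by (rule compact_continuous_image[OF continuous_on_subset[OF k]]) auto
  then have "bounded (k ` cbox (upd (fst K) i c) (upd (snd K) i c))"
    by (rule compact_imp_bounded)
  then obtain B where B: "\<And>x. x \<in> cbox (upd (fst K) i c) (upd (snd K) i c) \<Longrightarrow> \<bar>k x\<bar> \<le> B"
    unfolding bounded_iff by (metis imageI real_norm_def)
  show ?thesis
    unfolding set_integrable_def
  proof (rule integrableI_bounded_set[where A="face_box K i" and B=B])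
    show "AE x\<in>face_box K i in face_measure i. norm (indicator (face_box K i) x *\<^sub>R k (pt i x c)) \<le> B"
      by (intro AE_I2) (auto intro!: B simp: mem_cbox_vec PiE_def Pi_def less_imp_le split: split_indicator)
  qed (use S mk face_box_emeasure in auto)
qed

lemma continuous_line_integral:
  fixes g :: "real ^ 'n::finite \<Rightarrow> real"
  assumes g: "continuous_on UNIV g"
  shows "continuous_on UNIV (\<lambda>x. integral {l..u} (\<lambda>s. g (upd x i s)))"
  unfolding cbox_interval[symmetric]
  apply (rule integral_continuous_on_param)
  unfolding split_beta
  apply (rule continuous_on_compose2[OF g])
  apply (auto intro!: continuous_intros)
  done

text \<open>Inserting the index \<open>i\<close> into \<open>UNIV - {i}\<close> splits the product
  measure: the line in direction \<open>i\<close> is inside, the face outside. Continuity on the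
  whole space makes every slice integrable.\<close>

lemma fubini_face:
  fixes g :: "real ^ 'n::finite \<Rightarrow> real"
  assumes g: "continuous_on UNIV g"
  shows "set_integrable (face_measure i) (face_box K i)
      (\<lambda>y. integral {fst K $ i..snd K $ i} (\<lambda>s. g (pt i y s)))"
    and "integral (cbox (fst K) (snd K)) g =
      (LINT y:face_box K i|face_measure i. integral {fst K $ i..snd K $ i} (\<lambda>s. g (pt i y s)))"
proof -
  let ?l = "fst K" and ?u = "snd K"
  let ?f = "\<lambda>x. indicator (box ?l ?u) x *\<^sub>R g x"
  let ?h = "\<lambda>y :: 'n \<Rightarrow> real. ?f (\<chi> i. y i)"
  have ig: "set_integrable lborel (box ?l ?u) g"
    by (rule continuous_integrable_box) (rule continuous_on_subset[OF g], simp)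
  have I: "integrable (\<Pi>\<^sub>M i\<in>(UNIV::'n set). lborel) ?h"
    using ig unfolding set_integrable_def
    by (subst (asm) lborel_vec[symmetric]) (rule integrable_distr[OF measurable_vec_lambda_borel])
  have U: "insert i (UNIV - {i}) = (UNIV :: 'n set)" by auto
  have inner: "(LINT s|lborel. ?h (y(i := s))) = indicator (face_box K i) y *\<^sub>R integral {?l $ i..?u $ i} (\<lambda>s. g (pt i y s))"
    if y: "y \<in> space (face_measure i)" for y
  proof -
    have v: "(\<chi> j. (y(i := s)) j) = pt i y s" for s by (simp add: vec_eq_iff)
    have ind: "indicator (box ?l ?u) (pt i y s) = (indicator (face_box K i) y * indicator {?l $ i<..<?u $ i} s :: real)" for s
      using y by (auto simp: indicator_def mem_box_vec space_PiM PiE_def Pi_def split: if_splits)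
    have c: "continuous_on {?l $ i..?u $ i} (\<lambda>s. g (pt i y s))"
      by (rule continuous_on_compose2[OF g]) (auto intro!: continuous_intros)
    have "(LINT s:{?l $ i<..<?u $ i}|lborel. g (pt i y s)) = integral {?l $ i<..<?u $ i} (\<lambda>s. g (pt i y s))"
      by (rule set_borel_integral_eq_integral)
         (rule set_integrable_subset[OF borel_integrable_compact[OF _ c, folded set_integrable_def]], auto)
    also have "\<dots> = integral {?l $ i..?u $ i} (\<lambda>s. g (pt i y s))"
      using integral_open_interval[of "?l $ i" "?u $ i" "\<lambda>s. g (pt i y s)"] by (simp only: box_real cbox_interval)
    finally show ?thesis
      unfolding v ind by (simp add: set_lebesgue_integral_def mult.assoc)
  qed
  have I': "integrable (Pi\<^sub>M (insert i (UNIV - {i})) (\<lambda>_. lborel)) ?h"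
    using I by (simp only: U)
  show "set_integrable (face_measure i) (face_box K i)
      (\<lambda>y. integral {?l $ i..?u $ i} (\<lambda>s. g (pt i y s)))"
    using face_integrable[OF continuous_line_integral[OF g, of "?l $ i" "?u $ i" i], of i K 0] by simp
  have "integral (cbox ?l ?u) g = integral (box ?l ?u) g"
    by (simp add: integral_open_interval)
  also have "\<dots> = (LINT x:box ?l ?u|lborel. g x)"
    by (rule set_borel_integral_eq_integral(2)[OF ig, symmetric])
  also have "\<dots> = integral\<^sup>L (distr (\<Pi>\<^sub>M i\<in>(UNIV::'n set). lborel) borel (\<lambda>f. \<chi> i. f i)) ?f"
    unfolding set_lebesgue_integral_def by (subst lborel_vec) simp
  also have "\<dots> = integral\<^sup>L (\<Pi>\<^sub>M i\<in>(UNIV::'n set). lborel) ?h"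
    by (rule integral_distr[OF measurable_vec_lambda_borel])
       (use ig in \<open>auto simp: set_integrable_def\<close>)
  also have "\<dots> = (LINT y|face_measure i. LINT s|lborel. ?h (y(i := s)))"
    by (subst lborel_prod.product_integral_insert[of "UNIV - {i}" i ?h, unfolded U]) (use I in auto)
  also have "\<dots> = (LINT y:face_box K i|face_measure i. integral {?l $ i..?u $ i} (\<lambda>s. g (pt i y s)))"
    unfolding set_lebesgue_integral_def by (rule Bochner_Integration.integral_cong[OF refl inner])
  finally show "integral (cbox ?l ?u) g = (LINT y:face_box K i|face_measure i. integral {?l $ i..?u $ i} (\<lambda>s. g (pt i y s)))" .
qed

text \<open>Agreement on the open cell suffices, so the arbitrary values of a discrete function on
  the skeleton disappear here. What remains are integrals over closed boxes of functions continuous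
  on the whole space.\<close>

lemma cell_LINT:
  fixes g :: "real ^ 'n::finite \<Rightarrow> real"
  assumes "continuous_on UNIV g" "\<And>x. x \<in> cell K \<Longrightarrow> f x = g x"
  shows "set_integrable lebesgue (cell K) f"
    and "(LINT x:cell K|lebesgue. f x) = integral (cbox (fst K) (snd K)) g"
proof -
  have i: "set_integrable lborel (box (fst K) (snd K)) g"
    by (rule continuous_integrable_box) (rule continuous_on_subset[OF assms(1)], simp)
  have "set_integrable lebesgue (cell K) g"
    using i unfolding set_integrable_def cell_def by (intro integrable_completion[THEN iffD2]) auto
  moreover have "set_integrable lebesgue (cell K) f = set_integrable lebesgue (cell K) g"
    by (rule set_integrable_cong) (use assms in auto)
  ultimately show "set_integrable lebesgue (cell K) f" by simp
  have "(LINT x:cell K|lebesgue. f x) = (LINT x:cell K|lebesgue. g x)"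
    by (rule set_lebesgue_integral_cong) (use assms in \<open>auto simp: cell_def\<close>)
  also have "\<dots> = (LINT x:box (fst K) (snd K)|lborel. g x)"
    using i unfolding set_lebesgue_integral_def cell_def set_integrable_def
    by (intro integral_completion) auto
  also have "\<dots> = integral (cbox (fst K) (snd K)) g"
    by (simp add: set_borel_integral_eq_integral(2)[OF i] integral_open_interval)
  finally show "(LINT x:cell K|lebesgue. f x) = integral (cbox (fst K) (snd K)) g" .
qed

section \<open>Spatial smoothness classes and their closure properties\<close>

definition ldiff :: "'n::finite \<Rightarrow> (real ^ 'n \<Rightarrow> real) \<Rightarrow> bool" where
  "ldiff i g \<longleftrightarrow> (\<forall>x. (\<lambda>s. g (x + s *\<^sub>R axis i 1)) differentiable (at 0))"

lemma pd_upd: "pd i g x = deriv (\<lambda>s. g (upd x i s)) (x $ i)"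
  unfolding pd_def add_axis_upd deriv_def
  using DERIV_shift[of "\<lambda>s. g (upd x i s)" _ 0 "x $ i"] by (simp add: add.commute)

lemma ldiff_DERIV0:
  assumes "ldiff i g"
  shows "((\<lambda>s. g (upd x i s)) has_real_derivative pd i g x) (at (x $ i))"
proof -
  have "(\<lambda>s. g (upd x i (s + x $ i))) differentiable (at 0)"
    using assms unfolding ldiff_def by (simp add: add_axis_upd add.commute)
  then obtain D where "((\<lambda>s. g (upd x i (s + x $ i))) has_real_derivative D) (at 0)"
    by (auto simp: real_differentiable_def)
  then have "((\<lambda>s. g (upd x i s)) has_real_derivative D) (at (x $ i))"
    using DERIV_shift[of "\<lambda>s. g (upd x i s)" D 0 "x $ i"] by simp
  then show ?thesis
    by (simp add: pd_upd DERIV_imp_deriv)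
qed

lemma ldiff_DERIV:
  assumes "ldiff i g"
  shows "((\<lambda>s. g (upd x i s)) has_real_derivative pd i g (upd x i s)) (at s)"
  using ldiff_DERIV0[OF assms, of "upd x i s"] by simp

lemma ldiff_DERIV_axis:
  assumes "ldiff i g"
  shows "((\<lambda>s. g (x + s *\<^sub>R axis i 1)) has_real_derivative pd i g (x + s *\<^sub>R axis i 1)) (at s)"
  using ldiff_DERIV[OF assms, of x "s + x $ i"] DERIV_shift[of "\<lambda>s. g (upd x i s)" _ s "x $ i"]
  by (simp add: add_axis_upd add.commute)

lemma ldiffI:
  assumes "\<And>x. ((\<lambda>s. g (upd x i s)) has_real_derivative g' x) (at (x $ i))"
  shows "ldiff i g" and "pd i g = g'"
proof -
  show "ldiff i g" unfolding ldiff_def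
  proof
    fix x
    show "(\<lambda>s. g (x + s *\<^sub>R axis i 1)) differentiable (at 0)"
      using assms[of x] DERIV_shift[of "\<lambda>s. g (upd x i s)" "g' x" 0 "x $ i"]
      by (auto simp: add_axis_upd add.commute real_differentiable_def)
  qed
  show "pd i g = g'"
    by (rule ext) (simp add: pd_upd DERIV_imp_deriv[OF assms])
qed

text \<open>The recursion takes out the derivative that is applied first. Closure under sums,
  products, restriction to hyperplanes and integration along lines then follows by induction on
  \<open>k\<close> from one formula for \<open>pd i\<close>. Joint continuity is kept at every level
  because derivatives in time are later exchanged with spatial derivatives and with
  integrals.\<close>

primrec JS :: "nat \<Rightarrow> real set \<Rightarrow> (real \<Rightarrow> real ^ 'n::finite \<Rightarrow> real) \<Rightarrow> bool" where
  "JS 0 S z = continuous_on (S \<times> UNIV) (\<lambda>(t, x). z t x)"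
| "JS (Suc k) S z = (continuous_on (S \<times> UNIV) (\<lambda>(t, x). z t x) \<and>
     (\<forall>i. (\<forall>t\<in>S. ldiff i (z t)) \<and> JS k S (\<lambda>t. pd i (z t))))"

abbreviation CS :: "nat \<Rightarrow> (real ^ 'n::finite \<Rightarrow> real) \<Rightarrow> bool" where
  "CS k g \<equiv> JS k UNIV (\<lambda>_. g)"

lemma JS_continuous: "JS k S z \<Longrightarrow> continuous_on (S \<times> UNIV) (\<lambda>(t, x). z t x)"
  by (cases k) auto

lemma JS_Suc_le: "JS (Suc k) S z \<Longrightarrow> JS k S z"
  by (induction k arbitrary: z) auto

lemma JS_le: "JS k S z \<Longrightarrow> j \<le> k \<Longrightarrow> JS j S z"
  by (induction k arbitrary: j) (auto simp: le_Suc_eq dest: JS_Suc_le simp del: JS.simps(2))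

lemma JS_pd: "JS (Suc k) S z \<Longrightarrow> JS k S (\<lambda>t. pd i (z t))"
  by auto

lemma CS_ldiff: "CS k g \<Longrightarrow> k \<ge> 1 \<Longrightarrow> ldiff i g"
  by (cases k) auto

lemma JS_cong:
  assumes "\<And>t. t \<in> S \<Longrightarrow> z t = z' t"
  shows "JS k S z = JS k S z'"
  using assms
proof (induction k arbitrary: z z')
  case 0
  then show ?case by (auto intro!: continuous_on_cong)
next
  case (Suc k)
  have "JS k S (\<lambda>t. pd i (z t)) = JS k S (\<lambda>t. pd i (z' t))" for i
    by (rule Suc.IH) (simp add: Suc.prems)
  moreover have "continuous_on (S \<times> UNIV) (\<lambda>(t, x). z t x) = continuous_on (S \<times> UNIV) (\<lambda>(t, x). z' t x)"
    by (rule continuous_on_cong) (auto simp: Suc.prems)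
  ultimately show ?case by (simp add: Suc.prems)
qed

lemma JS_comp_time:
  fixes z :: "real \<Rightarrow> real ^ 'n::finite \<Rightarrow> real"
  assumes "JS k S z" "continuous_on S' \<phi>" "\<And>t. t \<in> S' \<Longrightarrow> \<phi> t \<in> S"
  shows "JS k S' (\<lambda>t. z (\<phi> t))"
proof -
  have c: "continuous_on (S' \<times> UNIV) (\<lambda>(t, x). z (\<phi> t) x)"
    if "continuous_on (S \<times> UNIV) (\<lambda>(t, x). z t x)" for z :: "real \<Rightarrow> real ^ 'n \<Rightarrow> real"
    unfolding split_beta
    by (rule continuous_on_compose2[OF that, where f="\<lambda>p. (\<phi> (fst p), snd p)", simplified split_beta fst_conv snd_conv])
       (use assms(3) in \<open>auto intro!: continuous_intros continuous_on_compose2[OF assms(2)]\<close>)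
  show ?thesis
  using assms(1)
proof (induction k arbitrary: z)
  case 0 then show ?case using c by simp
next
  case (Suc k) then show ?case using c assms(3) by auto
qed
qed

lemma JS_static: "JS k S z \<Longrightarrow> t \<in> S \<Longrightarrow> CS k (z t)"
  by (rule JS_comp_time[where \<phi>="\<lambda>_. t"]) auto

lemma CS_JS: "CS k g \<Longrightarrow> JS k S (\<lambda>_. g)"
  using JS_comp_time[of k UNIV "\<lambda>_. g" S id] by auto

lemma CS_continuous: "CS k g \<Longrightarrow> continuous_on UNIV g"
  using continuous_on_compose2[OF JS_continuous[of k UNIV "\<lambda>_. g"], of UNIV "\<lambda>x. (0, x)"]
  by (simp add: continuous_on_Pair continuous_on_const continuous_on_id)

lemma JS_cont_x: "JS k S z \<Longrightarrow> t \<in> S \<Longrightarrow> continuous_on UNIV (z t)"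
  using JS_static CS_continuous by blast

lemma JS_cont_t: "JS k S z \<Longrightarrow> continuous_on S (\<lambda>t. z t x)"
  using continuous_on_compose2[OF JS_continuous[of k S z], of S "\<lambda>t. (t, x)"]
  by (auto simp: continuous_on_Pair continuous_on_const continuous_on_id)

lemma pd_lin:
  assumes "ldiff i f" "ldiff i g"
  shows "ldiff i (\<lambda>x. c * f x + d * g x)" "pd i (\<lambda>x. c * f x + d * g x) = (\<lambda>x. c * pd i f x + d * pd i g x)"
  by (rule ldiffI; auto intro!: derivative_eq_intros ldiff_DERIV0[OF assms(1)] ldiff_DERIV0[OF assms(2)])+

lemma pd_mult:
  assumes "ldiff i f" "ldiff i g"
  shows "ldiff i (\<lambda>x. f x * g x)" "pd i (\<lambda>x. f x * g x) = (\<lambda>x. pd i f x * g x + f x * pd i g x)"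
  by (rule ldiffI; auto intro!: derivative_eq_intros ldiff_DERIV0[OF assms(1)] ldiff_DERIV0[OF assms(2)])+

lemma pd_const [simp]: "ldiff i (\<lambda>x. c)" "pd i (\<lambda>x. c) = (\<lambda>x. 0)"
  by (rule ldiffI; auto intro!: derivative_eq_intros)+

lemma JS_lin:
  assumes "JS k S f" "JS k S g"
  shows "JS k S (\<lambda>t x. c * f t x + d * g t x)"
  using assms
proof (induction k arbitrary: f g)
  case 0 then show ?case by (auto simp: split_beta intro!: continuous_intros)
next
  case (Suc k)
  have "JS k S (\<lambda>t. pd i (\<lambda>x. c * f t x + d * g t x)) = JS k S (\<lambda>t x. c * pd i (f t) x + d * pd i (g t) x)" for i
    by (rule JS_cong) (use Suc.prems in \<open>auto simp: pd_lin(2)\<close>)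
  then show ?case using Suc by (auto simp: split_beta intro!: continuous_intros pd_lin)
qed

lemma JS_const [simp]: "JS k S (\<lambda>t x. c)"
  by (induction k arbitrary: c) (auto intro!: continuous_intros simp: split_beta)

lemma JS_cmult: "JS k S f \<Longrightarrow> JS k S (\<lambda>t x. c * f t x)"
  using JS_lin[of k S f "\<lambda>_ _. 0" c 0] by simp

lemma JS_add: "JS k S f \<Longrightarrow> JS k S g \<Longrightarrow> JS k S (\<lambda>t x. f t x + g t x)"
  using JS_lin[of k S f g 1 1] by simp

lemma JS_diff: "JS k S f \<Longrightarrow> JS k S g \<Longrightarrow> JS k S (\<lambda>t x. f t x - g t x)"
  using JS_lin[of k S f g 1 "-1"] by simp

lemma JS_sum:
  assumes "\<And>j. j \<in> J \<Longrightarrow> JS k S (f j)"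
  shows "JS k S (\<lambda>t x. \<Sum>j\<in>J. f j t x)"
  using assms by (induction J rule: infinite_finite_induct) (auto intro!: JS_add)

lemma JS_mult:
  assumes "JS k S f" "JS k S g"
  shows "JS k S (\<lambda>t x. f t x * g t x)"
  using assms
proof (induction k arbitrary: f g)
  case 0 then show ?case by (auto simp: split_beta intro!: continuous_intros)
next
  case (Suc k)
  have "JS k S (\<lambda>t. pd i (\<lambda>x. f t x * g t x)) = JS k S (\<lambda>t x. pd i (f t) x * g t x + f t x * pd i (g t) x)" for i
    by (rule JS_cong) (use Suc.prems in \<open>auto simp: pd_mult(2)\<close>)
  moreover have "JS k S (\<lambda>t x. pd i (f t) x * g t x + f t x * pd i (g t) x)" for i
    using Suc.prems by (intro JS_add Suc.IH JS_Suc_le[of k S f] JS_Suc_le[of k S g]) auto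
  ultimately show ?case using Suc.prems by (auto simp: split_beta intro!: continuous_intros pd_mult)
qed

lemma JS_power: "JS k S f \<Longrightarrow> JS k S (\<lambda>t x. f t x ^ n)"
  by (induction n) (auto intro!: JS_mult)

lemma JS_prod:
  assumes "\<And>j. j \<in> J \<Longrightarrow> JS k S (f j)"
  shows "JS k S (\<lambda>t x. \<Prod>j\<in>J. f j t x)"
  using assms by (induction J rule: infinite_finite_induct) (auto intro!: JS_mult)

lemma pd_poly:
  "ldiff j (\<lambda>x. poly p (x $ i))"
  "pd j (\<lambda>x. poly p (x $ i)) = (if j = i then (\<lambda>x. poly (pderiv p) (x $ i)) else (\<lambda>x. 0))"
  by (rule ldiffI[where g'="if j = i then (\<lambda>x. poly (pderiv p) (x $ i)) else (\<lambda>x. 0)"]; auto intro!: derivative_eq_intros poly_DERIV)+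

lemma CS_poly: "JS k S (\<lambda>t x. poly p (x $ i))"
proof (induction k arbitrary: p)
  case (Suc k)
  have "JS k S (\<lambda>t. pd j (\<lambda>x. poly p (x $ i)))" for j
    using Suc[of "pderiv p"] by (simp add: pd_poly)
  then show ?case by (auto simp: split_beta pd_poly intro!: continuous_intros)
qed (auto simp: split_beta intro!: continuous_intros)

lemma CS_coord: "JS k S (\<lambda>t x. x $ i)"
  using CS_poly[of k S "[:0, 1:]" i] by simp

lemma CS_Qpoly: "p \<in> Qpoly q \<Longrightarrow> JS k S (\<lambda>_. p)"
proof -
  assume "p \<in> Qpoly q"
  then obtain c :: "('a \<Rightarrow> nat) \<Rightarrow> real" where
    "p = (\<lambda>x. \<Sum>\<alpha> | \<forall>i. \<alpha> i \<le> q. c \<alpha> * (\<Prod>i\<in>UNIV. x $ i ^ \<alpha> i))"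
    by (auto simp: Qpoly_def)
  then show ?thesis
    by (auto intro!: JS_sum JS_cmult JS_prod JS_power CS_coord)
qed

text \<open>Freezing coordinate \<open>i\<close> leaves nothing to differentiate in that direction
  and does not affect the others. Values on hyperplanes are one ingredient of the Gauss--Radau
  projection; the others are polynomial factors and moments along lines.\<close>

lemma pd_restrict:
  assumes "j \<noteq> i \<Longrightarrow> ldiff j g"
  shows "ldiff j (\<lambda>x. g (upd x i c))"
    "pd j (\<lambda>x. g (upd x i c)) = (if j = i then (\<lambda>x. 0) else (\<lambda>x. pd j g (upd x i c)))"
proof -
  have "((\<lambda>s. g (upd (upd x j s) i c)) has_real_derivative
      (if j = i then (\<lambda>x. 0) else (\<lambda>x. pd j g (upd x i c))) x) (at (x $ j))" for x
  proof (cases "j = i")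
    case False
    then show ?thesis
      using ldiff_DERIV[OF assms, of "upd x i c" "x $ j"] upd_commute[of i j x c "x $ j"]
      by (simp add: upd_commute)
  qed simp
  from ldiffI[OF this] show "ldiff j (\<lambda>x. g (upd x i c))"
    "pd j (\<lambda>x. g (upd x i c)) = (if j = i then (\<lambda>x. 0) else (\<lambda>x. pd j g (upd x i c)))" .
qed

lemma JS_restrict:
  fixes z :: "real \<Rightarrow> real ^ 'n::finite \<Rightarrow> real"
  assumes "JS k S z"
  shows "JS k S (\<lambda>t x. z t (upd x i c))"
proof -
  have c: "continuous_on (S \<times> UNIV) (\<lambda>(t, x). z t (upd x i c))"
    if "continuous_on (S \<times> UNIV) (\<lambda>(t, x). z t x)" for z :: "real \<Rightarrow> real ^ 'n \<Rightarrow> real"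
    unfolding split_beta
    by (rule continuous_on_compose2[OF that, where f="\<lambda>p. (fst p, upd (snd p) i c)", simplified split_beta fst_conv snd_conv])
       (auto intro!: continuous_intros)
  show ?thesis
  using assms
proof (induction k arbitrary: z)
  case 0 then show ?case using c by simp
next
  case (Suc k)
  have "JS k S (\<lambda>t. pd j (\<lambda>x. z t (upd x i c)))" for j
    using Suc.prems Suc.IH[of "\<lambda>t. pd j (z t)"]
    by (subst JS_cong[where z'="\<lambda>t. if j = i then (\<lambda>x. 0) else (\<lambda>x. pd j (z t) (upd x i c))"])
       (cases "j = i"; auto simp: pd_restrict(2))+
  then show ?case using c Suc.prems by (auto simp: pd_restrict)
qed
qed

text \<open>Leibniz' rule. With an orthogonal polynomial as the weight \<open>w\<close>, these
  integrals are the moments that enter a Gauss--Radau projection in direction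
  \<open>i\<close>.\<close>

lemma pd_line_integral:
  fixes g :: "real ^ 'n::finite \<Rightarrow> real"
  assumes w: "continuous_on {l..u} w" and g: "CS (Suc 0) g"
  shows "ldiff j (\<lambda>x. integral {l..u} (\<lambda>s. g (upd x i s) * w s))"
    "pd j (\<lambda>x. integral {l..u} (\<lambda>s. g (upd x i s) * w s)) =
      (if j = i then (\<lambda>x. 0) else (\<lambda>x. integral {l..u} (\<lambda>s. pd j g (upd x i s) * w s)))"
proof -
  have "((\<lambda>r. integral {l..u} (\<lambda>s. g (upd (upd x j r) i s) * w s)) has_real_derivative
     (if j = i then (\<lambda>x. 0) else (\<lambda>x. integral {l..u} (\<lambda>s. pd j g (upd x i s) * w s))) x) (at (x $ j))" for x
  proof (cases "j = i")
    case False
    have cg: "continuous_on UNIV g" and cpg: "continuous_on UNIV (pd j g)"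
      using g CS_continuous[OF g] JS_pd[OF g] CS_continuous by blast+
    have "((\<lambda>r. integral (cbox l u) (\<lambda>s. g (upd (upd x j r) i s) * w s)) has_real_derivative
      integral (cbox l u) (\<lambda>s. pd j g (upd (upd x j (x $ j)) i s) * w s)) (at (x $ j) within UNIV)"
    proof (rule leibniz_rule_field_derivative[of _ _ _ "\<lambda>r s. g (upd (upd x j r) i s) * w s"
            "\<lambda>r s. pd j g (upd (upd x j r) i s) * w s"])
      fix r s
      have "((\<lambda>r. g (upd (upd x i s) j r)) has_real_derivative pd j g (upd (upd x i s) j r)) (at r)"
        by (rule ldiff_DERIV) (use g in auto)
      then show "((\<lambda>r. g (upd (upd x j r) i s) * w s) has_real_derivative pd j g (upd (upd x j r) i s) * w s) (at r)"
        using False by (simp add: upd_commute DERIV_cmult_right)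
    next
      fix r show "(\<lambda>s. g (upd (upd x j r) i s) * w s) integrable_on cbox l u"
        by (rule integrable_continuous) (use w in \<open>auto intro!: continuous_intros continuous_on_compose2[OF cg]\<close>)
    next
      show "continuous_on (UNIV \<times> cbox l u) (\<lambda>(r, s). pd j g (upd (upd x j r) i s) * w s)"
        unfolding split_beta
        by (auto intro!: continuous_intros continuous_on_compose2[OF cpg] continuous_on_compose2[OF w])
    qed auto
    then show ?thesis using False by simp
  qed simp
  from ldiffI[OF this] show "ldiff j (\<lambda>x. integral {l..u} (\<lambda>s. g (upd x i s) * w s))"
    "pd j (\<lambda>x. integral {l..u} (\<lambda>s. g (upd x i s) * w s)) =
      (if j = i then (\<lambda>x. 0) else (\<lambda>x. integral {l..u} (\<lambda>s. pd j g (upd x i s) * w s)))" .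
qed

lemma JS_line_integral:
  fixes z :: "real \<Rightarrow> real ^ 'n::finite \<Rightarrow> real"
  assumes "JS k S z" and w: "continuous_on {l..u} w"
  shows "JS k S (\<lambda>t x. integral {l..u} (\<lambda>s. z t (upd x i s) * w s))"
proof -
  have c: "continuous_on (S \<times> UNIV) (\<lambda>(t, x). integral {l..u} (\<lambda>s. z t (upd x i s) * w s))"
    if "continuous_on (S \<times> UNIV) (\<lambda>(t, x). z t x)" for z :: "real \<Rightarrow> real ^ 'n \<Rightarrow> real"
    unfolding split_beta cbox_interval[symmetric]
    apply (rule integral_continuous_on_param)
    unfolding split_beta
    apply (rule continuous_on_mult)
     apply (rule continuous_on_compose2[OF that, where f="\<lambda>p. (fst (fst p), upd (snd (fst p)) i (snd p))", simplified split_beta fst_conv snd_conv])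
      apply (auto intro!: continuous_intros continuous_on_compose2[OF w])
    done
  show ?thesis
  using assms(1)
proof (induction k arbitrary: z)
  case 0 then show ?case using c by simp
next
  case (Suc k)
  have s1: "CS (Suc 0) (z t)" if "t \<in> S" for t
    using JS_static[OF JS_le[OF Suc.prems(1)], of "Suc 0" t] that by simp
  have "JS k S (\<lambda>t. pd j (\<lambda>x. integral {l..u} (\<lambda>s. z t (upd x i s) * w s)))" for j
    using Suc.prems Suc.IH[of "\<lambda>t. pd j (z t)"]
    by (subst JS_cong[where z'="\<lambda>t. if j = i then (\<lambda>x. 0) else (\<lambda>x. integral {l..u} (\<lambda>s. pd j (z t) (upd x i s) * w s))"])
       (cases "j = i"; auto simp: pd_line_integral(2)[OF w s1])+
  then show ?case using c[of z] Suc.prems by (auto intro!: pd_line_integral[OF w s1])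
qed
qed

section \<open>Iterated derivatives: symmetry, and interchange with the derivative in time\<close>

lemma pds_append: "pds (is @ js) g = pds is (pds js g)"
  by (induction "is") auto

lemma JS_pds:
  assumes "JS k S z" "length is + j \<le> k"
  shows "JS j S (\<lambda>t. pds is (z t))"
  using assms
proof (induction "is" arbitrary: j)
  case Nil
  then show ?case using JS_le by auto
next
  case (Cons i "is")
  have "JS (Suc j) S (\<lambda>t. pds is (z t))" by (rule Cons.IH) (use Cons.prems in auto)
  then show ?case by simp
qed

lemma JS_pds_cont: "JS k S z \<Longrightarrow> length is \<le> k \<Longrightarrow> continuous_on (S \<times> UNIV) (\<lambda>(t, x). pds is (z t) x)"
  using JS_continuous[OF JS_pds[of k S z "is" 0]] by simp

lemma CS_pds_cont: "CS k g \<Longrightarrow> length is \<le> k \<Longrightarrow> continuous_on UNIV (pds is g)"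
  using CS_continuous[OF JS_pds[of k UNIV "\<lambda>_. g" "is" 0]] by simp

text \<open>Lists are peeled at their last entry, the derivative applied first, since this is the
  one that the recursion of \<open>JS\<close> takes out.\<close>

lemma spatial_C_JS: "spatial_C T k z \<Longrightarrow> JS k {0..T} z"
proof (induction k arbitrary: z)
  case 0
  then show ?case by (auto simp: spatial_C_def)
next
  case (Suc k)
  have 1: "continuous_on ({0..T} \<times> UNIV) (\<lambda>(t, x). pds [] (z t) x)"
    using Suc.prems[unfolded spatial_C_def, THEN conjunct1, rule_format, of "[]"] by simp
  have 2: "ldiff i (z t)" if "t \<in> {0..T}" for i t
  proof -
    have "length ([] :: 'a list) < Suc k" by simp
    then show ?thesis
      using Suc.prems[unfolded spatial_C_def, THEN conjunct2, rule_format, of "[]" t _ i] that unfolding ldiff_def by simp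
  qed
  have "spatial_C T k (\<lambda>t. pd i (z t))" for i
    unfolding spatial_C_def
  proof (intro conjI allI impI ballI)
    fix "is" :: "'a list" assume "length is \<le> k"
    then show "continuous_on ({0..T} \<times> UNIV) (\<lambda>(t, x). pds is (pd i (z t)) x)"
      using Suc.prems[unfolded spatial_C_def, THEN conjunct1, rule_format, of "is @ [i]"] by (simp add: pds_append)
  next
    fix "is" :: "'a list" and t x j assume "length is < k" "t \<in> {0..T}"
    then show "(\<lambda>s. pds is (pd i (z t)) (x + s *\<^sub>R axis j 1)) differentiable at 0"
      using Suc.prems[unfolded spatial_C_def, THEN conjunct2, rule_format, of "is @ [i]" t x j] by (simp add: pds_append)
  qed
  then show ?case using 1 2 Suc.IH by simp
qed

text \<open>Interchange of a derivative in \<open>t\<close> with one in \<open>s\<close>: integrate in \<open>t\<close> and use Leibniz' rule.\<close>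

lemma swap_deriv:
  fixes F V A W :: "real \<Rightarrow> real \<Rightarrow> real"
  assumes dt: "\<And>s t. t \<in> {a..b} \<Longrightarrow> ((\<lambda>t. F s t) has_real_derivative V s t) (at t within {a..b})"
    and ds: "\<And>s t. t \<in> {a..b} \<Longrightarrow> ((\<lambda>s. F s t) has_real_derivative A s t) (at s)"
    and dV: "\<And>s t. t \<in> {a..b} \<Longrightarrow> ((\<lambda>s. V s t) has_real_derivative W s t) (at s)"
    and cV: "\<And>s. continuous_on {a..b} (V s)"
    and cW: "continuous_on (UNIV \<times> {a..b}) (\<lambda>(s, t). W s t)"
    and t0: "t0 \<in> {a..b}"
  shows "((\<lambda>t. A s t) has_real_derivative W s t0) (at t0 within {a..b})"
proof -
  have F: "F s t = F s a + integral {a..t} (V s)" if t: "t \<in> {a..b}" for s t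
  proof -
    have "(V s has_integral F s t - F s a) {a..t}"
    proof (rule fundamental_theorem_of_calculus)
      fix x assume "x \<in> {a..t}"
      then show "(F s has_vector_derivative V s x) (at x within {a..t})"
        using DERIV_subset[OF dt[of x s], of "{a..t}"] t
        by (simp add: has_real_derivative_iff_has_vector_derivative)
    qed (use t in auto)
    then show ?thesis by (simp add: integral_unique)
  qed
  have cWs: "continuous_on {a..b} (W s)" for s
    using continuous_on_compose2[OF cW, of "{a..b}" "\<lambda>t. (s, t)"] by (auto simp: continuous_on_Pair continuous_on_const continuous_on_id)
  have A: "A s t = A s a + integral {a..t} (W s)" if t: "t \<in> {a..b}" for s t
  proof -
    have "((\<lambda>s. integral (cbox a t) (V s)) has_real_derivative integral (cbox a t) (W s)) (at s within UNIV)"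
    proof (rule leibniz_rule_field_derivative)
      fix x r assume "r \<in> cbox a t"
      then show "((\<lambda>x. V x r) has_real_derivative W x r) (at x within UNIV)" using dV[of r x] t by auto
    next
      fix x show "V x integrable_on cbox a t"
        by (rule integrable_continuous) (use continuous_on_subset[OF cV] t in auto)
    next
      show "continuous_on (UNIV \<times> cbox a t) (\<lambda>(x, t). W x t)"
        by (rule continuous_on_subset[OF cW]) (use t in auto)
    qed auto
    moreover have "((\<lambda>s. F s a) has_real_derivative A s a) (at s)"
      by (rule ds) (use t in auto)
    ultimately have "((\<lambda>s. F s a + integral (cbox a t) (V s)) has_real_derivative A s a + integral (cbox a t) (W s)) (at s)"
      by (auto intro: DERIV_add)
    then have "((\<lambda>s. F s t) has_real_derivative A s a + integral (cbox a t) (W s)) (at s)"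
      using F[OF t] by simp
    then show ?thesis using DERIV_unique[OF ds[OF t]] by auto
  qed
  have "((\<lambda>t. A s a + integral {a..t} (W s)) has_real_derivative W s t0) (at t0 within {a..b})"
    using DERIV_add[OF DERIV_const integral_has_real_derivative[OF cWs t0], of "A s a"] by simp
  then show ?thesis
    by (rule has_field_derivative_transform_within[OF _ zero_less_one t0]) (simp add: A[symmetric])
qed

text \<open>An instance of \<open>swap_deriv\<close> in which the parameter along axis
  \<open>j\<close>, restricted to [-1,1], plays the role of time.\<close>

lemma pd_commute:
  fixes g :: "real ^ 'n::finite \<Rightarrow> real"
  assumes g: "CS (Suc (Suc 0)) g"
  shows "pd i (pd j g) = pd j (pd i g)"
proof
  fix x :: "real ^ 'n"
  let ?p = "\<lambda>(s::real) (t::real). x + s *\<^sub>R axis i 1 + t *\<^sub>R axis j 1"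
  have g1: "CS (Suc 0) (pd l g)" and g2: "CS 0 (pd k (pd l g))" for k l
    using JS_pd[OF g] by auto
  have c: "continuous_on UNIV (pd l g)" "continuous_on UNIV (pd k (pd l g))" for k l
    using g1 g2 CS_continuous by blast+
  have l: "ldiff k g" "ldiff k (pd l g)" for k l using g by auto
  have "((\<lambda>t. pd i g (?p 0 t)) has_real_derivative pd i (pd j g) (?p 0 0)) (at 0 within {-1..1})"
  proof (rule swap_deriv[where F="\<lambda>s t. g (?p s t)" and V="\<lambda>s t. pd j g (?p s t)"
        and A="\<lambda>s t. pd i g (?p s t)" and W="\<lambda>s t. pd i (pd j g) (?p s t)"])
    fix s t :: real
    show "((\<lambda>t. g (?p s t)) has_real_derivative pd j g (?p s t)) (at t within {- 1..1})"
      using ldiff_DERIV_axis[OF l(1)[of j], of "x + s *\<^sub>R axis i 1" t] by (rule DERIV_subset) auto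
    show "((\<lambda>s. g (?p s t)) has_real_derivative pd i g (?p s t)) (at s)"
      using ldiff_DERIV_axis[OF l(1)[of i], of "x + t *\<^sub>R axis j 1" s] by (simp add: add_ac)
    show "((\<lambda>s. pd j g (?p s t)) has_real_derivative pd i (pd j g) (?p s t)) (at s)"
      using ldiff_DERIV_axis[OF l(2)[of i j], of "x + t *\<^sub>R axis j 1" s] by (simp add: add_ac)
    show "continuous_on {- 1..1} (\<lambda>t. pd j g (?p s t))"
      by (rule continuous_on_compose2[OF c(1)]) (auto intro!: continuous_intros)
    show "continuous_on (UNIV \<times> {- 1..1}) (\<lambda>(s, t). pd i (pd j g) (?p s t))"
      unfolding split_beta by (rule continuous_on_compose2[OF c(2)]) (auto intro!: continuous_intros)
  qed auto
  then have "((\<lambda>t. pd i g (x + t *\<^sub>R axis j 1)) has_real_derivative pd i (pd j g) x) (at 0)"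
    using at_within_Icc_at[of "-1" 0 "1::real"] by simp
  moreover have "((\<lambda>t. pd i g (x + t *\<^sub>R axis j 1)) has_real_derivative pd j (pd i g) x) (at 0)"
    using ldiff_DERIV_axis[OF l(2)[of j i], of x 0] by simp
  ultimately show "pd i (pd j g) x = pd j (pd i g) x" by (rule DERIV_unique)
qed

lemma pd_pds_commute:
  assumes "CS k g" "length is < k"
  shows "pd i (pds is g) = pds is (pd i g)"
  using assms(2)
proof (induction "is")
  case (Cons j "is")
  have "CS (Suc (Suc 0)) (pds is g)" by (rule JS_pds[OF assms(1)]) (use Cons.prems in auto)
  then show ?case using Cons pd_commute[of "pds is g" i j] by simp
qed simp

text \<open>The head of one list is moved to the front of the other by
  \<open>pd_pds_commute\<close>. This connects lists of derivatives with the multi-indices of the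
  Sobolev norms.\<close>

lemma pds_perm:
  assumes "CS k g" "length is \<le> k" "mset is = mset js"
  shows "pds is g = pds js g"
  using assms(2,3)
proof (induction "is" arbitrary: js)
  case (Cons i "is")
  then have "i \<in># mset js" using Cons.prems(2)[symmetric] by simp
  then have "i \<in> set js" by simp
  then obtain js1 js2 where js: "js = js1 @ i # js2" by (auto dest: split_list)
  have l: "length (js1 @ js2) = length is" using arg_cong[OF Cons.prems(2), of size] js by simp
  have "CS (k - length js2) (pds js2 g)" by (rule JS_pds[OF assms(1)]) (use l Cons.prems in auto)
  then have "pds js g = pd i (pds (js1 @ js2) g)"
    using pd_pds_commute[of "k - length js2" "pds js2 g" js1 i] l Cons.prems by (simp add: js pds_append)
  moreover have "pds is g = pds (js1 @ js2) g"
    by (rule Cons.IH) (use Cons.prems js in auto)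
  ultimately show ?case by simp
qed auto

text \<open>Induction on the list, each step exchanging one spatial derivative with the time
  derivative by \<open>swap_deriv\<close>. It turns bounds for derivatives of u_t into Lipschitz
  bounds in time for those of u.\<close>

lemma pds_dt:
  assumes "JS k {a..b} z" "JS k {a..b} z'"
    and d: "\<And>t x. t \<in> {a..b} \<Longrightarrow> ((\<lambda>t. z t x) has_real_derivative z' t x) (at t within {a..b})"
    and "length is \<le> k" "t \<in> {a..b}"
  shows "((\<lambda>t. pds is (z t) x) has_real_derivative pds is (z' t) x) (at t within {a..b})"
  using assms(4,5)
proof (induction "is" arbitrary: t x)
  case Nil
  then show ?case using d by auto
next
  case (Cons i "is")
  have z: "JS (Suc 0) {a..b} (\<lambda>t. pds is (z t))" "JS (Suc 0) {a..b} (\<lambda>t. pds is (z' t))"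
    by (rule JS_pds[OF assms(1)] JS_pds[OF assms(2)]; use Cons.prems in simp)+
  have c: "continuous_on ({a..b} \<times> UNIV) (\<lambda>(t, x). pd i (pds is (z' t)) x)"
    using JS_continuous[OF JS_pd[OF z(2)]] .
  have "((\<lambda>t. pd i (pds is (z t)) (x + 0 *\<^sub>R axis i 1)) has_real_derivative pd i (pds is (z' t)) (x + 0 *\<^sub>R axis i 1)) (at t within {a..b})"
  proof (rule swap_deriv[where F="\<lambda>s t. pds is (z t) (x + s *\<^sub>R axis i 1)"
        and V="\<lambda>s t. pds is (z' t) (x + s *\<^sub>R axis i 1)"
        and A="\<lambda>s t. pd i (pds is (z t)) (x + s *\<^sub>R axis i 1)"
        and W="\<lambda>s t. pd i (pds is (z' t)) (x + s *\<^sub>R axis i 1)"])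
    fix s t assume t: "t \<in> {a..b}"
    show "((\<lambda>t. pds is (z t) (x + s *\<^sub>R axis i 1)) has_real_derivative pds is (z' t) (x + s *\<^sub>R axis i 1)) (at t within {a..b})"
      by (rule Cons.IH) (use Cons.prems t in auto)
    show "((\<lambda>s. pds is (z t) (x + s *\<^sub>R axis i 1)) has_real_derivative pd i (pds is (z t)) (x + s *\<^sub>R axis i 1)) (at s)"
      "((\<lambda>s. pds is (z' t) (x + s *\<^sub>R axis i 1)) has_real_derivative pd i (pds is (z' t)) (x + s *\<^sub>R axis i 1)) (at s)"
      by (rule ldiff_DERIV_axis; use z t in simp)+
  next
    fix s show "continuous_on {a..b} (\<lambda>t. pds is (z' t) (x + s *\<^sub>R axis i 1))"
      by (rule JS_cont_t[OF z(2)])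
  next
    show "continuous_on (UNIV \<times> {a..b}) (\<lambda>(s, t). pd i (pds is (z' t)) (x + s *\<^sub>R axis i 1))"
      unfolding split_beta
      by (rule continuous_on_compose2[OF c, where f="\<lambda>p. (snd p, x + fst p *\<^sub>R axis i 1)", simplified split_beta fst_conv snd_conv])
         (auto intro!: continuous_intros)
  qed (use Cons.prems in auto)
  then show ?case by simp
qed

lemma periodic_pd: "periodic a b g \<Longrightarrow> periodic a b (pd i g)"
  unfolding periodic_def pd_def
proof (intro allI)
  fix x j assume p: "\<forall>x i. g (x + (b $ i - a $ i) *\<^sub>R axis i 1) = g x"
  have "g (x + (b $ j - a $ j) *\<^sub>R axis j 1 + s *\<^sub>R axis i 1) = g (x + s *\<^sub>R axis i 1)" for s
    using p[rule_format, of "x + s *\<^sub>R axis i 1" j] by (simp add: add_ac)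
  then show "deriv (\<lambda>s. g (x + (b $ j - a $ j) *\<^sub>R axis j 1 + s *\<^sub>R axis i 1)) 0 = deriv (\<lambda>s. g (x + s *\<^sub>R axis i 1)) 0"
    by simp
qed

lemma periodic_pds: "periodic a b g \<Longrightarrow> periodic a b (pds is g)"
  by (induction "is") (auto intro: periodic_pd)

lemma pds_lin:
  assumes "CS k f" "CS k g" "length is \<le> k"
  shows "pds is (\<lambda>x. c * f x + d * g x) = (\<lambda>x. c * pds is f x + d * pds is g x)"
  using assms(3)
proof (induction "is")
  case (Cons i "is")
  have "CS 1 (pds is f)" "CS 1 (pds is g)"
    by (rule JS_pds[OF assms(1)] JS_pds[OF assms(2)]; use Cons.prems in simp)+
  then show ?case using Cons by (simp add: pd_lin CS_ldiff)
qed simp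

lemma lap_pds: "lap g x = (\<Sum>i\<in>UNIV. pds [i, i] g x)"
  by (simp add: lap_def)

lemma JS_lap: "JS (Suc (Suc k)) S z \<Longrightarrow> JS k S (\<lambda>t. lap (z t))"
  unfolding lap_pds[abs_def] by (intro JS_sum JS_pds[where k="Suc (Suc k)"]) (auto simp del: JS.simps)

lemma pds_sum:
  assumes "\<And>j. j \<in> J \<Longrightarrow> CS k (f j)" "length is \<le> k"
  shows "pds is (\<lambda>x. \<Sum>j\<in>J. f j x) = (\<lambda>x. \<Sum>j\<in>J. pds is (f j) x)"
  using assms(1)
proof (induction J rule: infinite_finite_induct)
  case (insert j J)
  then show ?case
    using pds_lin[of k "f j" "\<lambda>x. \<Sum>j\<in>J. f j x" "is" 1 1, OF _ JS_sum] assms(2) by simp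
next
  case empty
  have "pds is (\<lambda>x. 0) = (\<lambda>x. 0)" by (induction "is") auto
  then show ?case by simp
next
  case (infinite J)
  have "pds is (\<lambda>x. 0) = (\<lambda>x. 0)" by (induction "is") auto
  with infinite show ?case by simp
qed

lemma pds_lap:
  assumes "CS (Suc (Suc k)) g" "length is \<le> k"
  shows "pds is (lap g) = (\<lambda>x. \<Sum>i\<in>UNIV. pds (is @ [i, i]) g x)"
  unfolding lap_pds[abs_def] pds_append
  by (rule pds_sum[OF JS_pds[OF assms(1)] assms(2)]) simp

section \<open>Integrals over boxes\<close>

abbreviation bint :: "'n::finite elem \<Rightarrow> (real ^ 'n \<Rightarrow> real) \<Rightarrow> real" where
  "bint K g \<equiv> integral (cbox (fst K) (snd K)) g"

lemma cont_integrable: "continuous_on UNIV g \<Longrightarrow> g integrable_on cbox l u" for g :: "'a::euclidean_space \<Rightarrow> real"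
  by (rule integrable_continuous) (rule continuous_on_subset, auto)

text \<open>Fubini reduces the comparison to single lines. In this form the one-dimensional
  projection estimates become estimates on elements without further measure theory.\<close>

lemma bint_mono_lines:
  fixes g h :: "real ^ 'n::finite \<Rightarrow> real"
  assumes g: "continuous_on UNIV g" and h: "continuous_on UNIV h"
    and le: "\<And>x. (\<And>j. j \<noteq> i \<Longrightarrow> fst K $ j < x $ j \<and> x $ j < snd K $ j) \<Longrightarrow>
       integral {fst K $ i..snd K $ i} (\<lambda>s. g (upd x i s)) \<le> integral {fst K $ i..snd K $ i} (\<lambda>s. h (upd x i s))"
  shows "bint K g \<le> bint K h"
  unfolding fubini_face(2)[OF g, of K i] fubini_face(2)[OF h, of K i]
  by (rule set_integral_mono[OF fubini_face(1)[OF g] fubini_face(1)[OF h]])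
     (use le[of "pt i _ 0"] in \<open>auto simp: PiE_def Pi_def\<close>)

lemma bint_eq_lines:
  fixes g h :: "real ^ 'n::finite \<Rightarrow> real"
  assumes g: "continuous_on UNIV g" and h: "continuous_on UNIV h"
    and le: "\<And>x. (\<And>j. j \<noteq> i \<Longrightarrow> fst K $ j < x $ j \<and> x $ j < snd K $ j) \<Longrightarrow>
       integral {fst K $ i..snd K $ i} (\<lambda>s. g (upd x i s)) = integral {fst K $ i..snd K $ i} (\<lambda>s. h (upd x i s))"
  shows "bint K g = bint K h"
  using bint_mono_lines[OF g h, of i K] bint_mono_lines[OF h g, of i K] le by (simp add: antisym)

lemma line_FTC:
  fixes g :: "real ^ 'n::finite \<Rightarrow> real"
  assumes g: "CS (Suc 0) g" and lu: "l \<le> u"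
  shows "integral {l..u} (\<lambda>s. pd i g (upd x i s)) = g (upd x i u) - g (upd x i l)"
  by (rule integral_unique, rule fundamental_theorem_of_calculus[OF lu])
     (use ldiff_DERIV[of i g x] g in \<open>auto simp: has_real_derivative_iff_has_vector_derivative[symmetric] intro: DERIV_subset\<close>)

lemma face_int_pt: "face_int K i n g = (LINT y:face_box K i|face_measure i. g (pt i y (if n = 1 then snd K $ i else fst K $ i)))"
  unfolding face_int_def pt_def by simp

text \<open>The fundamental theorem on each line. Since the bilinear form splits into directions,
  this takes the place of the divergence theorem.\<close>

lemma bint_pd:
  fixes g :: "real ^ 'n::finite \<Rightarrow> real"
  assumes g: "CS (Suc 0) g" and lu: "fst K $ i \<le> snd K $ i"
  shows "bint K (pd i g) = face_int K i 1 g - face_int K i (-1) g"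
proof -
  have c: "continuous_on UNIV g" "continuous_on UNIV (pd i g)"
    using CS_continuous[OF g] CS_continuous[OF JS_pd[OF g]] by auto
  have "integral {fst K $ i..snd K $ i} (\<lambda>s. pd i g (pt i y s)) = g (pt i y (snd K $ i)) - g (pt i y (fst K $ i))" for y
    using line_FTC[OF g lu, of i "pt i y 0"] by simp
  then show ?thesis
    unfolding fubini_face(2)[OF c(2), of K i] face_int_pt
    by (simp add: set_integral_diff(2)[OF face_integrable[OF c(1)] face_integrable[OF c(1)]])
qed

lemma periodic_upd:
  assumes "periodic a b g"
  shows "g (upd x i (b $ i)) = g (upd x i (a $ i))"
  using assms[unfolded periodic_def, rule_format, of "upd x i (a $ i)" i] by (simp add: add_axis_upd)

lemma bint_pd_periodic:
  fixes g :: "real ^ 'n::finite \<Rightarrow> real"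
  assumes g: "CS (Suc 0) g" and p: "periodic a b g" and "a $ i \<le> b $ i"
  shows "bint (a, b) (pd i g) = 0"
  using bint_eq_lines[of "pd i g" "\<lambda>_. 0" i "(a, b)"] line_FTC[OF g assms(3)] periodic_upd[OF p, of _ i]
    CS_continuous[OF JS_pd[OF g]] by simp

section \<open>The one-dimensional Gauss--Radau projection\<close>

text \<open>The inner product with weight (x - e)^2. A polynomial with a double zero at
  \<open>e\<close> has the form (x - e)^2 r, and its integral against s is \<open>wip\<close> of r
  and s; so the orthogonality condition of the projection becomes ordinary orthogonality.\<close>

definition wip :: "real \<Rightarrow> real \<Rightarrow> real \<Rightarrow> real poly \<Rightarrow> real poly \<Rightarrow> real" where
  "wip lo hi e r s = integral {lo..hi} (\<lambda>x. (x - e)\<^sup>2 * poly r x * poly s x)"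

lemma cont_int_real: "continuous_on {l..u} g \<Longrightarrow> g integrable_on {l..u}" for g :: "real \<Rightarrow> real"
  using integrable_continuous_real by blast

lemma wip_sym: "wip lo hi e r s = wip lo hi e s r"
  by (simp add: wip_def mult_ac)

lemma wip_add: "wip lo hi e (r + r') s = wip lo hi e r s + wip lo hi e r' s"
  unfolding wip_def
  by (subst integral_add[symmetric]) (auto intro!: cont_int_real continuous_intros simp: algebra_simps)

lemma wip_smult: "wip lo hi e (smult c r) s = c * wip lo hi e r s"
  unfolding wip_def
  by (subst integral_mult_right[symmetric]) (auto simp: algebra_simps)

lemma wip_diff: "wip lo hi e (r - r') s = wip lo hi e r s - wip lo hi e r' s"
  using wip_add[of lo hi e r "smult (-1) r'" s] wip_smult[of lo hi e "-1" r' s] by simp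

lemma wip_0 [simp]: "wip lo hi e 0 s = 0"
  by (simp add: wip_def)

lemma wip_sum: "wip lo hi e (\<Sum>k\<in>J. f k) s = (\<Sum>k\<in>J. wip lo hi e (f k) s)"
  by (induction J rule: infinite_finite_induct) (auto simp: wip_add)

lemma wip_pos:
  assumes "lo < hi" "p \<noteq> 0"
  shows "wip lo hi e p p > 0"
proof -
  have c: "continuous_on (cbox lo hi) (\<lambda>x. (x - e)\<^sup>2 * poly p x * poly p x)"
    by (auto intro!: continuous_intros)
  have nn: "(x - e)\<^sup>2 * poly p x * poly p x \<ge> 0" for x
    by (simp add: mult.assoc)
  have "wip lo hi e p p \<noteq> 0"
  proof
    assume "wip lo hi e p p = 0"
    then have "\<forall>x\<in>cbox lo hi. (x - e)\<^sup>2 * poly p x * poly p x = 0"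
      using integral_cbox_eq_0_iff[OF c] nn assms(1) by (simp add: wip_def)
    then have "{lo..hi} \<subseteq> insert e {x. poly p x = 0}" by auto
    moreover have "finite (insert e {x. poly p x = 0})" using poly_roots_finite[OF assms(2)] by simp
    ultimately have "finite {lo..hi}" by (rule finite_subset)
    then show False using assms(1) by (simp add: infinite_Icc)
  qed
  moreover have "wip lo hi e p p \<ge> 0"
    unfolding wip_def by (rule integral_nonneg) (use nn in \<open>auto intro!: cont_int_real continuous_intros\<close>)
  ultimately show ?thesis by simp
qed

text \<open>Gram--Schmidt on 1, x, x^2 and so on. The expansion is stated for polynomials whose
  coefficients vanish from \<open>m\<close> on, because for \<open>m = 0\<close>, which occurs when
  q = 1, this leaves exactly the zero polynomial, while no degree bound would.\<close>

lemma orthonormal_polys: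
  assumes "lo < hi"
  shows "\<exists>\<pi> :: nat \<Rightarrow> real poly. (\<forall>k<m. degree (\<pi> k) \<le> k) \<and>
     (\<forall>k<m. \<forall>l<m. wip lo hi e (\<pi> k) (\<pi> l) = (if k = l then 1 else 0)) \<and>
     (\<forall>r. (\<forall>n\<ge>m. coeff r n = 0) \<longrightarrow> r = (\<Sum>k<m. smult (wip lo hi e r (\<pi> k)) (\<pi> k)))"
proof (induction m)
  case 0
  show ?case by (auto simp: poly_eq_iff)
next
  case (Suc m)
  let ?w = "wip lo hi e"
  obtain \<pi> :: "nat \<Rightarrow> real poly" where d: "\<And>k. k < m \<Longrightarrow> degree (\<pi> k) \<le> k"
    and o: "\<And>k l. k < m \<Longrightarrow> l < m \<Longrightarrow> ?w (\<pi> k) (\<pi> l) = (if k = l then 1 else 0)"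
    and r: "\<And>r. (\<And>n. n \<ge> m \<Longrightarrow> coeff r n = 0) \<Longrightarrow> r = (\<Sum>k<m. smult (?w r (\<pi> k)) (\<pi> k))"
    using Suc.IH by blast
  define p0 :: "real poly" where "p0 = monom 1 m"
  define p1 where "p1 = p0 - (\<Sum>k<m. smult (?w p0 (\<pi> k)) (\<pi> k))"
  have c0: "coeff (\<Sum>k<m. smult (?w p0 (\<pi> k)) (\<pi> k)) n = 0" if "n \<ge> m" for n
    unfolding coeff_sum coeff_smult
  proof (rule sum.neutral, intro ballI)
    fix k assume "k \<in> {..<m}"
    then have "coeff (\<pi> k) n = 0" using d[of k] that by (intro coeff_eq_0) auto
    then show "?w p0 (\<pi> k) * coeff (\<pi> k) n = 0" by simp
  qed
  have c1: "coeff p1 n = (if n = m then 1 else 0)" if "n \<ge> m" for n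
    using c0[OF that] that by (simp add: p1_def p0_def)
  have nz: "p1 \<noteq> 0" using c1[of m] by auto
  define N where "N = sqrt (?w p1 p1)"
  have N: "N > 0" "N * N = ?w p1 p1" using wip_pos[OF assms nz, of e] by (auto simp: N_def)
  have o1: "?w p1 (\<pi> l) = 0" if "l < m" for l
  proof -
    have "?w (\<Sum>k<m. smult (?w p0 (\<pi> k)) (\<pi> k)) (\<pi> l) = (\<Sum>k<m. if k = l then ?w p0 (\<pi> k) else 0)"
      unfolding wip_sum wip_smult by (rule sum.cong) (use o that in auto)
    then show ?thesis using that by (simp add: p1_def wip_diff)
  qed
  define \<pi>' where "\<pi>' = \<pi>(m := smult (1 / N) p1)"
  have \<pi>': "\<pi>' k = \<pi> k" if "k < m" for k using that by (simp add: \<pi>'_def)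
  have \<pi>'m: "\<pi>' m = smult (1 / N) p1" by (simp add: \<pi>'_def)
  show ?case
  proof (rule exI[of _ \<pi>'], intro conjI allI impI)
    fix k assume "k < Suc m"
    show "degree (\<pi>' k) \<le> k"
    proof (cases "k = m")
      case True
      have "degree p1 \<le> m" by (rule degree_le) (use c1 in auto)
      then show ?thesis using True \<pi>'m degree_smult_le[of "1/N" p1] by simp
    qed (use \<open>k < Suc m\<close> \<pi>' d in auto)
  next
    fix k l assume kl: "k < Suc m" "l < Suc m"
    show "?w (\<pi>' k) (\<pi>' l) = (if k = l then 1 else 0)"
    proof (cases "k = m"; cases "l = m")
      assume "k = m" "l = m"
      have "?w (smult (1/N) p1) (smult (1/N) p1) = 1 / N * (1 / N * ?w p1 p1)"
        by (simp add: wip_smult wip_sym[of lo hi e p1 "smult _ _"])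
      also have "\<dots> = 1" using N by (simp add: N(2)[symmetric])
      finally show ?thesis using \<open>k = m\<close> \<open>l = m\<close> \<pi>'m by simp
    qed (use kl o o1 in \<open>auto simp: \<pi>' \<pi>'m wip_smult wip_sym[of lo hi e "\<pi> _" "smult _ _"]\<close>)
  next
    fix s :: "real poly" assume s: "\<forall>n\<ge>Suc m. coeff s n = 0"
    define c where "c = coeff s m"
    define s' where "s' = s - smult c p1"
    have "coeff s' n = 0" if "n \<ge> m" for n
      using c1[OF that] s that by (cases "n = m") (auto simp: s'_def c_def)
    then have s': "s' = (\<Sum>k<m. smult (?w s' (\<pi> k)) (\<pi> k))" by (rule r)
    have w1: "?w s (\<pi> k) = ?w s' (\<pi> k)" if "k < m" for k
      using o1[OF that] by (simp add: s'_def wip_diff wip_smult)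
    have "?w s' p1 = 0"
      by (subst s') (simp add: wip_sum wip_smult wip_sym[of lo hi e _ p1] o1)
    then have "?w s p1 = c * ?w p1 p1" by (simp add: s'_def wip_diff wip_smult)
    then have w2: "smult (?w s (\<pi>' m)) (\<pi>' m) = smult c p1"
    proof -
      have "?w s (\<pi>' m) = 1 / N * ?w p1 s"
        by (subst wip_sym) (simp add: \<pi>'m wip_smult)
      then have "?w s (\<pi>' m) * (1 / N) = c"
        using N(1) \<open>?w s p1 = c * ?w p1 p1\<close> wip_sym[of lo hi e p1 s] by (simp add: N(2)[symmetric])
      then show ?thesis by (simp add: \<pi>'m)
    qed
    have "(\<Sum>k<m. smult (?w s (\<pi>' k)) (\<pi>' k)) = s'"
      by (subst s') (rule sum.cong, auto simp: \<pi>' w1)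
    then show "s = (\<Sum>k<Suc m. smult (?w s (\<pi>' k)) (\<pi>' k))"
      by (simp add: w2) (simp add: s'_def)
  qed
qed

lemma double_root:
  fixes d :: "real poly"
  assumes "poly d e = 0" "poly (pderiv d) e = 0"
  obtains \<rho> where "d = [:- e, 1:] * ([:- e, 1:] * \<rho>)"
proof -
  obtain \<sigma> where s: "d = [:- e, 1:] * \<sigma>" using assms(1) by (auto simp: poly_eq_0_iff_dvd elim: dvdE)
  have "poly (pderiv d) e = poly \<sigma> e" unfolding s by (subst pderiv_mult) (simp add: pderiv_pCons)
  then obtain \<rho> where "\<sigma> = [:- e, 1:] * \<rho>" using assms(2) by (auto simp: poly_eq_0_iff_dvd elim: dvdE)
  then show ?thesis using that s by blast
qed

definition radau_cond :: "nat \<Rightarrow> real \<Rightarrow> real \<Rightarrow> real \<Rightarrow> (real \<Rightarrow> real) \<Rightarrow> real poly \<Rightarrow> bool" where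
  "radau_cond q lo hi e g p \<longleftrightarrow> degree p \<le> q \<and>
     (\<forall>r. degree r + 2 \<le> q \<longrightarrow> integral {lo..hi} (\<lambda>s. (poly p s - g s) * poly r s) = 0) \<and>
     poly p e = g e \<and> poly (pderiv p) e = deriv g e"

lemma degree_double_root:
  fixes \<rho> :: "real poly"
  assumes "\<rho> \<noteq> 0"
  shows "degree ([:- e, 1:] * ([:- e, 1:] * \<rho>)) = degree \<rho> + 2"
proof -
  have "degree ([:- e, 1:] * \<rho>) = degree \<rho> + 1"
    using assms by (subst degree_mult_eq) auto
  moreover from this have "[:- e, 1:] * \<rho> \<noteq> 0" by force
  then have "degree ([:- e, 1:] * ([:- e, 1:] * \<rho>)) = 1 + degree ([:- e, 1:] * \<rho>)"
    by (subst degree_mult_eq) auto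
  ultimately show ?thesis by simp
qed

text \<open>The difference of two candidates has a double zero at \<open>e\<close>, so it is (x -
  e)^2 r with r of degree at most q - 2. Testing with r itself makes \<open>wip\<close> of r with r
  vanish.\<close>

lemma radau_cond_unique:
  assumes "lo < hi" "continuous_on {lo..hi} g" "radau_cond q lo hi e g p1" "radau_cond q lo hi e g p2"
  shows "p1 = p2"
proof (rule ccontr)
  assume ne: "p1 \<noteq> p2"
  have "poly (p1 - p2) e = 0" "poly (pderiv (p1 - p2)) e = 0"
    using assms(3,4) by (auto simp: radau_cond_def pderiv_diff)
  then obtain \<rho> where r: "p1 - p2 = [:- e, 1:] * ([:- e, 1:] * \<rho>)" by (rule double_root)
  have \<rho>: "\<rho> \<noteq> 0" using ne r by auto
  have "degree (p1 - p2) \<le> q" using assms(3,4) by (auto simp: radau_cond_def intro: degree_diff_le)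
  then have d: "degree \<rho> + 2 \<le> q" using degree_double_root[OF \<rho>, of e] r by simp
  have "wip lo hi e \<rho> \<rho> = integral {lo..hi} (\<lambda>s. (poly p1 s - g s) * poly \<rho> s - (poly p2 s - g s) * poly \<rho> s)"
    unfolding wip_def
  proof (rule integral_cong)
    fix x
    have "poly p1 x - poly p2 x = (x - e)\<^sup>2 * poly \<rho> x"
      using arg_cong[OF r, of "\<lambda>p. poly p x"] by (simp add: power2_eq_square algebra_simps)
    then show "(x - e)\<^sup>2 * poly \<rho> x * poly \<rho> x = (poly p1 x - g x) * poly \<rho> x - (poly p2 x - g x) * poly \<rho> x"
      by (simp add: algebra_simps)
  qed
  also have "\<dots> = 0 - 0"
    using assms(3,4) d unfolding radau_cond_def
    by (subst integral_diff) (auto intro!: cont_int_real continuous_intros assms(2))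
  finally show False using wip_pos[OF assms(1) \<rho>, of e] by simp
qed

lemma radau_eqI:
  assumes "lo < hi" "continuous_on {lo..hi} g" "radau_cond q lo hi e g p"
  shows "radau q lo hi e g = p"
proof -
  have "(LINT s:{lo<..<hi}|lebesgue. (poly p s - g s) * poly r s) = integral {lo..hi} (\<lambda>s. (poly p s - g s) * poly r s)" for p r
  proof -
    have "continuous_on {lo..hi} (\<lambda>s. (poly p s - g s) * poly r s)"
      by (auto intro!: continuous_intros assms(2))
    from borel_integrable_compact[OF _ this, folded set_integrable_def]
    have i: "set_integrable lborel {lo<..<hi} (\<lambda>s. (poly p s - g s) * poly r s)"
      by (rule set_integrable_subset) auto
    then have "(LINT s:{lo<..<hi}|lebesgue. (poly p s - g s) * poly r s) = (LINT s:{lo<..<hi}|lborel. (poly p s - g s) * poly r s)"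
      unfolding set_lebesgue_integral_def set_integrable_def by (intro integral_completion) auto
    also have "\<dots> = integral {lo<..<hi} (\<lambda>s. (poly p s - g s) * poly r s)"
      by (rule set_borel_integral_eq_integral(2)[OF i])
    finally show ?thesis
      using integral_open_interval[of lo hi "\<lambda>s. (poly p s - g s) * poly r s"] by (simp only: box_real cbox_interval)
  qed
  then have "radau q lo hi e g = (THE p. radau_cond q lo hi e g p)"
    unfolding radau_def radau_cond_def by simp
  also have "\<dots> = p"
    by (rule the_equality) (use assms radau_cond_unique[OF assms(1,2)] in auto)
  finally show ?thesis .
qed

text \<open>The projection sees \<open>g\<close> only through its value and derivative at
  \<open>e\<close> and finitely many moments, and the polynomials that multiply them do not depend
  on \<open>g\<close>. Linearity, smoothness in parameters and commutation with derivatives in other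
  variables and in time are all read off from this formula.\<close>

lemma radau_repr:
  assumes lh: "lo < hi" and q: "q \<ge> 1" and e: "e \<in> {lo..hi}"
  shows "\<exists>A B \<Psi> \<pi>. degree A \<le> q \<and> degree B \<le> q \<and> (\<forall>k<q - 1. degree (\<Psi> k) \<le> q) \<and>
    (\<forall>g. continuous_on {lo..hi} g \<longrightarrow>
       radau_cond q lo hi e g (smult (g e) A + smult (deriv g e) B +
          (\<Sum>k<q - 1. smult (integral {lo..hi} (\<lambda>s. g s * poly (\<pi> k) s)) (\<Psi> k))))"
proof -
  \<comment> \<open>The dimension of the space of test polynomials of degree at most q - 2; it is 0
    for q = 1.\<close>
  define m where "m = q - 1"
  obtain \<pi> :: "nat \<Rightarrow> real poly" where d: "\<And>k. k < m \<Longrightarrow> degree (\<pi> k) \<le> k"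
    and o: "\<And>k l. k < m \<Longrightarrow> l < m \<Longrightarrow> wip lo hi e (\<pi> k) (\<pi> l) = (if k = l then 1 else 0)"
    and r: "\<And>r. (\<And>n. n \<ge> m \<Longrightarrow> coeff r n = 0) \<Longrightarrow> r = (\<Sum>k<m. smult (wip lo hi e r (\<pi> k)) (\<pi> k))"
    using orthonormal_polys[OF lh, of m e] by blast
  define \<Psi> where "\<Psi> k = [:- e, 1:] * ([:- e, 1:] * \<pi> k)" for k
  \<comment> \<open>1 and x - e are corrected so that their integrals against every
    \<open>\<pi> l\<close> vanish. The correction keeps value and derivative at \<open>e\<close>,
    since each \<open>\<Psi> k\<close> has a double zero there, and it works because the integral of
    \<open>\<Psi> k\<close> against \<open>\<pi> l\<close> is 1 for k = l and 0 otherwise.\<close>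
  define A where "A = 1 - (\<Sum>k<m. smult (integral {lo..hi} (poly (\<pi> k))) (\<Psi> k))"
  define B where "B = [:- e, 1:] - (\<Sum>k<m. smult (integral {lo..hi} (\<lambda>s. (s - e) * poly (\<pi> k) s)) (\<Psi> k))"
  have d\<Psi>: "degree (\<Psi> k) \<le> q" if "k < m" for k
  proof (cases "\<pi> k = 0")
    case False
    then show ?thesis using degree_double_root[of "\<pi> k" e] d[OF that] that by (simp add: \<Psi>_def m_def)
  qed (simp add: \<Psi>_def)
  have p\<Psi>: "poly (\<Psi> k) s = (s - e)\<^sup>2 * poly (\<pi> k) s" for k s
    by (simp add: \<Psi>_def power2_eq_square algebra_simps)
  have \<Psi>e: "poly (\<Psi> k) e = 0" for k by (simp add: p\<Psi>)
  have \<Psi>e': "poly (pderiv (\<Psi> k)) e = 0" for k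
    unfolding \<Psi>_def by (subst pderiv_mult) (simp add: pderiv_pCons)
  have dA: "degree A \<le> q" unfolding A_def
    by (rule degree_diff_le) (auto intro!: degree_sum_le order_trans[OF degree_smult_le] d\<Psi>)
  have dB: "degree B \<le> q" unfolding B_def
    by (rule degree_diff_le) (use q in \<open>auto intro!: degree_sum_le order_trans[OF degree_smult_le] d\<Psi>\<close>)
  have "radau_cond q lo hi e g (smult (g e) A + smult (deriv g e) B +
          (\<Sum>k<m. smult (integral {lo..hi} (\<lambda>s. g s * poly (\<pi> k) s)) (\<Psi> k)))" (is "radau_cond q lo hi e g ?p")
    if g: "continuous_on {lo..hi} g" for g
    unfolding radau_cond_def
  proof (intro conjI allI impI)
    show "degree ?p \<le> q"
      by (intro degree_add_le) (auto intro!: degree_sum_le order_trans[OF degree_smult_le] d\<Psi> dA dB)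
    show "poly ?p e = g e"
      by (simp add: poly_sum \<Psi>e A_def B_def)
    have "pderiv (\<Sum>k<m. f k) = (\<Sum>k<m. pderiv (f k))" for f :: "nat \<Rightarrow> real poly"
      by (rule higher_pderiv_sum[of 1, simplified])
    then show "poly (pderiv ?p) e = deriv g e"
      by (simp add: pderiv_add pderiv_diff pderiv_smult poly_sum \<Psi>e' A_def B_def pderiv_pCons)
    fix s :: "real poly" assume s: "degree s + 2 \<le> q"
    define c where "c k = integral {lo..hi} (\<lambda>s. g s * poly (\<pi> k) s)
        - g e * integral {lo..hi} (poly (\<pi> k)) - deriv g e * integral {lo..hi} (\<lambda>s. (s - e) * poly (\<pi> k) s)" for k
    have p: "poly ?p x = g e + deriv g e * (x - e) + (\<Sum>k<m. c k * ((x - e)\<^sup>2 * poly (\<pi> k) x))" for x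
      by (simp add: A_def B_def c_def poly_sum p\<Psi> algebra_simps sum.distrib sum_subtractf sum_distrib_left)
    have "integral {lo..hi} (\<lambda>x. (poly ?p x - g x) * poly (\<pi> l) x) = 0" if l: "l < m" for l
    proof -
      have i: "(\<lambda>s. g s * poly (\<pi> l) s) integrable_on {lo..hi}" "poly (\<pi> l) integrable_on {lo..hi}"
        "(\<lambda>s. (s - e) * poly (\<pi> l) s) integrable_on {lo..hi}"
        "(\<lambda>x. (x - e)\<^sup>2 * poly (\<pi> k) x * poly (\<pi> l) x) integrable_on {lo..hi}" for k
        by (auto intro!: cont_int_real continuous_intros g)
      have "((\<lambda>x. g e * poly (\<pi> l) x + deriv g e * ((x - e) * poly (\<pi> l) x)
          + (\<Sum>k<m. c k * ((x - e)\<^sup>2 * poly (\<pi> k) x * poly (\<pi> l) x)) - g x * poly (\<pi> l) x)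
        has_integral g e * integral {lo..hi} (poly (\<pi> l)) + deriv g e * integral {lo..hi} (\<lambda>s. (s - e) * poly (\<pi> l) s)
           + (\<Sum>k<m. c k * wip lo hi e (\<pi> k) (\<pi> l)) - integral {lo..hi} (\<lambda>s. g s * poly (\<pi> l) s)) {lo..hi}"
        unfolding wip_def
        by (intro has_integral_diff has_integral_add has_integral_mult_right has_integral_sum integrable_integral i) auto
      moreover have "(\<Sum>k<m. c k * wip lo hi e (\<pi> k) (\<pi> l)) = c l"
      proof -
        have "(\<Sum>k<m. c k * wip lo hi e (\<pi> k) (\<pi> l)) = (\<Sum>k<m. if k = l then c k else 0)"
          by (rule sum.cong) (use o l in auto)
        then show ?thesis using l by simp
      qed
      moreover have "(\<lambda>x. g e * poly (\<pi> l) x + deriv g e * ((x - e) * poly (\<pi> l) x)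
          + (\<Sum>k<m. c k * ((x - e)\<^sup>2 * poly (\<pi> k) x * poly (\<pi> l) x)) - g x * poly (\<pi> l) x) =
          (\<lambda>x. (poly ?p x - g x) * poly (\<pi> l) x)"
        unfolding p by (simp add: fun_eq_iff algebra_simps sum_distrib_left sum_distrib_right)
      ultimately show ?thesis by (simp add: c_def integral_unique)
    qed
    then have z: "((\<lambda>x. (poly ?p x - g x) * poly (\<pi> l) x) has_integral 0) {lo..hi}" if "l < m" for l
      using that by (intro has_integral_integrable_integral[THEN iffD2] conjI) (auto intro!: cont_int_real continuous_intros g)
    define b where "b k = wip lo hi e s (\<pi> k)" for k
    have s': "s = (\<Sum>k<m. smult (b k) (\<pi> k))"
      unfolding b_def by (rule r) (use s in \<open>auto simp: m_def intro!: coeff_eq_0\<close>)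
    have "((\<lambda>x. \<Sum>l<m. b l * ((poly ?p x - g x) * poly (\<pi> l) x)) has_integral (\<Sum>l<m. b l * 0)) {lo..hi}"
      by (intro has_integral_sum has_integral_mult_right z) auto
    moreover have "(\<lambda>x. \<Sum>l<m. b l * ((poly ?p x - g x) * poly (\<pi> l) x)) = (\<lambda>x. (poly ?p x - g x) * poly s x)"
      unfolding s' poly_sum[of "\<lambda>k. smult (b k) (\<pi> k)"] poly_smult sum_distrib_left
      by (intro ext sum.cong) (simp_all only: mult_ac)
    ultimately show "integral {lo..hi} (\<lambda>x. (poly ?p x - g x) * poly s x) = 0"
      by (simp add: integral_unique)
  qed
  then show ?thesis using dA dB d\<Psi> unfolding m_def by blast
qed

lemma radau_cond_radau:
  assumes "lo < hi" "q \<ge> 1" "e \<in> {lo..hi}" "continuous_on {lo..hi} g"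
  shows "radau_cond q lo hi e g (radau q lo hi e g)"
proof -
  obtain p where "radau_cond q lo hi e g p" using radau_repr[OF assms(1-3)] assms(4) by blast
  then show ?thesis using radau_eqI[OF assms(1,4)] by metis
qed

text \<open>Cauchy--Schwarz against the constant 1, from the nonnegativity of the variance of
  \<open>g\<close> around its mean.\<close>

lemma integral_sq_le:
  fixes g :: "real \<Rightarrow> real"
  assumes g: "continuous_on {a..b} g" and ab: "a \<le> b"
  shows "(integral {a..b} g)\<^sup>2 \<le> (b - a) * integral {a..b} (\<lambda>x. (g x)\<^sup>2)"
proof (cases "a = b")
  case False
  define m where "m = integral {a..b} g / (b - a)"
  have ba: "b - a > 0" using False ab by simp
  have i: "g integrable_on {a..b}" "(\<lambda>x. (g x)\<^sup>2) integrable_on {a..b}"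
    by (auto intro!: cont_int_real continuous_intros g)
  have "((\<lambda>x. (g x)\<^sup>2 - 2 * m * g x + m\<^sup>2) has_integral
     integral {a..b} (\<lambda>x. (g x)\<^sup>2) - 2 * m * integral {a..b} g + (b - a) * m\<^sup>2) {a..b}"
    using has_integral_const_real[of "m\<^sup>2" a b] ab
    by (intro has_integral_add has_integral_diff has_integral_mult_right integrable_integral i) simp
  moreover have "(g x)\<^sup>2 - 2 * m * g x + m\<^sup>2 = (g x - m)\<^sup>2" for x
    by (simp add: power2_eq_square algebra_simps)
  ultimately have h: "((\<lambda>x. (g x - m)\<^sup>2) has_integral
     integral {a..b} (\<lambda>x. (g x)\<^sup>2) - 2 * m * integral {a..b} g + (b - a) * m\<^sup>2) {a..b}"
    by simp
  have "0 \<le> integral {a..b} (\<lambda>x. (g x)\<^sup>2) - 2 * m * integral {a..b} g + (b - a) * m\<^sup>2"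
    by (rule has_integral_nonneg[OF h]) simp
  moreover have "integral {a..b} g = m * (b - a)" using ba by (simp add: m_def)
  ultimately have "m\<^sup>2 * (b - a) \<le> integral {a..b} (\<lambda>x. (g x)\<^sup>2)"
    by (simp add: power2_eq_square algebra_simps)
  then have "(b - a) * (m\<^sup>2 * (b - a)) \<le> (b - a) * integral {a..b} (\<lambda>x. (g x)\<^sup>2)"
    using ba by (intro mult_left_mono) auto
  then show ?thesis by (simp add: \<open>integral {a..b} g = m * (b - a)\<close> power2_eq_square algebra_simps)
qed simp

lemma taylor_poly_exists:
  fixes c :: "nat \<Rightarrow> real"
  shows "\<exists>T. degree T \<le> q \<and> (\<forall>k\<le>q. poly ((pderiv ^^ k) T) e = c k)"
proof -
  define p where "p = (\<Sum>k\<le>q. monom (c k / fact k) k)"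
  have cp: "coeff p k = (if k \<le> q then c k / fact k else 0)" for k
    by (simp add: p_def coeff_sum coeff_monom)
  have d: "(pderiv ^^ k) (pcompose p [:- e, 1:]) = pcompose ((pderiv ^^ k) p) [:- e, 1:]" for k
    by (induction k) (auto simp: pderiv_pcompose pderiv_pCons)
  have "poly ((pderiv ^^ k) (pcompose p [:- e, 1:])) e = c k" if "k \<le> q" for k
    unfolding d poly_pcompose using that cp
    by (simp add: poly_0_coeff_0 coeff_higher_pderiv pochhammer_fact[symmetric])
  moreover have "degree p \<le> q" by (rule degree_le) (simp add: cp)
  then have "degree (pcompose p [:- e, 1:]) \<le> q" by (simp add: degree_pcompose)
  ultimately show ?thesis by blast
qed

text \<open>Cauchy--Schwarz bounds the remainder of the derivative of order q by one power of |s -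
  e|, and each use of the mean value theorem adds two more. Squares are kept throughout, so that
  half-integer powers do not occur.\<close>

lemma taylor_remainder_sq:
  fixes R :: "nat \<Rightarrow> real \<Rightarrow> real"
  assumes d: "\<And>k s. k \<le> q \<Longrightarrow> (R k has_real_derivative R (Suc k) s) (at s)"
    and c: "continuous_on UNIV (R (Suc q))"
    and z: "\<And>k. k \<le> q \<Longrightarrow> R k e = 0"
    and e: "e \<in> {lo..hi}" and s: "s \<in> {lo..hi}" and j: "j \<le> q"
  shows "(R (q - j) s)\<^sup>2 \<le> \<bar>s - e\<bar> ^ (2 * j + 1) * integral {lo..hi} (\<lambda>x. (R (Suc q) x)\<^sup>2)"
  using s j
proof (induction j arbitrary: s)
  case 0
  let ?I = "\<lambda>a b. integral {a..b} (\<lambda>x. (R (Suc q) x)\<^sup>2)"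
  have cc: "continuous_on S (R (Suc q))" for S using continuous_on_subset[OF c] by auto
  have key: "(R q b - R q a)\<^sup>2 \<le> (b - a) * ?I lo hi" if "a \<le> b" "lo \<le> a" "b \<le> hi" for a b
  proof -
    have "(R (Suc q) has_integral R q b - R q a) {a..b}"
      by (rule fundamental_theorem_of_calculus[OF that(1)])
         (use d[of q] in \<open>auto simp: has_real_derivative_iff_has_vector_derivative[symmetric] intro: DERIV_subset\<close>)
    then have "(R q b - R q a)\<^sup>2 \<le> (b - a) * ?I a b"
      using integral_sq_le[OF cc that(1)] by (simp add: integral_unique)
    also have "\<dots> \<le> (b - a) * ?I lo hi"
      by (intro mult_left_mono integral_subset_le) (use that in \<open>auto intro!: cont_int_real continuous_intros cc\<close>)
    finally show ?thesis .
  qed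
  show ?case
    using key[of e s] key[of s e] z[of q] e 0 by (cases "e \<le> s") (auto simp: abs_if)
next
  case (Suc j)
  let ?I = "integral {lo..hi} (\<lambda>x. (R (Suc q) x)\<^sup>2)"
  have I0: "?I \<ge> 0"
    by (rule integral_nonneg) (auto intro!: cont_int_real continuous_intros continuous_on_subset[OF c])
  have Sq: "Suc (q - Suc j) = q - j" using Suc.prems by simp
  have "\<exists>x\<in>{lo..hi}. \<bar>x - e\<bar> \<le> \<bar>s - e\<bar> \<and> R (q - Suc j) s = (s - e) * R (q - j) x"
  proof (cases "s = e")
    case True
    then show ?thesis using e z[of "q - Suc j"] by auto
  next
    case False
    have dd: "(R (q - Suc j) has_real_derivative R (q - j) x) (at x)" for x
      using d[of "q - Suc j" x] Sq by simp
    show ?thesis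
    proof (cases "e < s")
      case True
      from MVT2[OF this, of "R (q - Suc j)" "R (q - j)"] dd obtain x where
        "e < x" "x < s" "R (q - Suc j) s - R (q - Suc j) e = (s - e) * R (q - j) x" by auto
      then show ?thesis using z[of "q - Suc j"] e Suc.prems by (intro bexI[of _ x]) auto
    next
      case F: False
      with False have "s < e" by simp
      from MVT2[OF this, of "R (q - Suc j)" "R (q - j)"] dd obtain x where
        "s < x" "x < e" "R (q - Suc j) e - R (q - Suc j) s = (e - s) * R (q - j) x" by auto
      then show ?thesis using z[of "q - Suc j"] e Suc.prems by (intro bexI[of _ x]) (auto simp: algebra_simps)
    qed
  qed
  then obtain x where x: "x \<in> {lo..hi}" "\<bar>x - e\<bar> \<le> \<bar>s - e\<bar>" "R (q - Suc j) s = (s - e) * R (q - j) x" by auto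
  have "(R (q - Suc j) s)\<^sup>2 = \<bar>s - e\<bar>\<^sup>2 * (R (q - j) x)\<^sup>2" by (simp add: x(3) power_mult_distrib)
  also have "\<dots> \<le> \<bar>s - e\<bar>\<^sup>2 * (\<bar>x - e\<bar> ^ (2 * j + 1) * ?I)"
    by (intro mult_left_mono Suc.IH) (use x Suc.prems in auto)
  also have "\<dots> \<le> \<bar>s - e\<bar>\<^sup>2 * (\<bar>s - e\<bar> ^ (2 * j + 1) * ?I)"
    by (intro mult_left_mono mult_right_mono power_mono I0) (use x in auto)
  also have "\<dots> = \<bar>s - e\<bar> ^ (2 * Suc j + 1) * ?I" by (simp add: power2_eq_square)
  finally show ?case .
qed

text \<open>With \<open>T\<close> the Taylor polynomial at \<open>e\<close>, the polynomial \<open>radau g - T\<close> equals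
  \<open>(s - e)\<^sup>2 \<rho>\<close>, and \<open>\<rho>\<close> is admissible as a test function; this gives the bound without any scaling
  or inverse inequality.\<close>

lemma radau_error:
  fixes G :: "nat \<Rightarrow> real \<Rightarrow> real"
  assumes lh: "lo < hi" and q: "q \<ge> 1" and e: "e \<in> {lo..hi}"
    and d: "\<And>k s. k \<le> q \<Longrightarrow> (G k has_real_derivative G (Suc k) s) (at s)"
    and c: "continuous_on UNIV (G (Suc q))"
  shows "integral {lo..hi} (\<lambda>s. (G 0 s - poly (radau q lo hi e (G 0)) s)\<^sup>2)
     \<le> 4 * (hi - lo) ^ (2 * q + 2) * integral {lo..hi} (\<lambda>s. (G (Suc q) s)\<^sup>2)"
proof -
  define p where "p = radau q lo hi e (G 0)"
  let ?l = "hi - lo"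
  obtain T where T: "degree T \<le> q" "\<And>k. k \<le> q \<Longrightarrow> poly ((pderiv ^^ k) T) e = G k e"
    using taylor_poly_exists[of q e "\<lambda>k. G k e"] by blast
  define R where "R k s = G k s - poly ((pderiv ^^ k) T) s" for k s
  have cG: "continuous_on S (G 0)" for S
    using d[of 0] by (intro continuous_at_imp_continuous_on) (auto intro: DERIV_isCont)
  have pc: "radau_cond q lo hi e (G 0) p"
    unfolding p_def by (rule radau_cond_radau[OF lh q e cG])
  have dR: "(R k has_real_derivative R (Suc k) s) (at s)" if "k \<le> q" for k s
    unfolding R_def using d[OF that, of s] poly_DERIV[of "(pderiv ^^ k) T" s] by (auto intro!: derivative_eq_intros)
  have "(pderiv ^^ Suc q) T = 0"
    by (rule poly_eqI) (use T(1) in \<open>simp add: coeff_higher_pderiv coeff_eq_0 del: funpow.simps\<close>)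
  then have RS: "R (Suc q) = G (Suc q)" by (simp add: R_def fun_eq_iff del: funpow.simps)
  define I where "I = integral {lo..hi} (\<lambda>x. (G (Suc q) x)\<^sup>2)"
  have I0: "I \<ge> 0" unfolding I_def
    by (rule integral_nonneg) (auto intro!: cont_int_real continuous_intros continuous_on_subset[OF c])
  have R0: "(R 0 s)\<^sup>2 \<le> \<bar>s - e\<bar> ^ (2 * q + 1) * I" if "s \<in> {lo..hi}" for s
    using taylor_remainder_sq[of q R e lo hi s q] dR RS c T(2) e that by (simp add: R_def I_def)
  have cR: "continuous_on {lo..hi} (R 0)" unfolding R_def by (auto intro!: continuous_intros cG)
  have dG: "deriv (G 0) e = G (Suc 0) e" using DERIV_imp_deriv[OF d[of 0]] by simp
  have "poly (p - T) e = 0" "poly (pderiv (p - T)) e = 0"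
    using pc T(2)[of 0] T(2)[of 1] q dG by (auto simp: radau_cond_def pderiv_diff)
  then obtain \<rho> where \<rho>: "p - T = [:- e, 1:] * ([:- e, 1:] * \<rho>)" by (rule double_root)
  have ps: "poly p s = poly T s + (s - e)\<^sup>2 * poly \<rho> s" for s
    using arg_cong[OF \<rho>, of "\<lambda>p. poly p s"] by (simp add: power2_eq_square algebra_simps)
  define W where "W = integral {lo..hi} (\<lambda>s. (s - e)\<^sup>2 * (poly \<rho> s)\<^sup>2)"
  have iW: "(\<lambda>s. (s - e)\<^sup>2 * (poly \<rho> s)\<^sup>2) integrable_on {lo..hi}"
    by (auto intro!: cont_int_real continuous_intros)
  have lw: "\<bar>s - e\<bar> \<le> ?l" if "s \<in> {lo..hi}" for s using that e by auto
  have "W = integral {lo..hi} (\<lambda>s. R 0 s * poly \<rho> s)"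
  proof (cases "\<rho> = 0")
    case False
    have "degree (p - T) \<le> q" using pc T(1) by (auto simp: radau_cond_def intro: degree_diff_le)
    then have "degree \<rho> + 2 \<le> q" using degree_double_root[OF False, of e] \<rho> by simp
    then have "0 = integral {lo..hi} (\<lambda>s. (poly p s - G 0 s) * poly \<rho> s)"
      using pc by (simp add: radau_cond_def)
    also have "\<dots> = integral {lo..hi} (\<lambda>s. (s - e)\<^sup>2 * (poly \<rho> s)\<^sup>2 - R 0 s * poly \<rho> s)"
      unfolding ps R_def by (rule integral_cong) (simp add: power2_eq_square algebra_simps)
    also have "\<dots> = W - integral {lo..hi} (\<lambda>s. R 0 s * poly \<rho> s)"
      unfolding W_def by (rule integral_diff) (auto intro!: cont_int_real continuous_intros cR)
    finally show ?thesis by simp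
  qed (simp add: W_def)
  also have "\<dots> \<le> integral {lo..hi} (\<lambda>s. (1/2) * ((s - e)\<^sup>2 * (poly \<rho> s)\<^sup>2) + (1/2) * (?l ^ (2 * q - 1) * I))"
  proof (rule integral_le)
    fix s assume s: "s \<in> {lo..hi}"
    show "R 0 s * poly \<rho> s \<le> (1/2) * ((s - e)\<^sup>2 * (poly \<rho> s)\<^sup>2) + (1/2) * (?l ^ (2 * q - 1) * I)"
    proof (cases "s = e")
      case True
      then have "R 0 s = 0" using T(2)[of 0] by (simp add: R_def)
      then show ?thesis using I0 lh by simp
    next
      case False
      \<comment> \<open>One factor s - e is moved next to \<open>\<rho>\<close>, where Young's
        inequality forms the integrand of \<open>W\<close>; half of \<open>W\<close> is then
        absorbed on the left.\<close>
      define y where "y = R 0 s / (s - e)"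
      have Ry: "R 0 s = y * (s - e)" using False by (simp add: y_def)
      have "2 * q + 1 = (2 * q - 1) + 2" using q by simp
      then have "y\<^sup>2 * (s - e)\<^sup>2 \<le> \<bar>s - e\<bar> ^ (2 * q - 1) * I * (s - e)\<^sup>2"
        using R0[OF s] unfolding Ry by (simp only: power_add power_mult_distrib power2_abs) (simp add: mult_ac)
      then have "y\<^sup>2 \<le> \<bar>s - e\<bar> ^ (2 * q - 1) * I" using False by simp
      also have "\<dots> \<le> ?l ^ (2 * q - 1) * I"
        by (intro mult_right_mono power_mono I0 lw[OF s]) auto
      finally have "y\<^sup>2 \<le> ?l ^ (2 * q - 1) * I" .
      moreover have "2 * (y * (s - e) * poly \<rho> s) \<le> y\<^sup>2 + (s - e)\<^sup>2 * (poly \<rho> s)\<^sup>2"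
        using sum_squares_bound[of y "(s - e) * poly \<rho> s"] by (simp only: power_mult_distrib mult.assoc)
      ultimately show ?thesis unfolding Ry by linarith
    qed
  qed (auto intro!: cont_int_real continuous_intros cR)
  also have "\<dots> = (1/2) * W + (1/2) * (?l ^ (2 * q - 1) * I) * ?l"
    using lh iW unfolding W_def by (subst integral_add) auto
  also have "\<dots> = (W + (?l ^ (2 * q - 1) * ?l) * I) / 2" by (simp only: mult_ac) simp
  finally have "W \<le> (W + (?l ^ (2 * q - 1) * ?l) * I) / 2" .
  moreover have "W \<le> X" if "W \<le> (W + X) / 2" for X using that by simp
  ultimately have "W \<le> (?l ^ (2 * q - 1) * ?l) * I" by blast
  also have "?l ^ (2 * q - 1) * ?l = ?l ^ (2 * q)" using q by (simp add: power_Suc2[symmetric] del: power_Suc)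
  finally have W: "W \<le> ?l ^ (2 * q) * I" .
  have "integral {lo..hi} (\<lambda>s. (G 0 s - poly p s)\<^sup>2)
     \<le> integral {lo..hi} (\<lambda>s. 2 * (?l ^ (2 * q + 1) * I) + 2 * ?l\<^sup>2 * ((s - e)\<^sup>2 * (poly \<rho> s)\<^sup>2))"
  proof (rule integral_le)
    fix s assume s: "s \<in> {lo..hi}"
    have "(G 0 s - poly p s)\<^sup>2 = (R 0 s - (s - e)\<^sup>2 * poly \<rho> s)\<^sup>2" unfolding ps R_def by (simp add: algebra_simps)
    also have "\<dots> \<le> 2 * (R 0 s)\<^sup>2 + 2 * ((s - e)\<^sup>2 * poly \<rho> s)\<^sup>2"
      using zero_le_power2[of "R 0 s + (s - e)\<^sup>2 * poly \<rho> s"] by (simp add: power2_sum power2_diff)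
    also have "\<dots> \<le> 2 * (?l ^ (2 * q + 1) * I) + 2 * (?l\<^sup>2 * ((s - e)\<^sup>2 * (poly \<rho> s)\<^sup>2))"
    proof -
      have "(R 0 s)\<^sup>2 \<le> ?l ^ (2 * q + 1) * I"
        by (rule order_trans[OF R0[OF s]]) (intro mult_right_mono power_mono I0 lw[OF s], auto)
      moreover have "((s - e)\<^sup>2 * poly \<rho> s)\<^sup>2 = \<bar>s - e\<bar>\<^sup>2 * ((s - e)\<^sup>2 * (poly \<rho> s)\<^sup>2)"
        by (simp add: power_mult_distrib power2_eq_square)
      moreover have "\<dots> \<le> ?l\<^sup>2 * ((s - e)\<^sup>2 * (poly \<rho> s)\<^sup>2)"
        by (intro mult_right_mono power_mono lw[OF s]) auto
      ultimately show ?thesis by linarith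
    qed
    finally show "(G 0 s - poly p s)\<^sup>2 \<le> 2 * (?l ^ (2 * q + 1) * I) + 2 * ?l\<^sup>2 * ((s - e)\<^sup>2 * (poly \<rho> s)\<^sup>2)" by (simp add: mult_ac)
  qed (auto intro!: cont_int_real continuous_intros cG)
  also have "\<dots> = 2 * (?l ^ (2 * q + 1) * I) * ?l + 2 * ?l\<^sup>2 * W"
    using lh iW unfolding W_def by (subst integral_add) auto
  also have "\<dots> \<le> 2 * (?l ^ (2 * q + 1) * I) * ?l + 2 * ?l\<^sup>2 * (?l ^ (2 * q) * I)"
    using W by (intro add_left_mono mult_left_mono) auto
  also have "\<dots> = 4 * ?l ^ (2 * q + 2) * I" by (simp add: power_add power2_eq_square)
  finally show ?thesis by (simp add: p_def I_def)
qed

section \<open>Directional and tensor-product projections\<close>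

definition radau_pt :: "bool \<Rightarrow> 'n::finite elem \<Rightarrow> 'n \<Rightarrow> real" where
  "radau_pt low K i = (if low then fst K $ i else snd K $ i)"

definition proper :: "'n::finite elem \<Rightarrow> bool" where
  "proper K \<longleftrightarrow> (\<forall>i. fst K $ i < snd K $ i)"

lemma radau_pt_mem: "proper K \<Longrightarrow> radau_pt low K i \<in> {fst K $ i..snd K $ i}"
  by (auto simp: radau_pt_def proper_def less_imp_le)

lemma cont_line: "continuous_on UNIV g \<Longrightarrow> continuous_on S (\<lambda>s. g (upd x i s))"
  for g :: "real ^ 'n::finite \<Rightarrow> real"
  by (rule continuous_on_compose2[of UNIV g]) (auto intro!: continuous_intros)

lemma radau_dir_upd:
  "radau_dir low q K i g (upd x i s) =
     poly (radau q (fst K $ i) (snd K $ i) (radau_pt low K i) (\<lambda>s. g (upd x i s))) s"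
  unfolding radau_dir_def radau_pt_def by (simp add: upd_def[symmetric] flip: upd_def)

lemma radau_dir_x:
  "radau_dir low q K i g x =
     poly (radau q (fst K $ i) (snd K $ i) (radau_pt low K i) (\<lambda>s. g (upd x i s))) (x $ i)"
  using radau_dir_upd[of low q K i g x "x $ i"] by simp

text \<open>The formula of \<open>radau_repr\<close> on every line in direction \<open>i\<close>.
  Its polynomials depend on \<open>x $ i\<close> only, so they are constants for all other
  directions.\<close>

lemma radau_dir_repr:
  assumes K: "proper K" and q: "q \<ge> 1"
  shows "\<exists>A B \<Psi> \<pi>. degree A \<le> q \<and> degree B \<le> q \<and> (\<forall>k<q - 1. degree (\<Psi> k) \<le> q) \<and>
    (\<forall>g. continuous_on UNIV g \<longrightarrow> radau_dir low q K i g = (\<lambda>x.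
       g (upd x i (radau_pt low K i)) * poly A (x $ i) + pd i g (upd x i (radau_pt low K i)) * poly B (x $ i) +
       (\<Sum>k<q - 1. integral {fst K $ i..snd K $ i} (\<lambda>s. g (upd x i s) * poly (\<pi> k) s) * poly (\<Psi> k) (x $ i))))"
proof -
  let ?e = "radau_pt low K i"
  have lh: "fst K $ i < snd K $ i" using K by (simp add: proper_def)
  obtain A B \<Psi> \<pi> where d: "degree A \<le> q" "degree B \<le> q" "\<forall>k<q - 1. degree (\<Psi> k) \<le> q"
    and r: "\<And>g. continuous_on {fst K $ i..snd K $ i} g \<Longrightarrow>
       radau_cond q (fst K $ i) (snd K $ i) ?e g (smult (g ?e) A + smult (deriv g ?e) B +
          (\<Sum>k<q - 1. smult (integral {fst K $ i..snd K $ i} (\<lambda>s. g s * poly (\<pi> k) s)) (\<Psi> k)))"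
    using radau_repr[OF lh q radau_pt_mem[OF K, of low i]] by blast
  have "radau_dir low q K i g x =
       g (upd x i ?e) * poly A (x $ i) + pd i g (upd x i ?e) * poly B (x $ i) +
       (\<Sum>k<q - 1. integral {fst K $ i..snd K $ i} (\<lambda>s. g (upd x i s) * poly (\<pi> k) s) * poly (\<Psi> k) (x $ i))"
    if g: "continuous_on UNIV g" for g x
    unfolding radau_dir_x radau_eqI[OF lh cont_line[OF g] r[OF cont_line[OF g]]]
    by (simp add: poly_sum pd_upd)
  with d show ?thesis by (intro exI[of _ A] exI[of _ B] exI[of _ \<Psi>] exI[of _ \<pi>]) (auto simp: fun_eq_iff)
qed

text \<open>One order is lost because the formula contains the normal derivative \<open>pd i\<close>
  on a hyperplane.\<close>

lemma JS_radau_dir: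
  assumes K: "proper K" and q: "q \<ge> 1" and z: "JS (Suc k) S z"
  shows "JS k S (\<lambda>t. radau_dir low q K i (z t))"
proof -
  obtain A B \<Psi> \<pi> where r: "\<And>g. continuous_on UNIV g \<Longrightarrow> radau_dir low q K i g = (\<lambda>x.
       g (upd x i (radau_pt low K i)) * poly A (x $ i) + pd i g (upd x i (radau_pt low K i)) * poly B (x $ i) +
       (\<Sum>k<q - 1. integral {fst K $ i..snd K $ i} (\<lambda>s. g (upd x i s) * poly (\<pi> k) s) * poly (\<Psi> k) (x $ i)))"
    using radau_dir_repr[OF K q, of low i] by blast
  have "JS k S (\<lambda>t x. z t (upd x i (radau_pt low K i)) * poly A (x $ i) + pd i (z t) (upd x i (radau_pt low K i)) * poly B (x $ i) +
       (\<Sum>k<q - 1. integral {fst K $ i..snd K $ i} (\<lambda>s. z t (upd x i s) * poly (\<pi> k) s) * poly (\<Psi> k) (x $ i)))"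
    by (intro JS_add JS_mult JS_sum JS_restrict JS_line_integral CS_poly JS_pd[OF z] JS_Suc_le[OF z])
       (auto intro!: continuous_intros)
  then show ?thesis
    by (rule JS_cong[THEN iffD1, rotated]) (simp add: r JS_cont_x[OF z])
qed

text \<open>Value, normal derivative and moments are all taken in direction \<open>i\<close>, and
  the derivative in direction \<open>j\<close> passes through each of them; for the normal
  derivative this is the symmetry of second derivatives.\<close>

lemma radau_dir_pd:
  assumes K: "proper K" and q: "q \<ge> 1" and g: "CS (Suc (Suc 0)) g" and j: "j \<noteq> i"
  shows "pd j (radau_dir low q K i g) = radau_dir low q K i (pd j g)"
proof -
  let ?e = "radau_pt low K i"
  obtain A B \<Psi> \<pi> where r: "\<And>g. continuous_on UNIV g \<Longrightarrow> radau_dir low q K i g = (\<lambda>x.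
       g (upd x i ?e) * poly A (x $ i) + pd i g (upd x i ?e) * poly B (x $ i) +
       (\<Sum>k<q - 1. integral {fst K $ i..snd K $ i} (\<lambda>s. g (upd x i s) * poly (\<pi> k) s) * poly (\<Psi> k) (x $ i)))"
    using radau_dir_repr[OF K q, of low i] by blast
  have g1: "CS (Suc 0) g" "CS (Suc 0) (pd i g)" using JS_Suc_le[OF g] JS_pd[OF g] by auto
  have c: "continuous_on UNIV g" "continuous_on UNIV (pd j g)"
    using CS_continuous[OF g] CS_continuous[OF JS_pd[OF g]] by auto
  have rj: "(\<lambda>x. radau_dir low q K i g (upd x j s)) x = radau_dir low q K i g (upd x j s)" for x s by simp
  have up: "upd (upd x j s) i r = upd (upd x i r) j s" for x s r using j by (simp add: upd_commute)
  have dint: "((\<lambda>s. integral {fst K $ i..snd K $ i} (\<lambda>r. g (upd (upd x j s) i r) * poly (\<pi> k) r)) has_real_derivative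
      integral {fst K $ i..snd K $ i} (\<lambda>r. pd j g (upd x i r) * poly (\<pi> k) r)) (at (x $ j))" for x k
    using ldiff_DERIV0[OF pd_line_integral(1)[OF _ g1(1), of "fst K $ i" "snd K $ i" "poly (\<pi> k)" j i]]
      pd_line_integral(2)[OF _ g1(1), of "fst K $ i" "snd K $ i" "poly (\<pi> k)" j i] j
    by (simp add: continuous_on_poly continuous_on_id)
  have d1: "((\<lambda>s. f (upd (upd x j s) i ?e)) has_real_derivative pd j f (upd x i ?e)) (at (x $ j))" if "CS (Suc 0) f" for f x
  proof -
    have "upd (upd x i ?e) j (x $ j) = upd x i ?e" using j upd_same[of "upd x i ?e" j] by simp
    then show ?thesis unfolding up
      using ldiff_DERIV[of j f "upd x i ?e" "x $ j"] that by simp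
  qed
  show ?thesis
  proof (rule ldiffI(2))
    fix x
    have xi: "upd x j s $ i = x $ i" for s using j by simp
    show "((\<lambda>s. radau_dir low q K i g (upd x j s)) has_real_derivative radau_dir low q K i (pd j g) x) (at (x $ j))"
      unfolding r[OF c(1)] r[OF c(2)] pd_commute[OF g, of i j] xi
      by (intro DERIV_add DERIV_sum DERIV_cmult_right d1 g1 dint)
  qed
qed

lemma radau_dir_pds:
  assumes K: "proper K" and q: "q \<ge> 1" and g: "CS (Suc (length is)) g" and j: "i \<notin> set is"
  shows "pds is (radau_dir low q K i g) = radau_dir low q K i (pds is g)"
  using g j
proof (induction "is")
  case (Cons j "is")
  have "CS (Suc (Suc 0)) (pds is g)" by (rule JS_pds[OF Cons.prems(1)]) simp
  then have "pd j (radau_dir low q K i (pds is g)) = radau_dir low q K i (pd j (pds is g))"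
    using Cons.prems(2) by (intro radau_dir_pd[OF K q]) auto
  moreover have "pds is (radau_dir low q K i g) = radau_dir low q K i (pds is g)"
    using Cons JS_le[OF Cons.prems(1), of "Suc (length is)"] by simp
  ultimately show ?case by simp
qed simp

lemma radau_dir_dt:
  assumes K: "proper K" and q: "q \<ge> 1" and z: "JS (Suc 0) {a..b} z" and z': "JS (Suc 0) {a..b} z'"
    and d: "\<And>t x. t \<in> {a..b} \<Longrightarrow> ((\<lambda>t. z t x) has_real_derivative z' t x) (at t within {a..b})"
    and t: "t \<in> {a..b}"
  shows "((\<lambda>t. radau_dir low q K i (z t) x) has_real_derivative radau_dir low q K i (z' t) x) (at t within {a..b})"
proof -
  let ?e = "radau_pt low K i"
  obtain A B \<Psi> \<pi> where r: "\<And>g. continuous_on UNIV g \<Longrightarrow> radau_dir low q K i g = (\<lambda>x.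
       g (upd x i ?e) * poly A (x $ i) + pd i g (upd x i ?e) * poly B (x $ i) +
       (\<Sum>k<q - 1. integral {fst K $ i..snd K $ i} (\<lambda>s. g (upd x i s) * poly (\<pi> k) s) * poly (\<Psi> k) (x $ i)))"
    using radau_dir_repr[OF K q, of low i] by blast
  have d1: "((\<lambda>t. pd i (z t) y) has_real_derivative pd i (z' t) y) (at t within {a..b})" for y
    using pds_dt[OF z z' d, of "[i]" t y] t by simp
  have dI: "((\<lambda>t. integral {fst K $ i..snd K $ i} (\<lambda>s. z t (upd x i s) * poly (\<pi> k) s)) has_real_derivative
       integral {fst K $ i..snd K $ i} (\<lambda>s. z' t (upd x i s) * poly (\<pi> k) s)) (at t within {a..b})" for k
    unfolding cbox_interval[symmetric]
  proof (rule leibniz_rule_field_derivative)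
    fix s r assume "s \<in> cbox a b"
    then show "((\<lambda>t. z t (upd x i r) * poly (\<pi> k) r) has_real_derivative z' s (upd x i r) * poly (\<pi> k) r) (at s within cbox a b)"
      using d by (intro DERIV_cmult_right) auto
  next
    fix s assume "s \<in> cbox a b"
    then show "(\<lambda>r. z s (upd x i r) * poly (\<pi> k) r) integrable_on cbox (fst K $ i) (snd K $ i)"
      by (intro integrable_continuous continuous_intros cont_line JS_cont_x[OF z]) auto
  next
    show "continuous_on (cbox a b \<times> cbox (fst K $ i) (snd K $ i)) (\<lambda>(t, s). z' t (upd x i s) * poly (\<pi> k) s)"
      unfolding split_beta
      by (intro continuous_on_mult continuous_on_compose2[OF JS_continuous[OF z'], where f="\<lambda>p. (fst p, upd x i (snd p))", simplified split_beta fst_conv snd_conv])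
         (auto intro!: continuous_intros)
  qed (use t in auto)
  have "((\<lambda>t. z t (upd x i ?e) * poly A (x $ i) + pd i (z t) (upd x i ?e) * poly B (x $ i) +
       (\<Sum>k<q - 1. integral {fst K $ i..snd K $ i} (\<lambda>s. z t (upd x i s) * poly (\<pi> k) s) * poly (\<Psi> k) (x $ i)))
     has_real_derivative z' t (upd x i ?e) * poly A (x $ i) + pd i (z' t) (upd x i ?e) * poly B (x $ i) +
       (\<Sum>k<q - 1. integral {fst K $ i..snd K $ i} (\<lambda>s. z' t (upd x i s) * poly (\<pi> k) s) * poly (\<Psi> k) (x $ i)))
     (at t within {a..b})"
    by (intro DERIV_add DERIV_sum DERIV_cmult_right d1 dI d t)
  then show ?thesis
    unfolding r[OF JS_cont_x[OF z' t]]
    by (rule has_field_derivative_transform_within[OF _ zero_less_one t]) (simp add: r[OF JS_cont_x[OF z]])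
qed

lemma radau_dir_lin:
  assumes K: "proper K" and q: "q \<ge> 1" and f: "CS (Suc 0) f" and g: "CS (Suc 0) g"
  shows "radau_dir low q K i (\<lambda>x. c * f x + d * g x) = (\<lambda>x. c * radau_dir low q K i f x + d * radau_dir low q K i g x)"
proof -
  let ?e = "radau_pt low K i"
  obtain A B \<Psi> \<pi> where r: "\<And>g. continuous_on UNIV g \<Longrightarrow> radau_dir low q K i g = (\<lambda>x.
       g (upd x i ?e) * poly A (x $ i) + pd i g (upd x i ?e) * poly B (x $ i) +
       (\<Sum>k<q - 1. integral {fst K $ i..snd K $ i} (\<lambda>s. g (upd x i s) * poly (\<pi> k) s) * poly (\<Psi> k) (x $ i)))"
    using radau_dir_repr[OF K q, of low i] by blast
  have cf: "continuous_on UNIV f" and cg: "continuous_on UNIV g" using f g CS_continuous by blast+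
  have I: "integral {fst K $ i..snd K $ i} (\<lambda>s. (c * f (upd x i s) + d * g (upd x i s)) * poly p s) =
     c * integral {fst K $ i..snd K $ i} (\<lambda>s. f (upd x i s) * poly p s) + d * integral {fst K $ i..snd K $ i} (\<lambda>s. g (upd x i s) * poly p s)" for x p
    unfolding integral_mult_right[symmetric]
    by (subst integral_add[symmetric]) (auto intro!: cont_int_real continuous_intros cont_line cf cg simp: algebra_simps)
  have c: "continuous_on UNIV (\<lambda>x. c * f x + d * g x)" by (intro continuous_intros cf cg)
  show ?thesis
    unfolding r[OF cf] r[OF cg] r[OF c] I
    using pd_lin(2)[of i f g c d] f g
    by (simp add: fun_eq_iff algebra_simps sum.distrib sum_distrib_left)
qed

lemma radau_dir_line:
  assumes K: "proper K" and q: "q \<ge> 1" and g: "continuous_on UNIV g"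
  obtains p where "degree p \<le> q" "\<And>s. radau_dir low q K i g (upd x i s) = poly p s"
    "poly p (radau_pt low K i) = g (upd x i (radau_pt low K i))"
    "poly (pderiv p) (radau_pt low K i) = pd i g (upd x i (radau_pt low K i))"
    "\<And>r. degree r + 2 \<le> q \<Longrightarrow> integral {fst K $ i..snd K $ i} (\<lambda>s. (poly p s - g (upd x i s)) * poly r s) = 0"
proof -
  have lh: "fst K $ i < snd K $ i" using K by (simp add: proper_def)
  show ?thesis
    using that[OF _ radau_dir_upd] radau_cond_radau[OF lh q radau_pt_mem[OF K] cont_line[OF g, of _ x i], of low]
    by (auto simp: radau_cond_def pd_upd)
qed

text \<open>Value and normal derivative at the Radau point are prescribed by the projection. The
  alternating fluxes read each function at just these faces, so there the one-dimensional projection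
  causes no error.\<close>

lemma radau_dir_face:
  assumes K: "proper K" and q: "q \<ge> 1" and g: "continuous_on UNIV g" and x: "x $ i = radau_pt low K i"
  shows "radau_dir low q K i g x = g x" "pd i (radau_dir low q K i g) x = pd i g x"
proof -
  obtain p where p: "\<And>s. radau_dir low q K i g (upd x i s) = poly p s"
    "poly p (radau_pt low K i) = g (upd x i (radau_pt low K i))"
    "poly (pderiv p) (radau_pt low K i) = pd i g (upd x i (radau_pt low K i))"
    by (rule radau_dir_line[OF K q g, where x=x and i=i and low=low], rule that)
  have u: "upd x i (radau_pt low K i) = x" using x by (metis upd_same)
  show "radau_dir low q K i g x = g x" using p(1)[of "radau_pt low K i"] p(2) u by simp
  show "pd i (radau_dir low q K i g) x = pd i g x"
    unfolding pd_upd[of i "radau_dir low q K i g"] p(1) x using p(3) u by (simp add: DERIV_imp_deriv[OF poly_DERIV])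
qed

lemma radau_dir_orth:
  assumes K: "proper K" and q: "q \<ge> 1" and g: "continuous_on UNIV g" and r: "degree r + 2 \<le> q"
  shows "integral {fst K $ i..snd K $ i} (\<lambda>s. (radau_dir low q K i g (upd x i s) - g (upd x i s)) * poly r s) = 0"
  by (rule radau_dir_line[OF K q g, where x=x and i=i and low=low]) (use r in simp)

text \<open>\<open>radau_error\<close> on every line, integrated over the other coordinates. Only
  the pure derivative in direction \<open>i\<close> enters.\<close>

lemma radau_dir_error:
  assumes K: "proper K" and q: "q \<ge> 1" and g: "CS (Suc q) g" and h: "snd K $ i - fst K $ i \<le> h"
  shows "bint K (\<lambda>x. (g x - radau_dir low q K i g x)\<^sup>2)
    \<le> 4 * h ^ (2 * q + 2) * bint K (\<lambda>x. (pds (replicate (Suc q) i) g x)\<^sup>2)"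
proof -
  have lh: "fst K $ i < snd K $ i" using K by (simp add: proper_def)
  have cP: "continuous_on UNIV (radau_dir low q K i g)"
    by (rule CS_continuous[of 0], rule JS_radau_dir[OF K q, of 0 UNIV "\<lambda>_. g"]) (rule JS_le[OF g], simp)
  have cd: "continuous_on UNIV (pds (replicate (Suc q) i) g)" by (rule CS_pds_cont[OF g]) simp
  have "bint K (\<lambda>x. (g x - radau_dir low q K i g x)\<^sup>2) \<le> bint K (\<lambda>x. 4 * h ^ (2 * q + 2) * (pds (replicate (Suc q) i) g x)\<^sup>2)"
  proof (rule bint_mono_lines[where i=i])
    fix x
    let ?G = "\<lambda>k s. pds (replicate k i) g (upd x i s)"
    have "integral {fst K $ i..snd K $ i} (\<lambda>s. (?G 0 s - poly (radau q (fst K $ i) (snd K $ i) (radau_pt low K i) (?G 0)) s)\<^sup>2)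
     \<le> 4 * (snd K $ i - fst K $ i) ^ (2 * q + 2) * integral {fst K $ i..snd K $ i} (\<lambda>s. (?G (Suc q) s)\<^sup>2)"
    proof (rule radau_error[OF lh q radau_pt_mem[OF K]])
      fix k s assume "k \<le> q"
      have "CS (Suc 0) (pds (replicate k i) g)" by (rule JS_pds[OF g]) (use \<open>k \<le> q\<close> in simp)
      then show "(?G k has_real_derivative ?G (Suc k) s) (at s)"
        using ldiff_DERIV[of i "pds (replicate k i) g" x s] by simp
    qed (rule cont_line[OF cd])
    also have "\<dots> \<le> 4 * h ^ (2 * q + 2) * integral {fst K $ i..snd K $ i} (\<lambda>s. (?G (Suc q) s)\<^sup>2)"
      by (intro mult_right_mono mult_left_mono power_mono integral_nonneg)
         (use h lh in \<open>auto intro!: cont_int_real continuous_intros cont_line[OF cd] simp del: replicate_Suc\<close>)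
    finally show "integral {fst K $ i..snd K $ i} (\<lambda>s. (g (upd x i s) - radau_dir low q K i g (upd x i s))\<^sup>2)
      \<le> integral {fst K $ i..snd K $ i} (\<lambda>s. 4 * h ^ (2 * q + 2) * (pds (replicate (Suc q) i) g (upd x i s))\<^sup>2)"
      by (simp add: radau_dir_upd del: replicate_Suc)
  qed (auto intro!: continuous_intros CS_continuous[OF g] cP cd simp del: replicate_Suc)
  then show ?thesis by (simp del: replicate_Suc)
qed

section \<open>Tensor-product polynomials\<close>

lemma lagrange_basis:
  fixes \<xi> :: "nat \<Rightarrow> real"
  assumes inj: "inj_on \<xi> {..q}"
  shows "\<exists>\<l>. (\<forall>b\<le>q. degree (\<l> b) \<le> q) \<and> (\<forall>p. degree p \<le> q \<longrightarrow> p = (\<Sum>b\<le>q. smult (poly p (\<xi> b)) (\<l> b)))"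
proof -
  define \<l> where "\<l> b = (\<Prod>c\<in>{..q} - {b}. smult (1 / (\<xi> b - \<xi> c)) [:- \<xi> c, 1:])" for b
  have d: "degree (\<l> b) \<le> q" if "b \<le> q" for b
  proof -
    have "degree (\<l> b) \<le> (\<Sum>c\<in>{..q} - {b}. degree (smult (1 / (\<xi> b - \<xi> c)) [:- \<xi> c, 1:]))"
      unfolding \<l>_def using degree_prod_sum_le[of "{..q} - {b}" "\<lambda>c. smult (1 / (\<xi> b - \<xi> c)) [:- \<xi> c, 1:]"]
      unfolding o_def by blast
    also have "\<dots> \<le> (\<Sum>c\<in>{..q} - {b}. 1)" by (rule sum_mono) simp
    also have "\<dots> = q" using that by simp
    finally show ?thesis .
  qed
  have v: "poly (\<l> b) (\<xi> c) = (if b = c then 1 else 0)" if "b \<le> q" "c \<le> q" for b c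
  proof (cases "b = c")
    case True
    have "\<xi> c \<noteq> \<xi> x" if "x \<in> {..q} - {c}" for x
      using inj that \<open>c \<le> q\<close> by (auto simp: inj_on_def)
    then show ?thesis using True by (auto simp: \<l>_def poly_prod diff_divide_distrib[symmetric] intro!: prod.neutral)
  next
    case False
    then show ?thesis using that by (auto simp: \<l>_def poly_prod intro!: prod_zero)
  qed
  have "p = (\<Sum>b\<le>q. smult (poly p (\<xi> b)) (\<l> b))" if "degree p \<le> q" for p
  proof (rule poly_eqI_degree[where A="\<xi> ` {..q}"])
    have c: "card (\<xi> ` {..q}) = Suc q" using card_image[OF inj] by simp
    fix x assume "x \<in> \<xi> ` {..q}"
    then obtain c where c: "c \<le> q" "x = \<xi> c" by auto
    have "poly (\<Sum>b\<le>q. smult (poly p (\<xi> b)) (\<l> b)) x = (\<Sum>b\<le>q. if b = c then poly p (\<xi> b) else 0)"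
      unfolding poly_sum c(2) by (rule sum.cong) (use v c in auto)
    then show "poly p x = poly (\<Sum>b\<le>q. smult (poly p (\<xi> b)) (\<l> b)) x" using c by simp
  next
    have c: "card (\<xi> ` {..q}) = Suc q" using card_image[OF inj] by simp
    show "degree p < card (\<xi> ` {..q})" using c that by simp
    have "degree (\<Sum>b\<le>q. smult (poly p (\<xi> b)) (\<l> b)) \<le> q"
      by (rule degree_sum_le) (auto intro: order_trans[OF degree_smult_le] d)
    then show "degree (\<Sum>b\<le>q. smult (poly p (\<xi> b)) (\<l> b)) < card (\<xi> ` {..q})" using c by simp
  qed
  then show ?thesis using d by blast
qed

text \<open>Membership in the tensor-product space tested along lines parallel to the axes. It turns
  out to be equivalent to \<open>Qpoly q\<close> and is the property that directional projections
  yield directly.\<close>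

definition sepq :: "nat \<Rightarrow> (real ^ 'n::finite \<Rightarrow> real) \<Rightarrow> bool" where
  "sepq q f \<longleftrightarrow> (\<forall>i x. \<exists>p. degree p \<le> q \<and> (\<forall>s. f (upd x i s) = poly p s))"

lemma finite_multi_index: "finite {\<beta> :: 'n::finite \<Rightarrow> nat. \<forall>i. \<beta> i \<le> q}"
proof -
  have "{\<beta> :: 'n \<Rightarrow> nat. \<forall>i. \<beta> i \<le> q} = Pi\<^sub>E UNIV (\<lambda>_. {..q})" by (auto simp: PiE_def Pi_def)
  then show ?thesis by (simp add: finite_PiE)
qed

text \<open>Interpolation in one coordinate after the other, by induction on the set
  \<open>A\<close> of coordinates already treated.\<close>

lemma tensor_lagrange:
  fixes f :: "real ^ 'n::finite \<Rightarrow> real" and \<xi> :: "'n \<Rightarrow> nat \<Rightarrow> real"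
  assumes f: "sepq q f"
    and \<l>: "\<And>i p. degree p \<le> q \<Longrightarrow> p = (\<Sum>b\<le>q. smult (poly p (\<xi> i b)) (\<l> i b))"
  shows "f x = (\<Sum>\<beta> | \<forall>i. \<beta> i \<le> q. f (\<chi> i. \<xi> i (\<beta> i)) * (\<Prod>i\<in>UNIV. poly (\<l> i (\<beta> i)) (x $ i)))"
proof -
  define \<B> :: "'n set \<Rightarrow> ('n \<Rightarrow> nat) set" where "\<B> A = {\<beta>. \<forall>i. if i \<in> A then \<beta> i \<le> q else \<beta> i = 0}" for A
  have finB: "finite (\<B> A)" for A
    by (rule finite_subset[OF _ finite_multi_index[of q]]) (unfold \<B>_def, safe, metis zero_le)
  have line: "f y = (\<Sum>b\<le>q. f (upd y i (\<xi> i b)) * poly (\<l> i b) (y $ i))" for y i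
  proof -
    obtain p where p: "degree p \<le> q" "\<And>s. f (upd y i s) = poly p s" using f unfolding sepq_def by blast
    have "f y = poly p (y $ i)" using p(2)[of "y $ i"] by simp
    also have "\<dots> = (\<Sum>b\<le>q. poly p (\<xi> i b) * poly (\<l> i b) (y $ i))"
      by (subst \<l>[OF p(1), of i]) (simp add: poly_sum)
    finally show ?thesis by (simp add: p(2))
  qed
  have "f x = (\<Sum>\<beta>\<in>\<B> A. f (\<chi> i. if i \<in> A then \<xi> i (\<beta> i) else x $ i) * (\<Prod>i\<in>A. poly (\<l> i (\<beta> i)) (x $ i)))" if "finite A" for A
    using that
  proof (induction A)
    case empty
    have "\<B> {} = {\<lambda>_. 0}" by (auto simp: \<B>_def)
    then show ?case by simp
  next
    case (insert i A)
    let ?y = "\<lambda>\<beta>. \<chi> j. if j \<in> A then \<xi> j (\<beta> j) else x $ j"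
    let ?z = "\<lambda>\<beta>. \<chi> j. if j \<in> insert i A then \<xi> j (\<beta> j) else x $ j"
    let ?P = "\<lambda>A \<beta>. \<Prod>i\<in>A. poly (\<l> i (\<beta> i)) (x $ i)"
    have "f x = (\<Sum>\<beta>\<in>\<B> A. (\<Sum>b\<le>q. f (upd (?y \<beta>) i (\<xi> i b)) * poly (\<l> i b) (x $ i)) * ?P A \<beta>)"
      by (subst insert.IH, rule sum.cong[OF refl], subst line[of _ i]) (use insert.hyps in simp)
    also have "\<dots> = (\<Sum>(\<beta>, b)\<in>\<B> A \<times> {..q}. f (upd (?y \<beta>) i (\<xi> i b)) * poly (\<l> i b) (x $ i) * ?P A \<beta>)"
      by (simp add: sum_distrib_right sum.cartesian_product)
    also have "\<dots> = (\<Sum>\<beta>\<in>\<B> (insert i A). f (?z \<beta>) * ?P (insert i A) \<beta>)"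
    proof (rule sum.reindex_bij_witness[where i="\<lambda>\<gamma>. (\<gamma>(i := 0), \<gamma> i)" and j="\<lambda>(\<beta>, b). \<beta>(i := b)"])
      fix p assume p: "p \<in> \<B> A \<times> {..q}"
      obtain \<beta> b where pb: "p = (\<beta>, b)" by (cases p)
      have "\<beta> i = 0" using p insert.hyps by (auto simp: pb \<B>_def split: if_splits)
      then show "(\<lambda>\<gamma>. (\<gamma>(i := 0), \<gamma> i)) ((\<lambda>(\<beta>, b). \<beta>(i := b)) p) = p" by (auto simp: pb)
      show "(\<lambda>(\<beta>, b). \<beta>(i := b)) p \<in> \<B> (insert i A)" using p by (auto simp: pb \<B>_def split: if_splits)
      have "?z (\<beta>(i := b)) = upd (?y \<beta>) i (\<xi> i b)" by (auto simp: vec_eq_iff)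
      moreover have "?P A (\<beta>(i := b)) = ?P A \<beta>" using insert.hyps by (intro prod.cong) auto
      ultimately show "f (?z ((\<lambda>(\<beta>, b). \<beta>(i := b)) p)) * ?P (insert i A) ((\<lambda>(\<beta>, b). \<beta>(i := b)) p) =
          (case p of (\<beta>, b) \<Rightarrow> f (upd (?y \<beta>) i (\<xi> i b)) * poly (\<l> i b) (x $ i) * ?P A \<beta>)"
        unfolding pb prod.case using insert.hyps by (simp add: mult_ac)
    next
      fix \<gamma> assume g: "\<gamma> \<in> \<B> (insert i A)"
      show "(\<lambda>(\<beta>, b). \<beta>(i := b)) (\<gamma>(i := 0), \<gamma> i) = \<gamma>" by simp
      show "(\<gamma>(i := 0), \<gamma> i) \<in> \<B> A \<times> {..q}" using g insert.hyps by (auto simp: \<B>_def split: if_splits)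
    qed
    finally show ?case .
  qed
  from this[of UNIV] show ?thesis by (simp add: \<B>_def)
qed

lemma Qpoly_cmult: "p \<in> Qpoly q \<Longrightarrow> (\<lambda>x. c * p x) \<in> Qpoly q"
proof -
  assume "p \<in> Qpoly q"
  then obtain d :: "('a \<Rightarrow> nat) \<Rightarrow> real" where "\<And>x. p x = (\<Sum>\<alpha> | \<forall>i. \<alpha> i \<le> q. d \<alpha> * (\<Prod>i\<in>UNIV. x $ i ^ \<alpha> i))"
    by (auto simp: Qpoly_def)
  then show ?thesis unfolding Qpoly_def
    by (intro CollectI exI[of _ "\<lambda>\<alpha>. c * d \<alpha>"]) (simp add: sum_distrib_left mult.assoc)
qed

lemma Qpoly_add: "p \<in> Qpoly q \<Longrightarrow> r \<in> Qpoly q \<Longrightarrow> (\<lambda>x. p x + r x) \<in> Qpoly q"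
proof -
  assume "p \<in> Qpoly q" "r \<in> Qpoly q"
  then obtain d d' :: "('a \<Rightarrow> nat) \<Rightarrow> real" where "\<And>x. p x = (\<Sum>\<alpha> | \<forall>i. \<alpha> i \<le> q. d \<alpha> * (\<Prod>i\<in>UNIV. x $ i ^ \<alpha> i))"
    "\<And>x. r x = (\<Sum>\<alpha> | \<forall>i. \<alpha> i \<le> q. d' \<alpha> * (\<Prod>i\<in>UNIV. x $ i ^ \<alpha> i))"
    by (auto simp: Qpoly_def)
  then show ?thesis unfolding Qpoly_def
    by (intro CollectI exI[of _ "\<lambda>\<alpha>. d \<alpha> + d' \<alpha>"]) (simp add: sum.distrib distrib_right)
qed

lemma Qpoly_diff: "p \<in> Qpoly q \<Longrightarrow> r \<in> Qpoly q \<Longrightarrow> (\<lambda>x. p x - r x) \<in> Qpoly q"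
  using Qpoly_add[OF _ Qpoly_cmult[of r q "-1"], of p] by simp

lemma Qpoly_zero: "(\<lambda>x. 0) \<in> Qpoly q"
  unfolding Qpoly_def by (intro CollectI exI[of _ "\<lambda>_. 0"]) simp

lemma Qpoly_sum: "(\<And>j. j \<in> J \<Longrightarrow> f j \<in> Qpoly q) \<Longrightarrow> (\<lambda>x. \<Sum>j\<in>J. f j x) \<in> Qpoly q"
  by (induction J rule: infinite_finite_induct) (auto intro: Qpoly_add Qpoly_zero)

lemma Qpoly_prod:
  assumes "\<And>i. degree (p i) \<le> q"
  shows "(\<lambda>x. \<Prod>i\<in>UNIV. poly (p i) (x $ i)) \<in> Qpoly q"
proof -
  have "poly (p i) s = (\<Sum>k\<le>q. coeff (p i) k * s ^ k)" for i s
    unfolding poly_altdef using assms[of i]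
    by (intro sum.mono_neutral_left) (auto simp: coeff_eq_0)
  then have "(\<Prod>i\<in>UNIV. poly (p i) (x $ i)) = (\<Sum>\<alpha>\<in>Pi\<^sub>E UNIV (\<lambda>_. {..q}). \<Prod>i\<in>UNIV. coeff (p i) (\<alpha> i) * x $ i ^ \<alpha> i)" for x
    by (simp add: prod_sum_PiE)
  moreover have "Pi\<^sub>E UNIV (\<lambda>_. {..q}) = {\<alpha> :: 'a \<Rightarrow> nat. \<forall>i. \<alpha> i \<le> q}" by (auto simp: PiE_def Pi_def)
  ultimately show ?thesis unfolding Qpoly_def
    by (intro CollectI exI[of _ "\<lambda>\<alpha>. \<Prod>i\<in>UNIV. coeff (p i) (\<alpha> i)"]) (simp add: prod.distrib)
qed

lemma sepq_Qpoly: "sepq q f \<Longrightarrow> f \<in> Qpoly q"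
proof -
  assume f: "sepq q f"
  have "inj_on real {..q}" by (simp add: inj_on_def)
  then obtain \<l> where d: "\<And>b. b \<le> q \<Longrightarrow> degree (\<l> b) \<le> q"
    and l: "\<And>p. degree p \<le> q \<Longrightarrow> p = (\<Sum>b\<le>q. smult (poly p (real b)) (\<l> b))"
    using lagrange_basis[of real q] by blast
  have "f = (\<lambda>x. \<Sum>\<beta> | \<forall>i. \<beta> i \<le> q. f (\<chi> i. real (\<beta> i)) * (\<Prod>i\<in>UNIV. poly (\<l> (\<beta> i)) (x $ i)))"
    by (rule ext, rule tensor_lagrange[OF f, of "\<lambda>_. real" "\<lambda>_. \<l>"], rule l)
  also have "\<dots> \<in> Qpoly q" by (intro Qpoly_sum Qpoly_cmult Qpoly_prod) (use d in auto)
  finally show ?thesis .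
qed

lemma Qpoly_sepq: "p \<in> Qpoly q \<Longrightarrow> sepq q p"
proof -
  assume "p \<in> Qpoly q"
  then obtain c :: "('a \<Rightarrow> nat) \<Rightarrow> real" where c: "\<And>x. p x = (\<Sum>\<alpha> | \<forall>i. \<alpha> i \<le> q. c \<alpha> * (\<Prod>i\<in>UNIV. x $ i ^ \<alpha> i))"
    by (auto simp: Qpoly_def)
  show ?thesis unfolding sepq_def
  proof (intro allI)
    fix i x
    let ?P = "\<Sum>\<alpha> | \<forall>i. \<alpha> i \<le> q. monom (c \<alpha> * (\<Prod>j\<in>UNIV - {i}. x $ j ^ \<alpha> j)) (\<alpha> i)"
    have "degree ?P \<le> q"
      by (rule degree_sum_le[OF finite_multi_index]) (auto intro: order_trans[OF degree_monom_le])
    moreover have "p (upd x i s) = poly ?P s" for s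
    proof -
      have "(\<Prod>j\<in>UNIV. upd x i s $ j ^ \<alpha> j) = s ^ \<alpha> i * (\<Prod>j\<in>UNIV - {i}. x $ j ^ \<alpha> j)" for \<alpha> :: "'a \<Rightarrow> nat"
        by (subst prod.remove[of _ i]) (auto intro!: prod.cong)
      then show ?thesis unfolding c poly_sum poly_monom by (simp add: mult_ac)
    qed
    ultimately show "\<exists>P. degree P \<le> q \<and> (\<forall>s. p (upd x i s) = poly P s)" by blast
  qed
qed

text \<open>The Lagrange formula has values at finitely many nodes as coefficients, and these are
  differentiable in time. Hence the time derivatives in the scheme are polynomials on each element
  and may serve as test functions.\<close>

lemma Qpoly_time_derivative:
  fixes w :: "real \<Rightarrow> real ^ 'n::finite \<Rightarrow> real"
  assumes K: "proper K" and t: "t \<in> S"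
    and p: "\<And>s. s \<in> S \<Longrightarrow> \<exists>p\<in>Qpoly q. \<forall>x\<in>cell K. w s x = p x"
    and d: "\<And>x. x \<in> cell K \<Longrightarrow> ((\<lambda>s. w s x) has_real_derivative w' x) (at t within S)"
    and nt: "at t within S \<noteq> bot"
  shows "\<exists>p\<in>Qpoly q. \<forall>x\<in>cell K. w' x = p x"
proof -
  \<comment> \<open>The nodes lie strictly inside the element, because the polynomial form and the
    time derivative are known on the open cell only.\<close>
  define \<xi> where "\<xi> i b = fst K $ i + (real b + 1) / (real q + 2) * (snd K $ i - fst K $ i)" for i and b :: nat
  have lh: "fst K $ i < snd K $ i" for i using K by (simp add: proper_def)
  have "\<exists>\<l>. (\<forall>b\<le>q. degree (\<l> b) \<le> q) \<and> (\<forall>p. degree p \<le> q \<longrightarrow> p = (\<Sum>b\<le>q. smult (poly p (\<xi> i b)) (\<l> b)))" for i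
    by (rule lagrange_basis) (use lh[of i] in \<open>auto simp: inj_on_def \<xi>_def\<close>)
  then obtain \<l> where dl: "\<And>i b. b \<le> q \<Longrightarrow> degree (\<l> i b) \<le> q"
    and l: "\<And>i p. degree p \<le> q \<Longrightarrow> p = (\<Sum>b\<le>q. smult (poly p (\<xi> i b)) (\<l> i b))"
    by metis
  let ?y = "\<lambda>\<beta>. \<chi> i. \<xi> i (\<beta> i)"
  let ?L = "\<lambda>\<beta> x. \<Prod>i\<in>UNIV. poly (\<l> i (\<beta> i)) (x $ i)"
  have y: "?y \<beta> \<in> cell K" if "\<forall>i. \<beta> i \<le> q" for \<beta> :: "'n \<Rightarrow> nat"
  proof -
    have "0 < (real (\<beta> i) + 1) / (real q + 2)" "(real (\<beta> i) + 1) / (real q + 2) < 1" for i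
      using that[rule_format, of i] by (auto simp: field_simps)
    then have "fst K $ i < \<xi> i (\<beta> i)" "\<xi> i (\<beta> i) < snd K $ i" for i
      using lh[of i] mult_strict_right_mono[of "(real (\<beta> i) + 1) / (real q + 2)" 1 "snd K $ i - fst K $ i"]
      by (auto simp: \<xi>_def)
    then show ?thesis by (simp add: cell_def mem_box_vec)
  qed
  have w: "w s x = (\<Sum>\<beta> | \<forall>i. \<beta> i \<le> q. w s (?y \<beta>) * ?L \<beta> x)" if x: "x \<in> cell K" and s: "s \<in> S" for x s
  proof -
    obtain p where p: "p \<in> Qpoly q" "\<And>x. x \<in> cell K \<Longrightarrow> w s x = p x" using p[OF s] by auto
    have "p x = (\<Sum>\<beta> | \<forall>i. \<beta> i \<le> q. p (?y \<beta>) * ?L \<beta> x)"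
      by (rule tensor_lagrange[OF Qpoly_sepq[OF p(1)]], rule l)
    then show ?thesis using p(2)[OF x] p(2)[OF y] by simp
  qed
  have "w' x = (\<Sum>\<beta> | \<forall>i. \<beta> i \<le> q. w' (?y \<beta>) * ?L \<beta> x)" if x: "x \<in> cell K" for x
  proof -
    have "((\<lambda>s. \<Sum>\<beta> | \<forall>i. \<beta> i \<le> q. w s (?y \<beta>) * ?L \<beta> x) has_real_derivative (\<Sum>\<beta> | \<forall>i. \<beta> i \<le> q. w' (?y \<beta>) * ?L \<beta> x)) (at t within S)"
      by (intro DERIV_sum DERIV_cmult_right d y) simp
    then have "((\<lambda>s. w s x) has_real_derivative (\<Sum>\<beta> | \<forall>i. \<beta> i \<le> q. w' (?y \<beta>) * ?L \<beta> x)) (at t within S)"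
      by (rule has_field_derivative_transform_within[OF _ zero_less_one t]) (simp add: w[OF x])
    then have h: "((\<lambda>s. w s x) has_vector_derivative (\<Sum>\<beta> | \<forall>i. \<beta> i \<le> q. w' (?y \<beta>) * ?L \<beta> x)) (at t within S)"
      "((\<lambda>s. w s x) has_vector_derivative w' x) (at t within S)"
      using d[OF x] by (simp_all add: has_real_derivative_iff_has_vector_derivative)
    show ?thesis by (rule vector_derivative_unique_within[OF nt h(2,1)])
  qed
  moreover have "(\<lambda>x. \<Sum>\<beta> | \<forall>i. \<beta> i \<le> q. w' (?y \<beta>) * ?L \<beta> x) \<in> Qpoly q"
    by (intro Qpoly_sum Qpoly_cmult Qpoly_prod) (use dl in auto)
  ultimately show ?thesis by (intro bexI[of _ "\<lambda>x. \<Sum>\<beta> | \<forall>i. \<beta> i \<le> q. w' (?y \<beta>) * ?L \<beta> x"]) auto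
qed

section \<open>The projections on an element\<close>

text \<open>The projection in all directions other than \<open>i\<close>, so the identity in
  dimension one. It is what the form in direction \<open>i\<close> retains of the tensor
  projection.\<close>

definition cross_radau :: "bool \<Rightarrow> nat \<Rightarrow> 'n::finite elem \<Rightarrow> 'n \<Rightarrow> (real ^ 'n \<Rightarrow> real) \<Rightarrow> real ^ 'n \<Rightarrow> real" where
  "cross_radau low q K i g = foldr (radau_dir low q K) (filter (\<lambda>j. j \<noteq> i) coords) g"

lemma coords: "distinct (coords :: 'n::finite list)" "set (coords :: 'n list) = UNIV"
proof -
  have "\<exists>is :: 'n list. distinct is \<and> set is = UNIV" using finite_distinct_list[of "UNIV :: 'n set"] by auto
  from someI_ex[OF this] show "distinct (coords :: 'n list)" "set (coords :: 'n list) = UNIV"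
    unfolding coords_def by auto
qed

text \<open>\<open>coords\<close> results from a choice, so in dimension two a given direction may
  be that of the outer or of the inner projection; the proofs below treat both positions.\<close>

lemma coords_cases:
  assumes "CARD('n) \<in> {1, 2}"
  obtains (one) i :: "'n::finite" where "coords = [i]" "UNIV = {i}"
  | (two) i j :: "'n::finite" where "i \<noteq> j" "coords = [i, j]" "UNIV = {i, j}"
proof -
  have l: "length (coords :: 'n list) = CARD('n)"
    using distinct_card[OF coords(1)] coords(2) by metis
  show ?thesis
  proof (cases "CARD('n) = 1")
    case True
    with l obtain i :: 'n where "coords = [i]" by (auto simp: length_Suc_conv)
    then show ?thesis using one coords(2) by (metis list.set(1,2))
  next
    case False
    with l assms obtain i j :: 'n where c: "coords = [i, j]" by (auto simp: length_Suc_conv numeral_2_eq_2)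
    moreover have "i \<noteq> j" using coords(1) c by (metis distinct_length_2_or_more)
    ultimately show ?thesis using two coords(2) by (metis list.set(1,2))
  qed
qed

text \<open>A second derivative has degree at most q - 2, or it is zero. Second derivatives of
  discrete functions are what the volume term of the form contains.\<close>

lemma radau_orth2:
  assumes K: "proper K" and q: "q \<ge> 1" and g: "continuous_on UNIV g" and p: "degree p \<le> q"
  shows "integral {fst K $ i..snd K $ i} (\<lambda>s. (radau_dir low q K i g (upd x i s) - g (upd x i s)) * poly (pderiv (pderiv p)) s) = 0"
proof (cases "degree p \<ge> 2")
  case True
  then show ?thesis by (intro radau_dir_orth[OF K q g]) (use p in \<open>simp add: degree_pderiv\<close>)
next
  case False
  then have "pderiv (pderiv p) = 0" by (simp add: pderiv_eq_0_iff degree_pderiv)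
  then show ?thesis by simp
qed

text \<open>The property of \<open>P\<^sub>j z - z\<close> that makes the boundary terms and the volume term in direction \<open>j\<close>
  vanish survives the projection in another direction.\<close>

definition annihilated :: "bool \<Rightarrow> nat \<Rightarrow> 'n::finite elem \<Rightarrow> 'n \<Rightarrow> (real ^ 'n \<Rightarrow> real) \<Rightarrow> bool" where
  "annihilated low q K j h \<longleftrightarrow> (\<forall>x. x $ j = radau_pt low K j \<longrightarrow> h x = 0 \<and> pd j h x = 0) \<and>
     (\<forall>p x. degree p \<le> q \<longrightarrow> integral {fst K $ j..snd K $ j} (\<lambda>s. h (upd x j s) * poly (pderiv (pderiv p)) s) = 0)"

lemma annihilated_radau:
  assumes K: "proper K" and q: "q \<ge> 1" and g: "CS (Suc (Suc 0)) g"
  shows "annihilated low q K i (\<lambda>x. radau_dir low q K i g x - g x)"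
proof -
  have P: "CS (Suc 0) (radau_dir low q K i g)" by (rule JS_radau_dir[OF K q g])
  have c: "continuous_on UNIV g" using CS_continuous[OF g] .
  have "pd i (\<lambda>x. radau_dir low q K i g x - g x) = (\<lambda>x. pd i (radau_dir low q K i g) x - pd i g x)"
    using pd_lin(2)[of i "radau_dir low q K i g" g 1 "-1"] P g by simp
  then show ?thesis
    unfolding annihilated_def using radau_dir_face[OF K q c] radau_orth2[OF K q c] by auto
qed

lemma radau_dir_zero_plane:
  assumes K: "proper K" and q: "q \<ge> 1" and h: "continuous_on UNIV h" and j: "i \<noteq> j"
    and z: "\<And>x. x $ j = e \<Longrightarrow> h x = 0" and x: "x $ j = e"
  shows "radau_dir low q K i h x = 0"
proof -
  have u: "h (upd x i s) = 0" for s using z[of "upd x i s"] x j by simp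
  have "pd i h (upd x i (radau_pt low K i)) = 0" by (simp add: pd_upd u)
  then show ?thesis using radau_dir_repr[OF K q, of low i] h u by force
qed

lemma hi0: "continuous_on {l..u} f \<Longrightarrow> integral {l..u} f = 0 \<Longrightarrow> (f has_integral 0) {l..u}" for f :: "real \<Rightarrow> real"
  using integrable_integral[OF cont_int_real] by metis

text \<open>By \<open>radau_dir_repr\<close>, the projection in direction \<open>i\<close> is built
  from values on a hyperplane, normal derivatives and moments, and each of them inherits the
  vanishing in direction \<open>j\<close>. For the moments the two line integrals are
  exchanged.\<close>

lemma annihilated_radau_dir:
  assumes K: "proper K" and q: "q \<ge> 1" and h: "CS (Suc (Suc 0)) h" and j: "i \<noteq> j"
    and a: "annihilated low q K j h"
  shows "annihilated low q K j (radau_dir low q K i h)"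
  unfolding annihilated_def
proof (intro conjI allI impI)
  fix x assume x: "x $ j = radau_pt low K j"
  have c: "continuous_on UNIV h" "continuous_on UNIV (pd j h)"
    using CS_continuous[OF h] CS_continuous[OF JS_pd[OF h]] by auto
  show "radau_dir low q K i h x = 0"
    by (rule radau_dir_zero_plane[OF K q c(1) j _ x]) (use a in \<open>auto simp: annihilated_def\<close>)
  have "radau_dir low q K i (pd j h) x = 0"
    by (rule radau_dir_zero_plane[OF K q c(2) j _ x]) (use a in \<open>auto simp: annihilated_def\<close>)
  then show "pd j (radau_dir low q K i h) x = 0"
    using radau_dir_pd[OF K q h, of j i low] j by simp
next
  fix p :: "real poly" and x assume p: "degree p \<le> q"
  let ?r = "poly (pderiv (pderiv p))" and ?e = "radau_pt low K i"
  let ?J = "{fst K $ j..snd K $ j}" and ?I = "{fst K $ i..snd K $ i}"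
  have h1: "CS (Suc 0) h" using JS_Suc_le[OF h] .
  have c: "continuous_on UNIV h" "continuous_on UNIV (pd i h)"
    using CS_continuous[OF h] CS_continuous[OF JS_pd[OF h]] by auto
  have z0: "integral ?J (\<lambda>s. h (upd y j s) * ?r s) = 0" for y
    using a p by (auto simp: annihilated_def)
  have z1: "integral ?J (\<lambda>s. pd i h (upd y j s) * ?r s) = 0" for y
    using fun_cong[OF pd_line_integral(2)[OF _ h1, of "fst K $ j" "snd K $ j" ?r i j], of y] j
    by (simp add: z0 continuous_on_poly continuous_on_id)
  obtain A B \<Psi> \<pi> where r: "\<And>g. continuous_on UNIV g \<Longrightarrow> radau_dir low q K i g = (\<lambda>x.
       g (upd x i ?e) * poly A (x $ i) + pd i g (upd x i ?e) * poly B (x $ i) +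
       (\<Sum>k<q - 1. integral ?I (\<lambda>s. g (upd x i s) * poly (\<pi> k) s) * poly (\<Psi> k) (x $ i)))"
    using radau_dir_repr[OF K q, of low i] by blast
  have up: "upd (upd x j s) i r = upd (upd x i r) j s" for s r using j by (simp add: upd_commute)
  have cJ: "continuous_on ?J (\<lambda>s. integral ?I (\<lambda>r. h (upd (upd x i r) j s) * poly (\<pi> k) r))" for k
    unfolding cbox_interval[symmetric]
    by (rule integral_continuous_on_param, unfold split_beta)
       (auto intro!: continuous_intros continuous_on_compose2[OF c(1)])
  have z2: "integral ?J (\<lambda>s. integral ?I (\<lambda>r. h (upd (upd x i r) j s) * poly (\<pi> k) r) * ?r s) = 0" for k
  proof -
    have "integral ?J (\<lambda>s. integral ?I (\<lambda>r. h (upd (upd x i r) j s) * poly (\<pi> k) r) * ?r s)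
      = integral ?J (\<lambda>s. integral ?I (\<lambda>r. h (upd (upd x i r) j s) * poly (\<pi> k) r * ?r s))"
      by simp
    also have "\<dots> = integral ?I (\<lambda>r. integral ?J (\<lambda>s. h (upd (upd x i r) j s) * poly (\<pi> k) r * ?r s))"
      unfolding cbox_interval[symmetric]
      by (rule integral_swap_continuous, unfold split_beta)
         (auto intro!: continuous_intros continuous_on_compose2[OF c(1)])
    also have "\<dots> = integral ?I (\<lambda>r. poly (\<pi> k) r * integral ?J (\<lambda>s. h (upd (upd x i r) j s) * ?r s))"
      unfolding integral_mult_right[symmetric] by (simp add: mult_ac)
    finally show ?thesis by (simp add: z0)
  qed
  have "((\<lambda>s. poly A (x $ i) * (h (upd (upd x i ?e) j s) * ?r s) + poly B (x $ i) * (pd i h (upd (upd x i ?e) j s) * ?r s)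
      + (\<Sum>k<q - 1. poly (\<Psi> k) (x $ i) * (integral ?I (\<lambda>r. h (upd (upd x i r) j s) * poly (\<pi> k) r) * ?r s)))
     has_integral poly A (x $ i) * 0 + poly B (x $ i) * 0 + (\<Sum>k<q - 1. poly (\<Psi> k) (x $ i) * 0)) ?J"
    by (intro has_integral_add has_integral_sum has_integral_mult_right hi0 z0 z1 z2)
       (auto intro!: continuous_intros cont_line c cJ)
  moreover have "(\<lambda>s. poly A (x $ i) * (h (upd (upd x i ?e) j s) * ?r s) + poly B (x $ i) * (pd i h (upd (upd x i ?e) j s) * ?r s)
      + (\<Sum>k<q - 1. poly (\<Psi> k) (x $ i) * (integral ?I (\<lambda>r. h (upd (upd x i r) j s) * poly (\<pi> k) r) * ?r s)))
    = (\<lambda>s. radau_dir low q K i h (upd x j s) * ?r s)"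
    unfolding r[OF c(1)] up using j by (simp add: fun_eq_iff algebra_simps sum_distrib_left)
  ultimately show "integral ?J (\<lambda>s. radau_dir low q K i h (upd x j s) * ?r s) = 0"
    by (simp add: integral_unique)
qed

locale element =
  fixes K :: "'n::finite elem" and q :: nat
  assumes K: "proper K" and q: "q \<ge> 1" and card: "CARD('n) \<in> {1, 2}"
begin

text \<open>Each directional projection costs one order; two are given away in either dimension, so
  that the statement does not depend on it.\<close>

lemma JS_tensor:
  assumes "JS (Suc (Suc k)) S z"
  shows "JS k S (\<lambda>t. tensor_radau low q K (z t))"
  using card
proof (cases rule: coords_cases)
  case (one i)
  then show ?thesis unfolding tensor_radau_def
    using JS_Suc_le[OF JS_radau_dir[OF K q assms]] by (simp add: one(1) del: JS.simps)
next
  case (two i j)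
  then show ?thesis unfolding tensor_radau_def
    using JS_radau_dir[OF K q JS_radau_dir[OF K q assms]] by (simp add: two(2) del: JS.simps)
qed

lemma JS_cross:
  assumes "JS (Suc k) S z"
  shows "JS k S (\<lambda>t. cross_radau low q K i (z t))"
  using card
proof (cases rule: coords_cases)
  case (one l)
  then have "i = l" by (metis UNIV_I singletonD)
  then show ?thesis unfolding cross_radau_def using JS_Suc_le[OF assms] by (simp add: one(1) del: JS.simps)
next
  case (two l j)
  then have "i = l \<or> i = j" by (metis UNIV_I insertE singletonD)
  then show ?thesis unfolding cross_radau_def using two(1) JS_radau_dir[OF K q assms] by (auto simp: two(2) simp del: JS.simps)
qed

text \<open>In the direction of the outer projection the result is polynomial by construction. In
  the other direction the inner projection is expanded in a Lagrange basis of that variable, and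
  linearity of the outer projection leaves the basis polynomials untouched.\<close>

lemma tensor_Qpoly:
  assumes z: "CS (Suc (Suc 0)) z"
  shows "tensor_radau low q K z \<in> Qpoly q"
proof (rule sepq_Qpoly)
  have c: "continuous_on UNIV z" using CS_continuous[OF z] .
  have line: "\<exists>p. degree p \<le> q \<and> (\<forall>s. radau_dir low q K i f (upd x i s) = poly p s)"
    if "continuous_on UNIV f" for f :: "real ^ 'n \<Rightarrow> real" and i x
    by (rule radau_dir_line[OF K q that]) blast
  show "sepq q (tensor_radau low q K z)"
    using card
  proof (cases rule: coords_cases)
    case (one i)
    have "tensor_radau low q K z = radau_dir low q K i z" by (simp add: tensor_radau_def one(1))
    moreover have "k = i" for k using one(2) by (metis UNIV_I singletonD)
    ultimately show ?thesis using line[OF c] unfolding sepq_def by metis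
  next
    case (two i j)
    let ?f = "radau_dir low q K j z"
    have f: "CS (Suc 0) ?f" by (rule JS_radau_dir[OF K q z])
    have cf: "continuous_on UNIV ?f" using CS_continuous[OF f] .
    have Pi: "\<exists>p. degree p \<le> q \<and> (\<forall>s. radau_dir low q K i ?f (upd x j s) = poly p s)" for x
    proof -
      have inj: "inj_on real {..q}" by (simp add: inj_on_def)
      obtain \<l> where d: "\<And>b. b \<le> q \<Longrightarrow> degree (\<l> b) \<le> q"
        and l: "\<And>p. degree p \<le> q \<Longrightarrow> p = (\<Sum>b\<le>q. smult (poly p (real b)) (\<l> b))"
        using lagrange_basis[OF inj] by blast
      have fl: "?f (upd y j s) = (\<Sum>b\<le>q. ?f (upd y j (real b)) * poly (\<l> b) s)" for y s
      proof -
        obtain p where p: "degree p \<le> q" "\<And>s. ?f (upd y j s) = poly p s" using line[OF c] by blast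
        have "poly p s = (\<Sum>b\<le>q. poly p (real b) * poly (\<l> b) s)"
          by (subst l[OF p(1)]) (simp add: poly_sum)
        then show ?thesis by (simp add: p(2))
      qed
      have R: "CS (Suc 0) (\<lambda>y. ?f (upd y j c))" for c by (rule JS_restrict[OF f])
      have lin: "radau_dir low q K i (\<lambda>y. \<Sum>b\<in>B. c b * ?f (upd y j (real b))) y =
          (\<Sum>b\<in>B. c b * radau_dir low q K i (\<lambda>y. ?f (upd y j (real b))) y)" if "finite B" for B :: "nat set" and c y
        using that
      proof (induction B)
        case empty
        have "radau_dir low q K i (\<lambda>y. 0 * z y + 0 * z y) = (\<lambda>y. 0 * radau_dir low q K i z y + 0 * radau_dir low q K i z y)"
          by (rule radau_dir_lin[OF K q JS_Suc_le[OF z] JS_Suc_le[OF z]])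
        then show ?case by (simp add: fun_eq_iff)
      next
        case (insert b B)
        have "CS (Suc 0) (\<lambda>y. \<Sum>b\<in>B. c b * ?f (upd y j (real b)))" by (intro JS_sum JS_cmult R)
        from radau_dir_lin[OF K q R[of "real b"] this, of low i "c b" 1] insert
        show ?case by (simp add: fun_eq_iff)
      qed
      have up: "upd (upd x j s) i r = upd (upd x i r) j s" for s r using two(1) by (simp add: upd_commute)
      have "radau_dir low q K i ?f (upd x j s) = radau_dir low q K i (\<lambda>y. \<Sum>b\<le>q. poly (\<l> b) s * ?f (upd y j (real b))) x" for s
      proof -
        have xi: "upd x j s $ i = x $ i" using two(1) by simp
        show ?thesis unfolding radau_dir_x[of low q K i ?f] xi up
          by (subst fl) (simp add: mult.commute radau_dir_x[of low q K i "\<lambda>y. \<Sum>b\<le>q. poly (\<l> b) s * ?f (upd y j (real b))"])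
      qed
      then have "radau_dir low q K i ?f (upd x j s) = poly (\<Sum>b\<le>q. smult (radau_dir low q K i (\<lambda>y. ?f (upd y j (real b))) x) (\<l> b)) s" for s
        by (simp add: lin poly_sum mult.commute)
      moreover have "degree (\<Sum>b\<le>q. smult (radau_dir low q K i (\<lambda>y. ?f (upd y j (real b))) x) (\<l> b)) \<le> q"
        by (rule degree_sum_le) (auto intro: order_trans[OF degree_smult_le] d)
      ultimately show ?thesis by blast
    qed
    have kk: "k = i \<or> k = j" for k using two(3) by (metis UNIV_I insertE singletonD)
    moreover have "tensor_radau low q K z = radau_dir low q K i ?f" by (simp add: tensor_radau_def two(2))
    moreover have "\<exists>p. degree p \<le> q \<and> (\<forall>s. radau_dir low q K i ?f (upd x k s) = poly p s)" for k x
      using kk[of k] line[OF cf] Pi by blast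
    ultimately show ?thesis unfolding sepq_def by simp
  qed
qed

lemma tensor_dt:
  assumes z: "JS (Suc (Suc 0)) {a..b} z" and z': "JS (Suc (Suc 0)) {a..b} z'"
    and d: "\<And>t x. t \<in> {a..b} \<Longrightarrow> ((\<lambda>t. z t x) has_real_derivative z' t x) (at t within {a..b})"
    and t: "t \<in> {a..b}"
  shows "((\<lambda>t. tensor_radau low q K (z t) x) has_real_derivative tensor_radau low q K (z' t) x) (at t within {a..b})"
  using card
proof (cases rule: coords_cases)
  case (one i)
  then show ?thesis unfolding tensor_radau_def
    using radau_dir_dt[OF K q JS_Suc_le[OF z] JS_Suc_le[OF z'] d t] by (simp add: one(1))
next
  case (two i j)
  then show ?thesis unfolding tensor_radau_def
    using radau_dir_dt[OF K q JS_radau_dir[OF K q z] JS_radau_dir[OF K q z']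
        radau_dir_dt[OF K q JS_Suc_le[OF z] JS_Suc_le[OF z'] d] t] by (simp add: two(2))
qed

text \<open>Let \<open>l\<close> be the outer and \<open>j\<close> the inner direction. For i = l
  the difference is P_l y - y with y = P_j z, and the defining conditions of P_l apply. For i = j it
  is P_l (P_j z - z), and \<open>annihilated_radau_dir\<close> applies.\<close>

lemma tensor_split:
  assumes z: "CS (Suc (Suc (Suc (Suc 0)))) z"
  shows "annihilated low q K i (\<lambda>x. tensor_radau low q K z x - cross_radau low q K i z x)"
  using card
proof (cases rule: coords_cases)
  case (one l)
  then have "i = l" by (metis UNIV_I singletonD)
  then show ?thesis
    using annihilated_radau[OF K q JS_le[OF z], of low i] by (simp add: tensor_radau_def cross_radau_def one(1))
next
  case (two l j)
  then have "i = l \<or> i = j" by (metis UNIV_I insertE singletonD)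
  moreover have Pj: "CS (Suc (Suc (Suc 0))) (radau_dir low q K j z)" by (rule JS_radau_dir[OF K q z])
  have ?thesis if "i = l"
    using annihilated_radau[OF K q JS_le[OF Pj], of low i] two(1) that by (simp add: tensor_radau_def cross_radau_def two(2))
  moreover have ?thesis if "i = j"
  proof -
    have "annihilated low q K j (radau_dir low q K l (\<lambda>x. radau_dir low q K j z x - z x))"
      by (rule annihilated_radau_dir[OF K q _ two(1) annihilated_radau[OF K q JS_le[OF z]]])
         (auto intro!: JS_diff JS_le[OF Pj] JS_le[OF z] simp del: JS.simps)
    moreover have "radau_dir low q K l (\<lambda>x. radau_dir low q K j z x - z x) =
        (\<lambda>x. radau_dir low q K l (radau_dir low q K j z) x - radau_dir low q K l z x)"
      using radau_dir_lin[OF K q JS_le[OF Pj, of "Suc 0"] JS_le[OF z, of "Suc 0"], of low l 1 "-1"] by simp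
    ultimately show ?thesis using two(1) that by (simp add: tensor_radau_def cross_radau_def two(2))
  qed
  ultimately show ?thesis by blast
qed

lemma cross_pd2:
  assumes z: "CS (Suc (Suc (Suc 0))) z"
  shows "pd i (pd i (cross_radau low q K i z)) = cross_radau low q K i (pd i (pd i z))"
  using card
proof (cases rule: coords_cases)
  case (one l)
  then have "i = l" by (metis UNIV_I singletonD)
  then show ?thesis by (simp add: cross_radau_def one(1))
next
  case (two l j)
  then have "i = l \<or> i = j" by (metis UNIV_I insertE singletonD)
  then show ?thesis
    using two(1) radau_dir_pds[OF K q, of "[i, i]" z _ low] z
    by (auto simp: cross_radau_def two(2) simp del: JS.simps)
qed

lemma cross_error:
  assumes z: "CS (Suc q) z" and h: "\<And>i. snd K $ i - fst K $ i \<le> h" and h0: "h \<ge> 0"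
  shows "bint K (\<lambda>x. (z x - cross_radau low q K i z x)\<^sup>2)
     \<le> 4 * h ^ (2 * q + 2) * (\<Sum>j\<in>UNIV. bint K (\<lambda>x. (pds (replicate (Suc q) j) z x)\<^sup>2))"
  (is "?L \<le> ?c * (\<Sum>j\<in>UNIV. ?b j)")
proof -
  have b0: "?b j \<ge> 0" for j
    by (rule integral_nonneg) (auto intro!: cont_integrable continuous_intros CS_pds_cont[OF z] simp del: replicate_Suc)
  have c0: "?c \<ge> 0" using h0 by simp
  have le: "?c * ?b j \<le> ?c * (\<Sum>j\<in>UNIV. ?b j)" for j
    by (intro mult_left_mono member_le_sum b0 c0) auto
  show ?thesis
    using card
  proof (cases rule: coords_cases)
    case (one l)
    then have "i = l" by (metis UNIV_I singletonD)
    moreover have "?c * (\<Sum>j\<in>UNIV. ?b j) \<ge> 0" by (intro mult_nonneg_nonneg sum_nonneg b0 c0)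
    ultimately show ?thesis by (simp add: cross_radau_def one(1) del: replicate_Suc)
  next
    case (two l j)
    then have "i = l \<or> i = j" by (metis UNIV_I insertE singletonD)
    then obtain k where "cross_radau low q K i z = radau_dir low q K k z" using two(1) by (auto simp: cross_radau_def two(2))
    then show ?thesis
      using radau_dir_error[OF K q z h, of low k] le[of k] by simp
  qed
qed

text \<open>I - P_i P_j = (I - P_i) + (I - P_j) - (I - P_i)(I - P_j). The product is kept apart: it
  alone involves mixed derivatives of order 2q + 2, and it carries the square of the usual power of
  h. The factors are 12 = 3 * 4 and 48 = 3 * 4 * 4, with 4 from \<open>radau_error\<close> and 3
  from squaring a sum of three terms.\<close>

lemma tensor_error:
  assumes z: "CS (2 * q + 2) z" and h: "\<And>i. snd K $ i - fst K $ i \<le> h" and h0: "h \<ge> 0"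
  shows "bint K (\<lambda>x. (z x - tensor_radau low q K z x)\<^sup>2)
     \<le> 12 * h ^ (2 * q + 2) * (\<Sum>j\<in>UNIV. bint K (\<lambda>x. (pds (replicate (Suc q) j) z x)\<^sup>2))
       + 48 * h ^ (2 * (2 * q + 2)) * (\<Sum>i\<in>UNIV. \<Sum>j\<in>UNIV - {i}. bint K (\<lambda>x. (pds (replicate (Suc q) j @ replicate (Suc q) i) z x)\<^sup>2))"
  (is "?L \<le> 12 * ?H * (\<Sum>j\<in>UNIV. ?b j) + 48 * ?H2 * (\<Sum>i\<in>UNIV. \<Sum>j\<in>UNIV - {i}. ?d i j)")
proof -
  have H0: "?H \<ge> 0" "?H2 = ?H * ?H" using h0 by (auto simp: power_add[symmetric])
  have zq: "CS (Suc q) z" by (rule JS_le[OF z]) simp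
  have b0: "?b j \<ge> 0" for j
    by (rule integral_nonneg) (auto intro!: cont_integrable continuous_intros CS_pds_cont[OF z] simp del: replicate_Suc)
  have d0: "?d i j \<ge> 0" for i j
    by (rule integral_nonneg) (auto intro!: cont_integrable continuous_intros CS_pds_cont[OF z] simp del: replicate_Suc)
  show ?thesis
    using card
  proof (cases rule: coords_cases)
    case (one i)
    have u: "UNIV - {i} = {}" using one(2) by auto
    have "?L \<le> 4 * ?H * ?b i"
      using radau_dir_error[OF K q zq h, of low i] by (simp add: tensor_radau_def one(1) del: replicate_Suc)
    also have "\<dots> \<le> 12 * ?H * ?b i" using H0 b0[of i] by (intro mult_right_mono) auto
    finally show ?thesis unfolding one(2) by (simp add: u del: replicate_Suc)
  next
    case (two i j)
    define y where "y x = z x - radau_dir low q K j z x" for x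
    define z' where "z' = pds (replicate (Suc q) i) z"
    have P: "CS (Suc q) (radau_dir low q K l z)" for l by (rule JS_radau_dir[OF K q JS_le[OF z]]) (use q in simp)
    have yq: "CS (Suc q) y" unfolding y_def by (intro JS_diff zq P)
    have z'q: "CS (Suc q) z'" unfolding z'_def by (rule JS_pds[OF z]) simp
    have c: "continuous_on UNIV z" "continuous_on UNIV (radau_dir low q K l z)" "continuous_on UNIV y"
      "continuous_on UNIV (radau_dir low q K l y)" for l
      using CS_continuous[OF z] CS_continuous[OF P] CS_continuous[OF yq] CS_continuous[OF JS_radau_dir[OF K q yq]] by auto
    have py: "pds (replicate (Suc q) i) y = (\<lambda>x. z' x - radau_dir low q K j z' x)"
    proof -
      have "pds (replicate (Suc q) i) (\<lambda>x. 1 * z x + (-1) * radau_dir low q K j z x)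
         = (\<lambda>x. 1 * z' x + (-1) * pds (replicate (Suc q) i) (radau_dir low q K j z) x)"
        unfolding z'_def by (rule pds_lin[OF zq P]) simp
      moreover have "pds (replicate (Suc q) i) (radau_dir low q K j z) = radau_dir low q K j z'"
        unfolding z'_def by (rule radau_dir_pds[OF K q]) (use two(1) q in \<open>auto intro!: JS_le[OF z] simp del: JS.simps\<close>)
      ultimately show ?thesis by (simp add: y_def[abs_def])
    qed
    have lin: "radau_dir low q K i y = (\<lambda>x. radau_dir low q K i z x - radau_dir low q K i (radau_dir low q K j z) x)"
      using radau_dir_lin[OF K q JS_le[OF zq, of "Suc 0"] JS_le[OF P[of j], of "Suc 0"], of low i 1 "-1"] by (simp add: y_def[abs_def] del: JS.simps)
    let ?e1 = "\<lambda>x. z x - radau_dir low q K i z x" and ?e2 = "\<lambda>x. z x - radau_dir low q K j z x" and ?e3 = "\<lambda>x. y x - radau_dir low q K i y x"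
    have "?L \<le> bint K (\<lambda>x. 3 * ((?e1 x)\<^sup>2 + (?e2 x)\<^sup>2 + (?e3 x)\<^sup>2))"
    proof (rule integral_le)
      fix x
      have "z x - tensor_radau low q K z x = ?e1 x + ?e2 x - ?e3 x"
        by (simp add: tensor_radau_def lin y_def two(2))
      moreover have "(a + b - c)\<^sup>2 \<le> 3 * (a\<^sup>2 + b\<^sup>2 + c\<^sup>2)" for a b c :: real
        using zero_le_power2[of "a - b"] zero_le_power2[of "a + c"] zero_le_power2[of "b + c"]
        by (simp add: power2_eq_square algebra_simps)
      ultimately show "(z x - tensor_radau low q K z x)\<^sup>2 \<le> 3 * ((?e1 x)\<^sup>2 + (?e2 x)\<^sup>2 + (?e3 x)\<^sup>2)" by metis
    qed (auto intro!: cont_integrable continuous_intros c CS_continuous[OF JS_tensor[OF JS_le[OF z]]])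
    also have "\<dots> = 3 * (bint K (\<lambda>x. (?e1 x)\<^sup>2) + bint K (\<lambda>x. (?e2 x)\<^sup>2) + bint K (\<lambda>x. (?e3 x)\<^sup>2))"
      by (simp add: integral_add cont_integrable continuous_intros c)
    also have "\<dots> \<le> 3 * (4 * ?H * ?b i + 4 * ?H * ?b j + 4 * ?H * (4 * ?H * ?d i j))"
    proof -
      have "bint K (\<lambda>x. (pds (replicate (Suc q) i) y x)\<^sup>2) \<le> 4 * ?H * ?d i j"
        unfolding py pds_append z'_def[symmetric] by (rule radau_dir_error[OF K q z'q h])
      then have "bint K (\<lambda>x. (?e3 x)\<^sup>2) \<le> 4 * ?H * (4 * ?H * ?d i j)"
        by (rule order_trans[OF radau_dir_error[OF K q yq h] mult_left_mono]) (use H0 in auto)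
      then show ?thesis
        using radau_dir_error[OF K q zq h, of low i] radau_dir_error[OF K q zq h, of low j] by (intro mult_left_mono add_mono) auto
    qed
    also have "\<dots> = 12 * ?H * (?b i + ?b j) + 48 * ?H2 * ?d i j"
      unfolding H0(2) by (simp add: algebra_simps del: replicate_Suc)
    also have "\<dots> \<le> 12 * ?H * (?b i + ?b j) + 48 * ?H2 * (?d i j + ?d j i)"
      using d0[of i j] H0 by (intro add_left_mono mult_left_mono) (simp_all del: replicate_Suc power_Suc)
    finally show ?thesis
      unfolding two(3) using two(1) by (simp add: insert_Diff_if del: replicate_Suc)
  qed
qed

end

section \<open>Meshes and traces\<close>

locale mesh =
  fixes a b :: "real ^ 'n::finite" and \<T> :: "'n elem set" and N :: "'n \<Rightarrow> nat" and X :: "'n \<Rightarrow> nat \<Rightarrow> real"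
  assumes N_pos: "\<And>i. N i > 0" and X_0: "\<And>i. X i 0 = a $ i" and X_N: "\<And>i. X i (N i) = b $ i"
    and X_Suc: "\<And>i j. j < N i \<Longrightarrow> X i j < X i (Suc j)"
    and T_eq: "\<T> = {(\<chi> i. X i (k i), \<chi> i. X i (Suc (k i))) | k. \<forall>i. k i < N i}"
begin

definition Idx :: "('n \<Rightarrow> nat) set" where "Idx = {k. \<forall>i. k i < N i}"

definition cl :: "('n \<Rightarrow> nat) \<Rightarrow> 'n elem" where "cl k = (\<chi> i. X i (k i), \<chi> i. X i (Suc (k i)))"

lemma T_cl: "\<T> = cl ` Idx"
  unfolding T_eq cl_def Idx_def by auto

lemma finite_T: "finite \<T>"
proof -
  have "Idx = Pi\<^sub>E UNIV (\<lambda>i. {..<N i})" by (auto simp: Idx_def PiE_def Pi_def)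
  then show ?thesis unfolding T_cl by (simp add: finite_PiE)
qed

lemma T_nonempty: "\<T> \<noteq> {}"
proof -
  have "(\<lambda>_. 0) \<in> Idx" using N_pos by (auto simp: Idx_def)
  then show ?thesis unfolding T_cl by blast
qed

lemma X_less: "j < j' \<Longrightarrow> j' \<le> N i \<Longrightarrow> X i j < X i j'"
proof (induction j')
  case (Suc j')
  then show ?case using X_Suc[of j' i] by (cases "j = j'") auto
qed simp

lemma X_le: "j \<le> j' \<Longrightarrow> j' \<le> N i \<Longrightarrow> X i j \<le> X i j'"
  using X_less[of j j' i] by (cases "j = j'") auto

lemma ab: "a $ i < b $ i"
  using X_less[of 0 "N i" i] N_pos X_0 X_N by simp

lemma cl_nth [simp]: "fst (cl k) $ i = X i (k i)" "snd (cl k) $ i = X i (Suc (k i))"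
  by (simp_all add: cl_def)

lemma proper_T: "K \<in> \<T> \<Longrightarrow> proper K"
  unfolding T_cl proper_def using X_Suc by (auto simp: Idx_def)

lemma T_bounds: "K \<in> \<T> \<Longrightarrow> a $ i \<le> fst K $ i \<and> snd K $ i \<le> b $ i"
proof -
  assume "K \<in> \<T>"
  then obtain k where k: "K = cl k" "\<And>i. k i < N i" by (auto simp: T_cl Idx_def)
  show ?thesis using X_le[of 0 "k i" i] X_le[of "Suc (k i)" "N i" i] k(2)[of i] by (simp add: k(1) X_0 X_N)
qed

lemma cbox_subset: "K \<in> \<T> \<Longrightarrow> cbox (fst K) (snd K) \<subseteq> cbox a b"
proof
  fix x assume K: "K \<in> \<T>" and x: "x \<in> cbox (fst K) (snd K)"
  show "x \<in> cbox a b" unfolding mem_cbox_vec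
  proof
    fix i show "a $ i \<le> x $ i \<and> x $ i \<le> b $ i" using T_bounds[OF K, of i] x[unfolded mem_cbox_vec, rule_format, of i] by linarith
  qed
qed

lemma cell_subset: "K \<in> \<T> \<Longrightarrow> cell K \<subseteq> box a b"
proof
  fix x assume K: "K \<in> \<T>" and x: "x \<in> cell K"
  show "x \<in> box a b" unfolding mem_box_vec
  proof
    fix i show "a $ i < x $ i \<and> x $ i < b $ i" using T_bounds[OF K, of i] x[unfolded cell_def mem_box_vec, rule_format, of i] by linarith
  qed
qed

lemma cl_disjoint:
  assumes "k \<in> Idx" "k' \<in> Idx" "x \<in> cell (cl k)" "x \<in> cell (cl k')"
  shows "k = k'"
proof
  fix i
  have x: "X i (k i) < x $ i" "x $ i < X i (Suc (k i))" "X i (k' i) < x $ i" "x $ i < X i (Suc (k' i))"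
    using assms(3,4) by (auto simp: cell_def mem_box_vec)
  have le: "Suc (k i) \<le> N i" "Suc (k' i) \<le> N i" using assms(1,2) by (auto simp: Idx_def Suc_le_eq)
  show "k i = k' i"
    using X_le[of "Suc (k i)" "k' i" i] X_le[of "Suc (k' i)" "k i" i] le x by (cases "k i" "k' i" rule: linorder_cases) auto
qed

lemma cell_nonempty: "proper K \<Longrightarrow> cell K \<noteq> {}"
  unfolding cell_def proper_def by (simp add: interval_ne_empty_cart)

lemma cell_unique: "K \<in> \<T> \<Longrightarrow> K' \<in> \<T> \<Longrightarrow> x \<in> cell K \<Longrightarrow> x \<in> cell K' \<Longrightarrow> K = K'"
  unfolding T_cl using cl_disjoint by blast

lemma inj_cl: "inj_on cl Idx"
proof (rule inj_onI)
  fix k k' assume k: "k \<in> Idx" "k' \<in> Idx" "cl k = cl k'"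
  have "cell (cl k) \<noteq> {}" by (rule cell_nonempty, rule proper_T) (use k in \<open>auto simp: T_cl\<close>)
  then show "k = k'" using cl_disjoint[OF k(1,2)] k(3) by auto
qed

text \<open>Cyclic successor in direction \<open>i\<close>. With a single element in that direction
  an element is its own neighbour.\<close>

definition nx :: "'n \<Rightarrow> ('n \<Rightarrow> nat) \<Rightarrow> 'n \<Rightarrow> nat" where
  "nx i k = k(i := if Suc (k i) < N i then Suc (k i) else 0)"

definition pv :: "'n \<Rightarrow> ('n \<Rightarrow> nat) \<Rightarrow> 'n \<Rightarrow> nat" where
  "pv i k = k(i := if k i = 0 then N i - 1 else k i - 1)"

lemma nx_pv:
  assumes "k \<in> Idx"
  shows "nx i k \<in> Idx" "pv i k \<in> Idx" "nx i (pv i k) = k" "pv i (nx i k) = k"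
proof -
  have k: "k l < N l" for l using assms by (auto simp: Idx_def)
  show "nx i k \<in> Idx" by (simp add: Idx_def nx_def k N_pos)
  show "pv i k \<in> Idx" using k N_pos by (auto simp: Idx_def pv_def less_imp_diff_less)
  show "nx i (pv i k) = k" "pv i (nx i k) = k"
    using k[of i] N_pos[of i] by (auto simp: nx_def pv_def fun_eq_iff)
qed

definition nbr :: "bool \<Rightarrow> 'n \<Rightarrow> 'n elem \<Rightarrow> 'n elem" where
  "nbr low i K = cl ((if low then nx else pv) i (inv_into Idx cl K))"

lemma nbr_cl: "k \<in> Idx \<Longrightarrow> nbr low i (cl k) = cl ((if low then nx else pv) i k)"
  by (simp add: nbr_def inj_cl)

lemma nbr_T: "K \<in> \<T> \<Longrightarrow> nbr low i K \<in> \<T>"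
  unfolding T_cl using nbr_cl nx_pv by (auto split: if_splits)

lemma nbr_inverse: "K \<in> \<T> \<Longrightarrow> nbr False i (nbr True i K) = K" "K \<in> \<T> \<Longrightarrow> nbr True i (nbr False i K) = K"
  unfolding T_cl by (auto simp: nbr_cl nx_pv)

lemma nbr_other: "K \<in> \<T> \<Longrightarrow> j \<noteq> i \<Longrightarrow> fst (nbr low i K) $ j = fst K $ j \<and> snd (nbr low i K) $ j = snd K $ j"
  unfolding T_cl by (auto simp: nbr_cl nx_def pv_def)

lemma nbr_True: "K \<in> \<T> \<Longrightarrow> fst (nbr True i K) $ i = snd K $ i \<or> (snd K $ i = b $ i \<and> fst (nbr True i K) $ i = a $ i)"
proof -
  assume "K \<in> \<T>"
  then obtain k where k: "K = cl k" "k \<in> Idx" by (auto simp: T_cl)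
  have "Suc (k i) = N i" if "\<not> Suc (k i) < N i" using k(2) that unfolding Idx_def by (metis (mono_tags, lifting) Suc_lessI mem_Collect_eq)
  then show ?thesis using k X_0[of i] X_N[of i] by (auto simp: nbr_cl nx_def)
qed

lemma nbr_False: "K \<in> \<T> \<Longrightarrow> snd (nbr False i K) $ i = fst K $ i \<or> (fst K $ i = a $ i \<and> snd (nbr False i K) $ i = b $ i)"
  using nbr_True[OF nbr_T[of K False i], of i] nbr_inverse(2)[of K i] by auto

text \<open>Passing to the neighbour in a fixed direction is a bijection of the periodic mesh. This
  replaces regrouping the boundaries of elements into faces.\<close>

lemma sum_nbr: "(\<Sum>K\<in>\<T>. f (nbr low i K)) = sum f \<T>"
  by (rule sum.reindex_bij_witness[where i="nbr (\<not> low) i" and j="nbr low i"])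
     (cases low; simp add: nbr_inverse nbr_T)+

text \<open>Reduction modulo the periods to the half-open box, used to extend elementwise data
  periodically.\<close>

definition wrap :: "real ^ 'n \<Rightarrow> real ^ 'n" where
  "wrap x = (\<chi> i. x $ i - (b $ i - a $ i) * \<lfloor>(x $ i - a $ i) / (b $ i - a $ i)\<rfloor>)"

lemma wrap_periodic: "wrap (x + (b $ i - a $ i) *\<^sub>R axis i 1) = wrap x"
proof -
  have e: "(x $ i + (b $ i - a $ i) - a $ i) / (b $ i - a $ i) = (x $ i - a $ i) / (b $ i - a $ i) + 1"
    using ab[of i] by (simp add: field_simps)
  have f: "\<lfloor>(x $ i + (b $ i - a $ i) - a $ i) / (b $ i - a $ i)\<rfloor> = \<lfloor>(x $ i - a $ i) / (b $ i - a $ i)\<rfloor> + 1"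
    unfolding e by simp
  show ?thesis unfolding wrap_def vec_eq_iff
  proof
    fix j
    show "(\<chi> j. (x + (b $ i - a $ i) *\<^sub>R axis i 1) $ j - (b $ j - a $ j) * \<lfloor>((x + (b $ i - a $ i) *\<^sub>R axis i 1) $ j - a $ j) / (b $ j - a $ j)\<rfloor>) $ j =
      (\<chi> j. x $ j - (b $ j - a $ j) * \<lfloor>(x $ j - a $ j) / (b $ j - a $ j)\<rfloor>) $ j"
    proof (cases "j = i")
      case True
      show ?thesis unfolding True vec_lambda_beta axis_nth' if_P[OF refl] f by (simp add: algebra_simps)
    qed (simp add: axis_def)
  qed
qed

lemma wrap_box: "x \<in> box a b \<Longrightarrow> wrap x = x"
proof -
  assume "x \<in> box a b"
  then have "0 < (x $ i - a $ i) / (b $ i - a $ i) \<and> (x $ i - a $ i) / (b $ i - a $ i) < 1" for i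
    using ab[of i] by (auto simp: mem_box_vec field_simps)
  then have "\<lfloor>(x $ i - a $ i) / (b $ i - a $ i)\<rfloor> = 0" for i by (simp add: floor_eq_iff less_imp_le)
  then show ?thesis by (simp add: wrap_def vec_eq_iff)
qed

text \<open>Test functions arise as one polynomial per element, whereas members of \<open>Vh\<close>
  are periodic functions on the whole space. The value 0 on the skeleton is arbitrary.\<close>

definition glue :: "('n elem \<Rightarrow> real ^ 'n \<Rightarrow> real) \<Rightarrow> real ^ 'n \<Rightarrow> real" where
  "glue p x = (if \<exists>K\<in>\<T>. wrap x \<in> cell K then p (SOME K. K \<in> \<T> \<and> wrap x \<in> cell K) (wrap x) else 0)"

lemma glue_cell: "K \<in> \<T> \<Longrightarrow> x \<in> cell K \<Longrightarrow> glue p x = p K x"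
proof -
  assume K: "K \<in> \<T>" "x \<in> cell K"
  have w: "wrap x = x" using wrap_box cell_subset K by blast
  have "(SOME K. K \<in> \<T> \<and> x \<in> cell K) = K"
    by (rule some_equality) (use K cell_unique in blast)+
  then show ?thesis using K by (auto simp: glue_def w)
qed

lemma glue_periodic: "periodic a b (glue p)"
  by (simp add: periodic_def glue_def wrap_periodic)

lemma glue_Vh: "(\<And>K. K \<in> \<T> \<Longrightarrow> p K \<in> Qpoly q) \<Longrightarrow> glue p \<in> Vh a b \<T> q"
  unfolding Vh_def using glue_cell glue_periodic by auto

lemma T_cover: "x \<in> cbox a b \<Longrightarrow> \<exists>K\<in>\<T>. x \<in> cbox (fst K) (snd K)"
proof -
  assume x: "x \<in> cbox a b"
  have "\<exists>j. j < N i \<and> X i j \<le> x $ i \<and> x $ i \<le> X i (Suc j)" for i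
  proof -
    let ?P = "\<lambda>j. x $ i \<le> X i (Suc j)"
    have P: "?P (N i - 1)" using x N_pos[of i] X_N[of i] by (auto simp: mem_cbox_vec)
    define j where "j = (LEAST j. ?P j)"
    have j: "?P j" unfolding j_def by (rule LeastI[of ?P, OF P])
    have jN: "j \<le> N i - 1" unfolding j_def by (rule Least_le[of ?P, OF P])
    have "X i j \<le> x $ i"
    proof (cases j)
      case 0
      then show ?thesis using x X_0[of i] by (auto simp: mem_cbox_vec)
    next
      case (Suc j')
      then have "\<not> ?P j'" using not_less_Least[of j' ?P] by (simp add: j_def)
      then show ?thesis using Suc by simp
    qed
    then show ?thesis using j jN N_pos[of i] by (intro exI[of _ j]) auto
  qed
  then obtain k where k: "\<And>i. k i < N i \<and> X i (k i) \<le> x $ i \<and> x $ i \<le> X i (Suc (k i))" by metis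
  then have "cl k \<in> \<T>" "x \<in> cbox (fst (cl k)) (snd (cl k))" by (auto simp: T_cl Idx_def mem_cbox_vec)
  then show ?thesis by blast
qed

lemma sum_measure: "(\<Sum>K\<in>\<T>. measure lebesgue (cell K)) \<le> measure lebesgue (box a b)"
proof -
  have "(\<Sum>K\<in>\<T>. measure lebesgue (cell K)) = measure lebesgue (\<Union>K\<in>\<T>. cell K)"
    by (rule measure_finite_Union[symmetric, OF finite_T])
       (use cell_unique in \<open>auto simp: disjoint_family_on_def cell_def emeasure_lborel_box_eq\<close>)
  also have "\<dots> \<le> measure lebesgue (box a b)"
    by (rule measure_mono_fmeasurable) (use cell_subset in \<open>auto simp: cell_def finite_T\<close>)
  finally show ?thesis .
qed

end

text \<open>\<open>low\<close> selects the projection with conditions at the lower ends together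
  with its flux: traces from the right go with it, traces from the left with the other one.\<close>

definition sg :: "bool \<Rightarrow> real" where "sg low = (if low then 1 else - 1)"

lemma face_pt_cell:
  assumes y: "y \<in> face_box K i" and s: "fst K $ i < s" "s < snd K $ i"
  shows "pt i y s \<in> cell K"
  using assms by (auto simp: cell_def mem_box_vec PiE_def Pi_def)

lemma pd_cell:
  assumes v: "\<And>x. x \<in> cell K \<Longrightarrow> v x = g x" and x: "x \<in> cell K"
  shows "pd i v x = pd i g x"
proof -
  have "open (cell K)" unfolding cell_def by (rule open_box)
  have t: "((\<lambda>s. x + s *\<^sub>R axis i 1) \<longlongrightarrow> x) (nhds 0)"
    using tendsto_add[OF tendsto_const[of x "nhds 0"] tendsto_scaleR[OF filterlim_ident tendsto_const[of "axis i 1" "nhds 0"]]] by simp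
  have "eventually (\<lambda>s. x + s *\<^sub>R axis i 1 \<in> cell K) (nhds 0)"
    by (rule topological_tendstoD[OF t \<open>open (cell K)\<close> x])
  then have "eventually (\<lambda>s. v (x + s *\<^sub>R axis i 1) = g (x + s *\<^sub>R axis i 1)) (nhds 0)"
    by eventually_elim (rule v)
  then show ?thesis unfolding pd_def by (rule deriv_cong_ev) simp
qed

text \<open>Seen from the Radau face of \<open>K\<close>, the side \<open>sg low\<close> is the
  interior of \<open>K\<close>. Hence the flux trace at such a face is the value of the function
  that represents \<open>v\<close> on \<open>K\<close>.\<close>

lemma tr_inner:
  assumes K: "proper K" and y: "y \<in> face_box K i" and g: "continuous_on UNIV g"
    and v: "\<And>x. x \<in> cell K \<Longrightarrow> v x = g x"
  shows "tr (sg low) i v (pt i y (radau_pt low K i)) = g (pt i y (radau_pt low K i))"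
proof -
  let ?c = "radau_pt low K i"
  have lh: "fst K $ i < snd K $ i" using K by (simp add: proper_def)
  have "eventually (\<lambda>\<epsilon>. \<epsilon> \<in> {0<..<snd K $ i - fst K $ i}) (at_right 0)"
    by (rule eventually_at_rightI) (use lh in auto)
  then have ev: "eventually (\<lambda>\<epsilon>. g (pt i y (?c + sg low * \<epsilon>)) = v (pt i y ?c + (sg low * \<epsilon>) *\<^sub>R axis i 1)) (at_right 0)"
  proof eventually_elim
    case (elim \<epsilon>)
    have "pt i y (?c + sg low * \<epsilon>) \<in> cell K"
      by (rule face_pt_cell[OF y]) (use elim in \<open>auto simp: sg_def radau_pt_def\<close>)
    then show ?case by (simp add: pt_add_axis v)
  qed
  have "continuous_on UNIV (\<lambda>\<epsilon>. g (pt i y (?c + sg low * \<epsilon>)))"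
    by (rule continuous_on_compose2[OF g]) (auto intro!: continuous_intros)
  then have "isCont (\<lambda>\<epsilon>. g (pt i y (?c + sg low * \<epsilon>))) 0"
    by (simp add: continuous_on_eq_continuous_at)
  then have "((\<lambda>\<epsilon>. g (pt i y (?c + sg low * \<epsilon>))) \<longlongrightarrow> g (pt i y ?c)) (at_right 0)"
    by (auto simp: isCont_def intro: tendsto_mono[OF at_le])
  then have "((\<lambda>\<epsilon>. v (pt i y ?c + (sg low * \<epsilon>) *\<^sub>R axis i 1)) \<longlongrightarrow> g (pt i y ?c)) (at_right 0)"
    by (rule Lim_transform_eventually[OF _ ev])
  then show ?thesis unfolding tr_def by (intro tendsto_Lim) simp
qed

lemma tr_periodic:
  assumes "periodic a b v"
  shows "tr s i v (pt i y (b $ i)) = tr s i v (pt i y (a $ i))"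
proof -
  have e: "pt i y (b $ i) + r *\<^sub>R axis i 1 = (pt i y (a $ i) + r *\<^sub>R axis i 1) + (b $ i - a $ i) *\<^sub>R axis i 1" for r
    by (simp add: vec_eq_iff axis_def)
  have "v (pt i y (b $ i) + r *\<^sub>R axis i 1) = v (pt i y (a $ i) + r *\<^sub>R axis i 1)" for r
    unfolding e using assms by (simp add: periodic_def)
  then show ?thesis unfolding tr_def by simp
qed

definition face_pos :: "'n::finite elem \<Rightarrow> 'n \<Rightarrow> real \<Rightarrow> real" where
  "face_pos K i n = (if n = 1 then snd K $ i else fst K $ i)"

context mesh
begin

text \<open>The element from which the flux on the face of \<open>K\<close> with outward normal \<open>n\<close> is taken.\<close>

definition fe :: "bool \<Rightarrow> 'n \<Rightarrow> 'n elem \<Rightarrow> real \<Rightarrow> 'n elem" where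
  "fe low i K n = (if n = - sg low then K else nbr low i K)"

lemma fe_T: "K \<in> \<T> \<Longrightarrow> fe low i K n \<in> \<T>"
  by (simp add: fe_def nbr_T)

lemma face_box_fe: "K \<in> \<T> \<Longrightarrow> face_box (fe low i K n) i = face_box K i"
  by (auto simp: fe_def nbr_other intro!: PiE_cong)

text \<open>The face of \<open>K\<close> and the Radau face of the flux element coincide or are
  opposite sides of the domain, and \<open>h\<close> does not distinguish the latter.\<close>

lemma fe_pos:
  assumes "K \<in> \<T>" "n \<in> {-1, 1}" "\<And>y. h (pt i y (b $ i)) = h (pt i y (a $ i))"
  shows "h (pt i y (radau_pt low (fe low i K n) i)) = h (pt i y (face_pos K i n))"
  using assms nbr_True[of K i] nbr_False[of K i]
  by (cases low) (auto simp: fe_def sg_def radau_pt_def face_pos_def)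

lemma tr_flux:
  assumes K: "K \<in> \<T>" and n: "n \<in> {-1, 1}" and y: "y \<in> face_box K i"
    and p: "periodic a b v" and V: "\<And>K. K \<in> \<T> \<Longrightarrow> continuous_on UNIV (V K)"
    and v: "\<And>K x. K \<in> \<T> \<Longrightarrow> x \<in> cell K \<Longrightarrow> v x = V K x"
  shows "tr (sg low) i v (pt i y (face_pos K i n)) = V (fe low i K n) (pt i y (radau_pt low (fe low i K n) i))"
proof -
  have "tr (sg low) i v (pt i y (face_pos K i n)) = tr (sg low) i v (pt i y (radau_pt low (fe low i K n) i))"
    by (rule fe_pos[OF K n, symmetric]) (rule tr_periodic[OF p])
  also have "\<dots> = V (fe low i K n) (pt i y (radau_pt low (fe low i K n) i))"
    using fe_T[OF K] face_box_fe[OF K] y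
    by (intro tr_inner proper_T V v) auto
  finally show ?thesis .
qed

end

section \<open>The discrete bilinear form\<close>

text \<open>Volume and boundary terms change sign together, so one form with two choices of the flux
  side serves both equations.\<close>

lemma B2_B1: "B2 K w \<phi> ws gs = - B1 K w \<phi> ws gs"
proof -
  have f: "face_int K i n (\<lambda>x. A x - B x) = - face_int K i n (\<lambda>x. B x - A x)" for i n and A B :: "real ^ 'a \<Rightarrow> real"
    unfolding face_int_def set_lebesgue_integral_def
    by (subst integral_minus[symmetric]) (simp add: right_diff_distrib)
  have "(LINT x:cell K|lebesgue. - w x * lap \<phi> x) = - (LINT x:cell K|lebesgue. w x * lap \<phi> x)"
    unfolding set_lebesgue_integral_def by (subst integral_minus[symmetric]) simp
  moreover have "bdry_int K (\<lambda>i n x. tr (- n) i (pd i \<phi>) x * n * ws i x - tr (- n) i \<phi> x * (gs i x * n))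
     = - bdry_int K (\<lambda>i n x. tr (- n) i \<phi> x * (gs i x * n) - tr (- n) i (pd i \<phi>) x * n * ws i x)"
    unfolding bdry_int_def by (subst f) (simp only: sum_negf)
  ultimately show ?thesis unfolding B1_def B2_def by simp
qed

lemma pd2_line:
  assumes p: "CS (Suc (Suc 0)) p" and P: "\<And>s. p (upd x i s) = poly P s"
  shows "pd i (pd i p) (upd x i s) = poly (pderiv (pderiv P)) s"
proof -
  have "pd i p (upd x i s) = poly (pderiv P) s" for s
    using ldiff_DERIV[of i p x s] p P DERIV_unique[OF _ poly_DERIV[of P s]] by simp
  moreover have "ldiff i (pd i p)" using p by simp
  ultimately show ?thesis
    using ldiff_DERIV[of i "pd i p" x s] DERIV_unique[OF _ poly_DERIV[of "pderiv P" s]] by simp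
qed

definition Lf :: "'n::finite elem \<Rightarrow> 'n \<Rightarrow> (('n \<Rightarrow> real) \<Rightarrow> real) \<Rightarrow> real" where
  "Lf K i f = (LINT y:face_box K i|face_measure i. f y)"

lemma face_integrable2:
  fixes f1 f2 g1 g2 :: "real ^ 'n::finite \<Rightarrow> real"
  assumes "continuous_on UNIV f1" "continuous_on UNIV f2" "continuous_on UNIV g1" "continuous_on UNIV g2"
  shows "set_integrable (face_measure i) (face_box K i) (\<lambda>y. f1 (pt i y c) * g1 (pt i y d) - f2 (pt i y c) * g2 (pt i y d))"
proof -
  have "continuous_on UNIV (\<lambda>x. f1 (upd x i c) * g1 (upd x i d) - f2 (upd x i c) * g2 (upd x i d))"
    by (intro continuous_intros cont_line continuous_on_compose2[OF assms(1)] continuous_on_compose2[OF assms(2)]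
        continuous_on_compose2[OF assms(3)] continuous_on_compose2[OF assms(4)]) auto
  from face_integrable[OF this, of i K 0] show ?thesis by simp
qed

context mesh
begin

text \<open>The part of \<open>B1\<close> in direction \<open>i\<close>, written for one smooth
  function per element in place of traces. The projections, which are different functions on
  different elements, can be inserted directly.\<close>

definition Bf :: "bool \<Rightarrow> 'n elem \<Rightarrow> ('n elem \<Rightarrow> real ^ 'n \<Rightarrow> real) \<Rightarrow> (real ^ 'n \<Rightarrow> real) \<Rightarrow> 'n \<Rightarrow> real" where
  "Bf low K V p i = - bint K (\<lambda>x. V K x * pd i (pd i p) x) -
     (\<Sum>n\<in>{-1, 1}. n * Lf K i (\<lambda>y. p (pt i y (face_pos K i n)) * pd i (V (fe low i K n)) (pt i y (radau_pt low (fe low i K n) i))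
         - pd i p (pt i y (face_pos K i n)) * V (fe low i K n) (pt i y (radau_pt low (fe low i K n) i))))"

lemma B1_eq:
  assumes K: "K \<in> \<T>" and p: "CS (Suc (Suc 0)) p" and \<phi>: "\<And>x. x \<in> cell K \<Longrightarrow> \<phi> x = p x"
    and per: "periodic a b v" and V: "\<And>K. K \<in> \<T> \<Longrightarrow> CS (Suc (Suc 0)) (V K)"
    and v: "\<And>K x. K \<in> \<T> \<Longrightarrow> x \<in> cell K \<Longrightarrow> v x = V K x"
  shows "B1 K v \<phi> (\<lambda>i. tr (sg low) i v) (\<lambda>i. tr (sg low) i (pd i v)) = (\<Sum>i\<in>UNIV. Bf low K V p i)"
proof -
  have c: "continuous_on UNIV p" "continuous_on UNIV (pd i p)" "continuous_on UNIV (pd i (pd i p))" for i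
    using CS_continuous[OF p] CS_continuous[OF JS_pd[OF p]] CS_continuous[OF JS_pd[OF JS_pd[OF p]]] by auto
  have cV: "continuous_on UNIV (V K)" "continuous_on UNIV (pd i (V K))" if "K \<in> \<T>" for i K
    using CS_continuous[OF V] CS_continuous[OF JS_pd[OF V]] that by auto
  have p2: "pd i \<phi> x = pd i p x" if "x \<in> cell K" for x i using pd_cell[OF \<phi> that] .
  have "pd i (pd i \<phi>) x = pd i (pd i p) x" if "x \<in> cell K" for x i using pd_cell[OF p2 that] .
  then have "(LINT x:cell K|lebesgue. - v x * lap \<phi> x) = bint K (\<lambda>x. \<Sum>i\<in>UNIV. - (V K x * pd i (pd i p) x))"
    by (intro cell_LINT(2)) (auto simp: lap_def v[OF K] sum_distrib_left sum_negf intro!: continuous_intros c cV K)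
  also have "\<dots> = (\<Sum>i\<in>UNIV. - bint K (\<lambda>x. V K x * pd i (pd i p) x))"
    by (subst integral_sum) (auto intro!: cont_integrable continuous_intros c cV K)
  finally have 1: "(LINT x:cell K|lebesgue. - v x * lap \<phi> x) = (\<Sum>i\<in>UNIV. - bint K (\<lambda>x. V K x * pd i (pd i p) x))" .
  have 2: "face_int K i n (\<lambda>x. tr (- n) i \<phi> x * (tr (sg low) i (pd i v) x * n) - tr (- n) i (pd i \<phi>) x * n * tr (sg low) i v x)
      = n * Lf K i (\<lambda>y. p (pt i y (face_pos K i n)) * pd i (V (fe low i K n)) (pt i y (radau_pt low (fe low i K n) i))
         - pd i p (pt i y (face_pos K i n)) * V (fe low i K n) (pt i y (radau_pt low (fe low i K n) i)))"
    if n: "n \<in> {-1, 1}" for i n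
  proof -
    let ?x = "\<lambda>y. pt i y (face_pos K i n)"
    have fp: "sg (n \<noteq> 1) = - n" "radau_pt (n \<noteq> 1) K i = face_pos K i n"
      using n by (auto simp: sg_def radau_pt_def face_pos_def)
    have i1: "tr (- n) i \<phi> (?x y) = p (?x y)" "tr (- n) i (pd i \<phi>) (?x y) = pd i p (?x y)" if "y \<in> face_box K i" for y
      using tr_inner[OF proper_T[OF K] that c(1) \<phi>, of "n \<noteq> 1"]
        tr_inner[OF proper_T[OF K] that c(2) p2, of "n \<noteq> 1"] by (simp_all only: fp)
    have i2: "tr (sg low) i v (?x y) = V (fe low i K n) (pt i y (radau_pt low (fe low i K n) i))"
       if "y \<in> face_box K i" for y
      by (rule tr_flux[OF K n that per cV(1) v])
    have i3: "tr (sg low) i (pd i v) (?x y) = pd i (V (fe low i K n)) (pt i y (radau_pt low (fe low i K n) i))"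
       if "y \<in> face_box K i" for y
      by (rule tr_flux[OF K n that periodic_pd[OF per], where V="\<lambda>K. pd i (V K)"])
         (auto intro: cV pd_cell v)
    show ?thesis
      unfolding face_int_pt Lf_def face_pos_def[symmetric] 
      by (subst set_integral_mult_right[symmetric], rule set_lebesgue_integral_cong)
         (auto simp: i1 i2 i3 sets_PiM_I_finite algebra_simps)
  qed
  show ?thesis
    unfolding B1_def bdry_int_def 1 Bf_def
    by (simp add: sum_subtractf sum_negf 2)
qed

lemma Bf_diff:
  assumes K: "K \<in> \<T>" and p: "CS (Suc (Suc 0)) p"
    and V: "\<And>K. K \<in> \<T> \<Longrightarrow> CS (Suc 0) (V K)" and W: "\<And>K. K \<in> \<T> \<Longrightarrow> CS (Suc 0) (W K)"
  shows "Bf low K (\<lambda>K x. V K x - W K x) p i = Bf low K V p i - Bf low K W p i"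
proof -
  have c: "continuous_on UNIV p" "continuous_on UNIV (pd i p)" "continuous_on UNIV (pd i (pd i p))"
    using CS_continuous[OF p] CS_continuous[OF JS_pd[OF p]] CS_continuous[OF JS_pd[OF JS_pd[OF p]]] by auto
  have cV: "continuous_on UNIV (V K)" "continuous_on UNIV (pd i (V K))"
    "continuous_on UNIV (W K)" "continuous_on UNIV (pd i (W K))" if "K \<in> \<T>" for K
    using CS_continuous[OF V] CS_continuous[OF JS_pd[OF V]] CS_continuous[OF W] CS_continuous[OF JS_pd[OF W]] that by auto
  have d: "pd i (\<lambda>x. V K x - W K x) = (\<lambda>x. pd i (V K) x - pd i (W K) x)" if "K \<in> \<T>" for K
    using pd_lin(2)[of i "V K" "W K" 1 "-1"] V[OF that] W[OF that] by simp
  have b: "bint K (\<lambda>x. (V K x - W K x) * pd i (pd i p) x) = bint K (\<lambda>x. V K x * pd i (pd i p) x) - bint K (\<lambda>x. W K x * pd i (pd i p) x)"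
    by (subst integral_diff[symmetric]) (auto intro!: cont_integrable continuous_intros c cV K simp: algebra_simps)
  have l: "Lf K i (\<lambda>y. p (pt i y e) * (pd i (V E) (pt i y r) - pd i (W E) (pt i y r)) - pd i p (pt i y e) * (V E (pt i y r) - W E (pt i y r)))
     = Lf K i (\<lambda>y. p (pt i y e) * pd i (V E) (pt i y r) - pd i p (pt i y e) * V E (pt i y r))
     - Lf K i (\<lambda>y. p (pt i y e) * pd i (W E) (pt i y r) - pd i p (pt i y e) * W E (pt i y r))" if "E \<in> \<T>" for E e r
    unfolding Lf_def
    by (subst set_integral_diff(2)[symmetric, OF face_integrable2 face_integrable2, OF c(1,2) cV(2,1) c(1,2) cV(4,3)])
       (simp_all add: that algebra_simps)
  show ?thesis unfolding Bf_def
    by (simp add: b d[OF fe_T[OF K]] l[OF fe_T[OF K]])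
qed

text \<open>Green's formula on \<open>K\<close> turns the volume terms into boundary terms with both
  factors from \<open>K\<close>. These cancel the terms whose flux is taken from \<open>K\<close>
  itself; what is left is a term at the lower face minus one at the upper face, and it telescopes
  over the periodic mesh.\<close>

lemma Bf_skew:
  assumes V: "\<And>K. K \<in> \<T> \<Longrightarrow> CS (Suc (Suc 0)) (V K)" and W: "\<And>K. K \<in> \<T> \<Longrightarrow> CS (Suc (Suc 0)) (W K)"
  shows "(\<Sum>K\<in>\<T>. Bf True K V (W K) i) = (\<Sum>K\<in>\<T>. Bf False K W (V K) i)"
proof -
  \<comment> \<open>The boundary terms at the upper face of \<open>K\<close> with \<open>W\<close>
    from \<open>K\<close> and \<open>V\<close> from the next element: the pairing that the two
    alternating fluxes have in common.\<close>
  define T1 where "T1 K = Lf K i (\<lambda>y. W K (pt i y (snd K $ i)) * pd i (V (nbr True i K)) (pt i y (fst (nbr True i K) $ i))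
         - pd i (W K) (pt i y (snd K $ i)) * V (nbr True i K) (pt i y (fst (nbr True i K) $ i)))" for K
  have "Bf True K V (W K) i - Bf False K W (V K) i = T1 (nbr False i K) - T1 K" if K: "K \<in> \<T>" for K
  proof -
    let ?E = "nbr False i K"
    have E: "?E \<in> \<T>" "nbr True i ?E = K" using nbr_T[OF K, of False i] nbr_inverse(2)[OF K, of i] by auto
    have fE: "face_box ?E i = face_box K i" using face_box_fe[OF K, where low=False and i=i and n="-1"] by (simp add: fe_def sg_def)
    have c: "continuous_on UNIV (V K)" "continuous_on UNIV (pd i (V K))" "continuous_on UNIV (pd i (pd i (V K)))"
      "continuous_on UNIV (W K)" "continuous_on UNIV (pd i (W K))" "continuous_on UNIV (pd i (pd i (W K)))"
      using CS_continuous[OF V] CS_continuous[OF JS_pd[OF V]] CS_continuous[OF JS_pd[OF JS_pd[OF V]]]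
        CS_continuous[OF W] CS_continuous[OF JS_pd[OF W]] CS_continuous[OF JS_pd[OF JS_pd[OF W]]] K by auto
    let ?G = "\<lambda>x. W K x * pd i (V K) x - pd i (W K) x * V K x"
    have dG: "pd i ?G = (\<lambda>x. W K x * pd i (pd i (V K)) x - V K x * pd i (pd i (W K)) x)" "CS (Suc 0) ?G"
    proof -
      have l: "ldiff i (W K)" "ldiff i (V K)" "ldiff i (pd i (W K))" "ldiff i (pd i (V K))"
        using V[OF K] W[OF K] by auto
      show "pd i ?G = (\<lambda>x. W K x * pd i (pd i (V K)) x - V K x * pd i (pd i (W K)) x)"
        using pd_lin(2)[OF pd_mult(1)[OF l(1,4)] pd_mult(1)[OF l(3,2)], of 1 "-1"]
        unfolding pd_mult(2)[OF l(1,4)] pd_mult(2)[OF l(3,2)] by (simp add: mult.commute)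
      show "CS (Suc 0) ?G"
        by (intro JS_diff JS_mult JS_Suc_le[OF V[OF K]] JS_Suc_le[OF W[OF K]] JS_pd[OF V[OF K]] JS_pd[OF W[OF K]])
    qed
    have le: "fst K $ i \<le> snd K $ i" using proper_T[OF K] by (simp add: proper_def less_imp_le)
    have g: "bint K (\<lambda>x. W K x * pd i (pd i (V K)) x) - bint K (\<lambda>x. V K x * pd i (pd i (W K)) x)
      = Lf K i (\<lambda>y. ?G (pt i y (snd K $ i))) - Lf K i (\<lambda>y. ?G (pt i y (fst K $ i)))"
      using bint_pd[OF dG(2) le] unfolding dG(1) face_int_pt Lf_def
      by (subst integral_diff[symmetric]) (auto intro!: cont_integrable continuous_intros c)
    have m: "Lf K i (\<lambda>y. f y - g y) = - Lf K i (\<lambda>y. g y - f y)" for f g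
      unfolding Lf_def set_lebesgue_integral_def by (subst integral_minus[symmetric]) (simp add: right_diff_distrib)
    have "T1 ?E = Lf K i (\<lambda>y. W ?E (pt i y (snd ?E $ i)) * pd i (V K) (pt i y (fst K $ i))
         - pd i (W ?E) (pt i y (snd ?E $ i)) * V K (pt i y (fst K $ i)))"
      unfolding T1_def E(2) Lf_def fE by simp
    also have "\<dots> = - Lf K i (\<lambda>y. V K (pt i y (fst K $ i)) * pd i (W ?E) (pt i y (snd ?E $ i))
         - pd i (V K) (pt i y (fst K $ i)) * W ?E (pt i y (snd ?E $ i)))"
      by (subst m) (simp add: mult.commute)
    finally have T1E: "Lf K i (\<lambda>y. V K (pt i y (fst K $ i)) * pd i (W ?E) (pt i y (snd ?E $ i))
         - pd i (V K) (pt i y (fst K $ i)) * W ?E (pt i y (snd ?E $ i))) = - T1 ?E" by simp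
    have S1: "Lf K i (\<lambda>y. V K (pt i y (snd K $ i)) * pd i (W K) (pt i y (snd K $ i)) - pd i (V K) (pt i y (snd K $ i)) * W K (pt i y (snd K $ i)))
       = - Lf K i (\<lambda>y. ?G (pt i y (snd K $ i)))"
      by (subst m) (simp add: mult.commute)
    show ?thesis
      unfolding Bf_def using g
      by (simp add: fe_def sg_def radau_pt_def face_pos_def T1_def[symmetric] T1E S1)
  qed
  then have "(\<Sum>K\<in>\<T>. Bf True K V (W K) i) - (\<Sum>K\<in>\<T>. Bf False K W (V K) i) = (\<Sum>K\<in>\<T>. T1 (nbr False i K)) - sum T1 \<T>"
    unfolding sum_subtractf[symmetric] by simp
  then show ?thesis by (simp add: sum_nbr)
qed

end

lemma (in element) cross_periodic:
  assumes "periodic a b z"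
  shows "cross_radau low q K i z (upd x i (b $ i)) = cross_radau low q K i z (upd x i (a $ i))"
proof -
  note p = periodic_upd[OF assms, of _ i]
  have r: "radau_dir low q K j z (upd x i (b $ i)) = radau_dir low q K j z (upd x i (a $ i))" if "j \<noteq> i" for j
  proof -
    have "upd (upd x i c) j s = upd (upd x j s) i c" for c s using that by (simp add: upd_commute)
    then show ?thesis using that by (simp add: radau_dir_x p)
  qed
  show ?thesis
    using card
  proof (cases rule: coords_cases)
    case (one l)
    then have "i = l" by (metis UNIV_I singletonD)
    then show ?thesis using p by (simp add: cross_radau_def one(1))
  next
    case (two l j)
    then have "i = l \<or> i = j" by (metis UNIV_I insertE singletonD)
    then show ?thesis using two(1) r by (auto simp: cross_radau_def two(2))
  qed
qed

lemma radau_dir_elem_cong: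
  assumes "fst K $ j = fst K' $ j" "snd K $ j = snd K' $ j"
  shows "radau_dir low q K j = radau_dir low q K' j"
  unfolding radau_dir_def[abs_def] assms ..

text \<open>Neighbours in direction \<open>i\<close> have the same extent in the other directions,
  so they share one cross projection, which is smooth across the face between them.\<close>

lemma cross_elem_cong:
  assumes "\<And>j. j \<noteq> i \<Longrightarrow> fst K $ j = fst K' $ j \<and> snd K $ j = snd K' $ j"
  shows "cross_radau low q K i z = cross_radau low q K' i z"
  unfolding cross_radau_def by (rule foldr_cong) (auto dest!: assms intro!: fun_cong[OF radau_dir_elem_cong])

locale dg_mesh = mesh a b \<T> N X for a b :: "real ^ 'n::finite" and \<T> N X +
  fixes q :: nat
  assumes q1: "q \<ge> 1" and card: "CARD('n) \<in> {1, 2}"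
begin

lemma element_T: "K \<in> \<T> \<Longrightarrow> element K q"
  unfolding element_def using proper_T q1 card by blast

text \<open>At every flux face the tensor projection and its normal derivative agree with those of
  the cross projection \<open>s\<close>, and in the volume term the difference is annihilated. As
  \<open>s\<close> is common to \<open>K\<close> and its neighbours and respects periodicity, all
  fluxes become traces of \<open>s\<close> from inside, and Green's formula moves both derivatives
  onto \<open>s\<close>.\<close>

lemma Bf_tensor:
  assumes KT: "K \<in> \<T>" and z: "CS 5 z" and per: "periodic a b z" and p: "p \<in> Qpoly q"
  shows "Bf low K (\<lambda>K. tensor_radau low q K z) p i = - bint K (\<lambda>x. cross_radau low q K i (pd i (pd i z)) x * p x)"
proof -
  interpret element K q by (rule element_T[OF KT])
  let ?V = "\<lambda>K. tensor_radau low q K z"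
  define s where "s = cross_radau low q K i z"
  have z4: "CS (Suc (Suc (Suc (Suc 0)))) z" by (rule JS_le[OF z]) simp
  have z3: "CS (Suc (Suc (Suc 0))) z" by (rule JS_le[OF z]) simp
  have sC: "CS (Suc (Suc (Suc 0))) s" unfolding s_def by (rule JS_cross[OF z4])
  have pC: "CS k p" for k by (rule CS_Qpoly[OF p])
  have VC: "CS (Suc 0) (?V E)" if "E \<in> \<T>" for E
    by (rule element.JS_tensor[OF element_T[OF that] z3])
  have cE: "cross_radau low q (fe low i K n) i z = s" for n
    unfolding s_def by (rule cross_elem_cong) (use nbr_other[OF KT] in \<open>auto simp: fe_def\<close>)
  have ann: "annihilated low q (fe low i K n) i (\<lambda>x. ?V (fe low i K n) x - s x)" for n
    unfolding cE[of n, symmetric] by (rule element.tensor_split[OF element_T[OF fe_T[OF KT]] z4])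
  have per_s: "s (pt i y (b $ i)) = s (pt i y (a $ i))" for y
    using cross_periodic[OF per, of low i "pt i y 0"] by (simp add: s_def)
  have per_s': "pd i s (pt i y (b $ i)) = pd i s (pt i y (a $ i))" for y
  proof -
    have "pd i s = cross_radau low q K i (pd i z)"
      using card
    proof (cases rule: coords_cases)
      case (one l)
      then have "i = l" by (metis UNIV_I singletonD)
      then show ?thesis by (simp add: s_def cross_radau_def one(1))
    next
      case (two l j)
      then have "i = l \<or> i = j" by (metis UNIV_I insertE singletonD)
      then show ?thesis using two(1) radau_dir_pd[OF K q JS_le[OF z], of i _ low] by (auto simp: s_def cross_radau_def two(2) simp del: JS.simps)
    qed
    then show ?thesis using cross_periodic[OF periodic_pd[OF per, of i], of low i "pt i y 0"] by simp
  qed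
  have v: "?V (fe low i K n) (pt i y (radau_pt low (fe low i K n) i)) = s (pt i y (face_pos K i n))"
    "pd i (?V (fe low i K n)) (pt i y (radau_pt low (fe low i K n) i)) = pd i s (pt i y (face_pos K i n))"
    if n: "n \<in> {-1, 1}" for y n
  proof -
    let ?x = "pt i y (radau_pt low (fe low i K n) i)"
    have "pd i (\<lambda>x. ?V (fe low i K n) x - s x) = (\<lambda>x. pd i (?V (fe low i K n)) x - pd i s x)"
      using pd_lin(2)[of i "?V (fe low i K n)" s 1 "-1"] VC[OF fe_T[OF KT]] sC by simp
    then have "?V (fe low i K n) ?x = s ?x" "pd i (?V (fe low i K n)) ?x = pd i s ?x"
      using ann[of n] unfolding annihilated_def by (auto dest: spec[of _ ?x])
    moreover have "s ?x = s (pt i y (face_pos K i n))" "pd i s ?x = pd i s (pt i y (face_pos K i n))"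
      by (rule fe_pos[OF KT n], rule per_s, rule fe_pos[OF KT n], rule per_s')
    ultimately show "?V (fe low i K n) ?x = s (pt i y (face_pos K i n))"
      "pd i (?V (fe low i K n)) ?x = pd i s (pt i y (face_pos K i n))" by simp_all
  qed
  have c: "continuous_on UNIV p" "continuous_on UNIV (pd i p)" "continuous_on UNIV (pd i (pd i p))"
    "continuous_on UNIV s" "continuous_on UNIV (pd i s)" "continuous_on UNIV (pd i (pd i s))" "continuous_on UNIV (?V K)"
    using CS_continuous[OF pC] CS_continuous[OF JS_pd[OF pC]] CS_continuous[OF JS_pd[OF JS_pd[OF pC]]]
      CS_continuous[OF sC] CS_continuous[OF JS_pd[OF sC]] CS_continuous[OF JS_pd[OF JS_pd[OF sC]]] CS_continuous[OF VC[OF KT]]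
    by (auto simp del: JS.simps)
  let ?G = "\<lambda>x. p x * pd i s x - pd i p x * s x"
  have l: "ldiff i p" "ldiff i (pd i p)" "ldiff i s" "ldiff i (pd i s)"
    using pC[of "Suc (Suc 0)"] sC by auto
  have dG: "pd i ?G = (\<lambda>x. p x * pd i (pd i s) x - pd i (pd i p) x * s x)"
    using pd_lin(2)[OF pd_mult(1)[OF l(1,4)] pd_mult(1)[OF l(2,3)], of 1 "-1"]
    unfolding pd_mult(2)[OF l(1,4)] pd_mult(2)[OF l(2,3)] by simp
  have CG: "CS (Suc 0) ?G"
    by (intro JS_diff JS_mult pC JS_pd[OF pC] JS_le[OF sC] JS_le[OF JS_pd[OF sC]]) auto
  have le: "fst K $ i \<le> snd K $ i" using proper_T[OF KT] by (simp add: proper_def less_imp_le)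
  have sumL: "(\<Sum>n\<in>{-1, 1}. n * Lf K i (\<lambda>y. p (pt i y (face_pos K i n)) * pd i (?V (fe low i K n)) (pt i y (radau_pt low (fe low i K n) i))
         - pd i p (pt i y (face_pos K i n)) * ?V (fe low i K n) (pt i y (radau_pt low (fe low i K n) i)))) = bint K (pd i ?G)"
    unfolding bint_pd[OF CG le] face_int_pt by (simp add: v Lf_def face_pos_def)
  have z0: "bint K (\<lambda>x. (?V K x - s x) * pd i (pd i p) x) = 0"
  proof -
    have "bint K (\<lambda>x. (?V K x - s x) * pd i (pd i p) x) = bint K (\<lambda>_. 0)"
    proof (rule bint_eq_lines[where i=i])
      fix x
      obtain P where P: "degree P \<le> q" "\<And>s. p (upd x i s) = poly P s" using Qpoly_sepq[OF p] unfolding sepq_def by blast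
      \<comment> \<open>For the normal \<open>- sg low\<close> the flux element is \<open>K\<close>
        itself.\<close>
      have a': "annihilated low q K i (\<lambda>x. ?V K x - s x)" using ann[of "- sg low"] by (simp add: fe_def)
      show "integral {fst K $ i..snd K $ i} (\<lambda>r. (?V K (upd x i r) - s (upd x i r)) * pd i (pd i p) (upd x i r)) = integral {fst K $ i..snd K $ i} (\<lambda>s. 0)"
        using a' P(1) unfolding pd2_line[OF pC P(2)] annihilated_def by simp
    qed (intro continuous_intros c)+
    then show ?thesis by simp
  qed
  have "bint K (\<lambda>x. ?V K x * pd i (pd i p) x) = bint K (\<lambda>x. (?V K x - s x) * pd i (pd i p) x) + bint K (\<lambda>x. s x * pd i (pd i p) x)"
    by (subst integral_add[symmetric]) (auto intro!: cont_integrable continuous_intros c simp: algebra_simps)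
  moreover have "bint K (pd i ?G) = bint K (\<lambda>x. pd i (pd i s) x * p x) - bint K (\<lambda>x. s x * pd i (pd i p) x)"
    unfolding dG by (subst integral_diff[symmetric]) (auto intro!: cont_integrable continuous_intros c simp: mult.commute)
  ultimately show ?thesis
    unfolding Bf_def sumL z0 using cross_pd2[OF z3, of i low] by (simp add: s_def)
qed

end

section \<open>Smooth bump functions\<close>

text \<open>The functions p(1/x) exp(-1/x), continued by 0: a family that contains the usual smooth
  cutoff, for \<open>p = 1\<close>, and is closed under differentiation; \<open>bump'\<close> is the
  induced map on polynomials.\<close>

definition bump :: "real poly \<Rightarrow> real \<Rightarrow> real" where
  "bump p x = (if x > 0 then poly p (1 / x) * exp (- (1 / x)) else 0)"

definition bump' :: "real poly \<Rightarrow> real poly" where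
  "bump' p = [:0, 0, 1:] * (p - pderiv p)"

lemma poly_exp_tendsto_0: "((\<lambda>z. poly p z * exp (- z)) \<longlongrightarrow> (0::real)) at_top"
proof -
  have "((\<lambda>z. \<Sum>k\<le>degree p. coeff p k * (z ^ k / exp z)) \<longlongrightarrow> (\<Sum>k\<le>degree p. coeff p k * 0)) at_top"
    by (intro tendsto_sum tendsto_mult tendsto_const tendsto_power_div_exp_0)
  then show ?thesis
    by (simp add: poly_altdef sum_distrib_right exp_minus divide_inverse mult.assoc)
qed

lemma bump_DERIV: "(bump p has_real_derivative bump (bump' p) x) (at x)"
proof (cases x "0 :: real" rule: linorder_cases)
  case less
  have "((\<lambda>_. 0) has_real_derivative 0) (at x)" by simp
  moreover have "eventually (\<lambda>y. 0 = bump p y) (nhds x)"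
    using eventually_nhds_in_open[of "{..<0}" x] less by (auto elim!: eventually_mono simp: bump_def)
  ultimately show ?thesis using less
    by (subst DERIV_cong_ev[OF refl _ refl, of _ "\<lambda>_. 0"]) (auto simp: bump_def elim: eventually_mono)
next
  case greater
  have "((\<lambda>y. poly p (1 / y) * exp (- (1 / y))) has_real_derivative
      poly (pderiv p) (1 / x) * (- 1 / x\<^sup>2) * exp (- (1 / x)) + poly p (1 / x) * (exp (- (1 / x)) * (1 / x\<^sup>2))) (at x)"
    using greater
    by (auto intro!: derivative_eq_intros poly_DERIV[THEN DERIV_chain2] simp: power2_eq_square field_simps)
  also have "poly (pderiv p) (1 / x) * (- 1 / x\<^sup>2) * exp (- (1 / x)) + poly p (1 / x) * (exp (- (1 / x)) * (1 / x\<^sup>2)) = bump (bump' p) x"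
    using greater by (simp add: bump_def bump'_def power2_eq_square field_simps)
  finally have d: "((\<lambda>y. poly p (1 / y) * exp (- (1 / y))) has_real_derivative bump (bump' p) x) (at x)" .
  have "eventually (\<lambda>y. bump p y = poly p (1 / y) * exp (- (1 / y))) (nhds x)"
    using eventually_nhds_in_open[of "{0<..}" x] greater by (auto elim!: eventually_mono simp: bump_def)
  then show ?thesis using d by (subst DERIV_cong_ev[OF refl _ refl]) auto
next
  case equal
  \<comment> \<open>At 0 the difference quotient is again of the form p(1/h) exp(-1/h), with one
    more power of 1/h, so the limit at infinity applies.\<close>
  have "((\<lambda>h. poly (pCons 0 p) (inverse h) * exp (- inverse h)) \<longlongrightarrow> 0) (at_right 0)"
    by (rule filterlim_compose[OF poly_exp_tendsto_0 filterlim_inverse_at_top_right])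
  then have r: "((\<lambda>h. bump p h / h) \<longlongrightarrow> 0) (at_right 0)"
    by (rule Lim_transform_eventually)
       (auto simp: bump_def field_simps eventually_at_right_field intro!: exI[of _ 1])
  have l: "((\<lambda>h. bump p h / h) \<longlongrightarrow> 0) (at_left 0)"
    by (rule Lim_transform_eventually[OF tendsto_const])
       (auto simp: bump_def eventually_at_left_field intro!: exI[of _ "-1"])
  have "((\<lambda>h. bump p h / h) \<longlongrightarrow> 0) (at 0)"
    using filterlim_split_at[OF l r] by simp
  then show ?thesis using equal by (simp add: DERIV_def bump_def)
qed

text \<open>The arguments of the factors of a product of bumps adapted to the box \<open>(c,d)\<close>; for large
  \<open>k\<close> the product of \<open>bump 1\<close> approximates the indicator function of the box.\<close>

definition barg :: "real \<Rightarrow> real ^ 'n \<Rightarrow> real ^ 'n \<Rightarrow> 'n::finite \<times> bool \<Rightarrow> real ^ 'n \<Rightarrow> real" where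
  "barg k c d e x = (if snd e then k * (x $ fst e - c $ fst e) else k * (d $ fst e - x $ fst e))"

definition bprod :: "real \<Rightarrow> real ^ 'n \<Rightarrow> real ^ 'n \<Rightarrow> ('n::finite \<times> bool \<Rightarrow> real poly) \<Rightarrow> real ^ 'n \<Rightarrow> real" where
  "bprod k c d p x = (\<Prod>e\<in>UNIV. bump (p e) (barg k c d e x))"

lemma bprod_differentiable: "bprod k c d p differentiable (at x)"
proof -
  have b: "(barg k c d e has_derivative (\<lambda>h. (if snd e then k else - k) * (h $ fst e))) (at x)" for e
  proof -
    have n: "((\<lambda>x. x $ fst e) has_derivative (\<lambda>h. h $ fst e)) (at x)"
      by (rule bounded_linear_imp_has_derivative) (rule bounded_linear_vec_nth)
    show ?thesis unfolding barg_def[abs_def]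
      by (cases "snd e") (auto intro!: derivative_eq_intros n simp: algebra_simps)
  qed
  have "((\<lambda>x. bump (p e) (barg k c d e x)) has_derivative
      (\<lambda>h. (if snd e then k else - k) * (h $ fst e) * bump (bump' (p e)) (barg k c d e x))) (at x)" for e
    using DERIV_compose_FDERIV[OF bump_DERIV b] .
  from has_derivative_prod[where I=UNIV and f="\<lambda>e x. bump (p e) (barg k c d e x)", OF this] show ?thesis
    unfolding bprod_def[abs_def] differentiable_def by blast
qed

lemma bprod_pd:
  "ldiff j (bprod k c d p)"
  "pd j (bprod k c d p) = (\<lambda>x. \<Sum>s\<in>UNIV. (if s then k else - k) * bprod k c d (p((j, s) := bump' (p (j, s)))) x)"
proof -
  have d: "((\<lambda>r. bprod k c d p (upd x j r)) has_real_derivative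
     (\<Sum>s\<in>UNIV. (if s then k else - k) * bprod k c d (p((j, s) := bump' (p (j, s)))) x)) (at (x $ j))" for x
  proof -
    define D where "D e = (if fst e = j then (if snd e then k else - k) * bump (bump' (p e)) (barg k c d e x) else 0)" for e
    have "((\<lambda>r. bump (p e) (barg k c d e (upd x j r))) has_real_derivative D e) (at (x $ j))" for e
    proof (cases "fst e = j")
      case True
      have b: "((\<lambda>r. barg k c d e (upd x j r)) has_real_derivative (if snd e then k else - k)) (at (x $ j))"
        using True by (cases "snd e") (auto simp: barg_def intro!: derivative_eq_intros)
      show ?thesis using DERIV_chain2[OF bump_DERIV b, of "p e"] True by (simp add: D_def mult.commute)
    qed (cases "snd e"; simp add: D_def barg_def)
    then have d1: "((\<lambda>r. \<Prod>e\<in>UNIV. bump (p e) (barg k c d e (upd x j r))) has_real_derivative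
        (\<Sum>e\<in>UNIV. D e * (\<Prod>e'\<in>UNIV - {e}. bump (p e') (barg k c d e' (upd x j (x $ j)))))) (at (x $ j))"
      by (intro has_field_derivative_prod) auto
    have t: "D (i, s) * (\<Prod>e'\<in>UNIV - {(i, s)}. bump (p e') (barg k c d e' x)) =
        (if i = j then (if s then k else - k) * bprod k c d (p((j, s) := bump' (p (j, s)))) x else 0)" for i s
    proof (cases "i = j")
      case True
      have "bprod k c d (p((j, s) := bump' (p (j, s)))) x =
        bump (bump' (p (j, s))) (barg k c d (j, s) x) * (\<Prod>e'\<in>UNIV - {(j, s)}. bump (p e') (barg k c d e' x))"
        unfolding bprod_def by (subst prod.remove[of _ "(j, s)"]) (auto intro!: prod.cong)
      then show ?thesis using True by (simp add: D_def)
    qed (simp add: D_def)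
    have "(\<Sum>e\<in>UNIV. D e * (\<Prod>e'\<in>UNIV - {e}. bump (p e') (barg k c d e' x)))
      = (\<Sum>i\<in>UNIV. \<Sum>s\<in>UNIV. D (i, s) * (\<Prod>e'\<in>UNIV - {(i, s)}. bump (p e') (barg k c d e' x)))"
      by (simp add: sum.cartesian_product UNIV_Times_UNIV[symmetric] split_beta del: UNIV_Times_UNIV)
    also have "\<dots> = (\<Sum>i\<in>UNIV. if i = j then (\<Sum>s\<in>UNIV. (if s then k else - k) * bprod k c d (p((j, s) := bump' (p (j, s)))) x) else 0)"
      unfolding t by (rule sum.cong) auto
    also have "\<dots> = (\<Sum>s\<in>UNIV. (if s then k else - k) * bprod k c d (p((j, s) := bump' (p (j, s)))) x)" by simp
    finally show ?thesis using d1 unfolding bprod_def by simp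
  qed
  from ldiffI[OF d] show "ldiff j (bprod k c d p)"
    "pd j (bprod k c d p) = (\<lambda>x. \<Sum>s\<in>UNIV. (if s then k else - k) * bprod k c d (p((j, s) := bump' (p (j, s)))) x)" .
qed

text \<open>The linear span of products of bumps is closed under partial derivatives, which reduces
  smoothness of every order to the differentiability of a single product.\<close>

lemma bprod_pds:
  "\<exists>L. pds is (bprod k c d p) = (\<lambda>x. \<Sum>(r, p)\<leftarrow>L. r * bprod k c d p x)"
proof (induction "is")
  case Nil
  show ?case by (intro exI[of _ "[(1, p)]"]) simp
next
  case (Cons j "is")
  then obtain L where L: "pds is (bprod k c d p) = (\<lambda>x. \<Sum>(r, p)\<leftarrow>L. r * bprod k c d p x)" by blast
  have "ldiff j (\<lambda>x. \<Sum>(r, p)\<leftarrow>L. r * bprod k c d p x) \<and>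
     (\<exists>L'. pd j (\<lambda>x. \<Sum>(r, p)\<leftarrow>L. r * bprod k c d p x) = (\<lambda>x. \<Sum>(r, p)\<leftarrow>L'. r * bprod k c d p x))"
  proof (induction L)
    case Nil
    show ?case by (auto intro!: exI[of _ "[]"])
  next
    case (Cons rp L)
    obtain r p where rp: "rp = (r, p)" by (cases rp)
    from Cons obtain L' where L': "ldiff j (\<lambda>x. \<Sum>(r, p)\<leftarrow>L. r * bprod k c d p x)"
      "pd j (\<lambda>x. \<Sum>(r, p)\<leftarrow>L. r * bprod k c d p x) = (\<lambda>x. \<Sum>(r, p)\<leftarrow>L'. r * bprod k c d p x)" by blast
    let ?L = "(r * k, p((j, True) := bump' (p (j, True)))) # (- (r * k), p((j, False) := bump' (p (j, False)))) # L'"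
    note l = pd_lin[OF bprod_pd(1)[of j k c d p] L'(1), of r 1]
    have pdL: "pd j (\<lambda>x. \<Sum>(r, p)\<leftarrow>rp # L. r * bprod k c d p x) = (\<lambda>x. \<Sum>(r, p)\<leftarrow>?L. r * bprod k c d p x)"
      using l(2) by (simp add: rp L'(2) bprod_pd(2) UNIV_bool algebra_simps)
    then show ?case using l(1) by (intro conjI exI[of _ ?L]) (simp add: rp, rule pdL)
  qed
  then show ?case using L by auto
qed

lemma bprod_nonzero: "k > 0 \<Longrightarrow> bprod k c d p x \<noteq> 0 \<Longrightarrow> x \<in> box c d"
proof -
  assume k: "k > 0" and nz: "bprod k c d p x \<noteq> 0"
  have pos: "barg k c d e x > 0" for e
  proof (rule ccontr)
    assume "\<not> barg k c d e x > 0"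
    then have z: "bump (p e) (barg k c d e x) = 0" by (simp add: bump_def)
    have "bprod k c d p x = 0" unfolding bprod_def
      by (rule prod_zero) (simp, rule bexI[of _ e], rule z, simp)
    then show False using nz by simp
  qed
  show ?thesis unfolding mem_box_vec
    using pos[of "(_, True)"] pos[of "(_, False)"] k by (simp add: barg_def zero_less_mult_iff)
qed

lemma bprod_test_function:
  assumes k: "k > 0" and S: "cbox c d \<subseteq> S"
  shows "test_function S (bprod k c d (\<lambda>_. 1))"
proof -
  have "pds is (bprod k c d (\<lambda>_. 1)) differentiable (at x)" for "is" x
  proof -
    obtain L where L: "pds is (bprod k c d (\<lambda>_. 1)) = (\<lambda>x. \<Sum>(r, p)\<leftarrow>L. r * bprod k c d p x)" using bprod_pds by blast
    have "(\<lambda>x. \<Sum>(r, p)\<leftarrow>L. r * bprod k c d p x) differentiable (at x)"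
    proof (induction L)
      case (Cons a L)
      then show ?case by (cases a) (simp add: differentiable_add differentiable_mult bprod_differentiable)
    qed simp
    then show ?thesis by (simp add: L)
  qed
  moreover have "\<forall>x. x \<notin> cbox c d \<longrightarrow> bprod k c d (\<lambda>_. 1) x = 0"
    using bprod_nonzero[OF k] box_subset_cbox by blast
  ultimately show ?thesis unfolding test_function_def
    by (intro conjI exI[of _ "cbox c d"] S compact_cbox) auto
qed

lemma bprod_bounds: "bprod k c d (\<lambda>_. 1) x \<in> {0..1}"
  unfolding bprod_def by (auto intro!: prod_nonneg prod_le_1 simp: bump_def)

text \<open>Inside the box each factor is exp(-1 / (k y)) with a fixed y > 0 and a growing k;
  outside, some factor vanishes.\<close>

lemma bprod_lim: "(\<lambda>k. bprod (real (Suc k)) c d (\<lambda>_. 1) x) \<longlonglongrightarrow> indicator (box c d) x"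
proof (cases "x \<in> box c d")
  case False
  then have "bprod (real (Suc k)) c d (\<lambda>_. 1) x = 0" for k using bprod_nonzero[of "real (Suc k)" c d _ x] by auto
  then show ?thesis using False by simp
next
  case True
  have "(\<lambda>k. bump 1 (barg (real (Suc k)) c d e x)) \<longlonglongrightarrow> 1" for e
  proof -
    define y where "y = (if snd e then x $ fst e - c $ fst e else d $ fst e - x $ fst e)"
    have y: "y > 0" using True by (auto simp: y_def mem_box_vec)
    have "(\<lambda>k. exp (- ((1 / y) * (1 / real (Suc k))))) \<longlonglongrightarrow> exp (- ((1 / y) * 0))"
      by (intro tendsto_intros LIMSEQ_Suc lim_1_over_n)
    moreover have "bump 1 (barg (real (Suc k)) c d e x) = exp (- ((1 / y) * (1 / real (Suc k))))" for k
      using y by (auto simp: bump_def barg_def y_def zero_less_mult_iff mult.commute)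
    ultimately show ?thesis by simp
  qed
  then have "(\<lambda>k. bprod (real (Suc k)) c d (\<lambda>_. 1) x) \<longlonglongrightarrow> (\<Prod>e\<in>(UNIV :: ('a \<times> bool) set). 1)"
    unfolding bprod_def by (intro tendsto_prod)
  then show ?thesis using True by simp
qed

section \<open>Weak derivatives of smooth functions\<close>

text \<open>Boxes generate the Borel sets and are stable under intersection; the vanishing total
  integral supplies the complements in the Dynkin argument. Since \<open>f\<close> is only Lebesgue
  measurable, it is first replaced by a Borel function.\<close>

lemma box_integrals_zero_AE:
  fixes f :: "real ^ 'n::finite \<Rightarrow> real"
  assumes f: "integrable lebesgue f" and z: "\<And>l u. (LINT x:box l u|lebesgue. f x) = 0" and U: "integral\<^sup>L lebesgue f = 0"
  shows "AE x in lebesgue. f x = 0"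
proof -
  obtain f' where f': "f' \<in> borel_measurable lborel" "AE x in lborel. f x = f' x"
    using completion_ex_borel_measurable_real[of f lborel] f by auto
  have ae: "AE x in lebesgue. f x = f' x" using f'(2) by (rule AE_completion)
  have fm: "f' \<in> borel_measurable lebesgue" using f'(1) by (rule measurable_completion)
  have "integrable lebesgue f'" using integrable_cong_AE[OF _ fm ae] f by auto
  then have i: "integrable lborel f'" using integrable_completion[OF f'(1)] by simp
  have eq: "(LINT x:A|lborel. f' x) = (LINT x:A|lebesgue. f x)" if A: "A \<in> sets borel" for A
  proof -
    have "(LINT x:A|lborel. f' x) = (LINT x:A|lebesgue. f' x)"
      unfolding set_lebesgue_integral_def by (rule integral_completion[symmetric]) (use A f'(1) in auto)
    also have "\<dots> = (LINT x:A|lebesgue. f x)"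
    proof (rule set_lebesgue_integral_cong_AE)
      show "AE x\<in>A in lebesgue. f' x = f x" using ae by eventually_elim simp
    qed (use A f fm in auto)
    finally show ?thesis .
  qed
  have U': "(LINT x:UNIV|lborel. f' x) = 0" using eq[of UNIV] U by (simp add: set_lebesgue_integral_def)
  have "(LINT x:A|lborel. f' x) = 0" if "A \<in> sets lborel" for A
  proof -
    let ?G = "range (\<lambda>(a, b). box a b :: (real ^ 'n) set)"
    have si: "set_integrable lborel B f'" if "B \<in> sets borel" for B
      unfolding set_integrable_def using that i by (intro integrable_mult_indicator) auto
    have A: "A \<in> sigma_sets UNIV ?G" using that by (simp add: borel_eq_box)
    have s: "sigma_sets UNIV ?G = sets borel" by (simp add: borel_eq_box)
    have "\<exists>l u. box a b \<inter> box c d = box l u" for a b c d :: "real ^ 'n" using box_Int_box by blast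
    then have IS: "Int_stable ?G" unfolding Int_stable_def by (auto simp: image_iff)
    show ?thesis
    proof (induction rule: sigma_sets_induct_disjoint[OF _ _ A])
      case 1 show ?case by (rule IS)
    next
      case 2 show ?case by simp
    next
      case (3 B)
      then show ?case using eq z by auto
    next
      case 4 show ?case by (simp add: set_lebesgue_integral_def)
    next
      case (5 B)
      have "(LINT x:UNIV|lborel. f' x) = (LINT x:B|lborel. f' x) + (LINT x:(UNIV - B)|lborel. f' x)"
        using set_integral_Un[of B "UNIV - B" lborel f'] si[of B] si[of "UNIV - B"] 5 s by (simp add: Un_Diff_cancel)
      then show ?case using 5 U' by simp
    next
      case (6 B)
      then have B: "B i \<in> sets lborel" for i using s by auto
      have "(LINT x:(\<Union>i. B i)|lborel. f' x) = (\<Sum>i. LINT x:B i|lborel. f' x)"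
        by (rule lebesgue_integral_countable_add) (use B 6 in \<open>auto simp: disjoint_family_on_def intro!: si\<close>)
      then show ?case using 6 by simp
    qed
  qed
  then have "AE x in lborel. f' x = 0"
    by (intro density_unique_real i) (auto simp: set_lebesgue_integral_def)
  then have "AE x in lebesgue. f' x = 0" by (rule AE_completion)
  with ae show ?thesis by eventually_elim simp
qed

text \<open>Lower corners of compact boxes that exhaust a cell; weak derivatives are known to be
  integrable on compact subsets only. For small \<open>n\<close> such a box may be empty.\<close>

definition inner_lo :: "'n::finite elem \<Rightarrow> nat \<Rightarrow> real ^ 'n" where
  "inner_lo K n = (\<chi> i. fst K $ i + 1 / real (Suc n))"

definition inner_hi :: "'n::finite elem \<Rightarrow> nat \<Rightarrow> real ^ 'n" where
  "inner_hi K n = (\<chi> i. snd K $ i - 1 / real (Suc n))"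

lemma inner_subset: "cbox (inner_lo K n) (inner_hi K n) \<subseteq> cell K"
proof
  fix x assume x: "x \<in> cbox (inner_lo K n) (inner_hi K n)"
  have p: "0 < 1 / real (Suc n)" by simp
  have "fst K $ i < x $ i \<and> x $ i < snd K $ i" for i
    using x[unfolded mem_cbox_vec, rule_format, of i] p unfolding inner_lo_def inner_hi_def vec_lambda_beta by linarith
  then show "x \<in> cell K" by (simp add: cell_def mem_box_vec)
qed

lemma cell_exhaust:
  assumes x: "x \<in> cell K"
  shows "\<exists>n0. \<forall>n\<ge>n0. x \<in> box (inner_lo K n) (inner_hi K n)"
proof -
  have "\<exists>n0. \<forall>n\<ge>n0. inner_lo K n $ i < x $ i \<and> x $ i < inner_hi K n $ i" for i
  proof -
    have p: "min (x $ i - fst K $ i) (snd K $ i - x $ i) > 0" using x by (auto simp: cell_def mem_box_vec)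
    then obtain n0 where n0: "1 / real (Suc n0) < min (x $ i - fst K $ i) (snd K $ i - x $ i)"
      using nat_approx_posE by blast
    have "inner_lo K n $ i < x $ i \<and> x $ i < inner_hi K n $ i" if "n \<ge> n0" for n
    proof -
      have "1 / real (Suc n) \<le> 1 / real (Suc n0)" using that by (simp add: frac_le)
      then show ?thesis using n0 unfolding inner_lo_def inner_hi_def vec_lambda_beta by linarith
    qed
    then show ?thesis by blast
  qed
  then obtain m where m: "\<And>i n. n \<ge> m i \<Longrightarrow> inner_lo K n $ i < x $ i \<and> x $ i < inner_hi K n $ i" by metis
  have "m i \<le> Max (range m)" for i by simp
  then show ?thesis using m by (intro exI[of _ "Max (range m)"]) (auto simp: mem_box_vec intro: order_trans)
qed

text \<open>Test functions converging to the indicator of a box show that the difference has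
  integral zero over every box whose closure lies in the cell. This identifies the derivative chosen
  in \<open>wderiv\<close> with the classical one.\<close>

lemma weak_deriv_unique:
  fixes g g1 g2 :: "real ^ 'n::finite \<Rightarrow> real"
  assumes 1: "has_weak_deriv (cell K) \<alpha> g g1" and 2: "has_weak_deriv (cell K) \<alpha> g g2"
  shows "AE x in lebesgue. x \<in> cell K \<longrightarrow> g1 x = g2 x"
proof -
  have li: "set_integrable lebesgue C g1" "set_integrable lebesgue C g2" if "compact C" "C \<subseteq> cell K" for C
    using 1 2 that by (auto simp: has_weak_deriv_def locally_integrable_def)
  have zero: "(LINT x:box c d|lebesgue. g1 x - g2 x) = 0" if cd: "cbox c d \<subseteq> cell K" for c d
  proof -
    have ib: "set_integrable lebesgue (cbox c d) g1" "set_integrable lebesgue (cbox c d) g2"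
      using li[OF compact_cbox cd] by auto
    let ?D = "\<lambda>x. g1 x - g2 x" and ?b = "\<lambda>k. bprod (real (Suc k)) c d (\<lambda>_. 1)"
    have iD: "set_integrable lebesgue (cbox c d) ?D" by (rule set_integral_diff(1)[OF ib])
    have tf: "test_function (cell K) (?b k)" for k by (rule bprod_test_function[OF _ cd]) simp
    have ind: "indicator (cell K) x *\<^sub>R (h x * ?b k x) = (indicator (cbox c d) x *\<^sub>R h x) * ?b k x" for h k x
      using bprod_nonzero[of "real (Suc k)" c d "\<lambda>_. 1" x] cd box_subset_cbox[of c d] by (cases "?b k x = 0") (auto simp: indicator_def)
    have contb: "continuous_on UNIV (?b k)" for k
      by (intro differentiable_imp_continuous_on) (auto simp: differentiable_on_def intro: differentiable_at_withinI bprod_differentiable)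
    then have bm: "?b k \<in> borel_measurable lebesgue" for k
      by (intro measurable_completion) (simp add: borel_measurable_continuous_onI)
    have z: "(LINT x|lebesgue. (indicator (cbox c d) x *\<^sub>R ?D x) * ?b k x) = 0" for k
    proof -
      have "(LINT x:cell K|lebesgue. g1 x * ?b k x) = (LINT x:cell K|lebesgue. g2 x * ?b k x)"
      proof -
        have "(LINT x:cell K|lebesgue. g x * mi_deriv \<alpha> (?b k) x) = (-1) ^ mi_order \<alpha> * (LINT x:cell K|lebesgue. g1 x * ?b k x)"
          using 1 tf[of k] unfolding has_weak_deriv_def by blast
        moreover have "(LINT x:cell K|lebesgue. g x * mi_deriv \<alpha> (?b k) x) = (-1) ^ mi_order \<alpha> * (LINT x:cell K|lebesgue. g2 x * ?b k x)"
          using 2 tf[of k] unfolding has_weak_deriv_def by blast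
        ultimately show ?thesis by simp
      qed
      then have e: "(LINT x|lebesgue. (indicator (cbox c d) x *\<^sub>R g1 x) * ?b k x) = (LINT x|lebesgue. (indicator (cbox c d) x *\<^sub>R g2 x) * ?b k x)"
        unfolding set_lebesgue_integral_def ind .
      have ii: "integrable lebesgue (\<lambda>x. (indicator (cbox c d) x *\<^sub>R h x) * ?b k x)" if "set_integrable lebesgue (cbox c d) h" for h
      proof (rule Bochner_Integration.integrable_bound)
        show ih: "integrable lebesgue (\<lambda>x. indicator (cbox c d) x *\<^sub>R h x)" using that by (simp add: set_integrable_def)
        show "(\<lambda>x. indicator (cbox c d) x *\<^sub>R h x * ?b k x) \<in> borel_measurable lebesgue"
          by (rule borel_measurable_times[OF borel_measurable_integrable[OF ih] bm])
        show "AE x in lebesgue. norm (indicator (cbox c d) x *\<^sub>R h x * ?b k x) \<le> norm (indicator (cbox c d) x *\<^sub>R h x)"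
        proof (intro AE_I2)
          fix x
          have "\<bar>?b k x\<bar> \<le> 1" using bprod_bounds[of "real (Suc k)" c d x] by simp
          then show "norm (indicator (cbox c d) x *\<^sub>R h x * ?b k x) \<le> norm (indicator (cbox c d) x *\<^sub>R h x)"
            unfolding norm_mult using mult_left_mono[of "\<bar>?b k x\<bar>" 1 "norm (indicator (cbox c d) x *\<^sub>R h x)"] by simp
        qed
      qed
      have "(LINT x|lebesgue. (indicator (cbox c d) x *\<^sub>R ?D x) * ?b k x) =
        (LINT x|lebesgue. (indicator (cbox c d) x *\<^sub>R g1 x) * ?b k x - (indicator (cbox c d) x *\<^sub>R g2 x) * ?b k x)"
        by (simp add: algebra_simps)
      also have "\<dots> = 0" by (subst Bochner_Integration.integral_diff[OF ii[OF ib(1)] ii[OF ib(2)]]) (simp only: e diff_self)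
      finally show ?thesis .
    qed
    have lim: "(\<lambda>k. LINT x|lebesgue. (indicator (cbox c d) x *\<^sub>R ?D x) * ?b k x) \<longlonglongrightarrow>
        (LINT x|lebesgue. (indicator (cbox c d) x *\<^sub>R ?D x) * indicator (box c d) x)"
    proof (rule integral_dominated_convergence[where w="\<lambda>x. norm (indicator (cbox c d) x *\<^sub>R ?D x)"])
      have m: "(\<lambda>x. indicator (cbox c d) x *\<^sub>R ?D x) \<in> borel_measurable lebesgue"
        using iD unfolding set_integrable_def by (rule borel_measurable_integrable)
      show "(\<lambda>x. indicator (cbox c d) x *\<^sub>R ?D x * indicator (box c d) x) \<in> borel_measurable lebesgue"
        by (intro borel_measurable_times m borel_measurable_indicator) simp
      show "(\<lambda>x. indicator (cbox c d) x *\<^sub>R ?D x * ?b k x) \<in> borel_measurable lebesgue" for k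
        by (intro borel_measurable_times m bm)
      show "integrable lebesgue (\<lambda>x. norm (indicator (cbox c d) x *\<^sub>R ?D x))"
        using iD unfolding set_integrable_def by (rule integrable_norm)
      show "AE x in lebesgue. (\<lambda>k. indicator (cbox c d) x *\<^sub>R ?D x * ?b k x) \<longlonglongrightarrow> indicator (cbox c d) x *\<^sub>R ?D x * indicator (box c d) x"
        by (intro AE_I2 tendsto_mult tendsto_const bprod_lim)
      show "AE x in lebesgue. norm (indicator (cbox c d) x *\<^sub>R ?D x * ?b k x) \<le> norm (indicator (cbox c d) x *\<^sub>R ?D x)" for k
      proof (intro AE_I2)
        fix x
        have "\<bar>?b k x\<bar> \<le> 1" using bprod_bounds[of "real (Suc k)" c d x] by simp
        then show "norm (indicator (cbox c d) x *\<^sub>R ?D x * ?b k x) \<le> norm (indicator (cbox c d) x *\<^sub>R ?D x)"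
          unfolding norm_mult using mult_left_mono[of "\<bar>?b k x\<bar>" 1 "norm (indicator (cbox c d) x *\<^sub>R ?D x)"] by simp
      qed
    qed
    have "(LINT x|lebesgue. (indicator (cbox c d) x *\<^sub>R ?D x) * indicator (box c d) x) = 0"
      using lim unfolding z LIMSEQ_const_iff by simp
    moreover have e: "(indicator (cbox c d) x *\<^sub>R ?D x) * indicator (box c d) x = indicator (box c d) x *\<^sub>R ?D x" for x
      using box_subset_cbox[of c d] by (auto simp: indicator_def)
    ultimately show ?thesis unfolding set_lebesgue_integral_def e by blast
  qed
  have "AE x in lebesgue. x \<in> box (inner_lo K n) (inner_hi K n) \<longrightarrow> g1 x = g2 x" for n
  proof -
    let ?B = "box (inner_lo K n) (inner_hi K n)"
    let ?f = "\<lambda>x. indicator ?B x *\<^sub>R (g1 x - g2 x)"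
    note s = inner_subset[of K n]
    have "set_integrable lebesgue (cbox (inner_lo K n) (inner_hi K n)) (\<lambda>x. g1 x - g2 x)"
      by (rule set_integral_diff(1)[OF li[OF compact_cbox s]])
    then have i: "set_integrable lebesgue ?B (\<lambda>x. g1 x - g2 x)"
      by (rule set_integrable_subset) (auto intro: box_subset_cbox[THEN subsetD])
    have "AE x in lebesgue. ?f x = 0"
    proof (rule box_integrals_zero_AE)
      show "integrable lebesgue ?f" using i by (simp add: set_integrable_def)
      show "integral\<^sup>L lebesgue ?f = 0" using zero[OF s] by (simp add: set_lebesgue_integral_def)
      fix l u :: "real ^ 'n"
      obtain l' u' where b: "box l u \<inter> ?B = box l' u'" using box_Int_box by blast
      have e: "indicator (box l u) x *\<^sub>R ?f x = indicator (box l' u') x *\<^sub>R (g1 x - g2 x)" for x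
        unfolding b[symmetric] by (simp add: indicator_inter_arith)
      have "(LINT x:box l' u'|lebesgue. g1 x - g2 x) = 0"
      proof (cases "box l' u' = {}")
        case True
        then show ?thesis by (simp add: set_lebesgue_integral_def)
      next
        case False
        \<comment> \<open>The intersection is an open box, but \<open>zero\<close> needs its closed
          box inside the cell; for a nonempty box this is the closure, which stays in the closed
          inner box.\<close>
        have "closure (box l' u') \<subseteq> cbox (inner_lo K n) (inner_hi K n)"
          by (rule closure_minimal) (use b box_subset_cbox[of "inner_lo K n" "inner_hi K n"] in auto)
        then show ?thesis using closure_box[OF False] zero s by (metis order_trans)
      qed
      then show "(LINT x:box l u|lebesgue. ?f x) = 0" unfolding set_lebesgue_integral_def e .
    qed
    then show ?thesis by eventually_elim (auto simp: indicator_def split: if_splits)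
  qed
  then have "AE x in lebesgue. \<forall>n. x \<in> box (inner_lo K n) (inner_hi K n) \<longrightarrow> g1 x = g2 x" unfolding AE_all_countable by blast
  then show ?thesis by eventually_elim (use cell_exhaust in blast)
qed

lemma test_function_CS: "test_function S \<phi> \<Longrightarrow> CS k \<phi>"
proof -
  assume t: "test_function S \<phi>"
  have "CS k g" if "\<And>is x. pds is g differentiable (at x)" for g :: "real ^ 'a \<Rightarrow> real"
    using that
  proof (induction k arbitrary: g)
    case 0
    have "continuous_on UNIV g"
      by (intro differentiable_imp_continuous_on) (use 0[of "[]"] in \<open>auto simp: differentiable_on_def intro: differentiable_at_withinI\<close>)
    then show ?case by (simp add: split_beta continuous_on_compose2[of UNIV g] continuous_on_snd continuous_on_id)
  next
    case (Suc k)
    have "continuous_on UNIV g"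
      by (intro differentiable_imp_continuous_on) (use Suc.prems[of "[]"] in \<open>auto simp: differentiable_on_def intro: differentiable_at_withinI\<close>)
    then have c: "continuous_on (UNIV \<times> UNIV) (\<lambda>(t::real, x). g x)"
      by (simp add: split_beta continuous_on_compose2[of UNIV g] continuous_on_snd continuous_on_id)
    have l: "ldiff i g" for i unfolding ldiff_def
    proof
      fix x :: "real ^ 'a"
      have "(\<lambda>s. x + s *\<^sub>R axis i 1) differentiable (at (0::real))"
        by (auto intro!: derivative_intros)
      moreover have "g differentiable (at (x + 0 *\<^sub>R axis i 1))" using Suc.prems[of "[]" x] by simp
      ultimately show "(\<lambda>s. g (x + s *\<^sub>R axis i 1)) differentiable (at 0)"
        using differentiable_chain_at[of "\<lambda>s. x + s *\<^sub>R axis i 1" 0 g] by (simp add: o_def)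
    qed
    have "CS k (pd i g)" for i
      by (rule Suc.IH) (use Suc.prems[of "_ @ [i]"] in \<open>simp add: pds_append\<close>)
    then show ?case using c l by simp
  qed
  then show ?thesis using t unfolding test_function_def by blast
qed

lemma pds_outside:
  assumes C: "closed C" and z: "\<And>x. x \<notin> C \<Longrightarrow> \<phi> x = 0" and x: "x \<notin> C"
  shows "pds is \<phi> x = 0"
  using x
proof (induction "is" arbitrary: x)
  case Nil then show ?case using z by simp
next
  case (Cons i "is")
  have t: "((\<lambda>s. x + s *\<^sub>R axis i 1) \<longlongrightarrow> x) (nhds 0)"
    using tendsto_add[OF tendsto_const[of x "nhds 0"] tendsto_scaleR[OF filterlim_ident tendsto_const[of "axis i 1" "nhds 0"]]] by simp
  have "eventually (\<lambda>s. x + s *\<^sub>R axis i 1 \<in> - C) (nhds 0)"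
    by (rule topological_tendstoD[OF t]) (use C Cons.prems in auto)
  then have "eventually (\<lambda>s. pds is \<phi> (x + s *\<^sub>R axis i 1) = (\<lambda>_. 0) s) (nhds 0)"
    by eventually_elim (use Cons.IH in auto)
  then have "deriv (\<lambda>s. pds is \<phi> (x + s *\<^sub>R axis i 1)) 0 = deriv (\<lambda>_::real. 0 :: real) 0"
    by (rule deriv_cong_ev) simp
  then show ?case by (simp add: pd_def)
qed

text \<open>Each step removes the outermost derivative from the test function, without boundary
  terms since the faces lie outside the support. The derivatives arrive at \<open>g\<close> in
  reversed order.\<close>

lemma weak_integration_by_parts:
  assumes K: "proper K" and g: "CS k g" and t: "test_function (cell K) \<phi>" and l: "length is \<le> k"
  shows "bint K (\<lambda>x. g x * pds is \<phi> x) = (- 1) ^ length is * bint K (\<lambda>x. pds (rev is) g x * \<phi> x)"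
  using g l
proof (induction "is" arbitrary: g k)
  case (Cons i "is")
  obtain C where C: "compact C" "C \<subseteq> cell K" "\<And>x. x \<notin> C \<Longrightarrow> \<phi> x = 0" using t by (auto simp: test_function_def)
  let ?\<psi> = "pds is \<phi>"
  have k: "CS (Suc (k - 1)) g" using Cons.prems by simp
  have g1: "CS (Suc 0) g" by (rule JS_le[OF Cons.prems(1)]) (use Cons.prems in simp)
  have p1: "CS (Suc 0) ?\<psi>" by (rule JS_pds[OF test_function_CS[OF t, of "Suc (length is)"]]) simp
  have gp: "CS (Suc 0) (\<lambda>x. g x * ?\<psi> x)" by (rule JS_mult[OF g1 p1])
  have c: "continuous_on UNIV g" "continuous_on UNIV (pd i g)" "continuous_on UNIV ?\<psi>" "continuous_on UNIV (pd i ?\<psi>)"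
    using CS_continuous[OF g1] CS_continuous[OF JS_pd[OF g1]] CS_continuous[OF p1] CS_continuous[OF JS_pd[OF p1]] by auto
  have le: "fst K $ i \<le> snd K $ i" using K by (simp add: proper_def less_imp_le)
  have "?\<psi> (pt i y (face_pos K i n)) = 0" for y n
  proof (rule pds_outside[OF compact_imp_closed[OF C(1)] C(3)])
    have "pt i y (face_pos K i n) \<notin> cell K" unfolding cell_def mem_box_vec by (auto simp: face_pos_def intro!: exI[of _ i])
    then show "pt i y (face_pos K i n) \<notin> C" using C(2) by blast
  qed
  then have "bint K (pd i (\<lambda>x. g x * ?\<psi> x)) = 0"
    unfolding bint_pd[OF gp le] face_int_pt face_pos_def[symmetric] by simp
  moreover have "pd i (\<lambda>x. g x * ?\<psi> x) = (\<lambda>x. pd i g x * ?\<psi> x + g x * pd i ?\<psi> x)"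
    by (rule pd_mult) (use g1 p1 in auto)
  ultimately have "bint K (\<lambda>x. g x * pd i ?\<psi> x) = - bint K (\<lambda>x. pd i g x * ?\<psi> x)"
    using integral_add[of "\<lambda>x. pd i g x * ?\<psi> x" "cbox (fst K) (snd K)" "\<lambda>x. g x * pd i ?\<psi> x"]
    by (simp add: cont_integrable continuous_intros c)
  also have "bint K (\<lambda>x. pd i g x * ?\<psi> x) = (- 1) ^ length is * bint K (\<lambda>x. pds (rev is) (pd i g) x * \<phi> x)"
    by (rule Cons.IH[OF JS_pd[OF k]]) (use Cons.prems in simp)
  finally show ?case by (simp add: pds_append)
qed simp

definition mi_list :: "('n::finite \<Rightarrow> nat) \<Rightarrow> 'n list" where
  "mi_list \<alpha> = concat (map (\<lambda>i. replicate (\<alpha> i) i) coords)"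

lemma length_mi_list: "length (mi_list \<alpha>) = mi_order \<alpha>"
  unfolding mi_list_def mi_order_def
  by (simp add: length_concat o_def sum_list_distinct_conv_sum_set coords)

lemma count_mi_list: "count (mset (mi_list \<alpha>)) i = \<alpha> i"
proof -
  have "count (mset (concat (map (\<lambda>i. replicate (\<alpha> i) i) xs))) i = (\<Sum>j\<leftarrow>xs. if j = i then \<alpha> j else 0)" for xs
    by (induction xs) (auto simp: count_list_0_iff)
  also have "(\<Sum>j\<leftarrow>coords. if j = i then \<alpha> j else 0) = (\<Sum>j\<in>UNIV. if j = i then \<alpha> j else 0)"
    by (subst sum_list_distinct_conv_sum_set) (simp_all add: coords)
  finally show ?thesis by (simp add: mi_list_def)
qed

lemma mi_list_mset: "mset (mi_list (count (mset js))) = mset js"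
  by (rule multiset_eqI) (simp add: count_mi_list)

lemma has_weak_deriv_classical:
  assumes K: "proper K" and g: "CS k g" and \<alpha>: "mi_order \<alpha> \<le> k"
  shows "has_weak_deriv (cell K) \<alpha> g (pds (rev (mi_list \<alpha>)) g)"
proof -
  have c: "continuous_on UNIV g" "continuous_on UNIV (pds (rev (mi_list \<alpha>)) g)"
    using CS_continuous[OF g] CS_pds_cont[OF g, of "rev (mi_list \<alpha>)"] \<alpha> by (auto simp: length_mi_list)
  have li: "locally_integrable (cell K) h" if "continuous_on UNIV h" for h
    unfolding locally_integrable_def
  proof (intro allI impI)
    fix C :: "(real ^ 'a) set" assume C: "compact C \<and> C \<subseteq> cell K"
    have "set_integrable lborel C h" unfolding set_integrable_def
      by (rule borel_integrable_compact) (use C continuous_on_subset[OF that] in auto)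
    then show "set_integrable lebesgue C h" unfolding set_integrable_def
      by (intro integrable_completion[THEN iffD2]) auto
  qed
  have "(LINT x:cell K|lebesgue. g x * mi_deriv \<alpha> \<phi> x) = (- 1) ^ mi_order \<alpha> * (LINT x:cell K|lebesgue. pds (rev (mi_list \<alpha>)) g x * \<phi> x)"
    if t: "test_function (cell K) \<phi>" for \<phi>
  proof -
    have cp: "continuous_on UNIV (mi_deriv \<alpha> \<phi>)" "continuous_on UNIV \<phi>"
      using CS_pds_cont[OF test_function_CS[OF t], of "mi_list \<alpha>" "mi_order \<alpha>"] CS_continuous[OF test_function_CS[OF t]]
      by (auto simp: mi_deriv_def mi_list_def[symmetric] length_mi_list)
    have "(LINT x:cell K|lebesgue. g x * mi_deriv \<alpha> \<phi> x) = bint K (\<lambda>x. g x * mi_deriv \<alpha> \<phi> x)"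
      by (rule cell_LINT(2)) (auto intro!: continuous_intros c cp)
    also have "\<dots> = (- 1) ^ mi_order \<alpha> * bint K (\<lambda>x. pds (rev (mi_list \<alpha>)) g x * \<phi> x)"
      using weak_integration_by_parts[OF K g t, of "mi_list \<alpha>"] \<alpha> by (simp add: mi_deriv_def mi_list_def[symmetric] length_mi_list)
    also have "bint K (\<lambda>x. pds (rev (mi_list \<alpha>)) g x * \<phi> x) = (LINT x:cell K|lebesgue. pds (rev (mi_list \<alpha>)) g x * \<phi> x)"
      by (rule cell_LINT(2)[symmetric]) (auto intro!: continuous_intros c cp)
    finally show ?thesis .
  qed
  then show ?thesis unfolding has_weak_deriv_def using li c by blast
qed

text \<open>The classical derivative is a weak one, and weak derivatives are unique. Measurability
  of the chosen derivative on the cell is obtained as a limit along the inner boxes, where it is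
  integrable.\<close>

lemma wderiv_AE:
  assumes K: "proper K" and g: "CS k g" and \<alpha>: "mi_order \<alpha> \<le> k"
  shows "AE x in lebesgue. x \<in> cell K \<longrightarrow> wderiv (cell K) \<alpha> g x = pds (mi_list \<alpha>) g x"
    and "(\<lambda>x. indicator (cell K) x * wderiv (cell K) \<alpha> g x) \<in> borel_measurable lebesgue"
proof -
  have w: "has_weak_deriv (cell K) \<alpha> g (wderiv (cell K) \<alpha> g)"
    unfolding wderiv_def
    by (rule someI[of "has_weak_deriv (cell K) \<alpha> g", OF has_weak_deriv_classical[OF K g \<alpha>]])
  have "pds (rev (mi_list \<alpha>)) g = pds (mi_list \<alpha>) g"
    by (rule pds_perm[OF g]) (use \<alpha> in \<open>auto simp: length_mi_list\<close>)
  then show "AE x in lebesgue. x \<in> cell K \<longrightarrow> wderiv (cell K) \<alpha> g x = pds (mi_list \<alpha>) g x"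
    using weak_deriv_unique[OF w has_weak_deriv_classical[OF K g \<alpha>]] by simp
  let ?B = "\<lambda>n. cbox (inner_lo K n) (inner_hi K n)"
  let ?w = "wderiv (cell K) \<alpha> g"
  have li: "locally_integrable (cell K) ?w" using w by (simp add: has_weak_deriv_def)
  have "set_integrable lebesgue (?B n) ?w" for n
    using li[unfolded locally_integrable_def, rule_format, of "?B n"] inner_subset[of K n] by simp
  then have m: "(\<lambda>x. indicator (?B n) x * ?w x) \<in> borel_measurable lebesgue" for n
    unfolding set_integrable_def real_scaleR_def by (rule borel_measurable_integrable)
  show "(\<lambda>x. indicator (cell K) x * ?w x) \<in> borel_measurable lebesgue"
  proof (rule borel_measurable_LIMSEQ_real[OF _ m])
    fix x
    show "(\<lambda>n. indicator (?B n) x * ?w x) \<longlonglongrightarrow> indicator (cell K) x * ?w x"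
    proof (cases "x \<in> cell K")
      case True
      then obtain n0 where "\<And>n. n \<ge> n0 \<Longrightarrow> x \<in> box (inner_lo K n) (inner_hi K n)" using cell_exhaust by blast
      then have "eventually (\<lambda>n. indicator (cell K) x * ?w x = indicator (?B n) x * ?w x) sequentially"
        using True box_subset_cbox by (intro eventually_sequentiallyI[of n0]) (auto simp: indicator_def)
      then show ?thesis by (rule Lim_transform_eventually[OF tendsto_const])
    next
      case False
      then have "x \<notin> ?B n" for n using inner_subset by blast
      then show ?thesis using False by simp
    qed
  qed
qed

lemma wderiv_sq:
  assumes K: "proper K" and g: "CS k g" and \<alpha>: "mi_order \<alpha> \<le> k"
  shows "(LINT x:cell K|lebesgue. (wderiv (cell K) \<alpha> g x)\<^sup>2) = bint K (\<lambda>x. (pds (mi_list \<alpha>) g x)\<^sup>2)"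
proof -
  note w = wderiv_AE[OF K g \<alpha>]
  have c: "continuous_on UNIV (\<lambda>x. (pds (mi_list \<alpha>) g x)\<^sup>2)"
    by (intro continuous_intros CS_pds_cont[OF g]) (use \<alpha> in \<open>simp add: length_mi_list\<close>)
  have m: "(\<lambda>x. indicator (cell K) x *\<^sub>R (wderiv (cell K) \<alpha> g x)\<^sup>2) \<in> borel_measurable lebesgue"
    using borel_measurable_power[OF w(2), of 2] by (rule measurable_cong[THEN iffD1, rotated]) (auto simp: indicator_def)
  have "(LINT x:cell K|lebesgue. (wderiv (cell K) \<alpha> g x)\<^sup>2) = (LINT x:cell K|lebesgue. (pds (mi_list \<alpha>) g x)\<^sup>2)"
    unfolding set_lebesgue_integral_def
  proof (rule integral_cong_AE[OF m])
    show "(\<lambda>x. indicator (cell K) x *\<^sub>R (pds (mi_list \<alpha>) g x)\<^sup>2) \<in> borel_measurable lebesgue"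
      using cell_LINT(1)[OF c, of K] unfolding set_integrable_def by (intro borel_measurable_integrable) simp
    show "AE x in lebesgue. indicator (cell K) x *\<^sub>R (wderiv (cell K) \<alpha> g x)\<^sup>2 = indicator (cell K) x *\<^sub>R (pds (mi_list \<alpha>) g x)\<^sup>2"
      using w(1) by eventually_elim (auto simp: indicator_def)
  qed
  also have "\<dots> = bint K (\<lambda>x. (pds (mi_list \<alpha>) g x)\<^sup>2)" by (rule cell_LINT(2)[OF c]) simp
  finally show ?thesis .
qed

lemma finite_mi: "finite {\<alpha> :: 'n::finite \<Rightarrow> nat. mi_order \<alpha> \<le> l}" "finite {\<alpha> :: 'n::finite \<Rightarrow> nat. mi_order \<alpha> = l}"
proof -
  have "\<alpha> i \<le> mi_order \<alpha>" for \<alpha> :: "'n \<Rightarrow> nat" and i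
    unfolding mi_order_def by (rule member_le_sum) auto
  then have "{\<alpha> :: 'n \<Rightarrow> nat. mi_order \<alpha> \<le> l} \<subseteq> {\<alpha>. \<forall>i. \<alpha> i \<le> l}" using order_trans by blast
  then show "finite {\<alpha> :: 'n \<Rightarrow> nat. mi_order \<alpha> \<le> l}" using finite_multi_index finite_subset by blast
  then show "finite {\<alpha> :: 'n \<Rightarrow> nat. mi_order \<alpha> = l}" by (rule rev_finite_subset) auto
qed

text \<open>A violation persists on a relatively open part of \<open>S\<close>, which contains a
  nonempty open set and hence is not null. It serves in space for the essential supremum and in time
  for the norms in \<open>Linf_le\<close>.\<close>

lemma AE_continuous_le:
  fixes c :: "'a::euclidean_space \<Rightarrow> real"
  assumes ae: "AE x in lebesgue. x \<in> S \<longrightarrow> c x \<le> B" and c: "continuous_on S c" and S: "S \<subseteq> closure (interior S)"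
    and x: "x \<in> S"
  shows "c x \<le> B"
proof (rule ccontr)
  assume "\<not> c x \<le> B"
  then have "B < c x" by simp
  then have "\<exists>T. open T \<and> x \<in> T \<and> (\<forall>y\<in>S \<inter> T. B < c y)"
    using c x unfolding continuous_on_topological by (metis IntD1 IntD2 greaterThan_iff open_greaterThan)
  then obtain T where T: "open T" "x \<in> T" "\<And>y. y \<in> S \<Longrightarrow> y \<in> T \<Longrightarrow> B < c y" by blast
  have "x \<in> closure (interior S)" using S x by auto
  then have ne: "interior S \<inter> T \<noteq> {}" using T closure_iff_nhds_not_empty[of x "interior S"] by blast
  have o: "open (interior S \<inter> T)" using T by auto
  have "AE y in lebesgue. y \<notin> interior S \<inter> T"
    using ae by eventually_elim (use T interior_subset in force)
  then have "interior S \<inter> T \<in> null_sets lebesgue"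
    using AE_iff_null_sets[of "interior S \<inter> T" lebesgue] o by auto
  then have "negligible (interior S \<inter> T)" by (simp add: negligible_iff_null_sets)
  then show False using open_not_negligible[OF o ne] by blast
qed

context mesh
begin

lemma Winf_bound:
  assumes T: "T > 0" and v: "JS l {0..T} v" and N: "Linf_le T (broken_Winf \<T> l) (Winf_norm \<T> l) v B"
    and t: "t \<in> {0..T}" and js: "length js \<le> l" and x: "x \<in> cbox a b"
  shows "\<bar>pds js (v t) x\<bar> \<le> B"
proof -
  obtain K where K: "K \<in> \<T>" "x \<in> cbox (fst K) (snd K)" using T_cover[OF x] by blast
  define \<alpha> where "\<alpha> = count (mset js)"
  have \<alpha>: "mi_order \<alpha> \<le> l" using js mset_eq_length[OF mi_list_mset[of js]] by (simp add: \<alpha>_def length_mi_list[symmetric])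
  have p: "pds js (v s) = pds (mi_list \<alpha>) (v s)" if "s \<in> {0..T}" for s
    by (rule pds_perm[OF JS_static[OF v that] js]) (simp add: \<alpha>_def mi_list_mset)
  have cx: "continuous_on UNIV (pds js (v s))" if "s \<in> {0..T}" for s by (rule CS_pds_cont[OF JS_static[OF v that] js])
  have key: "\<bar>pds js (v s) x\<bar> \<le> B" if s: "s \<in> {0..T}" and B: "Winf_norm \<T> l (v s) \<le> B" for s
  proof -
    let ?M = "lebesgue_on (cell K)" and ?w = "wderiv (cell K) \<alpha> (v s)"
    let ?E = "esssup ?M (\<lambda>x. ereal \<bar>?w x\<bar>)"
    note w = wderiv_AE[OF proper_T[OF K(1)] JS_static[OF v s] \<alpha>]
    have cs: "cell K \<in> sets lebesgue" by (simp add: cell_def)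
    have "real_of_ereal ?E \<le> Winf_norm \<T> l (v s)"
    proof -
      have "real_of_ereal ?E \<le> (MAX \<alpha>\<in>{\<alpha>. mi_order \<alpha> \<le> l}. real_of_ereal (esssup (lebesgue_on (cell K)) (\<lambda>x. ereal \<bar>wderiv (cell K) \<alpha> (v s) x\<bar>)))"
        by (rule Max_ge) (use finite_mi(1) \<alpha> in auto)
      also have "\<dots> \<le> Winf_norm \<T> l (v s)" unfolding Winf_norm_def
        by (rule Max_ge) (use finite_T K(1) in auto)
      finally show ?thesis .
    qed
    then have EB: "real_of_ereal ?E \<le> B" using B by simp
    have m: "?w \<in> borel_measurable ?M"
      using w(2) cs by (subst borel_measurable_restrict_space_iff) (auto simp: mult.commute)
    \<comment> \<open>\<open>real_of_ereal\<close> sends infinity to 0, so the essential supremum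
      has to be known finite before the bound on its real value says anything.\<close>
    have "bounded (pds js (v s) ` cbox (fst K) (snd K))"
      by (rule compact_imp_bounded, rule compact_continuous_image) (use cx[OF s] continuous_on_subset in auto)
    then obtain c where c: "\<And>x. x \<in> cbox (fst K) (snd K) \<Longrightarrow> \<bar>pds js (v s) x\<bar> \<le> c" unfolding bounded_iff by auto
    have ae: "AE x in ?M. ?w x = pds js (v s) x"
      using w(1) p[OF s] cs by (simp add: AE_restrict_space_iff)
    have "AE x in ?M. ereal \<bar>?w x\<bar> \<le> ereal c"
      using ae AE_space by eventually_elim (use c box_subset_cbox in \<open>auto simp: cell_def space_restrict_space\<close>)
    then have Ec: "?E \<le> ereal c" by (intro esssup_I) (use m in auto)
    have "AE x in ?M. ereal \<bar>?w x\<bar> \<le> ?E" by (rule esssup_AE)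
    then have "AE x in ?M. \<bar>?w x\<bar> \<le> B"
    proof eventually_elim
      case (elim x)
      show ?case using elim EB Ec by (cases ?E) auto
    qed
    then have "AE x in ?M. \<bar>pds js (v s) x\<bar> \<le> B" using ae by eventually_elim simp
    then have ae2: "AE x in lebesgue. x \<in> cbox (fst K) (snd K) \<longrightarrow> \<bar>pds js (v s) x\<bar> \<le> B"
    proof -
      have "negligible (cbox (fst K) (snd K) - box (fst K) (snd K))" by (rule negligible_frontier_interval)
      then have "AE x in lebesgue. x \<notin> cbox (fst K) (snd K) - cell K"
        unfolding cell_def negligible_iff_null_sets by (rule AE_not_in)
      moreover have "AE x in lebesgue. x \<in> cell K \<longrightarrow> \<bar>pds js (v s) x\<bar> \<le> B"
        using \<open>AE x in ?M. \<bar>pds js (v s) x\<bar> \<le> B\<close> cs by (simp add: AE_restrict_space_iff)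
      ultimately show ?thesis by eventually_elim auto
    qed
    show ?thesis
    proof (rule AE_continuous_le[OF ae2 _ _ K(2)])
      show "continuous_on (cbox (fst K) (snd K)) (\<lambda>x. \<bar>pds js (v s) x\<bar>)"
        by (intro continuous_intros continuous_on_subset[OF cx[OF s]]) simp
      have "box (fst K) (snd K) \<noteq> {}" using cell_nonempty[OF proper_T[OF K(1)]] by (simp add: cell_def)
      then show "cbox (fst K) (snd K) \<subseteq> closure (interior (cbox (fst K) (snd K)))" by (simp add: closure_box)
    qed
  qed
  have "AE s in lebesgue_on {0..T}. Winf_norm \<T> l (v s) \<le> B" using N by (simp add: Linf_le_def)
  then have "AE s in lebesgue. s \<in> {0..T} \<longrightarrow> Winf_norm \<T> l (v s) \<le> B" by (simp add: AE_restrict_space_iff)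
  then have "AE s in lebesgue. s \<in> {0..T} \<longrightarrow> \<bar>pds js (v s) x\<bar> \<le> B" by eventually_elim (use key in auto)
  then show ?thesis
  proof (rule AE_continuous_le[OF _ _ _ t])
    show "continuous_on {0..T} (\<lambda>s. \<bar>pds js (v s) x\<bar>)"
      by (intro continuous_intros JS_cont_t[OF JS_pds[OF v, of js 0]]) (use js in simp)
    show "{0..T} \<subseteq> closure (interior {0..T})" using T by simp
  qed
qed

lemma continuous_bint:
  assumes "continuous_on (S \<times> UNIV) (\<lambda>(t, x). z t x)"
  shows "continuous_on S (\<lambda>t. bint K (z t))"
  by (rule integral_continuous_on_param) (rule continuous_on_subset[OF assms], auto)

text \<open>One multi-index is kept from the sum in the norm. As a continuous function of time its
  contribution obeys the bound at every \<open>t\<close> and not only at almost every one.\<close>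

lemma H_bound:
  assumes T: "T > 0" and v: "JS l {0..T} v" and N: "Linf_le T (broken_H \<T> l) (H_norm \<T> l) v B"
    and t: "t \<in> {0..T}" and js: "length js \<le> l"
  shows "(\<Sum>K\<in>\<T>. bint K (\<lambda>x. (pds js (v t) x)\<^sup>2)) \<le> B\<^sup>2"
proof -
  define \<alpha> where "\<alpha> = count (mset js)"
  have \<alpha>: "mi_order \<alpha> \<le> l" using js mset_eq_length[OF mi_list_mset[of js]] by (simp add: \<alpha>_def length_mi_list[symmetric])
  have p: "pds js (v s) = pds (mi_list \<alpha>) (v s)" if "s \<in> {0..T}" for s
    by (rule pds_perm[OF JS_static[OF v that] js]) (simp add: \<alpha>_def mi_list_mset)
  have key: "(\<Sum>K\<in>\<T>. bint K (\<lambda>x. (pds js (v s) x)\<^sup>2)) \<le> B\<^sup>2" if s: "s \<in> {0..T}" and B: "H_norm \<T> l (v s) \<le> B" for s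
  proof -
    let ?b = "\<lambda>K \<beta>. LINT x:cell K|lebesgue. (wderiv (cell K) \<beta> (v s) x)\<^sup>2"
    have b0: "?b K \<beta> \<ge> 0" for K \<beta> by (simp add: set_lebesgue_integral_def)
    have "(\<Sum>K\<in>\<T>. bint K (\<lambda>x. (pds js (v s) x)\<^sup>2)) = (\<Sum>K\<in>\<T>. ?b K \<alpha>)"
      by (rule sum.cong) (simp_all add: wderiv_sq[OF proper_T JS_static[OF v s] \<alpha>] p[OF s])
    also have "\<dots> \<le> (\<Sum>K\<in>\<T>. \<Sum>\<beta> | mi_order \<beta> \<le> l. ?b K \<beta>)"
      by (intro sum_mono member_le_sum) (use \<alpha> b0 finite_mi(1) in auto)
    also have "\<dots> = (H_norm \<T> l (v s))\<^sup>2"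
      unfolding H_norm_def by (subst real_sqrt_pow2) (auto intro!: sum_nonneg b0)
    also have "\<dots> \<le> B\<^sup>2"
      by (rule power_mono[OF B]) (auto simp: H_norm_def intro!: sum_nonneg b0)
    finally show ?thesis .
  qed
  have "AE s in lebesgue_on {0..T}. H_norm \<T> l (v s) \<le> B" using N by (simp add: Linf_le_def)
  then have "AE s in lebesgue. s \<in> {0..T} \<longrightarrow> H_norm \<T> l (v s) \<le> B" by (simp add: AE_restrict_space_iff)
  then have "AE s in lebesgue. s \<in> {0..T} \<longrightarrow> (\<Sum>K\<in>\<T>. bint K (\<lambda>x. (pds js (v s) x)\<^sup>2)) \<le> B\<^sup>2" by eventually_elim (use key in auto)
  then show ?thesis
  proof (rule AE_continuous_le[OF _ _ _ t])
    have "continuous_on ({0..T} \<times> UNIV) (\<lambda>(t, x). (pds js (v t) x)\<^sup>2)"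
      using JS_pds_cont[OF v js] unfolding split_beta by (intro continuous_intros)
    then show "continuous_on {0..T} (\<lambda>s. \<Sum>K\<in>\<T>. bint K (\<lambda>x. (pds js (v s) x)\<^sup>2))"
      by (intro continuous_on_sum continuous_bint)
    show "{0..T} \<subseteq> closure (interior {0..T})" using T by simp
  qed
qed

lemma broken_H_smooth: "CS l g \<Longrightarrow> g \<in> broken_H \<T> l"
  unfolding broken_H_def
proof (intro CollectI ballI allI impI)
  fix K and \<alpha> :: "'n \<Rightarrow> nat" assume g: "CS l g" and K: "K \<in> \<T>" and \<alpha>: "mi_order \<alpha> \<le> l"
  have "continuous_on UNIV (\<lambda>x. (pds (rev (mi_list \<alpha>)) g x)\<^sup>2)"
    by (intro continuous_intros CS_pds_cont[OF g]) (use \<alpha> in \<open>simp add: length_mi_list\<close>)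
  then show "\<exists>g'. has_weak_deriv (cell K) \<alpha> g g' \<and> set_integrable lebesgue (cell K) (\<lambda>x. (g' x)\<^sup>2)"
    by (intro exI[of _ "pds (rev (mi_list \<alpha>)) g"] conjI has_weak_deriv_classical[OF proper_T[OF K] g \<alpha>]) (rule cell_LINT(1), auto)
qed

lemma H_seminorm_smooth:
  assumes g: "CS l g"
  shows "H_seminorm \<T> l g = sqrt (\<Sum>\<alpha> | mi_order \<alpha> = l. \<Sum>K\<in>\<T>. bint K (\<lambda>x. (pds (mi_list \<alpha>) g x)\<^sup>2))"
proof -
  have "(\<Sum>K\<in>\<T>. \<Sum>\<alpha> | mi_order \<alpha> = l. LINT x:cell K|lebesgue. (wderiv (cell K) \<alpha> g x)\<^sup>2)
    = (\<Sum>K\<in>\<T>. \<Sum>\<alpha> | mi_order \<alpha> = l. bint K (\<lambda>x. (pds (mi_list \<alpha>) g x)\<^sup>2))"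
    by (intro sum.cong refl wderiv_sq[OF proper_T g]) auto
  then show ?thesis unfolding H_seminorm_def by (subst sum.swap) simp
qed

end

section \<open>Bounds for the exact solution\<close>

text \<open>The one-dimensional Sobolev inequality: two values differ by at most the integral of
  |g'|, and one of them is averaged over the line.\<close>

lemma line_sup:
  fixes g :: "real ^ 'n::finite \<Rightarrow> real"
  assumes g: "CS (Suc 0) g" and s0: "s0 \<in> {l..u}"
  shows "(u - l) * \<bar>g (upd x i s0)\<bar> \<le> integral {l..u} (\<lambda>s. \<bar>g (upd x i s)\<bar> + (u - l) * \<bar>pd i g (upd x i s)\<bar>)"
proof -
  have c: "continuous_on UNIV g" "continuous_on UNIV (pd i g)"
    using CS_continuous[OF g] CS_continuous[OF JS_pd[OF g]] by auto
  let ?d = "\<lambda>s. pd i g (upd x i s)"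
  have cd: "continuous_on S ?d" for S by (rule cont_line[OF c(2)])
  let ?I = "integral {l..u} (\<lambda>s. \<bar>?d s\<bar>)"
  have diff: "g (upd x i q) - g (upd x i p) \<le> ?I \<and> g (upd x i p) - g (upd x i q) \<le> ?I" if "p \<le> q" "p \<in> {l..u}" "q \<in> {l..u}" for p q
  proof -
    have "\<bar>g (upd x i q) - g (upd x i p)\<bar> = norm (integral {p..q} ?d)" using line_FTC[OF g that(1), of i x] by simp
    also have "\<dots> \<le> integral {p..q} (\<lambda>s. \<bar>?d s\<bar>)"
      by (rule integral_norm_bound_integral) (auto intro!: cont_int_real continuous_intros cd)
    also have "\<dots> \<le> ?I"
      by (rule integral_subset_le) (use that in \<open>auto intro!: cont_int_real continuous_intros cd\<close>)
    finally show ?thesis by (simp add: abs_le_iff)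
  qed
  have le: "\<bar>g (upd x i s0)\<bar> \<le> \<bar>g (upd x i s)\<bar> + ?I" if "s \<in> {l..u}" for s
    using diff[of s0 s] diff[of s s0] s0 that by (cases "s0 \<le> s") linarith+
  have lu: "l \<le> u" using s0 by auto
  have "(u - l) * \<bar>g (upd x i s0)\<bar> = integral {l..u} (\<lambda>s. \<bar>g (upd x i s0)\<bar>)" using lu by simp
  also have "\<dots> \<le> integral {l..u} (\<lambda>s. \<bar>g (upd x i s)\<bar> + ?I)"
    by (rule integral_le) (use le in \<open>auto intro!: cont_int_real continuous_intros cont_line c\<close>)
  also have "\<dots> = integral {l..u} (\<lambda>s. \<bar>g (upd x i s)\<bar> + (u - l) * \<bar>?d s\<bar>)"
    using lu by (subst (1 2) integral_add) (auto intro!: cont_int_real continuous_intros cont_line c)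
  finally show ?thesis .
qed

text \<open>\<open>line_sup\<close> in both directions bounds the value by integrals of |G|, |G_i|,
  |G_j| and |G_ij|. The inequality |r| \<le> 1 + r^2 leads to squares, and since the hypotheses are
  normalised by the volume, it cancels.\<close>

lemma sobolev_2d:
  fixes G :: "real ^ 'n::finite \<Rightarrow> real"
  assumes U: "UNIV = {i, j :: 'n}" "i \<noteq> j" and ab: "\<And>i. a $ i < b $ i"
    and G: "CS (Suc (Suc 0)) G" and x0: "x0 \<in> cbox a b" and M: "M \<ge> 0"
    and M1: "bint (a, b) (\<lambda>x. (G x)\<^sup>2) \<le> M * measure lborel (cbox a b)" "bint (a, b) (\<lambda>x. (pd i G x)\<^sup>2) \<le> M * measure lborel (cbox a b)"
      "bint (a, b) (\<lambda>x. (pd j G x)\<^sup>2) \<le> M * measure lborel (cbox a b)" "bint (a, b) (\<lambda>x. (pd j (pd i G) x)\<^sup>2) \<le> M * measure lborel (cbox a b)"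
  shows "\<bar>G x0\<bar> \<le> (1 + (b $ i - a $ i)) * (1 + (b $ j - a $ j)) * (1 + M)"
proof -
  define li lj where "li = b $ i - a $ i" and "lj = b $ j - a $ j"
  have lp: "li > 0" "lj > 0" using ab by (auto simp: li_def lj_def)
  let ?V = "measure lborel (cbox a b)"
  have V: "?V = li * lj"
  proof -
    have "?V = (\<Prod>k\<in>UNIV. b $ k - a $ k)"
      using ab by (subst content_cbox_cart) (auto simp: interval_ne_empty_cart less_imp_le)
    then show ?thesis unfolding U(1) using U(2) by (simp add: li_def lj_def)
  qed
  have G1: "CS (Suc 0) G" "CS (Suc 0) (pd i G)" using G JS_Suc_le[OF G] JS_pd[OF G] by auto
  have c: "continuous_on UNIV G" "continuous_on UNIV (pd i G)" "continuous_on UNIV (pd j G)" "continuous_on UNIV (pd j (pd i G))"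
    using CS_continuous[OF G1(1)] CS_continuous[OF G1(2)] CS_continuous[OF JS_pd[OF G1(1)]] CS_continuous[OF JS_pd[OF G1(2)]] by auto
  define H2 where "H2 x = (\<bar>G x\<bar> + lj * \<bar>pd j G x\<bar>) + li * (\<bar>pd i G x\<bar> + lj * \<bar>pd j (pd i G) x\<bar>)" for x
  have cH: "continuous_on UNIV H2" unfolding H2_def by (intro continuous_intros c)
  define k where "k x = integral {a $ j..b $ j} (\<lambda>s. H2 (upd x j s))" for x
  have ck: "continuous_on UNIV k" unfolding k_def by (rule continuous_line_integral[OF cH])
  have H1: "lj * (\<bar>G y\<bar> + li * \<bar>pd i G y\<bar>) \<le> k y" if y: "y $ j \<in> {a $ j..b $ j}" for y
  proof -
    have "lj * \<bar>G y\<bar> + li * (lj * \<bar>pd i G y\<bar>) \<le> integral {a $ j..b $ j} (\<lambda>s. \<bar>G (upd y j s)\<bar> + lj * \<bar>pd j G (upd y j s)\<bar>)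
       + li * integral {a $ j..b $ j} (\<lambda>s. \<bar>pd i G (upd y j s)\<bar> + lj * \<bar>pd j (pd i G) (upd y j s)\<bar>)"
      using line_sup[OF G1(1) y, of y j] line_sup[OF G1(2) y, of y j] lp by (intro add_mono mult_left_mono) (auto simp: lj_def)
    also have "\<dots> = k y" unfolding k_def H2_def
      by (subst integral_mult_right[symmetric], subst integral_add[symmetric])
         (auto intro!: cont_int_real continuous_intros cont_line c)
    finally show ?thesis by (simp add: algebra_simps)
  qed
  define C where "C = li * lj * \<bar>G x0\<bar>"
  have xj: "x0 $ j \<in> {a $ j..b $ j}" and xi: "x0 $ i \<in> {a $ i..b $ i}" using x0 by (auto simp: mem_cbox_vec)
  have C: "C \<le> integral {a $ i..b $ i} (\<lambda>s. k (upd x0 i s))"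
  proof -
    have "C = lj * (li * \<bar>G (upd x0 i (x0 $ i))\<bar>)" by (simp add: C_def)
    also have "\<dots> \<le> lj * integral {a $ i..b $ i} (\<lambda>s. \<bar>G (upd x0 i s)\<bar> + li * \<bar>pd i G (upd x0 i s)\<bar>)"
      using line_sup[OF G1(1) xi, of x0 i] lp by (intro mult_left_mono) (auto simp: li_def)
    also have "\<dots> = integral {a $ i..b $ i} (\<lambda>s. lj * (\<bar>G (upd x0 i s)\<bar> + li * \<bar>pd i G (upd x0 i s)\<bar>))" by simp
    also have "\<dots> \<le> integral {a $ i..b $ i} (\<lambda>s. k (upd x0 i s))"
    proof (rule integral_le)
      show "lj * (\<bar>G (upd x0 i s)\<bar> + li * \<bar>pd i G (upd x0 i s)\<bar>) \<le> k (upd x0 i s)" for s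
        by (rule H1) (use xj U in simp)
    qed (auto intro!: cont_int_real continuous_intros cont_line c ck)
    finally show ?thesis .
  qed
  have kk: "k (upd x i s) = k (upd x0 i s)" for x s
  proof -
    have "upd (upd x i s) j r = upd (upd x0 i s) j r" for r
    proof (subst vec_eq_iff, rule allI)
      fix l have "l = i \<or> l = j" using U(1) by (metis UNIV_I insertE singletonD)
      then show "upd (upd x i s) j r $ l = upd (upd x0 i s) j r $ l" by auto
    qed
    then show ?thesis by (simp add: k_def)
  qed
  have "bint (a, b) (\<lambda>_. C / li) \<le> bint (a, b) k"
  proof (rule bint_mono_lines[where i=i])
    fix x :: "real ^ 'n"
    have "integral {a $ i..b $ i} (\<lambda>_. C / li) = C" using lp by (simp add: li_def)
    then show "integral {fst (a, b) $ i..snd (a, b) $ i} (\<lambda>_. C / li) \<le> integral {fst (a, b) $ i..snd (a, b) $ i} (\<lambda>s. k (upd x i s))"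
      unfolding kk[of x] using C by simp
  qed (auto simp: ck)
  also have "bint (a, b) k \<le> bint (a, b) (\<lambda>x. lj * H2 x)"
  proof (rule bint_mono_lines[where i=j])
    show "integral {fst (a, b) $ j..snd (a, b) $ j} (\<lambda>s. k (upd x j s)) \<le> integral {fst (a, b) $ j..snd (a, b) $ j} (\<lambda>s. lj * H2 (upd x j s))" for x
      using lp by (simp add: k_def lj_def)
  qed (auto intro!: continuous_intros cH ck)
  finally have CH: "C * lj \<le> lj * bint (a, b) H2" using lp by (simp add: V)
  then have CH: "C \<le> bint (a, b) H2" using lp by (simp add: mult.commute)
  have sq: "\<bar>r\<bar> \<le> 1 + r\<^sup>2" for r :: real
    using zero_le_power2[of "\<bar>r\<bar> - 1"] by (simp add: power2_diff)
  have "bint (a, b) H2 \<le> bint (a, b) (\<lambda>x. ((1 + (G x)\<^sup>2) + lj * (1 + (pd j G x)\<^sup>2)) + li * ((1 + (pd i G x)\<^sup>2) + lj * (1 + (pd j (pd i G) x)\<^sup>2)))"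
    unfolding H2_def
    by (rule integral_le) (use lp sq in \<open>auto intro!: cont_integrable continuous_intros c add_mono mult_left_mono\<close>)
  also have "\<dots> = ((?V + bint (a, b) (\<lambda>x. (G x)\<^sup>2)) + lj * (?V + bint (a, b) (\<lambda>x. (pd j G x)\<^sup>2)))
     + li * ((?V + bint (a, b) (\<lambda>x. (pd i G x)\<^sup>2)) + lj * (?V + bint (a, b) (\<lambda>x. (pd j (pd i G) x)\<^sup>2)))"
    by (simp add: integral_add cont_integrable continuous_intros c)
  also have "\<dots> \<le> ((?V + M * ?V) + lj * (?V + M * ?V)) + li * ((?V + M * ?V) + lj * (?V + M * ?V))"
    using lp M1 by (intro add_mono mult_left_mono) auto
  also have "\<dots> = (li * lj) * ((1 + li) * (1 + lj) * (1 + M))" unfolding V by (simp add: algebra_simps)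
  finally have "(li * lj) * \<bar>G x0\<bar> \<le> (li * lj) * ((1 + li) * (1 + lj) * (1 + M))" using CH by (simp add: C_def)
  then show ?thesis using lp by (simp add: li_def lj_def)
qed

text \<open>For a periodic function the second derivatives are controlled by the Laplacian in \<open>L\<^sup>2\<close>:
  the integral of \<open>g\<^sub>i\<^sub>i g\<^sub>j\<^sub>j - g\<^sub>i\<^sub>j\<^sup>2 = (g\<^sub>i g\<^sub>j\<^sub>j)\<^sub>i - (g\<^sub>i g\<^sub>i\<^sub>j)\<^sub>j\<close> vanishes.\<close>

lemma elliptic_2d:
  fixes g :: "real ^ 'n::finite \<Rightarrow> real"
  assumes U: "UNIV = {i, j :: 'n}" "i \<noteq> j" and ab: "\<And>i. a $ i < b $ i"
    and g: "CS (Suc (Suc (Suc 0))) g" and per: "periodic a b g"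
  shows "bint (a, b) (\<lambda>x. (pd k (pd l g) x)\<^sup>2) \<le> bint (a, b) (\<lambda>x. (lap g x)\<^sup>2)"
proof -
  have g2: "CS (Suc (Suc 0)) (pd k g)" for k using JS_pd[OF g] .
  have g1: "CS (Suc 0) (pd k (pd l g))" for k l using JS_pd[OF g2] .
  have c: "continuous_on UNIV (pd k g)" "continuous_on UNIV (pd k (pd l g))" "continuous_on UNIV (pd m (pd k (pd l g)))" for k l m
    using CS_continuous[OF g2] CS_continuous[OF g1] CS_continuous[OF JS_pd[OF g1]] by auto
  note p1 = JS_Suc_le[OF g2]
  have gg: "CS (Suc (Suc 0)) g" using JS_Suc_le[OF g] .
  let ?F1 = "\<lambda>x. pd i g x * pd j (pd j g) x" and ?F2 = "\<lambda>x. pd i g x * pd j (pd i g) x"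
  have d1: "pd i ?F1 = (\<lambda>x. pd i (pd i g) x * pd j (pd j g) x + pd i g x * pd i (pd j (pd j g)) x)"
    by (rule pd_mult(2)) (use p1 g1 in auto)
  have d2: "pd j ?F2 = (\<lambda>x. pd j (pd i g) x * pd j (pd i g) x + pd i g x * pd j (pd j (pd i g)) x)"
    by (rule pd_mult(2)) (use p1 g1 in auto)
  have sch: "pd i (pd j (pd j g)) = pd j (pd j (pd i g))"
    using pds_perm[OF g, of "[i, j, j]" "[j, j, i]"] by simp
  have per1: "periodic a b (pd k g)" "periodic a b (pd k (pd l g))" for k l using per periodic_pd by blast+
  have pF: "periodic a b (\<lambda>x. f x * h x)" if "periodic a b f" "periodic a b h" for f h using that by (simp add: periodic_def)
  have "bint (a, b) (pd i ?F1) = 0"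
    by (rule bint_pd_periodic[OF JS_mult[OF p1 g1] pF[OF per1(1) per1(2)]]) (use ab less_imp_le in blast)
  moreover have "bint (a, b) (pd j ?F2) = 0"
    by (rule bint_pd_periodic[OF JS_mult[OF p1 g1] pF[OF per1(1) per1(2)]]) (use ab less_imp_le in blast)
  ultimately have e: "bint (a, b) (\<lambda>x. pd i (pd i g) x * pd j (pd j g) x) = bint (a, b) (\<lambda>x. (pd j (pd i g) x)\<^sup>2)"
    unfolding d1 d2 sch by (simp add: integral_add cont_integrable continuous_intros c power2_eq_square)
  have lap: "lap g x = pd i (pd i g) x + pd j (pd j g) x" for x
    unfolding lap_def U(1) using U(2) by simp
  have "(\<lambda>x. (lap g x)\<^sup>2) = (\<lambda>x. (pd i (pd i g) x)\<^sup>2 + 2 * (pd i (pd i g) x * pd j (pd j g) x) + (pd j (pd j g) x)\<^sup>2)"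
    by (simp add: lap power2_sum fun_eq_iff)
  then have S: "bint (a, b) (\<lambda>x. (lap g x)\<^sup>2) = bint (a, b) (\<lambda>x. (pd i (pd i g) x)\<^sup>2) + 2 * bint (a, b) (\<lambda>x. (pd j (pd i g) x)\<^sup>2) + bint (a, b) (\<lambda>x. (pd j (pd j g) x)\<^sup>2)"
    by (simp add: integral_add cont_integrable continuous_intros c e[simplified])
  have nn: "bint (a, b) (\<lambda>x. (pd k (pd l g) x)\<^sup>2) \<ge> 0" for k l
    by (rule integral_nonneg) (auto intro!: cont_integrable continuous_intros c)
  have "k = i \<or> k = j" "l = i \<or> l = j" using U(1) by (metis UNIV_I insertE singletonD)+
  then show ?thesis using S nn[of i i] nn[of j i] nn[of j j] pd_commute[OF gg, of i j] by auto
qed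

text \<open>\<open>B\<close> itself serves dimension one; the other summand is the constant of
  \<open>sobolev_2d\<close> with \<open>M = B\<^sup>2\<close>.\<close>

definition sup_const :: "real ^ 'n::finite \<Rightarrow> real ^ 'n \<Rightarrow> real \<Rightarrow> real" where
  "sup_const a b B = B + (\<Prod>i\<in>UNIV. 1 + (b $ i - a $ i)) * (1 + B\<^sup>2)"

text \<open>In one dimension these are derivatives of the Laplacian. In two, the Laplacian does not
  bound single second derivatives pointwise, but it does so in L^2 by \<open>elliptic_2d\<close>;
  two further derivatives then give the supremum by \<open>sobolev_2d\<close>. Even with them at
  most \<open>l\<close> derivatives fall on \<open>lap u\<close>.\<close>

lemma sup_bound_laplacian:
  fixes u :: "real ^ 'n::finite \<Rightarrow> real"
  assumes card: "CARD('n) \<in> {1, 2}" and ab: "\<And>i. a $ i < b $ i" and B: "B \<ge> 0"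
    and u: "CS (l + 3) u" and per: "periodic a b u"
    and w: "\<And>is x. length is \<le> l \<Longrightarrow> x \<in> cbox a b \<Longrightarrow> \<bar>pds is (lap u) x\<bar> \<le> B"
    and js: "2 \<le> length js" "length js \<le> l" and x: "x \<in> cbox a b"
  shows "\<bar>pds js u x\<bar> \<le> sup_const a b B"
  using card
proof (cases rule: coords_cases)
  case (one i)
  have all: "k = i" for k using one(2) by (metis UNIV_I singletonD)
  obtain k l' ks where "js = k # l' # ks" using js(1) by (cases js; cases "tl js") auto
  then have js': "js = i # i # ks" using all by metis
  have "pds (ks @ [i, i]) u = pds js u" by (rule pds_perm[OF u]) (use js js' in auto)
  moreover have "pds [i, i] u = lap u" by (simp add: lap_def fun_eq_iff, unfold one(2), simp)
  ultimately have "pds js u = pds ks (lap u)" by (metis pds_append)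
  then have "\<bar>pds js u x\<bar> \<le> B" using w[of ks x] js js' x by simp
  also have "B \<le> sup_const a b B" unfolding sup_const_def
    using ab by (auto intro!: mult_nonneg_nonneg prod_nonneg simp: less_imp_le add_nonneg_nonneg)
  finally show ?thesis .
next
  case (two i j)
  let ?V = "measure lborel (cbox a b)"
  have L2: "bint (a, b) (\<lambda>x. (pds ks u x)\<^sup>2) \<le> B\<^sup>2 * ?V" if ks: "2 \<le> length ks" "length ks \<le> l + 2" for ks
  proof -
    obtain c d ks' where e: "ks = c # d # ks'" using ks(1) by (cases ks; cases "tl ks") auto
    have l: "length ks' \<le> l" using ks e by simp
    let ?g = "pds ks' u"
    have g: "CS (Suc (Suc (Suc 0))) ?g" by (rule JS_pds[OF u]) (use l in simp)
    have lapg: "lap ?g = pds ks' (lap u)"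
    proof -
      have "pds ks' (lap u) = (\<lambda>x. \<Sum>i\<in>UNIV. pds (ks' @ [i, i]) u x)"
        by (rule pds_lap[of "l + 1"]) (use u l in \<open>auto simp: numeral_3_eq_3 simp del: JS.simps\<close>)
      also have "\<dots> = (\<lambda>x. \<Sum>i\<in>UNIV. pds ([i, i] @ ks') u x)"
        by (intro ext sum.cong refl fun_cong[OF pds_perm[OF u]]) (use l in auto)
      finally show ?thesis by (simp add: lap_def fun_eq_iff)
    qed
    have cw: "continuous_on UNIV (pds ks' (lap u))"
      unfolding lapg[symmetric] by (rule CS_continuous[OF JS_lap[OF g]])
    have "bint (a, b) (\<lambda>x. (pds ks u x)\<^sup>2) \<le> bint (a, b) (\<lambda>x. (lap ?g x)\<^sup>2)"
      using elliptic_2d[OF two(3,1) ab g periodic_pds[OF per]] by (simp add: e)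
    also have "\<dots> \<le> bint (a, b) (\<lambda>_. B\<^sup>2)"
    proof (rule integral_le)
      fix x assume "x \<in> cbox (fst (a, b)) (snd (a, b))"
      then have "\<bar>lap ?g x\<bar> \<le> B" unfolding lapg using w[OF l] by simp
      then show "(lap ?g x)\<^sup>2 \<le> B\<^sup>2" using B by (metis abs_le_square_iff abs_of_nonneg)
    qed (auto intro!: cont_integrable continuous_intros simp: lapg cw)
    finally show ?thesis by (simp add: mult.commute)
  qed
  have G: "CS (Suc (Suc 0)) (pds js u)" by (rule JS_pds[OF u]) (use js in simp)
  have "\<bar>pds js u x\<bar> \<le> (1 + (b $ i - a $ i)) * (1 + (b $ j - a $ j)) * (1 + B\<^sup>2)"
    using L2[of js] L2[of "i # js"] L2[of "j # js"] L2[of "j # i # js"] js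
    by (intro sobolev_2d[OF two(3,1) ab G x]) auto
  also have "\<dots> \<le> sup_const a b B" unfolding sup_const_def two(3) using two(1) B by simp
  finally show ?thesis .
qed

section \<open>Taylor approximation on an element\<close>

lemma taylor_line:
  fixes z :: "real ^ 'n::finite \<Rightarrow> real"
  assumes K: "proper K" and z: "CS (Suc q) z" and x: "x \<in> cbox (fst K) (snd K)" and h: "snd K $ i - fst K $ i \<le> h"
    and B: "\<And>x. x \<in> cbox (fst K) (snd K) \<Longrightarrow> \<bar>pds (replicate (Suc q) i) z x\<bar> \<le> B"
  shows "\<bar>z x - (\<Sum>m<Suc q. pds (replicate m i) z (upd x i (fst K $ i)) / fact m * (x $ i - fst K $ i) ^ m)\<bar> \<le> h ^ Suc q * B"
proof -
  have xi: "fst K $ i \<le> x $ i" "x $ i \<le> snd K $ i" using x by (auto simp: mem_cbox_vec)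
  have lh: "fst K $ i < snd K $ i" using K by (simp add: proper_def)
  have B0: "B \<ge> 0" using B[OF x] by linarith
  let ?G = "\<lambda>m s. pds (replicate m i) z (upd x i s)"
  have "\<exists>t\<in>{fst K $ i..snd K $ i}. z x = (\<Sum>m<Suc q. ?G m (fst K $ i) / fact m * (x $ i - fst K $ i) ^ m)
      + ?G (Suc q) t / fact (Suc q) * (x $ i - fst K $ i) ^ Suc q"
  proof (cases "x $ i = fst K $ i")
    case True
    have "(\<Sum>m<Suc q. ?G m (fst K $ i) / fact m * 0 ^ m) = ?G 0 (fst K $ i)"
      by (subst sum.lessThan_Suc_shift) simp
    then show ?thesis using True lh upd_same[of x i] by (intro bexI[of _ "fst K $ i"]) (simp_all del: sum.lessThan_Suc upd_same)
  next
    case False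
    have "\<exists>t. (if x $ i < fst K $ i then x $ i < t \<and> t < fst K $ i else fst K $ i < t \<and> t < x $ i) \<and>
      ?G 0 (x $ i) = (\<Sum>m<Suc q. ?G m (fst K $ i) / fact m * (x $ i - fst K $ i) ^ m) + ?G (Suc q) t / fact (Suc q) * (x $ i - fst K $ i) ^ Suc q"
    proof (rule Taylor[of "Suc q" ?G])
      show "\<forall>m t. m < Suc q \<and> fst K $ i \<le> t \<and> t \<le> snd K $ i \<longrightarrow> DERIV (?G m) t :> ?G (Suc m) t"
      proof (intro allI impI)
        fix m t assume m: "m < Suc q \<and> fst K $ i \<le> t \<and> t \<le> snd K $ i"
        have "CS (Suc 0) (pds (replicate m i) z)" by (rule JS_pds[OF z]) (use m in simp)
        then show "DERIV (?G m) t :> ?G (Suc m) t"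
          using ldiff_DERIV[of i "pds (replicate m i) z" x t] by simp
      qed
    qed (use xi False lh in auto)
    then show ?thesis using xi by (auto simp del: sum.lessThan_Suc replicate_Suc power_Suc fact_Suc split: if_splits)
  qed
  then obtain t where t: "t \<in> {fst K $ i..snd K $ i}" "z x = (\<Sum>m<Suc q. ?G m (fst K $ i) / fact m * (x $ i - fst K $ i) ^ m)
      + ?G (Suc q) t / fact (Suc q) * (x $ i - fst K $ i) ^ Suc q" by blast
  have y: "upd x i t \<in> cbox (fst K) (snd K)" using x t(1) by (auto simp: mem_cbox_vec)
  have "\<bar>?G (Suc q) t / fact (Suc q) * (x $ i - fst K $ i) ^ Suc q\<bar> = \<bar>?G (Suc q) t\<bar> * (1 / fact (Suc q)) * \<bar>x $ i - fst K $ i\<bar> ^ Suc q"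
    by (simp add: abs_mult power_abs del: replicate_Suc power_Suc fact_Suc)
  also have "\<dots> \<le> B * 1 * h ^ Suc q"
    by (intro mult_mono power_mono B[OF y])
       (use xi h lh B0 fact_ge_1[of "Suc q", where 'a=real] in \<open>auto simp del: replicate_Suc power_Suc fact_Suc\<close>)
  finally show ?thesis using t(2) by (simp add: mult.commute del: replicate_Suc power_Suc fact_Suc sum.lessThan_Suc)
qed

text \<open>Taylor expansion in one coordinate, and then in the other for each of the q + 1
  coefficients. The remainders contain q + 1 derivatives in one direction and at most q in the
  other, hence the orders from q + 1 to 2q + 1. \<open>H\<close> only bounds the powers of the step
  that multiply the second remainders.\<close>

lemma (in element) taylor_Qpoly:
  fixes z :: "real ^ 'n \<Rightarrow> real"
  assumes z: "CS (2 * q + 1) z" and h: "\<And>i. snd K $ i - fst K $ i \<le> h" "h \<le> H"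
    and B: "\<And>is x. q < length is \<Longrightarrow> length is \<le> 2 * q + 1 \<Longrightarrow> x \<in> cbox (fst K) (snd K) \<Longrightarrow> \<bar>pds is z x\<bar> \<le> B"
  shows "\<exists>p\<in>Qpoly q. \<forall>x\<in>cbox (fst K) (snd K). \<bar>z x - p x\<bar> \<le> (1 + real (Suc q) * (1 + H) ^ q) * (h ^ Suc q * B)"
proof -
  have h0: "h \<ge> 0" using h(1)[of undefined] K unfolding proper_def by (meson diff_ge_0_iff_ge less_imp_le order_trans)
  have H0: "H \<ge> 0" using h0 h(2) by simp
  have fK: "fst K \<in> cbox (fst K) (snd K)" using K by (auto simp: mem_cbox_vec proper_def less_imp_le)
  have B0: "B \<ge> 0" using B[OF _ _ fK, of "replicate (Suc q) undefined"] by simp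
  have zq: "CS (Suc q) z" by (rule JS_le[OF z]) simp
  have hB: "h ^ Suc q * B \<ge> 0" using h0 B0 by simp
  have tri: "\<bar>y - y''\<bar> \<le> (1 + c) * r" if "\<bar>y - y'\<bar> \<le> r" "\<bar>y' - y''\<bar> \<le> c * r" for y y' y'' c r :: real
    using that unfolding distrib_right mult_1 by linarith
  have one_le: "h ^ Suc q * B \<le> (1 + real (Suc q) * (1 + H) ^ q) * (h ^ Suc q * B)"
    using mult_right_mono[OF _ hB, of 1 "1 + real (Suc q) * (1 + H) ^ q"] H0 by simp
  show ?thesis
    using card
  proof (cases rule: coords_cases)
    case (one i)
    have u: "upd x i (fst K $ i) = fst K" for x
    proof (subst vec_eq_iff, rule allI)
      fix k have "k = i" using one(2) by (metis UNIV_I singletonD)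
      then show "upd x i (fst K $ i) $ k = fst K $ k" by simp
    qed
    let ?p = "\<lambda>x. \<Sum>m<Suc q. pds (replicate m i) z (fst K) / fact m * (\<Prod>k\<in>UNIV. poly ([:- fst K $ k, 1:] ^ m) (x $ k))"
    have p: "?p \<in> Qpoly q"
      by (intro Qpoly_sum Qpoly_cmult Qpoly_prod) (auto simp: degree_linear_power)
    have "\<bar>z x - ?p x\<bar> \<le> h ^ Suc q * B" if x: "x \<in> cbox (fst K) (snd K)" for x
    proof -
      have "?p x = (\<Sum>m<Suc q. pds (replicate m i) z (upd x i (fst K $ i)) / fact m * (x $ i - fst K $ i) ^ m)"
        unfolding u one(2) by (simp add: poly_power del: sum.lessThan_Suc)
      then show ?thesis using taylor_line[OF K zq x h(1), of i B] B[of "replicate (Suc q) i"] by (simp del: sum.lessThan_Suc power_Suc replicate_Suc)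
    qed
    then show ?thesis using p one_le by (meson order_trans)
  next
    case (two i j)
    let ?Z = "\<lambda>m. pds (replicate m i) z"
    let ?P = "\<lambda>m n k. [:- fst K $ k, 1:] ^ (if k = i then m else n)"
    let ?p = "\<lambda>x. \<Sum>m<Suc q. \<Sum>n<Suc q. pds (replicate n j) (?Z m) (fst K) / (fact m * fact n) * (\<Prod>k\<in>UNIV. poly (?P m n k) (x $ k))"
    have p: "?p \<in> Qpoly q"
      by (intro Qpoly_sum Qpoly_cmult Qpoly_prod) (auto simp: degree_linear_power)
    have "\<bar>z x - ?p x\<bar> \<le> (1 + real (Suc q) * (1 + H) ^ q) * (h ^ Suc q * B)" if x: "x \<in> cbox (fst K) (snd K)" for x
    proof -
      define y where "y = upd x i (fst K $ i)"
      define d where "d = x $ i - fst K $ i"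
      have y: "y \<in> cbox (fst K) (snd K)" using x fK by (auto simp: mem_cbox_vec y_def)
      have d: "0 \<le> d" "d \<le> h" using x h(1)[of i] unfolding mem_cbox_vec d_def by (auto dest!: spec[of _ i])
      have yj: "y $ j = x $ j" using two(1) by (simp add: y_def)
      have uj: "upd y j (fst K $ j) = fst K"
      proof (subst vec_eq_iff, rule allI)
        fix k have "k = i \<or> k = j" using two(3) by (metis UNIV_I insertE singletonD)
        then show "upd y j (fst K $ j) $ k = fst K $ k" by (auto simp: y_def)
      qed
      let ?S = "\<lambda>m. \<Sum>n<Suc q. pds (replicate n j) (?Z m) (fst K) / fact n * (x $ j - fst K $ j) ^ n"
      have px: "?p x = (\<Sum>m<Suc q. d ^ m / fact m * ?S m)"
        unfolding two(3) using two(1)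
        by (simp add: poly_power d_def sum_distrib_left mult_ac del: sum.lessThan_Suc)
      have e1: "\<bar>z x - (\<Sum>m<Suc q. d ^ m / fact m * ?Z m y)\<bar> \<le> h ^ Suc q * B"
        using taylor_line[OF K zq x h(1), of i B] B[of "replicate (Suc q) i"] by (simp add: y_def d_def mult_ac del: sum.lessThan_Suc power_Suc replicate_Suc)
      have e2: "\<bar>?Z m y - ?S m\<bar> \<le> h ^ Suc q * B" if "m < Suc q" for m
      proof -
        have "CS (Suc q) (?Z m)" by (rule JS_pds[OF z]) (use that in simp)
        from taylor_line[OF K this y h(1), of j B] show ?thesis
          using B[of "replicate (Suc q) j @ replicate m i"] that unfolding uj yj
          by (simp add: pds_append del: sum.lessThan_Suc power_Suc)
      qed
      have "\<bar>(\<Sum>m<Suc q. d ^ m / fact m * ?Z m y) - ?p x\<bar> = \<bar>\<Sum>m<Suc q. d ^ m / fact m * (?Z m y - ?S m)\<bar>"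
        unfolding px by (simp add: sum_subtractf right_diff_distrib del: sum.lessThan_Suc)
      also have "\<dots> \<le> (\<Sum>m<Suc q. \<bar>d ^ m / fact m * (?Z m y - ?S m)\<bar>)" by (rule sum_abs)
      also have "\<dots> \<le> (\<Sum>m<Suc q. (1 + H) ^ q * (h ^ Suc q * B))"
      proof (rule sum_mono)
        fix m assume m: "m \<in> {..<Suc q}"
        have "d ^ m / fact m \<le> d ^ m" using d divide_left_mono[of 1 "fact m" "d ^ m"] fact_ge_1[of m, where 'a=real] by simp
        also have "\<dots> \<le> (1 + H) ^ m" using d h(2) by (intro power_mono) auto
        also have "\<dots> \<le> (1 + H) ^ q" using m H0 by (intro power_increasing) auto
        finally have f: "d ^ m / fact m \<le> (1 + H) ^ q" .
        have "\<bar>d ^ m / fact m * (?Z m y - ?S m)\<bar> = d ^ m / fact m * \<bar>?Z m y - ?S m\<bar>"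
          using d by (simp add: abs_mult del: sum.lessThan_Suc)
        also have "\<dots> \<le> (1 + H) ^ q * (h ^ Suc q * B)"
          using m H0 by (intro mult_mono f e2) auto
        finally show "\<bar>d ^ m / fact m * (?Z m y - ?S m)\<bar> \<le> (1 + H) ^ q * (h ^ Suc q * B)" .
      qed
      also have "\<dots> = real (Suc q) * (1 + H) ^ q * (h ^ Suc q * B)" by simp
      finally have "\<bar>(\<Sum>m<Suc q. d ^ m / fact m * ?Z m y) - ?p x\<bar> \<le> real (Suc q) * (1 + H) ^ q * (h ^ Suc q * B)" .
      from tri[OF e1 this] show ?thesis .
    qed
    then show ?thesis by (intro bexI[OF _ p] ballI)
  qed
qed

section \<open>Mean value estimates in time\<close>

lemma real_mean_value:
  fixes g :: "real \<Rightarrow> real"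
  assumes d: "\<And>s. s \<in> {t0..t1} \<Longrightarrow> (g has_real_derivative g' s) (at s within {t0..t1})"
    and B: "\<And>s. s \<in> {t0..t1} \<Longrightarrow> \<bar>g' s\<bar> \<le> B" and t: "t0 \<le> t1"
  shows "\<bar>g t1 - g t0\<bar> \<le> (t1 - t0) * B"
proof (cases "t0 = t1")
  case False
  then have lt: "t0 < t1" using t by simp
  have "(g has_derivative (\<lambda>h. h * g' s)) (at s within {t0..t1})" if "t0 \<le> s" "s \<le> t1" for s
    using d[of s] that by (simp add: has_field_derivative_def mult_commute_abs)
  from mvt_simple[OF lt this] obtain s where s: "s \<in> {t0<..<t1}" "g t1 - g t0 = (t1 - t0) * g' s" by auto
  have "\<bar>g t1 - g t0\<bar> = (t1 - t0) * \<bar>g' s\<bar>" using s lt by (simp add: abs_mult)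
  also have "\<dots> \<le> (t1 - t0) * B" using B[of s] s lt by (intro mult_left_mono) auto
  finally show ?thesis .
qed simp

lemma bint_DERIV:
  fixes G G' :: "real \<Rightarrow> real ^ 'n::finite \<Rightarrow> real"
  assumes G: "continuous_on ({t0..t1} \<times> UNIV) (\<lambda>(t, x). G t x)" and G': "continuous_on ({t0..t1} \<times> UNIV) (\<lambda>(t, x). G' t x)"
    and d: "\<And>t x. t \<in> {t0..t1} \<Longrightarrow> ((\<lambda>t. G t x) has_real_derivative G' t x) (at t within {t0..t1})"
    and t: "t \<in> {t0..t1}"
  shows "((\<lambda>t. bint K (G t)) has_real_derivative bint K (G' t)) (at t within {t0..t1})"
proof (rule leibniz_rule_field_derivative)
  fix s assume "s \<in> {t0..t1}"
  then have "continuous_on UNIV (G s)" using JS_cont_x[of 0 "{t0..t1}" G s] G by simp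
  then show "G s integrable_on cbox (fst K) (snd K)" by (rule cont_integrable)
next
  show "continuous_on ({t0..t1} \<times> cbox (fst K) (snd K)) (\<lambda>(t, x). G' t x)"
    by (rule continuous_on_subset[OF G']) auto
qed (use t d in auto)

text \<open>There is no mean value theorem with values in L^2. It is applied to the real function
  obtained by pairing with the fixed increment, and Young's inequality then absorbs the
  increment.\<close>

lemma (in mesh) L2_mean_value:
  fixes G G' :: "real \<Rightarrow> real ^ 'n \<Rightarrow> real"
  assumes G: "JS 0 {t0..t1} G" and G': "JS 0 {t0..t1} G'"
    and d: "\<And>t x. t \<in> {t0..t1} \<Longrightarrow> ((\<lambda>t. G t x) has_real_derivative G' t x) (at t within {t0..t1})"
    and M: "\<And>t. t \<in> {t0..t1} \<Longrightarrow> (\<Sum>K\<in>\<T>. bint K (\<lambda>x. (G' t x)\<^sup>2)) \<le> M" and t: "t0 \<le> t1"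
  shows "(\<Sum>K\<in>\<T>. bint K (\<lambda>x. (G t1 x - G t0 x)\<^sup>2)) \<le> (t1 - t0)\<^sup>2 * M"
proof (cases "t0 = t1")
  case False
  then have lt: "t0 < t1" using t by simp
  let ?D = "\<lambda>x. G t1 x - G t0 x"
  let ?S = "\<Sum>K\<in>\<T>. bint K (\<lambda>x. (?D x)\<^sup>2)"
  have c: "continuous_on UNIV (G s)" "continuous_on UNIV (G' s)" if "s \<in> {t0..t1}" for s
    using that JS_cont_x[OF G] JS_cont_x[OF G'] by auto
  have cD: "continuous_on UNIV ?D" using c t by (intro continuous_intros) auto
  define \<phi> where "\<phi> s = (\<Sum>K\<in>\<T>. bint K (\<lambda>x. G s x * ?D x))" for s
  define \<phi>' where "\<phi>' s = (\<Sum>K\<in>\<T>. bint K (\<lambda>x. G' s x * ?D x))" for s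
  have cGD: "continuous_on ({t0..t1} \<times> UNIV) (\<lambda>(t, x). F t x * ?D x)" if "JS 0 {t0..t1} F" for F
    using that unfolding JS.simps split_beta
    by (intro continuous_intros) (use t in \<open>auto intro!: continuous_on_compose2[OF c(1)] continuous_intros\<close>)
  have "(\<phi> has_real_derivative \<phi>' s) (at s within {t0..t1})" if "s \<in> {t0..t1}" for s
    unfolding \<phi>_def \<phi>'_def
    by (intro DERIV_sum bint_DERIV cGD[OF G] cGD[OF G'] that) (intro DERIV_cmult_right d)
  then have "(\<phi> has_derivative (\<lambda>h. h * \<phi>' s)) (at s within {t0..t1})" if "t0 \<le> s" "s \<le> t1" for s
    using that by (simp add: has_field_derivative_def mult_commute_abs)
  from mvt_simple[OF lt this] obtain s where "s \<in> {t0<..<t1}" and s2: "\<phi> t1 - \<phi> t0 = (t1 - t0) * \<phi>' s" by blast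
  then have s: "s \<in> {t0..t1}" by simp
  have "\<phi> t1 - \<phi> t0 = ?S"
    unfolding \<phi>_def sum_subtractf[symmetric]
    by (intro sum.cong refl, subst integral_diff[symmetric])
       (use t in \<open>auto intro!: cont_integrable continuous_intros c cD simp: power2_eq_square algebra_simps\<close>)
  then have "2 * ?S = 2 * (t1 - t0) * \<phi>' s" using s2 by (simp add: algebra_simps)
  also have "\<dots> = (\<Sum>K\<in>\<T>. bint K (\<lambda>x. 2 * ((t1 - t0) * G' s x) * ?D x))"
    unfolding \<phi>'_def sum_distrib_left by (intro sum.cong refl) (simp add: integral_mult_right[symmetric] mult_ac del: integral_mult_right)
  also have "\<dots> \<le> (\<Sum>K\<in>\<T>. bint K (\<lambda>x. (t1 - t0)\<^sup>2 * (G' s x)\<^sup>2 + (?D x)\<^sup>2))"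
  proof (intro sum_mono integral_le)
    fix K x
    show "2 * ((t1 - t0) * G' s x) * ?D x \<le> (t1 - t0)\<^sup>2 * (G' s x)\<^sup>2 + (?D x)\<^sup>2"
      using sum_squares_bound[of "(t1 - t0) * G' s x" "?D x"] by (simp only: power_mult_distrib)
  qed (auto intro!: cont_integrable continuous_intros c cD s)
  also have "\<dots> = (t1 - t0)\<^sup>2 * (\<Sum>K\<in>\<T>. bint K (\<lambda>x. (G' s x)\<^sup>2)) + ?S"
    by (subst integral_add) (auto intro!: cont_integrable continuous_intros c cD s simp: sum.distrib sum_distrib_left)
  also have "\<dots> \<le> (t1 - t0)\<^sup>2 * M + ?S" using M[OF s] by (intro add_right_mono mult_left_mono) auto
  finally show ?thesis by simp
next
  case True
  have "0 \<le> (\<Sum>K\<in>\<T>. bint K (\<lambda>x. (G' t0 x)\<^sup>2))"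
    using True by (intro sum_nonneg integral_nonneg) (auto intro!: cont_integrable continuous_intros JS_cont_x[OF G'])
  also have "\<dots> \<le> M" using M[of t0] True by simp
  finally have "0 \<le> M" .
  then show ?thesis using True by simp
qed

section \<open>The discrete solution\<close>

lemma dt_DERIV:
  assumes "t_differentiable T S g" "t \<in> {0..T}" "x \<in> S"
  shows "((\<lambda>s. g s x) has_real_derivative dt T g t x) (at t within {0..T})"
  using assms unfolding t_differentiable_def dt_def
  by (simp add: has_real_derivative_iff_has_vector_derivative vector_derivative_works)

lemma sq_add_le: "(x + y)\<^sup>2 \<le> 2 * x\<^sup>2 + 2 * y\<^sup>2" for x y :: real
  using zero_le_power2[of "x - y"] by (simp add: power2_sum power2_diff)

lemma young: "0 < r \<Longrightarrow> 2 * (x * y) \<le> x\<^sup>2 / r + r * y\<^sup>2" for x y :: real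
proof -
  assume l: "0 < r"
  have "0 \<le> (x - r * y)\<^sup>2 / r" using l by simp
  then show ?thesis using l by (simp add: power2_diff field_simps power2_eq_square)
qed

section \<open>Elementwise integrals and their inequalities\<close>

context mesh
begin

text \<open>The argument is one function per element, usually continuous on the whole space, so
  neither jumps between elements nor values on the skeleton enter.\<close>

definition brk :: "('n elem \<Rightarrow> real ^ 'n \<Rightarrow> real) \<Rightarrow> real" where
  "brk G = (\<Sum>K\<in>\<T>. bint K (G K))"

definition pcont :: "('n elem \<Rightarrow> real ^ 'n \<Rightarrow> real) \<Rightarrow> bool" where
  "pcont G \<longleftrightarrow> (\<forall>K\<in>\<T>. continuous_on UNIV (G K))"

lemma pcont_intros:
  "pcont (\<lambda>K x. c)"
  "pcont F \<Longrightarrow> pcont G \<Longrightarrow> pcont (\<lambda>K x. F K x + G K x)"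
  "pcont F \<Longrightarrow> pcont G \<Longrightarrow> pcont (\<lambda>K x. F K x - G K x)"
  "pcont F \<Longrightarrow> pcont G \<Longrightarrow> pcont (\<lambda>K x. F K x * G K x)"
  "pcont F \<Longrightarrow> pcont (\<lambda>K x. - F K x)"
  "pcont F \<Longrightarrow> pcont (\<lambda>K x. (F K x) ^ n)"
  "(\<And>i. i \<in> I \<Longrightarrow> pcont (H i)) \<Longrightarrow> pcont (\<lambda>K x. \<Sum>i\<in>I. H i K x)"
  unfolding pcont_def by (auto intro!: continuous_intros)

lemma brk_cong: "(\<And>K x. K \<in> \<T> \<Longrightarrow> x \<in> cbox (fst K) (snd K) \<Longrightarrow> F K x = G K x) \<Longrightarrow> brk F = brk G"
  unfolding brk_def by (intro sum.cong refl Henstock_Kurzweil_Integration.integral_cong) auto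

lemma brk_add: "pcont F \<Longrightarrow> pcont G \<Longrightarrow> brk (\<lambda>K x. F K x + G K x) = brk F + brk G"
  unfolding brk_def sum.distrib[symmetric] pcont_def by (intro sum.cong refl integral_add cont_integrable) auto

lemma brk_diff: "pcont F \<Longrightarrow> pcont G \<Longrightarrow> brk (\<lambda>K x. F K x - G K x) = brk F - brk G"
  unfolding brk_def sum_subtractf[symmetric] pcont_def by (intro sum.cong refl integral_diff cont_integrable) auto

lemma brk_cmult: "brk (\<lambda>K x. c * F K x) = c * brk F"
  unfolding brk_def sum_distrib_left by simp

lemma brk_sum: "finite I \<Longrightarrow> (\<And>i. i \<in> I \<Longrightarrow> pcont (H i)) \<Longrightarrow> brk (\<lambda>K x. \<Sum>i\<in>I. H i K x) = (\<Sum>i\<in>I. brk (H i))"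
proof (induction I rule: finite_induct)
  case empty then show ?case by (simp add: brk_def)
next
  case (insert i I)
  then show ?case by (simp add: brk_add pcont_intros)
qed

lemma brk_mono:
  assumes "pcont F" "pcont G" "\<And>K x. K \<in> \<T> \<Longrightarrow> x \<in> cbox (fst K) (snd K) \<Longrightarrow> F K x \<le> G K x"
  shows "brk F \<le> brk G"
  unfolding brk_def using assms by (intro sum_mono integral_le cont_integrable) (auto simp: pcont_def)

lemma brk_nonneg: "pcont F \<Longrightarrow> brk (\<lambda>K x. (F K x)\<^sup>2) \<ge> 0"
  unfolding brk_def pcont_def by (intro sum_nonneg integral_nonneg cont_integrable) (auto intro!: continuous_intros)

lemma brk_young:
  assumes F: "pcont F" and G: "pcont G" and l: "0 < r"
  shows "2 * brk (\<lambda>K x. F K x * G K x) \<le> brk (\<lambda>K x. (F K x)\<^sup>2) / r + r * brk (\<lambda>K x. (G K x)\<^sup>2)"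
proof -
  have "2 * brk (\<lambda>K x. F K x * G K x) = brk (\<lambda>K x. 2 * (F K x * G K x))" by (simp add: brk_cmult)
  also have "\<dots> \<le> brk (\<lambda>K x. (1 / r) * (F K x)\<^sup>2 + r * (G K x)\<^sup>2)"
    using young[OF l] by (intro brk_mono pcont_intros F G) simp
  also have "\<dots> = (1 / r) * brk (\<lambda>K x. (F K x)\<^sup>2) + r * brk (\<lambda>K x. (G K x)\<^sup>2)"
    by (subst brk_add) (auto intro!: pcont_intros F G simp only: brk_cmult)
  finally show ?thesis by simp
qed

lemma brk_sq_add:
  assumes F: "pcont F" and G: "pcont G"
  shows "brk (\<lambda>K x. (F K x + G K x)\<^sup>2) \<le> 2 * brk (\<lambda>K x. (F K x)\<^sup>2) + 2 * brk (\<lambda>K x. (G K x)\<^sup>2)"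
proof -
  have "brk (\<lambda>K x. (F K x + G K x)\<^sup>2) \<le> brk (\<lambda>K x. 2 * (F K x)\<^sup>2 + 2 * (G K x)\<^sup>2)"
    by (rule brk_mono) (use sq_add_le in \<open>auto intro!: pcont_intros F G\<close>)
  also have "\<dots> = 2 * brk (\<lambda>K x. (F K x)\<^sup>2) + 2 * brk (\<lambda>K x. (G K x)\<^sup>2)"
    by (subst brk_add) (auto intro!: pcont_intros F G simp only: brk_cmult)
  finally show ?thesis .
qed

lemma brk_sq_tri:
  assumes F: "pcont F" and G: "pcont G" and H: "pcont H"
  shows "brk (\<lambda>K x. (F K x - H K x)\<^sup>2) \<le> 2 * brk (\<lambda>K x. (F K x - G K x)\<^sup>2) + 2 * brk (\<lambda>K x. (G K x - H K x)\<^sup>2)"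
  using brk_sq_add[of "\<lambda>K x. F K x - G K x" "\<lambda>K x. G K x - H K x"] by (simp add: pcont_intros F G H)

lemma brk_sq_sup:
  assumes F: "pcont F" and B: "\<And>K x. K \<in> \<T> \<Longrightarrow> x \<in> cbox (fst K) (snd K) \<Longrightarrow> \<bar>F K x\<bar> \<le> B"
  shows "brk (\<lambda>K x. (F K x)\<^sup>2) \<le> B\<^sup>2 * measure lebesgue (box a b)"
proof -
  have "brk (\<lambda>K x. (F K x)\<^sup>2) \<le> brk (\<lambda>K x. B\<^sup>2)"
  proof (rule brk_mono)
    fix K x assume "K \<in> \<T>" "x \<in> cbox (fst K) (snd K)"
    from B[OF this] show "(F K x)\<^sup>2 \<le> B\<^sup>2" using power_mono[of "\<bar>F K x\<bar>" B 2] by simp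
  qed (auto intro!: pcont_intros F)
  also have "\<dots> = B\<^sup>2 * (\<Sum>K\<in>\<T>. measure lebesgue (cell K))"
    unfolding brk_def sum_distrib_left
  proof (intro sum.cong refl)
    fix K
    have "measure lebesgue (cell K) = measure lborel (cbox (fst K) (snd K))"
      unfolding cell_def by (simp add: measure_completion measure_lborel_box_eq measure_lborel_cbox_eq)
    then show "bint K (\<lambda>x. B\<^sup>2) = B\<^sup>2 * measure lebesgue (cell K)" by simp
  qed
  also have "\<dots> \<le> B\<^sup>2 * measure lebesgue (box a b)" by (intro mult_left_mono sum_measure) simp
  finally show ?thesis .
qed

lemma brk_cell: "pcont G \<Longrightarrow> (\<And>K x. K \<in> \<T> \<Longrightarrow> x \<in> cell K \<Longrightarrow> f x = G K x) \<Longrightarrow>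
    (\<Sum>K\<in>\<T>. LINT x:cell K|lebesgue. f x) = brk G"
  unfolding brk_def pcont_def by (intro sum.cong refl cell_LINT(2)) auto

lemma L2_norm_h_sq:
  assumes "pcont G" "\<And>K x. K \<in> \<T> \<Longrightarrow> x \<in> cell K \<Longrightarrow> f x = G K x"
  shows "(L2_norm_h \<T> f)\<^sup>2 = brk (\<lambda>K x. (G K x)\<^sup>2)"
proof -
  have "(\<Sum>K\<in>\<T>. LINT x:cell K|lebesgue. (f x)\<^sup>2) = brk (\<lambda>K x. (G K x)\<^sup>2)"
    by (rule brk_cell) (use assms in \<open>auto intro!: pcont_intros\<close>)
  then show ?thesis unfolding L2_norm_h_def using brk_nonneg[OF assms(1)] by simp
qed

end

section \<open>The scheme in terms of one polynomial per element\<close>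

locale dg_solution = dg_mesh a b \<T> N X q for a b :: "real ^ 'n::finite" and \<T> N X q +
  fixes T \<mu> M L C\<^sub>Q :: real and f :: "real \<Rightarrow> real" and m :: "'n elem \<Rightarrow> nat"
    and Y :: "'n elem \<Rightarrow> nat \<Rightarrow> real ^ 'n" and \<omega> :: "'n elem \<Rightarrow> nat \<Rightarrow> real"
    and uh vh wh :: "real \<Rightarrow> real ^ 'n \<Rightarrow> real"
  assumes T: "T > 0" and mu: "\<mu> \<ge> 0" and nl: "nonlinearity L M f"
    and qa: "quadrature_assumption a b \<T> q C\<^sub>Q m Y \<omega>"
    and sch: "dg_scheme a b T \<mu> f \<T> q m Y \<omega> uh vh wh"
begin

lemma f_lipschitz: "\<bar>f x - f y\<bar> \<le> M * \<bar>x - y\<bar>"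
proof -
  have "(f has_field_derivative deriv f z) (at z within UNIV)" for z
  proof -
    have "(deriv ^^ 0) f differentiable (at z)" using nl unfolding nonlinearity_def smooth_real_def by blast
    then show ?thesis by (simp add: DERIV_deriv_iff_real_differentiable)
  qed
  moreover have "norm (deriv f z) \<le> M" for z using nl by (simp add: nonlinearity_def)
  ultimately show ?thesis using field_differentiable_bound[of UNIV f "deriv f" M x y] by simp
qed

lemma M0: "M \<ge> 0"
  using nl abs_ge_zero[of "deriv f 0"] unfolding nonlinearity_def by (meson order_trans)

lemma fquot_pos: "fquot f s > 0"
  using nl by (simp add: nonlinearity_def)

lemma node: "K \<in> \<T> \<Longrightarrow> j < m K \<Longrightarrow> Y K j \<in> cell K" and weight: "K \<in> \<T> \<Longrightarrow> j < m K \<Longrightarrow> \<omega> K j > 0"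
  using qa unfolding quadrature_assumption_def by blast+

definition qd :: "('n elem \<Rightarrow> real ^ 'n \<Rightarrow> real) \<Rightarrow> real" where
  "qd G = (\<Sum>K\<in>\<T>. quad m Y \<omega> K (G K))"

lemma qd_add: "qd (\<lambda>K x. F K x + G K x) = qd F + qd G"
  unfolding qd_def quad_def by (simp add: sum.distrib distrib_left)

lemma qd_diff: "qd (\<lambda>K x. F K x - G K x) = qd F - qd G"
  unfolding qd_def quad_def by (simp add: sum_subtractf right_diff_distrib)

lemma qd_cmult: "qd (\<lambda>K x. c * F K x) = c * qd F"
  unfolding qd_def quad_def by (simp add: sum_distrib_left mult_ac)

lemma qd_mono:
  assumes "\<And>K x. K \<in> \<T> \<Longrightarrow> x \<in> cell K \<Longrightarrow> F K x \<le> G K x"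
  shows "qd F \<le> qd G"
  unfolding qd_def quad_def
  by (intro sum_mono mult_left_mono assms) (auto simp: node less_imp_le[OF weight])

lemma qd_cong:
  assumes "\<And>K x. K \<in> \<T> \<Longrightarrow> x \<in> cell K \<Longrightarrow> F K x = G K x"
  shows "qd F = qd G"
  unfolding qd_def quad_def by (intro sum.cong refl) (simp add: node assms)

lemma qd_nonneg: "qd (\<lambda>K x. (F K x)\<^sup>2) \<ge> 0"
  using qd_mono[of "\<lambda>K x. 0" "\<lambda>K x. (F K x)\<^sup>2"] by (simp add: qd_def quad_def)

lemma qd_young:
  assumes l: "0 < r"
  shows "2 * qd (\<lambda>K x. F K x * G K x) \<le> qd (\<lambda>K x. (F K x)\<^sup>2) / r + r * qd (\<lambda>K x. (G K x)\<^sup>2)"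
proof -
  have "2 * qd (\<lambda>K x. F K x * G K x) = qd (\<lambda>K x. 2 * (F K x * G K x))" by (simp add: qd_cmult)
  also have "\<dots> \<le> qd (\<lambda>K x. (1 / r) * (F K x)\<^sup>2 + r * (G K x)\<^sup>2)"
    by (rule qd_mono) (use young[OF l] in auto)
  finally show ?thesis by (simp only: qd_add qd_cmult) simp
qed

lemma qd_sq_tri: "qd (\<lambda>K x. (F K x - H K x)\<^sup>2) \<le> 2 * qd (\<lambda>K x. (F K x - G K x)\<^sup>2) + 2 * qd (\<lambda>K x. (G K x - H K x)\<^sup>2)"
proof -
  have "qd (\<lambda>K x. (F K x - H K x)\<^sup>2) \<le> qd (\<lambda>K x. 2 * (F K x - G K x)\<^sup>2 + 2 * (G K x - H K x)\<^sup>2)"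
  proof (rule qd_mono)
    fix K x show "(F K x - H K x)\<^sup>2 \<le> 2 * (F K x - G K x)\<^sup>2 + 2 * (G K x - H K x)\<^sup>2"
      using sq_add_le[of "F K x - G K x" "G K x - H K x"] by simp
  qed
  then show ?thesis by (simp only: qd_add qd_cmult)
qed

lemma Qpoly_continuous: "p \<in> Qpoly q \<Longrightarrow> continuous_on UNIV p"
  using CS_continuous[OF CS_Qpoly[where k = 0]] .

lemma quad_sq: "K \<in> \<T> \<Longrightarrow> p \<in> Qpoly q \<Longrightarrow> quad m Y \<omega> K (\<lambda>x. (p x)\<^sup>2) = bint K (\<lambda>x. (p x)\<^sup>2)"
proof -
  assume K: "K \<in> \<T>" and p: "p \<in> Qpoly q"
  have "quad m Y \<omega> K (\<lambda>x. (p x)\<^sup>2) = (LINT x:cell K|lebesgue. (p x)\<^sup>2)"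
    using qa K p unfolding quadrature_assumption_def by blast
  also have "\<dots> = bint K (\<lambda>x. (p x)\<^sup>2)"
    by (rule cell_LINT(2)) (auto intro!: continuous_intros Qpoly_continuous[OF p])
  finally show ?thesis .
qed

lemma pcont_Qpoly: "(\<And>K. K \<in> \<T> \<Longrightarrow> p K \<in> Qpoly q) \<Longrightarrow> pcont p"
  unfolding pcont_def using Qpoly_continuous by auto

lemma qd_sq: "(\<And>K. K \<in> \<T> \<Longrightarrow> p K \<in> Qpoly q) \<Longrightarrow> qd (\<lambda>K x. (p K x)\<^sup>2) = brk (\<lambda>K x. (p K x)\<^sup>2)"
  unfolding qd_def brk_def by (intro sum.cong refl quad_sq) auto

text \<open>Polarisation, since exactness of the quadrature is given for squares.\<close>

lemma qd_prod:
  assumes p: "\<And>K. K \<in> \<T> \<Longrightarrow> p K \<in> Qpoly q" and r: "\<And>K. K \<in> \<T> \<Longrightarrow> r K \<in> Qpoly q"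
  shows "qd (\<lambda>K x. p K x * r K x) = brk (\<lambda>K x. p K x * r K x)"
proof -
  have pr: "\<And>K. K \<in> \<T> \<Longrightarrow> (\<lambda>x. p K x + r K x) \<in> Qpoly q" by (intro Qpoly_add p r)
  note c = pcont_Qpoly[OF p] pcont_Qpoly[OF r]
  have e: "(\<lambda>K x. (p K x + r K x)\<^sup>2) = (\<lambda>K x. ((p K x)\<^sup>2 + (r K x)\<^sup>2) + 2 * (p K x * r K x))"
    by (simp add: fun_eq_iff power2_sum)
  have "qd (\<lambda>K x. (p K x)\<^sup>2) + qd (\<lambda>K x. (r K x)\<^sup>2) + 2 * qd (\<lambda>K x. p K x * r K x) = qd (\<lambda>K x. (p K x + r K x)\<^sup>2)"
    unfolding e by (simp only: qd_add qd_cmult)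
  also have "\<dots> = brk (\<lambda>K x. (p K x + r K x)\<^sup>2)" by (rule qd_sq[OF pr])
  also have "\<dots> = brk (\<lambda>K x. (p K x)\<^sup>2) + brk (\<lambda>K x. (r K x)\<^sup>2) + 2 * brk (\<lambda>K x. p K x * r K x)"
    unfolding e by (simp only: brk_add brk_cmult pcont_intros c)
  finally show ?thesis using qd_sq[OF p] qd_sq[OF r] by simp
qed

text \<open>Exactness for the square of a constant: the weights on an element add up to its
  measure.\<close>

lemma qd_sup:
  assumes B: "\<And>K x. K \<in> \<T> \<Longrightarrow> x \<in> cell K \<Longrightarrow> \<bar>F K x\<bar> \<le> B"
  shows "qd (\<lambda>K x. (F K x)\<^sup>2) \<le> B\<^sup>2 * measure lebesgue (box a b)"
proof -
  have "(\<lambda>x. B * (\<Prod>i\<in>UNIV. poly 1 (x $ i))) \<in> Qpoly q" by (intro Qpoly_cmult Qpoly_prod) simp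
  then have one: "(\<lambda>x. B) \<in> Qpoly q" by simp
  have "qd (\<lambda>K x. (F K x)\<^sup>2) \<le> qd (\<lambda>K x. B\<^sup>2)"
  proof (rule qd_mono)
    fix K x assume "K \<in> \<T>" "x \<in> cell K"
    from B[OF this] show "(F K x)\<^sup>2 \<le> B\<^sup>2" using power_mono[of "\<bar>F K x\<bar>" B 2] by simp
  qed
  also have "\<dots> = brk (\<lambda>K x. B\<^sup>2)" by (rule qd_sq[OF one])
  also have "\<dots> \<le> \<bar>B\<bar>\<^sup>2 * measure lebesgue (box a b)"
    using brk_sq_sup[of "\<lambda>K x. B" "\<bar>B\<bar>"] by (simp add: pcont_intros)
  finally show ?thesis by simp
qed

text \<open>A discrete function is a polynomial on each open cell. Choosing it allows evaluation and
  differentiation up to the boundary of the element.\<close>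

definition pc :: "(real \<Rightarrow> real ^ 'n \<Rightarrow> real) \<Rightarrow> real \<Rightarrow> 'n elem \<Rightarrow> real ^ 'n \<Rightarrow> real" where
  "pc g t K = (SOME p. p \<in> Qpoly q \<and> (\<forall>x\<in>cell K. g t x = p x))"

lemma pc_ex:
  assumes "\<exists>p\<in>Qpoly q. \<forall>x\<in>cell K. g t x = p x"
  shows "pc g t K \<in> Qpoly q" and "x \<in> cell K \<Longrightarrow> pc g t K x = g t x"
proof -
  have ex: "\<exists>p. p \<in> Qpoly q \<and> (\<forall>x\<in>cell K. g t x = p x)" using assms by blast
  have *: "pc g t K \<in> Qpoly q \<and> (\<forall>x\<in>cell K. g t x = pc g t K x)"
    unfolding pc_def by (rule someI_ex[OF ex])
  show "pc g t K \<in> Qpoly q" using * by blast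
  show "pc g t K x = g t x" if "x \<in> cell K" using * that by simp
qed

definition disc :: "(real \<Rightarrow> real ^ 'n \<Rightarrow> real) \<Rightarrow> bool" where
  "disc g \<longleftrightarrow> (\<forall>t\<in>{0..T}. g t \<in> Vh a b \<T> q) \<and> t_differentiable T (\<Union>K\<in>\<T>. cell K) g"

lemma disc_sol: "disc uh" "disc vh" "disc wh"
  using sch unfolding dg_scheme_def disc_def by blast+

lemma at_within_bot: "t \<in> {0..T} \<Longrightarrow> at t within {0..T} \<noteq> bot"
  using T connected_imp_perfect[of "{0..T}" t] by (auto simp: trivial_limit_within)

lemma pc_disc:
  assumes g: "disc g" and t: "t \<in> {0..T}" and K: "K \<in> \<T>"
  shows "pc g t K \<in> Qpoly q" and "x \<in> cell K \<Longrightarrow> pc g t K x = g t x"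
proof -
  have "\<exists>p\<in>Qpoly q. \<forall>x\<in>cell K. g t x = p x" using g t K unfolding disc_def Vh_def by blast
  from pc_ex[where g = g, OF this] show "pc g t K \<in> Qpoly q" "x \<in> cell K \<Longrightarrow> pc g t K x = g t x" by auto
qed

lemma pc_dt:
  assumes g: "disc g" and t: "t \<in> {0..T}" and K: "K \<in> \<T>"
  shows "pc (dt T g) t K \<in> Qpoly q" and "x \<in> cell K \<Longrightarrow> pc (dt T g) t K x = dt T g t x"
    and "x \<in> cell K \<Longrightarrow> ((\<lambda>s. g s x) has_real_derivative pc (dt T g) t K x) (at t within {0..T})"
proof -
  have d: "((\<lambda>s. g s x) has_real_derivative dt T g t x) (at t within {0..T})" if "x \<in> cell K" for x
    by (rule dt_DERIV[of T "\<Union>K\<in>\<T>. cell K"]) (use g t K that in \<open>auto simp: disc_def\<close>)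
  have "\<exists>p\<in>Qpoly q. \<forall>x\<in>cell K. dt T g t x = p x"
  proof (rule Qpoly_time_derivative[OF proper_T[OF K] t _ d at_within_bot[OF t]])
    fix s assume "s \<in> {0..T}"
    then show "\<exists>p\<in>Qpoly q. \<forall>x\<in>cell K. g s x = p x" using g K unfolding disc_def Vh_def by blast
  qed auto
  note P = pc_ex[where g = "dt T g", OF this]
  show "pc (dt T g) t K \<in> Qpoly q" "x \<in> cell K \<Longrightarrow> pc (dt T g) t K x = dt T g t x" using P by auto
  show "x \<in> cell K \<Longrightarrow> ((\<lambda>s. g s x) has_real_derivative pc (dt T g) t K x) (at t within {0..T})"
    using d P(2) by simp
qed

lemma glue_Qpoly: "p \<in> Qpoly q \<Longrightarrow> glue (\<lambda>_. p) \<in> Vh a b \<T> q"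
  by (rule glue_Vh)

lemma scheme:
  assumes "t \<in> {0..T}" "K \<in> \<T>" "\<phi> \<in> Vh a b \<T> q"
  shows "(LINT x:cell K|lebesgue. \<phi> x * (dt T uh t x - vh t x))
          + quad m Y \<omega> K (\<lambda>x. fquot f (uh t x) * \<phi> x * (dt T uh t x - vh t x)) = 0"
    and "(LINT x:cell K|lebesgue. dt T wh t x * \<phi> x)
          + B1 K (vh t) \<phi> (\<lambda>i. tr 1 i (vh t)) (\<lambda>i. tr 1 i (pd i (vh t))) = 0"
    and "(LINT x:cell K|lebesgue. dt T vh t x * \<phi> x + uh t x * \<phi> x + \<mu> * vh t x * \<phi> x)
          + quad m Y \<omega> K (\<lambda>x. \<phi> x * f (uh t x))
          + B2 K (wh t) \<phi> (\<lambda>i. tr (- 1) i (wh t)) (\<lambda>i. tr (- 1) i (pd i (wh t))) = 0"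
  using sch assms unfolding dg_scheme_def by blast+

lemma quad_cong: "K \<in> \<T> \<Longrightarrow> (\<And>x. x \<in> cell K \<Longrightarrow> F x = G x) \<Longrightarrow> quad m Y \<omega> K F = quad m Y \<omega> K G"
  unfolding quad_def by (intro sum.cong refl) (simp add: node)

text \<open>Testing the first equation with \<open>u\<^sub>h\<^sub>t - v\<^sub>h\<close> itself, both terms are nonnegative; as the
  quotient and the weights are positive, \<open>u\<^sub>h\<^sub>t = v\<^sub>h\<close> at every node.\<close>

lemma uh_DERIV:
  assumes t: "t \<in> {0..T}" and K: "K \<in> \<T>" and j: "j < m K"
  shows "((\<lambda>s. uh s (Y K j)) has_real_derivative vh t (Y K j)) (at t within {0..T})"
proof -
  define D where "D x = pc (dt T uh) t K x - pc vh t K x" for x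
  have D: "D \<in> Qpoly q" unfolding D_def by (intro Qpoly_diff pc_dt(1) pc_disc(1) disc_sol t K)
  have eD: "dt T uh t x - vh t x = D x" if "x \<in> cell K" for x
    unfolding D_def by (simp add: pc_dt(2)[OF disc_sol(1) t K that] pc_disc(2)[OF disc_sol(2) t K that])
  let ?\<phi> = "glue (\<lambda>_. D)"
  have g: "?\<phi> x = D x" if "x \<in> cell K" for x using glue_cell[OF K that] .
  have c: "continuous_on UNIV D" using CS_continuous[OF CS_Qpoly[OF D, of 0]] .
  have "(LINT x:cell K|lebesgue. ?\<phi> x * (dt T uh t x - vh t x)) = bint K (\<lambda>x. D x * D x)"
    by (rule cell_LINT(2)) (auto simp: g eD intro!: continuous_intros c)
  moreover have "bint K (\<lambda>x. D x * D x) \<ge> 0" by (rule integral_nonneg) (auto intro!: cont_integrable continuous_intros c)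
  moreover have "quad m Y \<omega> K (\<lambda>x. fquot f (uh t x) * ?\<phi> x * (dt T uh t x - vh t x)) = quad m Y \<omega> K (\<lambda>x. fquot f (uh t x) * (D x * D x))"
    by (rule quad_cong[OF K]) (simp add: g eD mult_ac)
  ultimately have "quad m Y \<omega> K (\<lambda>x. fquot f (uh t x) * (D x * D x)) \<le> 0"
    using scheme(1)[OF t K glue_Qpoly[OF D]] by linarith
  moreover have nn: "0 \<le> \<omega> K j * (fquot f (uh t (Y K j)) * (D (Y K j) * D (Y K j)))" if "j < m K" for j
    using weight[OF K that] fquot_pos[of "uh t (Y K j)"] by simp
  ultimately have "(\<Sum>j<m K. \<omega> K j * (fquot f (uh t (Y K j)) * (D (Y K j) * D (Y K j)))) = 0"
    unfolding quad_def by (intro antisym sum_nonneg) auto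
  then have "\<omega> K j * (fquot f (uh t (Y K j)) * (D (Y K j) * D (Y K j))) = 0"
    using sum_nonneg_eq_0_iff[of "{..<m K}" "\<lambda>j. \<omega> K j * (fquot f (uh t (Y K j)) * (D (Y K j) * D (Y K j)))"] nn j by auto
  then have "D (Y K j) = 0" using weight[OF K j] fquot_pos[of "uh t (Y K j)"] by simp
  then have "pc (dt T uh) t K (Y K j) = vh t (Y K j)"
    unfolding D_def using pc_disc(2)[OF disc_sol(2) t K node[OF K j]] by simp
  then show ?thesis using pc_dt(3)[OF disc_sol(1) t K node[OF K j]] by simp
qed

lemma pieces_periodic: "disc g \<Longrightarrow> t \<in> {0..T} \<Longrightarrow> periodic a b (g t)"
  unfolding disc_def Vh_def by blast

lemma scheme_w:
  assumes t: "t \<in> {0..T}" and K: "K \<in> \<T>" and p: "p \<in> Qpoly q"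
  shows "bint K (\<lambda>x. pc (dt T wh) t K x * p x) = - (\<Sum>i\<in>UNIV. Bf True K (pc vh t) p i)"
proof -
  let ?\<phi> = "glue (\<lambda>_. p)"
  have g: "?\<phi> x = p x" if "x \<in> cell K" for x using glue_cell[OF K that] .
  note c = Qpoly_continuous[OF p] Qpoly_continuous[OF pc_dt(1)[OF disc_sol(2) t K]] Qpoly_continuous[OF pc_dt(1)[OF disc_sol(3) t K]]
    Qpoly_continuous[OF pc_disc(1)[OF disc_sol(1) t K]] Qpoly_continuous[OF pc_disc(1)[OF disc_sol(2) t K]]
  have "B1 K (vh t) ?\<phi> (\<lambda>i. tr (sg True) i (vh t)) (\<lambda>i. tr (sg True) i (pd i (vh t))) = (\<Sum>i\<in>UNIV. Bf True K (pc vh t) p i)"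
    by (rule B1_eq[OF K CS_Qpoly[OF p] g]) (auto intro!: CS_Qpoly[of _ q] pieces_periodic pc_disc(1) disc_sol t simp: pc_disc(2)[OF disc_sol(2) t] simp del: JS.simps)
  moreover have "(LINT x:cell K|lebesgue. dt T wh t x * ?\<phi> x) = bint K (\<lambda>x. pc (dt T wh) t K x * p x)"
    by (rule cell_LINT(2)) (auto simp: g pc_dt(2)[OF disc_sol(3) t K] intro!: continuous_intros c)
  ultimately show ?thesis using scheme(2)[OF t K glue_Qpoly[OF p]] by (simp add: sg_def)
qed

lemma scheme_v:
  assumes t: "t \<in> {0..T}" and K: "K \<in> \<T>" and p: "p \<in> Qpoly q"
  shows "bint K (\<lambda>x. pc (dt T vh) t K x * p x + pc uh t K x * p x + \<mu> * pc vh t K x * p x)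
    + quad m Y \<omega> K (\<lambda>x. p x * f (pc uh t K x)) = (\<Sum>i\<in>UNIV. Bf False K (pc wh t) p i)"
proof -
  let ?\<phi> = "glue (\<lambda>_. p)"
  have g: "?\<phi> x = p x" if "x \<in> cell K" for x using glue_cell[OF K that] .
  note c = Qpoly_continuous[OF p] Qpoly_continuous[OF pc_dt(1)[OF disc_sol(2) t K]] Qpoly_continuous[OF pc_dt(1)[OF disc_sol(3) t K]]
    Qpoly_continuous[OF pc_disc(1)[OF disc_sol(1) t K]] Qpoly_continuous[OF pc_disc(1)[OF disc_sol(2) t K]]
  have "B1 K (wh t) ?\<phi> (\<lambda>i. tr (sg False) i (wh t)) (\<lambda>i. tr (sg False) i (pd i (wh t))) = (\<Sum>i\<in>UNIV. Bf False K (pc wh t) p i)"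
    by (rule B1_eq[OF K CS_Qpoly[OF p] g]) (auto intro!: CS_Qpoly[of _ q] pieces_periodic pc_disc(1) disc_sol t simp: pc_disc(2)[OF disc_sol(3) t] simp del: JS.simps)
  moreover have "(LINT x:cell K|lebesgue. dt T vh t x * ?\<phi> x + uh t x * ?\<phi> x + \<mu> * vh t x * ?\<phi> x)
      = bint K (\<lambda>x. pc (dt T vh) t K x * p x + pc uh t K x * p x + \<mu> * pc vh t K x * p x)"
    by (rule cell_LINT(2))
       (auto simp: g pc_dt(2)[OF disc_sol(2) t K] pc_disc(2)[OF disc_sol(1) t K] pc_disc(2)[OF disc_sol(2) t K]
          intro!: continuous_intros c)
  moreover have "quad m Y \<omega> K (\<lambda>x. ?\<phi> x * f (uh t x)) = quad m Y \<omega> K (\<lambda>x. p x * f (pc uh t K x))"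
    by (rule quad_cong[OF K]) (simp add: g pc_disc(2)[OF disc_sol(1) t K])
  ultimately show ?thesis using scheme(3)[OF t K glue_Qpoly[OF p]] by (simp add: sg_def B2_B1)
qed

text \<open>The quadrature assumption speaks of one global function, so the polynomials are glued.
  Young's inequality then gives the product of norms the shape used in the energy estimate.\<close>

lemma quad_error:
  assumes p: "\<And>K. K \<in> \<T> \<Longrightarrow> p K \<in> Qpoly q" and g: "CS (q + 1) g" and S: "H_seminorm \<T> (q + 1) g \<le> S"
  shows "2 * (qd (\<lambda>K x. p K x * g x) - brk (\<lambda>K x. p K x * g x)) \<le> (\<bar>C\<^sub>Q\<bar> * mesh_size \<T> ^ (q + 1) * S)\<^sup>2 + brk (\<lambda>K x. (p K x)\<^sup>2)"
proof -
  let ?\<phi> = "glue p" and ?h = "mesh_size \<T> ^ (q + 1)"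
  have gl: "?\<phi> x = p K x" if "K \<in> \<T>" "x \<in> cell K" for K x using glue_cell[OF that] .
  have cg: "continuous_on UNIV g" using CS_continuous[OF g] .
  have cp: "pcont p" by (rule pcont_Qpoly[OF p])
  have h0: "?h \<ge> 0"
  proof -
    obtain K where K: "K \<in> \<T>" using T_nonempty by blast
    have "0 \<le> diameter (cell K)" by (rule diameter_ge_0) (simp add: cell_def)
    also have "\<dots> \<le> mesh_size \<T>" unfolding mesh_size_def using finite_T K by (intro Max_ge) auto
    finally show ?thesis by simp
  qed
  have sn: "0 \<le> H_seminorm \<T> (q + 1) g" unfolding H_seminorm_smooth[OF g]
    by (intro real_sqrt_ge_zero sum_nonneg integral_nonneg cont_integrable continuous_on_power CS_pds_cont[OF g]) (auto simp: length_mi_list)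
  let ?P = "brk (\<lambda>K x. (p K x)\<^sup>2)"
  have L2: "(L2_norm_h \<T> ?\<phi>)\<^sup>2 = ?P" by (rule L2_norm_h_sq[OF cp gl])
  have L0: "0 \<le> L2_norm_h \<T> ?\<phi>" using brk_nonneg[OF cp] brk_cell[of "\<lambda>K x. (p K x)\<^sup>2" "\<lambda>x. (?\<phi> x)\<^sup>2"]
    unfolding L2_norm_h_def by (simp add: gl pcont_intros cp)
  have "qd (\<lambda>K x. p K x * g x) - brk (\<lambda>K x. p K x * g x)
     = (\<Sum>K\<in>\<T>. quad m Y \<omega> K (\<lambda>x. ?\<phi> x * g x) - (LINT x:cell K|lebesgue. ?\<phi> x * g x))"
    unfolding qd_def brk_def sum_subtractf[symmetric]
  proof (intro sum.cong refl arg_cong2[where f = minus])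
    fix K assume K: "K \<in> \<T>"
    show "quad m Y \<omega> K (\<lambda>x. p K x * g x) = quad m Y \<omega> K (\<lambda>x. ?\<phi> x * g x)"
      by (rule quad_cong[OF K]) (simp add: gl[OF K])
    show "bint K (\<lambda>x. p K x * g x) = (LINT x:cell K|lebesgue. ?\<phi> x * g x)"
      by (rule cell_LINT(2)[symmetric]) (use cp K in \<open>auto simp: gl[OF K] pcont_def intro!: continuous_intros cg\<close>)
  qed
  also have "\<dots> \<le> (\<Sum>K\<in>\<T>. \<bar>quad m Y \<omega> K (\<lambda>x. ?\<phi> x * g x) - (LINT x:cell K|lebesgue. ?\<phi> x * g x)\<bar>)"
    by (intro sum_mono) simp
  also have "\<dots> \<le> C\<^sub>Q * ?h * L2_norm_h \<T> ?\<phi> * H_seminorm \<T> (q + 1) g"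
  proof -
    have "?\<phi> \<in> Vh a b \<T> q" by (rule glue_Vh[OF p])
    moreover have "g \<in> broken_H \<T> (q + 1)" by (rule broken_H_smooth[OF g])
    moreover have "\<forall>K\<in>\<T>. continuous_on (cell K) g" using cg continuous_on_subset by blast
    ultimately show ?thesis using qa unfolding quadrature_assumption_def by blast
  qed
  also have "\<dots> \<le> \<bar>C\<^sub>Q\<bar> * ?h * L2_norm_h \<T> ?\<phi> * S"
    using h0 L0 S sn by (intro mult_mono mult_nonneg_nonneg) auto
  also have "\<dots> = (\<bar>C\<^sub>Q\<bar> * ?h * S) * L2_norm_h \<T> ?\<phi>" by simp
  finally show ?thesis using young[of 1 "\<bar>C\<^sub>Q\<bar> * ?h * S" "L2_norm_h \<T> ?\<phi>"] L2 by simp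
qed

end

section \<open>Approximation errors\<close>

lemma card_le_2: "CARD('n::finite) \<in> {1, 2} \<Longrightarrow> real CARD('n) \<le> 2"
  by auto

text \<open>\<open>S\<close> is a common bound for all data that the constants may use. The
  strengths differ: pointwise bounds for v and w up to order 2q + 4 and for u from order 2 to 2q +
  1, but only L^2 bounds for u_tt, up to order q + 1.\<close>

locale dg_error = dg_solution a b \<T> N X q T \<mu> M L C\<^sub>Q f m Y \<omega> uh vh wh
  for a b :: "real ^ 'n::finite" and \<T> N X q T \<mu> M L C\<^sub>Q f m Y \<omega> uh vh wh +
  fixes u :: "real \<Rightarrow> real ^ 'n \<Rightarrow> real" and S :: real
  assumes sol: "smooth_solution a b T \<mu> f q u" and S0: "S \<ge> 0"
    and Sv: "\<And>t is x. t \<in> {0..T} \<Longrightarrow> length is \<le> 2 * q + 4 \<Longrightarrow> x \<in> cbox a b \<Longrightarrow> \<bar>pds is (dt T u t) x\<bar> \<le> S"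
    and Sw: "\<And>t is x. t \<in> {0..T} \<Longrightarrow> length is \<le> 2 * q + 4 \<Longrightarrow> x \<in> cbox a b \<Longrightarrow> \<bar>pds is (lap (u t)) x\<bar> \<le> S"
    and Su: "\<And>t is x. t \<in> {0..T} \<Longrightarrow> 2 \<le> length is \<Longrightarrow> length is \<le> 2 * q + 1 \<Longrightarrow> x \<in> cbox a b \<Longrightarrow> \<bar>pds is (u t) x\<bar> \<le> S"
    and Sa: "\<And>t js. t \<in> {0..T} \<Longrightarrow> length js \<le> q + 1 \<Longrightarrow> brk (\<lambda>K x. (pds js (dt T (dt T u) t) x)\<^sup>2) \<le> S\<^sup>2"
begin

abbreviation "v \<equiv> dt T u"
abbreviation "acc \<equiv> dt T (dt T u)"
abbreviation "w \<equiv> \<lambda>t. lap (u t)"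
abbreviation "h \<equiv> mesh_size \<T>"
abbreviation "H \<equiv> diameter (box a b)"
abbreviation "vol \<equiv> measure lebesgue (box a b)"

lemma u_JS: "JS (2 * q + 6) {0..T} u" and v_JS: "JS (2 * q + 4) {0..T} v" and acc_JS: "JS (q + 1) {0..T} acc"
  using sol unfolding smooth_solution_def by (blast intro: spatial_C_JS)+

lemma w_JS: "JS (2 * q + 4) {0..T} w"
  by (rule JS_lap) (use u_JS in \<open>simp add: eval_nat_numeral del: JS.simps\<close>)

lemma v_periodic: "t \<in> {0..T} \<Longrightarrow> periodic a b (u t)"
  using sol unfolding smooth_solution_def by blast

lemma u_DERIV: "t \<in> {0..T} \<Longrightarrow> ((\<lambda>s. u s x) has_real_derivative v t x) (at t within {0..T})"
  by (rule dt_DERIV[where S = UNIV]) (use sol in \<open>auto simp: smooth_solution_def\<close>)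

lemma v_DERIV: "t \<in> {0..T} \<Longrightarrow> ((\<lambda>s. v s x) has_real_derivative acc t x) (at t within {0..T})"
  by (rule dt_DERIV[where S = UNIV]) (use sol in \<open>auto simp: smooth_solution_def\<close>)

lemma pds_u_DERIV: "t \<in> {0..T} \<Longrightarrow> length is \<le> 2 * q + 4 \<Longrightarrow>
    ((\<lambda>s. pds is (u s) x) has_real_derivative pds is (v t) x) (at t within {0..T})"
  by (rule pds_dt[OF JS_le[OF u_JS] v_JS u_DERIV]) auto

lemma pds_v_DERIV: "t \<in> {0..T} \<Longrightarrow> length is \<le> q + 1 \<Longrightarrow>
    ((\<lambda>s. pds is (v s) x) has_real_derivative pds is (acc t) x) (at t within {0..T})"
  by (rule pds_dt[OF JS_le[OF v_JS] acc_JS v_DERIV]) auto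

lemma w_DERIV: "t \<in> {0..T} \<Longrightarrow> ((\<lambda>s. w s x) has_real_derivative lap (v t) x) (at t within {0..T})"
  unfolding lap_pds by (intro DERIV_sum pds_u_DERIV) (use q1 in auto)

lemma lapv_JS: "JS (2 * q + 2) {0..T} (\<lambda>t. lap (v t))"
  by (rule JS_lap) (use v_JS in \<open>simp add: eval_nat_numeral del: JS.simps\<close>)

lemma pde: "t \<in> {0..T} \<Longrightarrow> acc t x = - lap (w t) x - u t x - \<mu> * v t x - f (u t x)"
  using sol unfolding smooth_solution_def by (smt (verit))

lemma sum_UNIV_le: "(\<And>i. g i \<le> c) \<Longrightarrow> 0 \<le> c \<Longrightarrow> (\<Sum>i\<in>(UNIV :: 'n set). g i) \<le> 2 * c" for c :: real
proof -
  assume g: "\<And>i. g i \<le> c" and c: "0 \<le> c"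
  have "(\<Sum>i\<in>(UNIV :: 'n set). g i) \<le> (\<Sum>i\<in>(UNIV :: 'n set). c)" by (rule sum_mono[OF g])
  also have "\<dots> \<le> 2 * c" using mult_right_mono[OF card_le_2[OF card] c] by simp
  finally show ?thesis .
qed

lemma cell_diameter: "K \<in> \<T> \<Longrightarrow> diameter (cell K) \<le> h"
  unfolding mesh_size_def using finite_T by (intro Max_ge) auto

lemma side_le: "K \<in> \<T> \<Longrightarrow> snd K $ i - fst K $ i \<le> h"
proof -
  assume K: "K \<in> \<T>"
  have le: "\<forall>i\<in>Basis. fst K \<bullet> i \<le> snd K \<bullet> i"
    using proper_T[OF K] unfolding proper_def by (auto simp: Basis_vec_def inner_axis less_imp_le)
  have ne: "box (fst K) (snd K) \<noteq> {}" using cell_nonempty[OF proper_T[OF K]] by (simp add: cell_def)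
  have "snd K $ i - fst K $ i \<le> norm (snd K - fst K)"
    using component_le_norm_cart[of "snd K - fst K" i] by simp
  also have "\<dots> = diameter (cbox (fst K) (snd K))" using diameter_cbox[OF le] by (simp add: dist_norm norm_minus_commute)
  also have "\<dots> = diameter (cell K)" unfolding cell_def
    using diameter_closure[of "box (fst K) (snd K)"] closure_box[OF ne] by simp
  finally show ?thesis using cell_diameter[OF K] by simp
qed

lemma h_pos: "h > 0"
proof -
  obtain K where K: "K \<in> \<T>" using T_nonempty by blast
  show ?thesis using side_le[OF K, of undefined] proper_T[OF K] unfolding proper_def by (smt (verit))
qed

lemma h_le: "h \<le> H"
proof -
  have "diameter (cell K) \<le> H" if "K \<in> \<T>" for K
    by (rule diameter_subset) (use cell_subset[OF that] in auto)
  then show ?thesis unfolding mesh_size_def using finite_T T_nonempty by (subst Max_le_iff) auto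
qed

lemma H0: "H \<ge> 0" using h_pos h_le by linarith

lemma pcont_fun: "continuous_on UNIV g \<Longrightarrow> pcont (\<lambda>K. g)"
  by (simp add: pcont_def)

lemma cross_cont: "CS 1 g \<Longrightarrow> pcont (\<lambda>K. cross_radau low q K i g)"
  unfolding pcont_def using CS_continuous[OF element.JS_cross[OF element_T, where k = 0]] by simp

lemma tensor_cont: "CS 2 g \<Longrightarrow> pcont (\<lambda>K. tensor_radau low q K g)"
  unfolding pcont_def using CS_continuous[OF element.JS_tensor[OF element_T, where k = 0]] by (simp add: eval_nat_numeral)

lemma tensor_Q: "CS 2 g \<Longrightarrow> K \<in> \<T> \<Longrightarrow> tensor_radau low q K g \<in> Qpoly q"
  by (rule element.tensor_Qpoly[OF element_T]) (simp_all add: eval_nat_numeral)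

lemma cross_nsq:
  assumes g: "CS (q + 1) g" and B: "\<And>is x. length is \<le> q + 1 \<Longrightarrow> x \<in> cbox a b \<Longrightarrow> \<bar>pds is g x\<bar> \<le> B"
  shows "brk (\<lambda>K x. (cross_radau low q K i g x - g x)\<^sup>2) \<le> (8 * B\<^sup>2 * vol) * h ^ (2 * q + 2)"
proof -
  have g': "CS (Suc q) g" using g by simp
  let ?b = "\<lambda>j. brk (\<lambda>K x. (pds (replicate (Suc q) j) g x)\<^sup>2)"
  have "brk (\<lambda>K x. (cross_radau low q K i g x - g x)\<^sup>2) = (\<Sum>K\<in>\<T>. bint K (\<lambda>x. (g x - cross_radau low q K i g x)\<^sup>2))"
    unfolding brk_def by (simp add: power2_commute)
  also have "\<dots> \<le> (\<Sum>K\<in>\<T>. 4 * h ^ (2 * q + 2) * (\<Sum>j\<in>UNIV. bint K (\<lambda>x. (pds (replicate (Suc q) j) g x)\<^sup>2)))"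
    by (intro sum_mono element.cross_error[OF element_T _ side_le] g') (use h_pos in auto)
  also have "\<dots> = 4 * h ^ (2 * q + 2) * (\<Sum>j\<in>UNIV. ?b j)"
    unfolding brk_def sum_distrib_left[symmetric] by (subst sum.swap) simp
  also have "\<dots> \<le> 4 * h ^ (2 * q + 2) * (2 * (B\<^sup>2 * vol))"
  proof (intro mult_left_mono sum_UNIV_le)
    show "?b j \<le> B\<^sup>2 * vol" for j
    proof (rule brk_sq_sup)
      show "pcont (\<lambda>K. pds (replicate (Suc q) j) g)" by (rule pcont_fun[OF CS_pds_cont[OF g]]) simp
      show "\<bar>pds (replicate (Suc q) j) g x\<bar> \<le> B" if "K \<in> \<T>" "x \<in> cbox (fst K) (snd K)" for K x
        by (rule B) (use cbox_subset[OF that(1)] that(2) in \<open>simp_all add: subset_iff\<close>)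
    qed
  qed (use h_pos in auto)
  finally show ?thesis by (simp add: mult_ac)
qed

text \<open>Pure and mixed derivatives have separate bounds because of the difference quotient of v:
  its pure derivatives of order q + 1 are bounded in L^2, its mixed ones of order 2q + 2 only by a
  multiple of S / \<tau>.\<close>

lemma tensor_nsq_general:
  assumes g: "CS (2 * q + 2) g"
    and c1: "\<And>j. brk (\<lambda>K x. (pds (replicate (Suc q) j) g x)\<^sup>2) \<le> c1" and c10: "0 \<le> c1"
    and c2: "\<And>is x. length is = 2 * q + 2 \<Longrightarrow> x \<in> cbox a b \<Longrightarrow> \<bar>pds is g x\<bar> \<le> c2"
  shows "brk (\<lambda>K x. (tensor_radau low q K g x - g x)\<^sup>2) \<le> 24 * c1 * h ^ (2 * q + 2) + 192 * c2\<^sup>2 * vol * (h ^ (2 * q + 2))\<^sup>2"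
proof -
  let ?b = "\<lambda>j. brk (\<lambda>K x. (pds (replicate (Suc q) j) g x)\<^sup>2)"
  let ?d = "\<lambda>i j. brk (\<lambda>K x. (pds (replicate (Suc q) j @ replicate (Suc q) i) g x)\<^sup>2)"
  have d: "?d i j \<le> c2\<^sup>2 * vol" for i j
  proof (rule brk_sq_sup)
    show "pcont (\<lambda>K. pds (replicate (Suc q) j @ replicate (Suc q) i) g)" by (rule pcont_fun[OF CS_pds_cont[OF g]]) simp
    show "\<bar>pds (replicate (Suc q) j @ replicate (Suc q) i) g x\<bar> \<le> c2" if "K \<in> \<T>" "x \<in> cbox (fst K) (snd K)" for K x
      by (rule c2) (use cbox_subset[OF that(1)] that(2) in \<open>simp_all add: subset_iff\<close>)
  qed
  have d0: "0 \<le> ?d i j" for i j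
    by (rule brk_nonneg) (rule pcont_fun[OF CS_pds_cont[OF g]], simp)
  have "brk (\<lambda>K x. (tensor_radau low q K g x - g x)\<^sup>2) = (\<Sum>K\<in>\<T>. bint K (\<lambda>x. (g x - tensor_radau low q K g x)\<^sup>2))"
    unfolding brk_def by (simp add: power2_commute)
  also have "\<dots> \<le> (\<Sum>K\<in>\<T>. 12 * h ^ (2 * q + 2) * (\<Sum>j\<in>UNIV. bint K (\<lambda>x. (pds (replicate (Suc q) j) g x)\<^sup>2))
      + 48 * h ^ (2 * (2 * q + 2)) * (\<Sum>i\<in>UNIV. \<Sum>j\<in>UNIV - {i}. bint K (\<lambda>x. (pds (replicate (Suc q) j @ replicate (Suc q) i) g x)\<^sup>2)))"
    by (intro sum_mono element.tensor_error[OF element_T _ side_le] g) (use h_pos in auto)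
  also have "\<dots> = 12 * h ^ (2 * q + 2) * (\<Sum>j\<in>UNIV. ?b j) + 48 * h ^ (2 * (2 * q + 2)) * (\<Sum>i\<in>UNIV. \<Sum>j\<in>UNIV - {i}. ?d i j)"
  proof -
    have e1: "(\<Sum>K\<in>\<T>. \<Sum>j\<in>UNIV. bint K (\<lambda>x. (pds (replicate (Suc q) j) g x)\<^sup>2)) = (\<Sum>j\<in>UNIV. ?b j)"
      unfolding brk_def by (rule sum.swap)
    have e2: "(\<Sum>K\<in>\<T>. \<Sum>i\<in>UNIV. \<Sum>j\<in>UNIV - {i}. bint K (\<lambda>x. (pds (replicate (Suc q) j @ replicate (Suc q) i) g x)\<^sup>2))
        = (\<Sum>i\<in>UNIV. \<Sum>j\<in>UNIV - {i}. ?d i j)"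
      unfolding brk_def by (subst sum.swap, intro sum.cong refl, subst sum.swap) (rule refl)
    show ?thesis unfolding sum.distrib sum_distrib_left[symmetric] e1 e2 by (rule refl)
  qed
  also have "\<dots> \<le> 12 * h ^ (2 * q + 2) * (2 * c1) + 48 * h ^ (2 * (2 * q + 2)) * (2 * (2 * (c2\<^sup>2 * vol)))"
  proof (intro add_mono mult_left_mono sum_UNIV_le c1 c10)
    show "(\<Sum>j\<in>UNIV - {i}. ?d i j) \<le> 2 * (c2\<^sup>2 * vol)" for i
    proof -
      have "(\<Sum>j\<in>UNIV - {i}. ?d i j) \<le> (\<Sum>j\<in>UNIV. ?d i j)" by (rule sum_mono2) (use d0 in auto)
      also have "\<dots> \<le> 2 * (c2\<^sup>2 * vol)" by (rule sum_UNIV_le[OF d]) simp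
      finally show ?thesis .
    qed
  qed (use h_pos in auto)
  also have "\<dots> = 24 * c1 * h ^ (2 * q + 2) + 192 * c2\<^sup>2 * vol * (h ^ (2 * q + 2))\<^sup>2"
  proof -
    have "h ^ (2 * (2 * q + 2)) = (h ^ (2 * q + 2))\<^sup>2"
      unfolding power_mult[symmetric] by (rule arg_cong[where f = "power h"]) simp
    then show ?thesis by simp
  qed
  finally show ?thesis .
qed

lemma tensor_nsq:
  assumes g: "CS (2 * q + 2) g" and B: "\<And>is x. length is \<le> 2 * q + 2 \<Longrightarrow> x \<in> cbox a b \<Longrightarrow> \<bar>pds is g x\<bar> \<le> B"
  shows "brk (\<lambda>K x. (tensor_radau low q K g x - g x)\<^sup>2) \<le> ((24 + 192 * H ^ (2 * q + 2)) * B\<^sup>2 * vol) * h ^ (2 * q + 2)"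
proof -
  have b: "brk (\<lambda>K x. (pds (replicate (Suc q) j) g x)\<^sup>2) \<le> B\<^sup>2 * vol" for j
  proof (rule brk_sq_sup)
    show "pcont (\<lambda>K. pds (replicate (Suc q) j) g)" by (rule pcont_fun[OF CS_pds_cont[OF g]]) simp
    show "\<bar>pds (replicate (Suc q) j) g x\<bar> \<le> B" if "K \<in> \<T>" "x \<in> cbox (fst K) (snd K)" for K x
      by (rule B) (use cbox_subset[OF that(1)] that(2) in \<open>simp_all add: subset_iff\<close>)
  qed
  have "brk (\<lambda>K x. (tensor_radau low q K g x - g x)\<^sup>2) \<le> 24 * (B\<^sup>2 * vol) * h ^ (2 * q + 2) + 192 * B\<^sup>2 * vol * (h ^ (2 * q + 2))\<^sup>2"
    by (rule tensor_nsq_general[OF g b]) (use B in auto)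
  also have "192 * B\<^sup>2 * vol * (h ^ (2 * q + 2))\<^sup>2 \<le> (192 * B\<^sup>2 * vol) * (H ^ (2 * q + 2) * h ^ (2 * q + 2))"
    unfolding power2_eq_square using h_pos h_le by (intro mult_left_mono mult_right_mono power_mono) auto
  finally show ?thesis by (simp add: algebra_simps)
qed

lemma taylor_pieces:
  assumes g: "CS (2 * q + 1) g" and B: "\<And>is x. q < length is \<Longrightarrow> length is \<le> 2 * q + 1 \<Longrightarrow> x \<in> cbox a b \<Longrightarrow> \<bar>pds is g x\<bar> \<le> S"
  obtains p where "\<And>K. K \<in> \<T> \<Longrightarrow> p K \<in> Qpoly q"
    "\<And>K x. K \<in> \<T> \<Longrightarrow> x \<in> cbox (fst K) (snd K) \<Longrightarrow> \<bar>g x - p K x\<bar> \<le> (1 + real (Suc q) * (1 + H) ^ q) * S * h ^ (q + 1)"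
proof -
  have "\<forall>K\<in>\<T>. \<exists>p. p \<in> Qpoly q \<and> (\<forall>x\<in>cbox (fst K) (snd K). \<bar>g x - p x\<bar> \<le> (1 + real (Suc q) * (1 + H) ^ q) * (h ^ Suc q * S))"
  proof
    fix K assume K: "K \<in> \<T>"
    have "\<bar>pds is g x\<bar> \<le> S" if "q < length is" "length is \<le> 2 * q + 1" "x \<in> cbox (fst K) (snd K)" for "is" x
      by (rule B) (use that cbox_subset[OF K] in auto)
    from element.taylor_Qpoly[OF element_T[OF K] g side_le[OF K] h_le this]
    show "\<exists>p. p \<in> Qpoly q \<and> (\<forall>x\<in>cbox (fst K) (snd K). \<bar>g x - p x\<bar> \<le> (1 + real (Suc q) * (1 + H) ^ q) * (h ^ Suc q * S))"
      by (simp only: Bex_def)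
  qed
  from bchoice[OF this] obtain p where p: "\<forall>K\<in>\<T>. p K \<in> Qpoly q \<and> (\<forall>x\<in>cbox (fst K) (snd K). \<bar>g x - p K x\<bar> \<le> (1 + real (Suc q) * (1 + H) ^ q) * (h ^ Suc q * S))"
    by auto
  show thesis
  proof (rule that)
    show "p K \<in> Qpoly q" if "K \<in> \<T>" for K using p that by simp
    show "\<bar>g x - p K x\<bar> \<le> (1 + real (Suc q) * (1 + H) ^ q) * S * h ^ (q + 1)" if "K \<in> \<T>" "x \<in> cbox (fst K) (snd K)" for K x
    proof -
      have "\<bar>g x - p K x\<bar> \<le> (1 + real (Suc q) * (1 + H) ^ q) * (h ^ Suc q * S)" using p that by blast
      also have "\<dots> = (1 + real (Suc q) * (1 + H) ^ q) * S * h ^ (q + 1)" by simp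
      finally show ?thesis .
    qed
  qed
qed

definition c_taylor :: real where
  "c_taylor = ((1 + real (Suc q) * (1 + H) ^ q) * S)\<^sup>2 * vol"

lemma c_taylor0: "c_taylor \<ge> 0" by (simp add: c_taylor_def)

lemma h_sq: "(h ^ (q + 1))\<^sup>2 = h ^ (2 * q + 2)"
  unfolding power_mult[symmetric] by (rule arg_cong[where f = "power h"]) simp

text \<open>One polynomial per element that is close both in L^2 and at the nodes. It carries
  estimates between integrals and nodal sums for functions that are not polynomials.\<close>

lemma taylor_sq:
  assumes g: "CS (2 * q + 1) g" and B: "\<And>is x. q < length is \<Longrightarrow> length is \<le> 2 * q + 1 \<Longrightarrow> x \<in> cbox a b \<Longrightarrow> \<bar>pds is g x\<bar> \<le> S"
  obtains p where "\<And>K. K \<in> \<T> \<Longrightarrow> p K \<in> Qpoly q"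
    "brk (\<lambda>K x. (g x - p K x)\<^sup>2) \<le> c_taylor * h ^ (2 * q + 2)" "qd (\<lambda>K x. (g x - p K x)\<^sup>2) \<le> c_taylor * h ^ (2 * q + 2)"
proof -
  let ?e = "(1 + real (Suc q) * (1 + H) ^ q) * S * h ^ (q + 1)"
  obtain p where p: "\<And>K. K \<in> \<T> \<Longrightarrow> p K \<in> Qpoly q"
    and e: "\<And>K x. K \<in> \<T> \<Longrightarrow> x \<in> cbox (fst K) (snd K) \<Longrightarrow> \<bar>g x - p K x\<bar> \<le> ?e"
    using taylor_pieces[OF g B] by blast
  have eq: "?e\<^sup>2 * vol = c_taylor * h ^ (2 * q + 2)"
    unfolding c_taylor_def power_mult_distrib h_sq by (simp only: mult_ac)
  have "brk (\<lambda>K x. (g x - p K x)\<^sup>2) \<le> ?e\<^sup>2 * vol"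
    by (rule brk_sq_sup[OF _ e]) (intro pcont_intros pcont_fun CS_continuous[OF g] pcont_Qpoly p)
  moreover have "qd (\<lambda>K x. (g x - p K x)\<^sup>2) \<le> ?e\<^sup>2 * vol"
    by (rule qd_sup[OF e]) (use box_subset_cbox in \<open>auto simp: cell_def\<close>)
  ultimately show thesis using that p unfolding eq by blast
qed

definition c_quad :: real where
  "c_quad = C\<^sub>Q\<^sup>2 * (real (card {\<alpha> :: 'n \<Rightarrow> nat. mi_order \<alpha> = q + 1}) * (2 * S\<^sup>2 + 2 * ((2 + \<mu>) * S)\<^sup>2 * vol))"

lemma lap_sup:
  fixes g :: "real ^ 'n \<Rightarrow> real"
  assumes g: "CS (k + 2) g" and l: "length js \<le> k" and B: "\<And>is. length is \<le> k + 2 \<Longrightarrow> \<bar>pds is g x\<bar> \<le> B"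
  shows "\<bar>pds js (lap g) x\<bar> \<le> 2 * B"
proof -
  have "pds js (lap g) = (\<lambda>x. \<Sum>i\<in>UNIV. pds (js @ [i, i]) g x)"
    by (rule pds_lap[of k]) (use g l in \<open>simp_all add: eval_nat_numeral del: JS.simps\<close>)
  then have "\<bar>pds js (lap g) x\<bar> \<le> (\<Sum>i\<in>UNIV. \<bar>pds (js @ [i, i]) g x\<bar>)" by (simp add: sum_abs)
  also have "\<dots> \<le> 2 * B"
  proof (rule sum_UNIV_le)
    show "\<bar>pds (js @ [i, i]) g x\<bar> \<le> B" for i by (rule B) (use l in simp)
    show "0 \<le> B" using B[of "[]"] by simp
  qed
  finally show ?thesis .
qed

text \<open>By the equation this is u + f(u). In this form its derivatives of order q + 1 are
  bounded without differentiating \<open>f\<close>, as the estimate of the quadrature error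
  requires.\<close>

definition src :: "real \<Rightarrow> real ^ 'n \<Rightarrow> real" where
  "src t = (\<lambda>x. (- 1) * acc t x + (- 1) * (1 * lap (w t) x + \<mu> * v t x))"

lemma src: "t \<in> {0..T} \<Longrightarrow> src t x = u t x + f (u t x)"
  unfolding src_def using pde by simp

lemma src_CS:
  assumes t: "t \<in> {0..T}"
  shows "CS (q + 1) (acc t)" "CS (q + 1) (lap (w t))" "CS (q + 1) (v t)" "CS (q + 1) (src t)"
proof -
  show 1: "CS (q + 1) (acc t)" by (rule JS_static[OF acc_JS t])
  have "JS (2 * q + 2) {0..T} (\<lambda>t. lap (w t))" by (rule JS_lap) (use w_JS in \<open>simp add: eval_nat_numeral del: JS.simps\<close>)
  from JS_static[OF this t] show 2: "CS (q + 1) (lap (w t))" by (rule JS_le) simp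
  show 3: "CS (q + 1) (v t)" by (rule JS_le[OF JS_static[OF v_JS t]]) simp
  show "CS (q + 1) (src t)" unfolding src_def by (intro JS_lin 1 2 3)
qed

lemma src_seminorm:
  assumes t: "t \<in> {0..T}"
  shows "(\<bar>C\<^sub>Q\<bar> * h ^ (q + 1) * H_seminorm \<T> (q + 1) (src t))\<^sup>2 \<le> c_quad * h ^ (2 * q + 2)"
proof -
  note cs = src_CS[OF t]
  have b: "brk (\<lambda>K x. (pds js (src t) x)\<^sup>2) \<le> 2 * S\<^sup>2 + 2 * ((2 + \<mu>) * S)\<^sup>2 * vol" if l: "length js = q + 1" for js
  proof -
    have cl: "CS (q + 1) (\<lambda>x. 1 * lap (w t) x + \<mu> * v t x)" by (intro JS_lin cs)
    have e: "pds js (src t) = (\<lambda>x. (- 1) * pds js (acc t) x + (- 1) * (1 * pds js (lap (w t)) x + \<mu> * pds js (v t) x))"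
      unfolding src_def using pds_lin[OF cs(1) cl, of js "- 1" "- 1"] pds_lin[OF cs(2,3), of js 1 \<mu>] l by (simp add: fun_eq_iff)
    have cc: "continuous_on UNIV (pds js (acc t))" "continuous_on UNIV (pds js (lap (w t)))" "continuous_on UNIV (pds js (v t))"
      using CS_pds_cont[OF cs(1)] CS_pds_cont[OF cs(2)] CS_pds_cont[OF cs(3)] l by simp_all
    have "brk (\<lambda>K x. (pds js (src t) x)\<^sup>2) \<le> 2 * brk (\<lambda>K x. ((- 1) * pds js (acc t) x)\<^sup>2) + 2 * brk (\<lambda>K x. ((- 1) * (1 * pds js (lap (w t)) x + \<mu> * pds js (v t) x))\<^sup>2)"
      unfolding e by (rule brk_sq_add) (auto intro!: pcont_fun continuous_intros cc)
    also have "\<dots> \<le> 2 * S\<^sup>2 + 2 * (((2 + \<mu>) * S)\<^sup>2 * vol)"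
    proof (intro add_mono mult_left_mono)
      show "brk (\<lambda>K x. ((- 1) * pds js (acc t) x)\<^sup>2) \<le> S\<^sup>2" using Sa[OF t, of js] l by simp
      show "brk (\<lambda>K x. ((- 1) * (1 * pds js (lap (w t)) x + \<mu> * pds js (v t) x))\<^sup>2) \<le> ((2 + \<mu>) * S)\<^sup>2 * vol"
      proof (rule brk_sq_sup)
        fix K x assume "K \<in> \<T>" "x \<in> cbox (fst K) (snd K)"
        then have x: "x \<in> cbox a b" using cbox_subset by blast
        have 1: "\<bar>pds js (lap (w t)) x\<bar> \<le> 2 * S"
          by (rule lap_sup[of "q + 1"]) (use Sw[OF t _ x] l q1 in \<open>auto intro: JS_le[OF JS_static[OF w_JS t]] simp del: JS.simps\<close>)
        have 2: "\<bar>\<mu> * pds js (v t) x\<bar> \<le> \<mu> * S"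
          unfolding abs_mult using Sv[OF t _ x, of js] l mu by (intro mult_mono) auto
        show "\<bar>(- 1) * (1 * pds js (lap (w t)) x + \<mu> * pds js (v t) x)\<bar> \<le> (2 + \<mu>) * S"
          using 1 2 by (simp add: distrib_right abs_if split: if_splits)
      qed (auto intro!: pcont_fun continuous_intros cc)
    qed auto
    finally show ?thesis by simp
  qed
  let ?G = "2 * S\<^sup>2 + 2 * ((2 + \<mu>) * S)\<^sup>2 * vol"
  have "(H_seminorm \<T> (q + 1) (src t))\<^sup>2 = (\<Sum>\<alpha> | mi_order \<alpha> = q + 1. brk (\<lambda>K x. (pds (mi_list \<alpha>) (src t) x)\<^sup>2))"
    unfolding H_seminorm_smooth[OF cs(4)] brk_def[symmetric]
    by (intro real_sqrt_pow2 sum_nonneg brk_nonneg pcont_fun CS_pds_cont[OF cs(4)]) (auto simp: length_mi_list)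
  also have "\<dots> \<le> (\<Sum>\<alpha> | mi_order (\<alpha> :: 'n \<Rightarrow> nat) = q + 1. ?G)"
    by (intro sum_mono b) (auto simp: length_mi_list)
  finally have n: "(H_seminorm \<T> (q + 1) (src t))\<^sup>2 \<le> real (card {\<alpha> :: 'n \<Rightarrow> nat. mi_order \<alpha> = q + 1}) * ?G" by simp
  have "(\<bar>C\<^sub>Q\<bar> * h ^ (q + 1) * H_seminorm \<T> (q + 1) (src t))\<^sup>2 = (C\<^sub>Q\<^sup>2 * h ^ (2 * q + 2)) * (H_seminorm \<T> (q + 1) (src t))\<^sup>2"
    unfolding power_mult_distrib h_sq by simp
  also have "\<dots> \<le> (C\<^sub>Q\<^sup>2 * h ^ (2 * q + 2)) * (real (card {\<alpha> :: 'n \<Rightarrow> nat. mi_order \<alpha> = q + 1}) * ?G)"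
    by (intro mult_left_mono n) (use h_pos in auto)
  finally show ?thesis by (simp add: c_quad_def mult_ac)
qed

end

section \<open>The energy inequality\<close>

context dg_error
begin

definition ip :: "('n elem \<Rightarrow> real ^ 'n \<Rightarrow> real) \<Rightarrow> ('n elem \<Rightarrow> real ^ 'n \<Rightarrow> real) \<Rightarrow> real" where
  "ip F G = brk (\<lambda>K x. F K x * G K x)"

lemma ip_add: "pcont F \<Longrightarrow> pcont G \<Longrightarrow> pcont P \<Longrightarrow> ip (\<lambda>K x. F K x + G K x) P = ip F P + ip G P"
  unfolding ip_def distrib_right by (intro brk_add pcont_intros)

lemma ip_diff: "pcont F \<Longrightarrow> pcont G \<Longrightarrow> pcont P \<Longrightarrow> ip (\<lambda>K x. F K x - G K x) P = ip F P - ip G P"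
  unfolding ip_def left_diff_distrib by (intro brk_diff pcont_intros)

lemma ip_cmult: "ip (\<lambda>K x. c * F K x) P = c * ip F P"
  unfolding ip_def mult.assoc brk_cmult by (rule refl)

lemma ip_sum: "(\<And>i. pcont (F i)) \<Longrightarrow> pcont P \<Longrightarrow> ip (\<lambda>K x. \<Sum>i\<in>(UNIV :: 'n set). F i K x) P = (\<Sum>i\<in>UNIV. ip (F i) P)"
  unfolding ip_def sum_distrib_right by (intro brk_sum pcont_intros finite)

lemma ip_young: "pcont F \<Longrightarrow> pcont P \<Longrightarrow> 2 * ip F P \<le> brk (\<lambda>K x. (F K x)\<^sup>2) + brk (\<lambda>K x. (P K x)\<^sup>2)"
  unfolding ip_def using brk_young[of F P 1] by simp

lemma ip_commute: "ip F P = ip P F"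
  unfolding ip_def by (simp add: mult.commute)

lemma ip_sum_young:
  assumes "\<And>i. pcont (F i)" "pcont P" "\<And>i. brk (\<lambda>K x. (F i K x)\<^sup>2) \<le> c"
  shows "2 * (\<Sum>i\<in>(UNIV :: 'n set). ip (F i) P) \<le> 2 * c + 2 * brk (\<lambda>K x. (P K x)\<^sup>2)"
proof -
  have "2 * (\<Sum>i\<in>(UNIV :: 'n set). ip (F i) P) = (\<Sum>i\<in>(UNIV :: 'n set). 2 * ip (F i) P)" by (simp add: sum_distrib_left)
  also have "\<dots> \<le> 2 * (c + brk (\<lambda>K x. (P K x)\<^sup>2))"
  proof (rule sum_UNIV_le)
    show "2 * ip (F i) P \<le> c + brk (\<lambda>K x. (P K x)\<^sup>2)" for i
      using ip_young[OF assms(1,2), of i] assms(3)[of i] by linarith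
    show "0 \<le> c + brk (\<lambda>K x. (P K x)\<^sup>2)"
      using brk_nonneg[OF assms(1)[of undefined]] brk_nonneg[OF assms(2)] assms(3)[of undefined] by linarith
  qed
  finally show ?thesis by simp
qed

lemma consistency:
  assumes g: "CS (2 * q + 4) g" and per: "periodic a b g" and p: "\<And>K. K \<in> \<T> \<Longrightarrow> p K \<in> Qpoly q"
  shows "(\<Sum>K\<in>\<T>. \<Sum>i\<in>UNIV. Bf low K (\<lambda>K. tensor_radau low q K g) (p K) i)
    = - (\<Sum>i\<in>UNIV. ip (\<lambda>K. cross_radau low q K i (pd i (pd i g))) p)"
proof -
  have g5: "CS 5 g" by (rule JS_le[OF g]) (use q1 in simp)
  have "(\<Sum>K\<in>\<T>. \<Sum>i\<in>UNIV. Bf low K (\<lambda>K. tensor_radau low q K g) (p K) i)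
     = (\<Sum>K\<in>\<T>. \<Sum>i\<in>UNIV. - bint K (\<lambda>x. cross_radau low q K i (pd i (pd i g)) x * p K x))"
    by (intro sum.cong refl Bf_tensor g5 per p)
  also have "\<dots> = (\<Sum>i\<in>UNIV. \<Sum>K\<in>\<T>. - bint K (\<lambda>x. cross_radau low q K i (pd i (pd i g)) x * p K x))"
    by (rule sum.swap)
  finally show ?thesis by (simp add: ip_def brk_def sum_negf)
qed

abbreviation "U \<equiv> pc uh"
abbreviation "V \<equiv> pc vh"
abbreviation "W \<equiv> pc wh"
abbreviation "V' \<equiv> pc (dt T vh)"
abbreviation "W' \<equiv> pc (dt T wh)"
abbreviation "\<xi> t K \<equiv> tensor_radau False q K (w t)"

lemma pcs:
  assumes "t \<in> {0..T}" "K \<in> \<T>"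
  shows "U t K \<in> Qpoly q" "V t K \<in> Qpoly q" "W t K \<in> Qpoly q" "V' t K \<in> Qpoly q" "W' t K \<in> Qpoly q"
  using assms by (simp_all add: pc_disc(1) pc_dt(1) disc_sol)

lemma pcs_cont:
  assumes "t \<in> {0..T}"
  shows "pcont (U t)" "pcont (V t)" "pcont (W t)" "pcont (V' t)" "pcont (W' t)"
  using pcs[OF assms] by (auto intro!: pcont_Qpoly)

lemma CS2_w: "t \<in> {0..T} \<Longrightarrow> CS 2 (w t)" and CS2_v: "t \<in> {0..T} \<Longrightarrow> CS 2 (v t)"
  by (rule JS_le[OF JS_static[OF w_JS]], simp, simp, rule JS_le[OF JS_static[OF v_JS]]) simp_all

lemma tested_v:
  assumes t: "t \<in> {0..T}" and p: "\<And>K. K \<in> \<T> \<Longrightarrow> p K \<in> Qpoly q"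
  shows "ip (V' t) p = - qd (\<lambda>K x. p K x * U t K x) - \<mu> * ip (V t) p - qd (\<lambda>K x. p K x * f (U t K x))
    + (\<Sum>K\<in>\<T>. \<Sum>i\<in>UNIV. Bf False K (W t) (p K) i)"
proof -
  note c = pcs_cont[OF t] pcont_Qpoly[OF p]
  have "brk (\<lambda>K x. (V' t K x * p K x + U t K x * p K x) + \<mu> * (V t K x * p K x)) + qd (\<lambda>K x. p K x * f (U t K x))
      = (\<Sum>K\<in>\<T>. \<Sum>i\<in>UNIV. Bf False K (W t) (p K) i)"
    unfolding brk_def qd_def sum.distrib[symmetric] mult.assoc[symmetric] by (intro sum.cong refl scheme_v t p)
  moreover have "brk (\<lambda>K x. (V' t K x * p K x + U t K x * p K x) + \<mu> * (V t K x * p K x)) = ip (V' t) p + ip (U t) p + \<mu> * ip (V t) p"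
    by (simp only: brk_add brk_cmult pcont_intros c ip_def)
  moreover have "ip (U t) p = qd (\<lambda>K x. p K x * U t K x)"
    unfolding ip_def by (subst qd_prod[symmetric, OF pcs(1)[OF t] p]) (simp_all add: mult.commute)
  ultimately show ?thesis by linarith
qed

lemma tested_w:
  assumes t: "t \<in> {0..T}" and p: "\<And>K. K \<in> \<T> \<Longrightarrow> p K \<in> Qpoly q"
  shows "ip (W' t) p = - (\<Sum>K\<in>\<T>. \<Sum>i\<in>UNIV. Bf True K (V t) (p K) i)"
proof -
  have "ip (W' t) p = (\<Sum>K\<in>\<T>. - (\<Sum>i\<in>UNIV. Bf True K (V t) (p K) i))"
    unfolding ip_def brk_def by (intro sum.cong refl scheme_w t p)
  then show ?thesis by (simp add: sum_negf)
qed

lemma Bf_diff_sum: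
  assumes "\<And>K. K \<in> \<T> \<Longrightarrow> F K \<in> Qpoly q" "\<And>K. K \<in> \<T> \<Longrightarrow> G K \<in> Qpoly q" "\<And>K. K \<in> \<T> \<Longrightarrow> p K \<in> Qpoly q"
  shows "(\<Sum>K\<in>\<T>. \<Sum>i\<in>UNIV. Bf low K G (p K) i)
    = (\<Sum>K\<in>\<T>. \<Sum>i\<in>UNIV. Bf low K F (p K) i) - (\<Sum>K\<in>\<T>. \<Sum>i\<in>UNIV. Bf low K (\<lambda>K x. F K x - G K x) (p K) i)"
proof -
  have "Bf low K (\<lambda>K x. F K x - G K x) (p K) i = Bf low K F (p K) i - Bf low K G (p K) i" if "K \<in> \<T>" for K i
    by (rule Bf_diff[OF that]) (use assms that in \<open>blast intro: CS_Qpoly\<close>)+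
  then show ?thesis by (simp add: sum_subtractf)
qed

lemma second_cont:
  assumes "CS (2 * q + 4) g"
  shows "pcont (\<lambda>K. pd i (pd i g))" "pcont (\<lambda>K. cross_radau low q K i (pd i (pd i g)))"
proof -
  have "CS (2 * q + 2) (\<lambda>x. pds [i, i] g x)" by (rule JS_pds[OF assms]) simp
  then have 2: "CS (2 * q + 2) (pd i (pd i g))" by (simp only: pds.simps)
  show "pcont (\<lambda>K. pd i (pd i g))" by (rule pcont_fun[OF CS_continuous[OF 2]])
  show "pcont (\<lambda>K. cross_radau low q K i (pd i (pd i g)))" by (rule cross_cont[OF JS_le[OF 2]]) simp
qed

lemma v_cont: "t \<in> {0..T} \<Longrightarrow> pcont (\<lambda>K. v t)" and acc_cont: "t \<in> {0..T} \<Longrightarrow> pcont (\<lambda>K. acc t)"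
  and src_cont: "t \<in> {0..T} \<Longrightarrow> pcont (\<lambda>K. src t)"
  by (rule pcont_fun[OF CS_continuous[OF src_CS(3)]] pcont_fun[OF CS_continuous[OF src_CS(1)]] pcont_fun[OF CS_continuous[OF src_CS(4)]], assumption)+

text \<open>The third equation of the scheme subtracted from the differential equation. The terms u
  + f(u) are moved under the nodal sum, which leaves the quadrature error of \<open>src\<close> and
  differences at the nodes; the Laplacian of w is matched by the form applied to
  \<open>\<xi>\<close> through \<open>consistency\<close>. \<open>Z\<close> will be the projection
  of z_t.\<close>

lemma v_error_eq:
  assumes t: "t \<in> {0..T}" and p: "\<And>K. K \<in> \<T> \<Longrightarrow> p K \<in> Qpoly q" and Z: "pcont Z"
  shows "ip (\<lambda>K x. Z K x - V' t K x) p = ip (\<lambda>K x. Z K x - acc t x) p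
    + (\<Sum>i\<in>UNIV. ip (\<lambda>K x. cross_radau False q K i (pd i (pd i (w t))) x - pd i (pd i (w t)) x) p)
    - \<mu> * ip (\<lambda>K x. v t x - V t K x) p
    + (qd (\<lambda>K x. p K x * src t x) - brk (\<lambda>K x. p K x * src t x))
    - qd (\<lambda>K x. p K x * (u t x - U t K x)) - qd (\<lambda>K x. p K x * (f (u t x) - f (U t K x)))
    + (\<Sum>K\<in>\<T>. \<Sum>i\<in>UNIV. Bf False K (\<lambda>K x. \<xi> t K x - W t K x) (p K) i)"
proof -
  have w4: "CS (2 * q + 4) (w t)" by (rule JS_static[OF w_JS t])
  note c = pcs_cont[OF t] pcont_Qpoly[OF p] Z v_cont[OF t] acc_cont[OF t] src_cont[OF t]
  note wc = second_cont(1,2)[OF w4]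
  have xi: "\<xi> t K \<in> Qpoly q" if "K \<in> \<T>" for K by (rule tensor_Q[OF CS2_w[OF t] that])
  have per: "periodic a b (w t)"
  proof -
    have "periodic a b (pds [i, i] (u t))" for i using v_periodic[OF t] by (rule periodic_pds)
    then show ?thesis unfolding periodic_def lap_pds by simp
  qed
  have a: "ip (\<lambda>K. acc t) p = - (\<Sum>i\<in>UNIV. ip (\<lambda>K. pd i (pd i (w t))) p) - \<mu> * ip (\<lambda>K. v t) p - ip (\<lambda>K. src t) p"
  proof -
    have "ip (\<lambda>K x. (\<Sum>i\<in>UNIV. pd i (pd i (w t)) x) + (\<mu> * v t x + src t x)) p = ip (\<lambda>K x. (- 1) * acc t x) p"
      unfolding ip_def src_def by (intro brk_cong) (simp add: lap_def)
    moreover have "ip (\<lambda>K x. (\<Sum>i\<in>UNIV. pd i (pd i (w t)) x) + (\<mu> * v t x + src t x)) p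
        = (\<Sum>i\<in>UNIV. ip (\<lambda>K. pd i (pd i (w t))) p) + (\<mu> * ip (\<lambda>K. v t) p + ip (\<lambda>K. src t) p)"
      by (simp only: ip_add ip_cmult ip_sum pcont_intros c wc)
    moreover have "ip (\<lambda>K x. (- 1) * acc t x) p = (- 1) * ip (\<lambda>K. acc t) p" by (rule ip_cmult)
    ultimately show ?thesis by linarith
  qed
  have cr: "(\<Sum>i\<in>UNIV. ip (\<lambda>K x. cross_radau False q K i (pd i (pd i (w t))) x - pd i (pd i (w t)) x) p)
     = (\<Sum>i\<in>UNIV. ip (\<lambda>K. cross_radau False q K i (pd i (pd i (w t)))) p) - (\<Sum>i\<in>UNIV. ip (\<lambda>K. pd i (pd i (w t))) p)"
    by (simp add: ip_diff wc c sum_subtractf)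
  have q1: "qd (\<lambda>K x. p K x * src t x) = qd (\<lambda>K x. p K x * u t x) + qd (\<lambda>K x. p K x * f (u t x))"
    unfolding qd_add[symmetric] using src[OF t] by (simp add: distrib_left)
  have q2: "qd (\<lambda>K x. p K x * (u t x - U t K x)) = qd (\<lambda>K x. p K x * u t x) - qd (\<lambda>K x. p K x * U t K x)"
    "qd (\<lambda>K x. p K x * (f (u t x) - f (U t K x))) = qd (\<lambda>K x. p K x * f (u t x)) - qd (\<lambda>K x. p K x * f (U t K x))"
    unfolding qd_diff[symmetric] by (simp_all add: right_diff_distrib)
  have s: "brk (\<lambda>K x. p K x * src t x) = ip (\<lambda>K. src t) p" unfolding ip_def by (simp add: mult.commute)
  have d: "ip (\<lambda>K x. Z K x - V' t K x) p = ip Z p - ip (V' t) p" "ip (\<lambda>K x. Z K x - acc t x) p = ip Z p - ip (\<lambda>K. acc t) p"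
    "ip (\<lambda>K x. v t x - V t K x) p = ip (\<lambda>K. v t) p - ip (V t) p"
    by (simp_all only: ip_diff c)
  show ?thesis
    using tested_v[where p = p, OF t p] Bf_diff_sum[where F = "\<xi> t" and G = "W t" and p = p and low = False, OF xi pcs(3)[OF t] p]
      consistency[where p = p and low = False, OF w4 per p]
    unfolding d s q1 q2 cr a right_diff_distrib[of \<mu>] by linarith
qed

text \<open>The analogue for the second equation. Exchanging v for z costs the difference of their
  second derivatives, which is why \<open>comparator\<close> includes derivatives of v - z.\<close>

lemma w_error_eq:
  assumes t: "t \<in> {0..T}" and p: "\<And>K. K \<in> \<T> \<Longrightarrow> p K \<in> Qpoly q" and G: "pcont G"
    and z: "CS (2 * q + 4) z" and per: "periodic a b z"
  shows "ip (\<lambda>K x. G K x - W' t K x) p = ip (\<lambda>K x. G K x - lap (v t) x) p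
    + (\<Sum>i\<in>UNIV. ip (\<lambda>K x. pd i (pd i (v t)) x - pd i (pd i z) x) p)
    + (\<Sum>i\<in>UNIV. ip (\<lambda>K x. pd i (pd i z) x - cross_radau True q K i (pd i (pd i z)) x) p)
    - (\<Sum>K\<in>\<T>. \<Sum>i\<in>UNIV. Bf True K (\<lambda>K x. tensor_radau True q K z x - V t K x) (p K) i)"
proof -
  have v4: "CS (2 * q + 4) (v t)" by (rule JS_static[OF v_JS t])
  have lv: "pcont (\<lambda>K. lap (v t))" by (rule pcont_fun[OF JS_cont_x[OF lapv_JS t]])
  note c = pcs_cont[OF t] pcont_Qpoly[OF p] G lv second_cont(1,2)[OF v4] second_cont(1,2)[OF z]
  have ze: "tensor_radau True q K z \<in> Qpoly q" if "K \<in> \<T>" for K by (rule tensor_Q[OF JS_le[OF z] that]) simp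
  have l: "ip (\<lambda>K. lap (v t)) p = (\<Sum>i\<in>UNIV. ip (\<lambda>K. pd i (pd i (v t))) p)"
    using ip_sum[of "\<lambda>i K. pd i (pd i (v t))" p] c by (simp add: lap_def[abs_def])
  have d: "ip (\<lambda>K x. G K x - W' t K x) p = ip G p - ip (W' t) p" "ip (\<lambda>K x. G K x - lap (v t) x) p = ip G p - ip (\<lambda>K. lap (v t)) p"
    "ip (\<lambda>K x. pd i (pd i (v t)) x - pd i (pd i z) x) p = ip (\<lambda>K. pd i (pd i (v t))) p - ip (\<lambda>K. pd i (pd i z)) p"
    "ip (\<lambda>K x. pd i (pd i z) x - cross_radau True q K i (pd i (pd i z)) x) p = ip (\<lambda>K. pd i (pd i z)) p - ip (\<lambda>K. cross_radau True q K i (pd i (pd i z))) p" for i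
    by (simp_all only: ip_diff c)
  show ?thesis
    using tested_w[where p = p, OF t p] Bf_diff_sum[where F = "\<lambda>K. tensor_radau True q K z" and G = "V t" and p = p and low = True, OF ze pcs(2)[OF t] p]
      consistency[where p = p and low = True, OF z per p]
    unfolding d sum_subtractf l by linarith
qed

lemma skew:
  assumes "\<And>K. K \<in> \<T> \<Longrightarrow> F K \<in> Qpoly q" "\<And>K. K \<in> \<T> \<Longrightarrow> G K \<in> Qpoly q"
  shows "(\<Sum>K\<in>\<T>. \<Sum>i\<in>UNIV. Bf True K F (G K) i) = (\<Sum>K\<in>\<T>. \<Sum>i\<in>UNIV. Bf False K G (F K) i)"
proof -
  have "(\<Sum>K\<in>\<T>. Bf True K F (G K) i) = (\<Sum>K\<in>\<T>. Bf False K G (F K) i)" for i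
    by (rule Bf_skew) (use assms in \<open>blast intro: CS_Qpoly\<close>)+
  then show ?thesis by (subst (1 2) sum.swap) simp
qed

text \<open>The functions \<open>z\<close> admissible in the energy; \<open>\<kappa>\<close> bounds the only residual that is small for
  the difference quotient but not for the frozen comparison function.\<close>

definition comparator :: "(real \<Rightarrow> real ^ 'n \<Rightarrow> real) \<Rightarrow> (real \<Rightarrow> real ^ 'n \<Rightarrow> real) \<Rightarrow> real \<Rightarrow> real \<Rightarrow> real \<Rightarrow> bool" where
  "comparator z z' t0 t1 \<kappa> \<longleftrightarrow> 0 \<le> t0 \<and> t1 \<le> T \<and> JS (2 * q + 4) {t0..t1} z \<and> JS 2 {t0..t1} z' \<and>
     (\<forall>t\<in>{t0..t1}. periodic a b (z t) \<and>
       (\<forall>x. ((\<lambda>s. z s x) has_real_derivative z' t x) (at t within {t0..t1})) \<and>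
       (\<forall>is x. length is \<le> 2 * q + 4 \<longrightarrow> x \<in> cbox a b \<longrightarrow> \<bar>pds is (z t) x\<bar> \<le> S) \<and>
       (\<forall>js. length js \<le> q + 1 \<longrightarrow> brk (\<lambda>K x. (pds js (v t) x - pds js (z t) x)\<^sup>2) \<le> S\<^sup>2 * h ^ (2 * q + 2)) \<and>
       brk (\<lambda>K x. (tensor_radau True q K (z' t) x - acc t x)\<^sup>2) \<le> \<kappa>)"

text \<open>Nodal sums throughout, so that only derivatives at the nodes are needed in time. In the
  last two parts the arguments are polynomials on each element and the sums are squared L^2 norms;
  the first part remains nodal, and there the Lipschitz bound of \<open>f\<close> is
  applied.\<close>

definition energy :: "(real \<Rightarrow> real ^ 'n \<Rightarrow> real) \<Rightarrow> real \<Rightarrow> real" where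
  "energy z t = qd (\<lambda>K x. (u t x - uh t x)\<^sup>2) + qd (\<lambda>K x. (tensor_radau True q K (z t) x - vh t x)\<^sup>2)
     + qd (\<lambda>K x. (\<xi> t K x - wh t x)\<^sup>2)"

lemma energy_eq:
  assumes t: "t \<in> {0..T}" and z: "CS 2 (z t)"
  shows "energy z t = qd (\<lambda>K x. (u t x - U t K x)\<^sup>2) + brk (\<lambda>K x. (tensor_radau True q K (z t) x - V t K x)\<^sup>2)
     + brk (\<lambda>K x. (\<xi> t K x - W t K x)\<^sup>2)"
proof -
  have e: "qd (\<lambda>K x. (F K x - g t x)\<^sup>2) = qd (\<lambda>K x. (F K x - pc g t K x)\<^sup>2)" if "disc g" for F g
    by (rule qd_cong) (simp add: pc_disc(2)[OF that t])
  show ?thesis unfolding energy_def e[OF disc_sol(1)] e[OF disc_sol(2)] e[OF disc_sol(3)]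
    by (subst qd_sq, (intro Qpoly_diff tensor_Q z CS2_w t pcs; assumption))+ (rule refl)
qed

lemma qd_DERIV:
  assumes "\<And>K j. K \<in> \<T> \<Longrightarrow> j < m K \<Longrightarrow> ((\<lambda>s. G s K (Y K j)) has_real_derivative G' K (Y K j)) (at t within I)"
  shows "((\<lambda>s. qd (G s)) has_real_derivative qd G') (at t within I)"
  unfolding qd_def quad_def by (intro DERIV_sum DERIV_cmult assms) auto

text \<open>The first summand relies on \<open>uh_DERIV\<close>, the other two on the fact that the
  tensor projection commutes with the derivative in time.\<close>

lemma energy_DERIV:
  assumes c: "comparator z z' t0 t1 \<kappa>" and t: "t \<in> {t0..t1}"
  shows "(energy z has_real_derivative 2 * qd (\<lambda>K x. (u t x - U t K x) * (v t x - V t K x))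
     + 2 * ip (\<lambda>K x. tensor_radau True q K (z' t) x - V' t K x) (\<lambda>K x. tensor_radau True q K (z t) x - V t K x)
     + 2 * ip (\<lambda>K x. tensor_radau False q K (lap (v t)) x - W' t K x) (\<lambda>K x. \<xi> t K x - W t K x)) (at t within {t0..t1})"
proof -
  have sub: "{t0..t1} \<subseteq> {0..T}" and z: "JS (2 * q + 4) {t0..t1} z" and z': "JS 2 {t0..t1} z'"
    and dz: "\<And>t x. t \<in> {t0..t1} \<Longrightarrow> ((\<lambda>s. z s x) has_real_derivative z' t x) (at t within {t0..t1})"
    using c unfolding comparator_def by auto
  have tT: "t \<in> {0..T}" using sub t by blast
  note ds = DERIV_subset[OF _ sub]
  have z2: "JS 2 {t0..t1} z" by (rule JS_le[OF z]) simp
  have w2: "JS 2 {0..T} w" "JS 2 {0..T} (\<lambda>t. lap (v t))" by (rule JS_le[OF w_JS], simp, rule JS_le[OF lapv_JS], simp)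
  have dze: "((\<lambda>t. tensor_radau True q K (z t) x) has_real_derivative tensor_radau True q K (z' t) x) (at t within {t0..t1})" if "K \<in> \<T>" for K x
    by (rule element.tensor_dt[OF element_T[OF that] _ _ dz t]) (use z2 z' in \<open>simp_all add: eval_nat_numeral del: JS.simps\<close>)
  have dxi: "((\<lambda>t. \<xi> t K x) has_real_derivative tensor_radau False q K (lap (v t)) x) (at t within {0..T})" if "K \<in> \<T>" for K x
    by (rule element.tensor_dt[OF element_T[OF that] _ _ w_DERIV tT]) (use w2 in \<open>simp_all add: eval_nat_numeral del: JS.simps\<close>)
  have sq: "((\<lambda>s. (F s - G s)\<^sup>2) has_real_derivative 2 * ((F t - G t) * (F' - G'))) (at t within {t0..t1})"
    if "(F has_real_derivative F') (at t within {t0..t1})" "(G has_real_derivative G') (at t within {t0..t1})" for F G :: "real \<Rightarrow> real" and F' G'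
    using DERIV_power[OF DERIV_diff[OF that], of 2] by (simp add: mult_ac)
  have V: "vh t (Y K j) = V t K (Y K j)" "wh t (Y K j) = W t K (Y K j)" "uh t (Y K j) = U t K (Y K j)" if "K \<in> \<T>" "j < m K" for K j
    using pc_disc(2)[OF _ tT that(1) node[OF that]] disc_sol by auto
  have 1: "((\<lambda>t. qd (\<lambda>K x. (u t x - uh t x)\<^sup>2)) has_real_derivative qd (\<lambda>K x. 2 * ((u t x - U t K x) * (v t x - V t K x)))) (at t within {t0..t1})"
  proof (rule qd_DERIV)
    fix K j assume k: "K \<in> \<T>" "j < m K"
    show "((\<lambda>s. (u s (Y K j) - uh s (Y K j))\<^sup>2) has_real_derivative 2 * ((u t (Y K j) - U t K (Y K j)) * (v t (Y K j) - V t K (Y K j)))) (at t within {t0..t1})"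
      using sq[OF ds[OF u_DERIV[OF tT]] ds[OF uh_DERIV[OF tT k]], of "Y K j"] V[OF k] by simp
  qed
  have 2: "((\<lambda>t. qd (\<lambda>K x. (tensor_radau True q K (z t) x - vh t x)\<^sup>2)) has_real_derivative
      qd (\<lambda>K x. 2 * ((tensor_radau True q K (z t) x - V t K x) * (tensor_radau True q K (z' t) x - V' t K x)))) (at t within {t0..t1})"
  proof (rule qd_DERIV)
    fix K j assume k: "K \<in> \<T>" "j < m K"
    show "((\<lambda>s. (tensor_radau True q K (z s) (Y K j) - vh s (Y K j))\<^sup>2) has_real_derivative
        2 * ((tensor_radau True q K (z t) (Y K j) - V t K (Y K j)) * (tensor_radau True q K (z' t) (Y K j) - V' t K (Y K j)))) (at t within {t0..t1})"
      using sq[OF dze[OF k(1)] ds[OF pc_dt(3)[OF disc_sol(2) tT k(1) node[OF k]]], of "Y K j"] V[OF k] by simp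
  qed
  have 3: "((\<lambda>t. qd (\<lambda>K x. (\<xi> t K x - wh t x)\<^sup>2)) has_real_derivative
      qd (\<lambda>K x. 2 * ((\<xi> t K x - W t K x) * (tensor_radau False q K (lap (v t)) x - W' t K x)))) (at t within {t0..t1})"
  proof (rule qd_DERIV)
    fix K j assume k: "K \<in> \<T>" "j < m K"
    show "((\<lambda>s. (\<xi> s K (Y K j) - wh s (Y K j))\<^sup>2) has_real_derivative
        2 * ((\<xi> t K (Y K j) - W t K (Y K j)) * (tensor_radau False q K (lap (v t)) (Y K j) - W' t K (Y K j)))) (at t within {t0..t1})"
      using sq[OF ds[OF dxi[OF k(1)]] ds[OF pc_dt(3)[OF disc_sol(3) tT k(1) node[OF k]]], of "Y K j"] V[OF k] by simp
  qed
  have zt: "CS 2 (z t)" "CS 2 (z' t)" "CS 2 (lap (v t))" using JS_static[OF z2 t] JS_static[OF z' t] JS_static[OF w2(2) tT] by auto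
  have e2: "qd (\<lambda>K x. 2 * ((tensor_radau True q K (z t) x - V t K x) * (tensor_radau True q K (z' t) x - V' t K x)))
      = 2 * ip (\<lambda>K x. tensor_radau True q K (z' t) x - V' t K x) (\<lambda>K x. tensor_radau True q K (z t) x - V t K x)"
    unfolding qd_cmult ip_commute[of "\<lambda>K x. tensor_radau True q K (z' t) x - V' t K x"] unfolding ip_def
    by (subst qd_prod) (auto intro!: Qpoly_diff tensor_Q zt pcs tT)
  have e3: "qd (\<lambda>K x. 2 * ((\<xi> t K x - W t K x) * (tensor_radau False q K (lap (v t)) x - W' t K x)))
      = 2 * ip (\<lambda>K x. tensor_radau False q K (lap (v t)) x - W' t K x) (\<lambda>K x. \<xi> t K x - W t K x)"
    unfolding qd_cmult ip_commute[of "\<lambda>K x. tensor_radau False q K (lap (v t)) x - W' t K x"] unfolding ip_def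
    by (subst qd_prod) (auto intro!: Qpoly_diff tensor_Q zt CS2_w pcs tT)
  from DERIV_add[OF DERIV_add[OF 1 2] 3] show ?thesis
    unfolding e2 e3 energy_def[abs_def] by (simp only: qd_cmult)
qed

end

text \<open>Under the differential inequality, exp(-A (s - t0)) (E + B / A) has a nonpositive
  derivative. The quotient B / A is essential: with A of size 1 / \<tau> the contribution of B
  shrinks with \<tau>.\<close>

lemma gronwall:
  fixes E E' :: "real \<Rightarrow> real"
  assumes d: "\<And>t. t \<in> {t0..t1} \<Longrightarrow> (E has_real_derivative E' t) (at t within {t0..t1})"
    and le: "\<And>t. t \<in> {t0..t1} \<Longrightarrow> E' t \<le> A * E t + B" and A: "A > 0" and B: "B \<ge> 0" and t: "t0 \<le> t1"
  shows "E t1 \<le> exp (A * (t1 - t0)) * (E t0 + B / A)"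
proof (cases "t0 = t1")
  case True
  then show ?thesis using A B by simp
next
  case False
  then have lt: "t0 < t1" using t by simp
  define G where "G s = exp (- A * (s - t0)) * (E s + B / A)" for s
  define G' where "G' s = exp (- A * (s - t0)) * (E' s - A * E s - B)" for s
  have "(G has_real_derivative G' s) (at s within {t0..t1})" if "s \<in> {t0..t1}" for s
  proof -
    have e: "((\<lambda>s. exp (- A * (s - t0))) has_real_derivative - A * exp (- A * (s - t0))) (at s within {t0..t1})"
      by (auto intro!: derivative_eq_intros)
    have AB: "A * (B / A) = B" using A by simp
    have "(- A * x) * (y + B / A) + (z + 0) * x = x * (z - A * y - A * (B / A))" for x y z
      by (simp add: algebra_simps del: times_divide_eq_right)
    then have eq: "(- A * exp (- A * (s - t0))) * (E s + B / A) + (E' s + 0) * exp (- A * (s - t0)) = G' s"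
      unfolding G'_def AB by blast
    have "((\<lambda>s. exp (- A * (s - t0)) * (E s + B / A)) has_real_derivative
        (- A * exp (- A * (s - t0))) * (E s + B / A) + (E' s + 0) * exp (- A * (s - t0))) (at s within {t0..t1})"
      by (rule DERIV_mult[OF e DERIV_add[OF d[OF that] DERIV_const]])
    then show ?thesis unfolding eq G_def[abs_def] .
  qed
  then have "(G has_derivative (\<lambda>h. h * G' s)) (at s within {t0..t1})" if "t0 \<le> s" "s \<le> t1" for s
    using that by (simp add: has_field_derivative_def mult_commute_abs)
  from mvt_simple[OF lt this] obtain s where s: "s \<in> {t0<..<t1}" and e: "G t1 - G t0 = (t1 - t0) * G' s" by blast
  have "G' s \<le> 0" unfolding G'_def using le[of s] s by (intro mult_nonneg_nonpos) auto
  then have "G t1 \<le> G t0" using e lt mult_nonneg_nonpos[of "t1 - t0" "G' s"] by simp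
  then have le: "exp (A * (t1 - t0)) * G t1 \<le> exp (A * (t1 - t0)) * G t0" by simp
  have "exp (A * (t1 - t0)) * exp (- A * (t1 - t0)) = 1" by (simp flip: exp_add)
  then have "exp (A * (t1 - t0)) * G t1 = E t1 + B / A" unfolding G_def mult.assoc[symmetric] by simp
  moreover have "G t0 = E t0 + B / A" by (simp add: G_def)
  moreover have "B / A \<ge> 0" using A B by simp
  ultimately have "E t1 + B / A \<le> exp (A * (t1 - t0)) * (E t0 + B / A)" "B / A \<ge> 0" using le by simp_all
  then show ?thesis by linarith
qed

context dg_error
begin

lemma ip_young_neg: "pcont F \<Longrightarrow> pcont P \<Longrightarrow> - 2 * ip F P \<le> brk (\<lambda>K x. (F K x)\<^sup>2) + brk (\<lambda>K x. (P K x)\<^sup>2)"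
  using ip_young[of "\<lambda>K x. - 1 * F K x" P] unfolding ip_cmult by (simp add: pcont_intros)

lemma qd_young_neg: "- 2 * qd (\<lambda>K x. F K x * G K x) \<le> qd (\<lambda>K x. (F K x)\<^sup>2) + qd (\<lambda>K x. (G K x)\<^sup>2)"
  using qd_young[of 1 "\<lambda>K x. - 1 * F K x" G] unfolding mult.assoc qd_cmult by simp

lemma u_cont: "t \<in> {0..T} \<Longrightarrow> pcont (\<lambda>K. u t)" and w_cont: "t \<in> {0..T} \<Longrightarrow> pcont (\<lambda>K. w t)"
  by (rule pcont_fun[OF JS_cont_x[OF u_JS]] pcont_fun[OF JS_cont_x[OF w_JS]], assumption)+

text \<open>v is no polynomial, so its Taylor polynomial p mediates: from v to p at the nodes, from
  p back to v in L^2, and from there to Z. The factors are 6 = 2 + 4 and 8 = 2 * 2 * 2.\<close>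

lemma node_v:
  assumes t: "t \<in> {0..T}" and Z: "\<And>K. K \<in> \<T> \<Longrightarrow> Z K \<in> Qpoly q"
  shows "qd (\<lambda>K x. (v t x - V t K x)\<^sup>2) \<le> 6 * (c_taylor * h ^ (2 * q + 2)) + 8 * brk (\<lambda>K x. (v t x - Z K x)\<^sup>2) + 8 * brk (\<lambda>K x. (Z K x - V t K x)\<^sup>2)"
proof -
  have "CS (2 * q + 1) (v t)" by (rule JS_le[OF JS_static[OF v_JS t]]) simp
  then obtain p where p: "\<And>K. K \<in> \<T> \<Longrightarrow> p K \<in> Qpoly q"
    and b: "brk (\<lambda>K x. (v t x - p K x)\<^sup>2) \<le> c_taylor * h ^ (2 * q + 2)" and d: "qd (\<lambda>K x. (v t x - p K x)\<^sup>2) \<le> c_taylor * h ^ (2 * q + 2)"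
    using taylor_sq[of "v t"] Sv[OF t] by auto
  have "pcont p" "pcont Z" by (rule pcont_Qpoly[OF p] pcont_Qpoly[OF Z], assumption)+
  note c = v_cont[OF t] pcs_cont(2)[OF t] this
  have "qd (\<lambda>K x. (p K x - V t K x)\<^sup>2) = brk (\<lambda>K x. (p K x - V t K x)\<^sup>2)"
    by (rule qd_sq) (intro Qpoly_diff p pcs t; assumption)
  moreover have "brk (\<lambda>K x. (p K x - V t K x)\<^sup>2) \<le> 2 * brk (\<lambda>K x. (p K x - v t x)\<^sup>2) + 2 * brk (\<lambda>K x. (v t x - V t K x)\<^sup>2)"
    by (rule brk_sq_tri) (fact c)+
  moreover have "brk (\<lambda>K x. (p K x - v t x)\<^sup>2) = brk (\<lambda>K x. (v t x - p K x)\<^sup>2)" by (simp add: power2_commute)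
  moreover have "brk (\<lambda>K x. (v t x - V t K x)\<^sup>2) \<le> 2 * brk (\<lambda>K x. (v t x - Z K x)\<^sup>2) + 2 * brk (\<lambda>K x. (Z K x - V t K x)\<^sup>2)"
    by (rule brk_sq_tri) (fact c)+
  moreover have "qd (\<lambda>K x. (v t x - V t K x)\<^sup>2) \<le> 2 * qd (\<lambda>K x. (v t x - p K x)\<^sup>2) + 2 * qd (\<lambda>K x. (p K x - V t K x)\<^sup>2)"
    by (rule qd_sq_tri)
  ultimately show ?thesis using b d by linarith
qed

definition c_tensor :: real where
  "c_tensor = (24 + 192 * H ^ (2 * q + 2)) * S\<^sup>2 * vol"

text \<open>A generous sum: each consistency error of the energy estimate other than
  \<open>\<kappa>\<close> is at most a fixed multiple, possibly involving \<mu>, of it times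
  h^(2q+2).\<close>

definition c_approx :: real where
  "c_approx = 2 * S\<^sup>2 + 8 * c_tensor + c_taylor + 8 * S\<^sup>2 * vol + c_quad"

lemma c_nonneg: "c_tensor \<ge> 0" "c_quad \<ge> 0" "c_approx \<ge> 0"
proof -
  show t: "c_tensor \<ge> 0" unfolding c_tensor_def using H0 by simp
  show "c_quad \<ge> 0" unfolding c_quad_def by (intro mult_nonneg_nonneg add_nonneg_nonneg) auto
  then show "c_approx \<ge> 0" unfolding c_approx_def using t c_taylor0 by simp
qed

lemma comparatorD:
  assumes c: "comparator z z' t0 t1 \<kappa>" and t: "t \<in> {t0..t1}"
  shows "t \<in> {0..T}" "CS (2 * q + 4) (z t)" "CS 2 (z' t)" "periodic a b (z t)"
    "length is \<le> 2 * q + 4 \<Longrightarrow> x \<in> cbox a b \<Longrightarrow> \<bar>pds is (z t) x\<bar> \<le> S"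
    "length is \<le> q + 1 \<Longrightarrow> brk (\<lambda>K x. (pds is (v t) x - pds is (z t) x)\<^sup>2) \<le> S\<^sup>2 * h ^ (2 * q + 2)"
    "brk (\<lambda>K x. (tensor_radau True q K (z' t) x - acc t x)\<^sup>2) \<le> \<kappa>"
proof -
  have j: "JS (2 * q + 4) {t0..t1} z" "JS 2 {t0..t1} z'" using c unfolding comparator_def by auto
  show "CS (2 * q + 4) (z t)" "CS 2 (z' t)" using JS_static[OF j(1) t] JS_static[OF j(2) t] .
qed (use c t in \<open>auto simp: comparator_def\<close>)

lemma zeta_error:
  assumes c: "comparator z z' t0 t1 \<kappa>" and t: "t \<in> {t0..t1}"
  shows "brk (\<lambda>K x. (v t x - tensor_radau True q K (z t) x)\<^sup>2) \<le> 2 * (S\<^sup>2 * h ^ (2 * q + 2)) + 2 * (c_tensor * h ^ (2 * q + 2))"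
proof -
  note C = comparatorD[OF c t]
  have z2: "CS (2 * q + 2) (z t)" by (rule JS_le[OF C(2)]) simp
  have 1: "brk (\<lambda>K x. (tensor_radau True q K (z t) x - z t x)\<^sup>2) \<le> c_tensor * h ^ (2 * q + 2)"
    unfolding c_tensor_def by (rule tensor_nsq[OF z2 C(5)]) auto
  have "brk (\<lambda>K x. (v t x - tensor_radau True q K (z t) x)\<^sup>2) \<le> 2 * brk (\<lambda>K x. (v t x - z t x)\<^sup>2) + 2 * brk (\<lambda>K x. (z t x - tensor_radau True q K (z t) x)\<^sup>2)"
    by (rule brk_sq_tri[OF v_cont[OF C(1)] pcont_fun[OF CS_continuous[OF z2]] tensor_cont[OF JS_le[OF C(2)]]]) simp
  moreover have "brk (\<lambda>K x. (z t x - tensor_radau True q K (z t) x)\<^sup>2) = brk (\<lambda>K x. (tensor_radau True q K (z t) x - z t x)\<^sup>2)" by (simp add: power2_commute)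
  ultimately show ?thesis using 1 C(6)[of "[]"] by simp
qed

lemma xi_error:
  assumes t: "t \<in> {0..T}"
  shows "brk (\<lambda>K x. (\<xi> t K x - w t x)\<^sup>2) \<le> c_tensor * h ^ (2 * q + 2)"
  unfolding c_tensor_def by (rule tensor_nsq[OF JS_le[OF JS_static[OF w_JS t]]]) (use Sw[OF t] in auto)

lemma second_error:
  assumes g: "CS (2 * q + 4) g" and B: "\<And>is x. length is \<le> 2 * q + 4 \<Longrightarrow> x \<in> cbox a b \<Longrightarrow> \<bar>pds is g x\<bar> \<le> S"
  shows "brk (\<lambda>K x. (cross_radau low q K i (pd i (pd i g)) x - pd i (pd i g) x)\<^sup>2) \<le> 8 * (S\<^sup>2 * vol * h ^ (2 * q + 2))"
proof -
  have "CS (q + 1) (\<lambda>x. pds [i, i] g x)" by (rule JS_pds[OF g]) simp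
  then have 2: "CS (q + 1) (pd i (pd i g))" by (simp only: pds.simps)
  have "brk (\<lambda>K x. (cross_radau low q K i (pd i (pd i g)) x - pd i (pd i g) x)\<^sup>2) \<le> 8 * S\<^sup>2 * vol * h ^ (2 * q + 2)"
  proof (rule cross_nsq[OF 2])
    show "\<bar>pds is (pd i (pd i g)) x\<bar> \<le> S" if "length is \<le> q + 1" "x \<in> cbox a b" for "is" x
      using B[of "is @ [i, i]" x] that by (simp add: pds_append)
  qed
  then show ?thesis by (simp add: mult_ac)
qed

text \<open>In the sum of the two error equations the discrete forms cancel by \<open>skew\<close>,
  and Young's inequality splits every remaining product. The residual of the comparison function has
  its own weight \<open>r\<close>, later 1 or 1 / \<tau>. The number 13 collects the part of v_h: 8
  from the nodal norm of v - v_h, 2 from the cross projection, and 1 each from the quadrature error,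
  the term u and the term f(u).\<close>

lemma energy_ineq:
  assumes c: "comparator z z' t0 t1 \<kappa>" and t: "t \<in> {t0..t1}" and l: "0 < r"
  shows "2 * qd (\<lambda>K x. (u t x - U t K x) * (v t x - V t K x))
     + 2 * ip (\<lambda>K x. tensor_radau True q K (z' t) x - V' t K x) (\<lambda>K x. tensor_radau True q K (z t) x - V t K x)
     + 2 * ip (\<lambda>K x. tensor_radau False q K (lap (v t)) x - W' t K x) (\<lambda>K x. \<xi> t K x - W t K x)
     \<le> (13 + 3 * \<mu> + M\<^sup>2 + r) * energy z t + ((22 + 2 * \<mu>) * (c_approx * h ^ (2 * q + 2)) + \<kappa> / r)"
proof -
  note C = comparatorD[OF c t]
  note tT = C(1)
  have z2: "CS 2 (z t)" by (rule JS_le[OF C(2)]) simp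
  have v4: "CS (2 * q + 4) (v t)" by (rule JS_static[OF v_JS tT])
  have w4: "CS (2 * q + 4) (w t)" by (rule JS_static[OF w_JS tT])
  have l2: "CS (2 * q + 2) (lap (v t))" by (rule JS_static[OF lapv_JS tT])
  define \<theta> where "\<theta> K x = tensor_radau True q K (z t) x - V t K x" for K x
  define \<psi> where "\<psi> K x = \<xi> t K x - W t K x" for K x
  have th: "\<theta> K \<in> Qpoly q" if "K \<in> \<T>" for K unfolding \<theta>_def by (intro Qpoly_diff tensor_Q z2 pcs tT that)
  have ps: "\<psi> K \<in> Qpoly q" if "K \<in> \<T>" for K unfolding \<psi>_def by (intro Qpoly_diff tensor_Q CS2_w pcs tT that)
  have cth: "pcont \<theta>" and cps: "pcont \<psi>" by (rule pcont_Qpoly[OF th] pcont_Qpoly[OF ps], assumption)+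
  have cv: "pcont (\<lambda>K x. v t x - V t K x)" by (intro pcont_intros v_cont pcs_cont tT)
  have cz': "pcont (\<lambda>K. tensor_radau True q K (z' t))" by (rule tensor_cont[OF C(3)])
  have cl: "pcont (\<lambda>K. tensor_radau False q K (lap (v t)))" by (rule tensor_cont[OF JS_le[OF l2]]) simp
  let ?\<eta> = "h ^ (2 * q + 2)"
  define Eu where "Eu = qd (\<lambda>K x. (u t x - U t K x)\<^sup>2)"
  define Ev where "Ev = brk (\<lambda>K x. (\<theta> K x)\<^sup>2)"
  define Ew where "Ew = brk (\<lambda>K x. (\<psi> K x)\<^sup>2)"
  have E: "energy z t = Eu + Ev + Ew" unfolding energy_eq[of t z, OF tT z2] Eu_def Ev_def Ew_def \<theta>_def \<psi>_def by (rule refl)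
  have Eq: "qd (\<lambda>K x. (\<theta> K x)\<^sup>2) = Ev" unfolding Ev_def by (rule qd_sq[where p = \<theta>, OF th])
  have nn: "0 \<le> Eu" "0 \<le> Ev" "0 \<le> Ew" unfolding Eu_def Ev_def Ew_def by (rule qd_nonneg brk_nonneg cth cps)+
  define a1 a2 a3 a4 a5 where "a1 = S\<^sup>2 * ?\<eta>" and "a2 = c_tensor * ?\<eta>" and "a3 = c_taylor * ?\<eta>" and "a4 = S\<^sup>2 * vol * ?\<eta>" and "a5 = c_quad * ?\<eta>"
  have e0: "0 \<le> ?\<eta>" using h_pos by simp
  have a0: "0 \<le> a1" "0 \<le> a2" "0 \<le> a3" "0 \<le> a4" "0 \<le> a5"
    unfolding a1_def a2_def a3_def a4_def a5_def using c_nonneg c_taylor0 e0 by (intro mult_nonneg_nonneg; simp)+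
  have A: "c_approx * ?\<eta> = 2 * a1 + 8 * a2 + a3 + 8 * a4 + a5"
    unfolding c_approx_def a1_def a2_def a3_def a4_def a5_def by (simp only: distrib_right mult.assoc)
  have d1: "brk (\<lambda>K x. (v t x - tensor_radau True q K (z t) x)\<^sup>2) \<le> 2 * a1 + 2 * a2"
    unfolding a1_def a2_def by (rule zeta_error[OF c t])
  have lin2: "p \<le> 2 * e + 2 * y" if "p \<le> 2 * x + 2 * y" "x \<le> e" for p x y e :: real using that by linarith
  have nv: "brk (\<lambda>K x. (v t x - V t K x)\<^sup>2) \<le> 2 * (2 * a1 + 2 * a2) + 2 * Ev"
  proof -
    have "brk (\<lambda>K x. (v t x - V t K x)\<^sup>2) \<le> 2 * brk (\<lambda>K x. (v t x - tensor_radau True q K (z t) x)\<^sup>2) + 2 * brk (\<lambda>K x. (tensor_radau True q K (z t) x - V t K x)\<^sup>2)"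
      by (rule brk_sq_tri[OF v_cont[OF tT] tensor_cont[OF z2] pcs_cont(2)[OF tT]])
    from lin2[OF this d1] show ?thesis unfolding Ev_def \<theta>_def .
  qed
  have F1: "2 * qd (\<lambda>K x. (u t x - U t K x) * (v t x - V t K x)) \<le> Eu + qd (\<lambda>K x. (v t x - V t K x)\<^sup>2)"
    using qd_young[of 1 "\<lambda>K x. u t x - U t K x" "\<lambda>K x. v t x - V t K x"] unfolding Eu_def by simp
  have F2: "qd (\<lambda>K x. (v t x - V t K x)\<^sup>2) \<le> 6 * a3 + 8 * (2 * a1 + 2 * a2) + 8 * Ev"
  proof -
    have lin3: "p \<le> 6 * s + 8 * e + 8 * y" if "p \<le> 6 * s + 8 * x + 8 * y" "x \<le> e" for p x y e s :: real using that by linarith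
    have "qd (\<lambda>K x. (v t x - V t K x)\<^sup>2) \<le> 6 * a3 + 8 * brk (\<lambda>K x. (v t x - tensor_radau True q K (z t) x)\<^sup>2) + 8 * Ev"
      unfolding Ev_def \<theta>_def a3_def by (rule node_v[OF tT tensor_Q[OF z2]])
    from lin3[OF this d1] show ?thesis .
  qed
  have F3: "2 * ip (\<lambda>K x. tensor_radau True q K (z' t) x - acc t x) \<theta> \<le> \<kappa> / r + r * Ev"
  proof -
    have "2 * ip (\<lambda>K x. tensor_radau True q K (z' t) x - acc t x) \<theta> \<le> brk (\<lambda>K x. (tensor_radau True q K (z' t) x - acc t x)\<^sup>2) / r + r * Ev"
      unfolding ip_def Ev_def by (rule brk_young) (intro pcont_intros cz' acc_cont tT cth l)+
    moreover have "brk (\<lambda>K x. (tensor_radau True q K (z' t) x - acc t x)\<^sup>2) / r \<le> \<kappa> / r" using C(7) l by (simp add: divide_right_mono)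
    ultimately show ?thesis by linarith
  qed
  have F4: "2 * (\<Sum>i\<in>UNIV. ip (\<lambda>K x. cross_radau False q K i (pd i (pd i (w t))) x - pd i (pd i (w t)) x) \<theta>) \<le> 2 * (8 * a4) + 2 * Ev"
    unfolding Ev_def a4_def
    by (rule ip_sum_young) (intro pcont_intros second_cont[OF w4] cth, rule cth, rule second_error[OF w4 Sw[OF tT]])
  have F5: "\<mu> * (- 2 * ip (\<lambda>K x. v t x - V t K x) \<theta>) \<le> \<mu> * ((2 * (2 * a1 + 2 * a2) + 2 * Ev) + Ev)"
    using ip_young_neg[OF cv cth] nv mu unfolding Ev_def by (intro mult_left_mono) linarith+
  have F6: "2 * (qd (\<lambda>K x. \<theta> K x * src t x) - brk (\<lambda>K x. \<theta> K x * src t x)) \<le> a5 + Ev"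
    using quad_error[where p = \<theta>, OF th src_CS(4)[OF tT] order_refl] src_seminorm[OF tT] unfolding a5_def Ev_def by linarith
  have F7: "- 2 * qd (\<lambda>K x. \<theta> K x * (u t x - U t K x)) \<le> Ev + Eu"
    using qd_young_neg[of \<theta> "\<lambda>K x. u t x - U t K x"] unfolding Eq Eu_def .
  have F8: "- 2 * qd (\<lambda>K x. \<theta> K x * (f (u t x) - f (U t K x))) \<le> Ev + M\<^sup>2 * Eu"
  proof -
    have "qd (\<lambda>K x. (f (u t x) - f (U t K x))\<^sup>2) \<le> qd (\<lambda>K x. M\<^sup>2 * (u t x - U t K x)\<^sup>2)"
    proof (rule qd_mono)
      fix K x
      have "\<bar>f (u t x) - f (U t K x)\<bar>\<^sup>2 \<le> (M * \<bar>u t x - U t K x\<bar>)\<^sup>2" by (intro power_mono f_lipschitz) simp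
      then show "(f (u t x) - f (U t K x))\<^sup>2 \<le> M\<^sup>2 * (u t x - U t K x)\<^sup>2" by (simp add: power_mult_distrib)
    qed
    then show ?thesis using qd_young_neg[of \<theta> "\<lambda>K x. f (u t x) - f (U t K x)"] unfolding Eq Eu_def qd_cmult by linarith
  qed
  have F9: "2 * ip (\<lambda>K x. tensor_radau False q K (lap (v t)) x - lap (v t) x) \<psi> \<le> 4 * a2 + Ew"
  proof -
    have "brk (\<lambda>K x. (tensor_radau False q K (lap (v t)) x - lap (v t) x)\<^sup>2) \<le> ((24 + 192 * H ^ (2 * q + 2)) * (2 * S)\<^sup>2 * vol) * ?\<eta>"
    proof (rule tensor_nsq[OF l2])
      show "\<bar>pds is (lap (v t)) x\<bar> \<le> 2 * S" if i: "length is \<le> 2 * q + 2" "x \<in> cbox a b" for "is" x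
      proof -
        have e: "2 * q + 2 + 2 = 2 * q + 4" by simp
        show ?thesis by (rule lap_sup[of "2 * q + 2", unfolded e, OF v4 i(1)]) (rule Sv[OF tT _ i(2)])
      qed
    qed
    also have "\<dots> = 4 * a2" by (simp add: a2_def c_tensor_def power_mult_distrib)
    finally show ?thesis
      using ip_young[of "\<lambda>K x. tensor_radau False q K (lap (v t)) x - lap (v t) x" \<psi>] cl pcont_fun[OF CS_continuous[OF l2]] cps
      unfolding Ew_def by (simp add: pcont_intros)
  qed
  have F10: "2 * (\<Sum>i\<in>UNIV. ip (\<lambda>K x. pd i (pd i (v t)) x - pd i (pd i (z t)) x) \<psi>) \<le> 2 * a1 + 2 * Ew"
    unfolding Ew_def a1_def
  proof (rule ip_sum_young)
    show "brk (\<lambda>K x. (pd i (pd i (v t)) x - pd i (pd i (z t)) x)\<^sup>2) \<le> S\<^sup>2 * ?\<eta>" for i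
      using C(6)[of "[i, i]"] q1 by simp
  qed (intro pcont_intros second_cont[OF v4] second_cont[OF C(2)] cps)+
  have F11: "2 * (\<Sum>i\<in>UNIV. ip (\<lambda>K x. pd i (pd i (z t)) x - cross_radau True q K i (pd i (pd i (z t))) x) \<psi>) \<le> 2 * (8 * a4) + 2 * Ew"
    unfolding Ew_def a4_def
  proof (rule ip_sum_young)
    show "brk (\<lambda>K x. (pd i (pd i (z t)) x - cross_radau True q K i (pd i (pd i (z t))) x)\<^sup>2) \<le> 8 * (S\<^sup>2 * vol * ?\<eta>)" for i
      using second_error[OF C(2,5), of True i] by (simp only: power2_commute[of "pd i (pd i (z t)) _"])
  qed (intro pcont_intros second_cont[OF C(2)] cps)+
  have sk: "(\<Sum>K\<in>\<T>. \<Sum>i\<in>UNIV. Bf True K (\<lambda>K x. tensor_radau True q K (z t) x - V t K x) (\<psi> K) i)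
      = (\<Sum>K\<in>\<T>. \<Sum>i\<in>UNIV. Bf False K (\<lambda>K x. \<xi> t K x - W t K x) (\<theta> K) i)"
    using skew[of \<theta> \<psi>, OF th ps] unfolding \<theta>_def \<psi>_def .
  \<comment> \<open>The form applied to the discrete errors; it enters \<open>ev\<close> and
    \<open>ew\<close> with opposite signs.\<close>
  define SK where "SK = (\<Sum>K\<in>\<T>. \<Sum>i\<in>UNIV. Bf False K (\<lambda>K x. \<xi> t K x - W t K x) (\<theta> K) i)"
  have ev: "ip (\<lambda>K x. tensor_radau True q K (z' t) x - V' t K x) \<theta> = ip (\<lambda>K x. tensor_radau True q K (z' t) x - acc t x) \<theta>
    + (\<Sum>i\<in>UNIV. ip (\<lambda>K x. cross_radau False q K i (pd i (pd i (w t))) x - pd i (pd i (w t)) x) \<theta>)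
    - \<mu> * ip (\<lambda>K x. v t x - V t K x) \<theta>
    + (qd (\<lambda>K x. \<theta> K x * src t x) - brk (\<lambda>K x. \<theta> K x * src t x))
    - qd (\<lambda>K x. \<theta> K x * (u t x - U t K x)) - qd (\<lambda>K x. \<theta> K x * (f (u t x) - f (U t K x))) + SK"
    unfolding SK_def by (rule v_error_eq[OF tT th cz'])
  have ew: "ip (\<lambda>K x. tensor_radau False q K (lap (v t)) x - W' t K x) \<psi> = ip (\<lambda>K x. tensor_radau False q K (lap (v t)) x - lap (v t) x) \<psi>
    + (\<Sum>i\<in>UNIV. ip (\<lambda>K x. pd i (pd i (v t)) x - pd i (pd i (z t)) x) \<psi>)
    + (\<Sum>i\<in>UNIV. ip (\<lambda>K x. pd i (pd i (z t)) x - cross_radau True q K i (pd i (pd i (z t))) x) \<psi>) - SK"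
    unfolding SK_def sk[symmetric] by (rule w_error_eq[OF tT ps cl C(2,4)])
  have mu': "0 \<le> \<mu> * Eu" "0 \<le> \<mu> * Ew" "0 \<le> \<mu> * a1" "0 \<le> \<mu> * a2" "0 \<le> \<mu> * a3" "0 \<le> \<mu> * a4" "0 \<le> \<mu> * a5"
    "0 \<le> M\<^sup>2 * Ev" "0 \<le> M\<^sup>2 * Ew" "0 \<le> r * Eu" "0 \<le> r * Ew"
    using mu nn a0 l by simp_all
  have rhs: "(13 + 3 * \<mu> + M\<^sup>2 + r) * energy z t + ((22 + 2 * \<mu>) * (c_approx * ?\<eta>) + \<kappa> / r)
     = 13 * Eu + 13 * Ev + 13 * Ew + 3 * (\<mu> * Eu) + 3 * (\<mu> * Ev) + 3 * (\<mu> * Ew) + M\<^sup>2 * Eu + M\<^sup>2 * Ev + M\<^sup>2 * Ew + r * Eu + r * Ev + r * Ew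
       + 44 * a1 + 176 * a2 + 22 * a3 + 176 * a4 + 22 * a5
       + 4 * (\<mu> * a1) + 16 * (\<mu> * a2) + 2 * (\<mu> * a3) + 16 * (\<mu> * a4) + 2 * (\<mu> * a5) + \<kappa> / r"
    unfolding E A by (simp add: algebra_simps)
  have F5': "- 2 * (\<mu> * ip (\<lambda>K x. v t x - V t K x) \<theta>) \<le> 4 * (\<mu> * a1) + 4 * (\<mu> * a2) + 3 * (\<mu> * Ev)"
    using F5 by (simp add: algebra_simps)
  have "2 * qd (\<lambda>K x. (u t x - U t K x) * (v t x - V t K x))
     + 2 * ip (\<lambda>K x. tensor_radau True q K (z' t) x - V' t K x) \<theta>
     + 2 * ip (\<lambda>K x. tensor_radau False q K (lap (v t)) x - W' t K x) \<psi>
     \<le> (13 + 3 * \<mu> + M\<^sup>2 + r) * energy z t + ((22 + 2 * \<mu>) * (c_approx * ?\<eta>) + \<kappa> / r)"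
    unfolding rhs ev ew using F1 F2 F3 F4 F5' F6 F7 F8 F9 F10 F11 nn a0 mu'
    by (simp only: distrib_left right_diff_distrib)
  then show ?thesis unfolding \<theta>_def \<psi>_def .
qed

end

section \<open>Comparison functions and the final estimate\<close>

lemma pds_zero: "pds is (\<lambda>x. 0) = (\<lambda>x. 0)"
  by (induction "is") simp_all

context dg_error
begin

abbreviation "\<tau> \<equiv> h ^ (q + 1)"

lemma tau_pos: "\<tau> > 0" using h_pos by simp

definition c_rate :: real where "c_rate = 13 + 3 * \<mu> + M\<^sup>2"

lemma c_rate_ge: "c_rate \<ge> 13" using mu by (simp add: c_rate_def)

text \<open>This quantity does not refer to a comparison function, so estimates on consecutive
  windows with different ones can be chained. The part of u is nodal, as in
  \<open>energy\<close>.\<close>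

definition err :: "real \<Rightarrow> real" where
  "err t = qd (\<lambda>K x. (u t x - U t K x)\<^sup>2) + brk (\<lambda>K x. (v t x - V t K x)\<^sup>2) + brk (\<lambda>K x. (w t x - W t K x)\<^sup>2)"

lemma energy_err:
  assumes c: "comparator z z' t0 t1 \<kappa>" and t: "t \<in> {t0..t1}"
  shows "energy z t \<le> 2 * err t + 2 * (c_approx * h ^ (2 * q + 2))" "err t \<le> 2 * energy z t + 2 * (c_approx * h ^ (2 * q + 2))"
proof -
  note C = comparatorD[OF c t]
  have z2: "CS 2 (z t)" by (rule JS_le[OF C(2)]) simp
  let ?\<eta> = "h ^ (2 * q + 2)"
  have E: "energy z t = qd (\<lambda>K x. (u t x - U t K x)\<^sup>2) + brk (\<lambda>K x. (tensor_radau True q K (z t) x - V t K x)\<^sup>2)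
     + brk (\<lambda>K x. (\<xi> t K x - W t K x)\<^sup>2)" by (rule energy_eq[of t z, OF C(1) z2])
  have ct: "pcont (\<lambda>K. tensor_radau True q K (z t))" "pcont (\<xi> t)"
    by (rule tensor_cont[OF z2] tensor_cont[OF CS2_w[OF C(1)]])+
  note k = v_cont[OF C(1)] w_cont[OF C(1)] pcs_cont[OF C(1)] ct
  have 1: "brk (\<lambda>K x. (v t x - V t K x)\<^sup>2) \<le> 2 * brk (\<lambda>K x. (v t x - tensor_radau True q K (z t) x)\<^sup>2) + 2 * brk (\<lambda>K x. (tensor_radau True q K (z t) x - V t K x)\<^sup>2)"
    by (rule brk_sq_tri) (rule k)+
  have 2: "brk (\<lambda>K x. (tensor_radau True q K (z t) x - V t K x)\<^sup>2) \<le> 2 * brk (\<lambda>K x. (tensor_radau True q K (z t) x - v t x)\<^sup>2) + 2 * brk (\<lambda>K x. (v t x - V t K x)\<^sup>2)"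
    by (rule brk_sq_tri) (rule k)+
  have 3: "brk (\<lambda>K x. (w t x - W t K x)\<^sup>2) \<le> 2 * brk (\<lambda>K x. (w t x - \<xi> t K x)\<^sup>2) + 2 * brk (\<lambda>K x. (\<xi> t K x - W t K x)\<^sup>2)"
    by (rule brk_sq_tri) (rule k)+
  have 4: "brk (\<lambda>K x. (\<xi> t K x - W t K x)\<^sup>2) \<le> 2 * brk (\<lambda>K x. (\<xi> t K x - w t x)\<^sup>2) + 2 * brk (\<lambda>K x. (w t x - W t K x)\<^sup>2)"
    by (rule brk_sq_tri) (rule k)+
  have s: "brk (\<lambda>K x. (tensor_radau True q K (z t) x - v t x)\<^sup>2) = brk (\<lambda>K x. (v t x - tensor_radau True q K (z t) x)\<^sup>2)"
    "brk (\<lambda>K x. (w t x - \<xi> t K x)\<^sup>2) = brk (\<lambda>K x. (\<xi> t K x - w t x)\<^sup>2)" by (simp_all add: power2_commute)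
  have A: "c_approx * ?\<eta> = 2 * (S\<^sup>2 * ?\<eta>) + 8 * (c_tensor * ?\<eta>) + c_taylor * ?\<eta> + 8 * (S\<^sup>2 * vol * ?\<eta>) + c_quad * ?\<eta>"
    unfolding c_approx_def by (simp only: distrib_right mult.assoc)
  have "0 \<le> ?\<eta>" using h_pos by simp
  then have nn: "0 \<le> S\<^sup>2 * ?\<eta>" "0 \<le> c_tensor * ?\<eta>" "0 \<le> c_taylor * ?\<eta>" "0 \<le> S\<^sup>2 * vol * ?\<eta>" "0 \<le> c_quad * ?\<eta>"
    using c_nonneg c_taylor0 by simp_all
  have q0: "0 \<le> qd (\<lambda>K x. (u t x - U t K x)\<^sup>2)" by (rule qd_nonneg)
  note za = zeta_error[OF c t] and xa = xi_error[OF C(1)]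
  show "energy z t \<le> 2 * err t + 2 * (c_approx * h ^ (2 * q + 2))" "err t \<le> 2 * energy z t + 2 * (c_approx * h ^ (2 * q + 2))"
    unfolding E A err_def using 1 2 3 4 s za xa nn q0 by argo+
qed

text \<open>\<open>gronwall\<close> for the energy, translated to \<open>err\<close> at both ends.
  The weight is left open because \<open>\<kappa>\<close> enters divided by r (c_rate + r), while
  the growth rate increases by r.\<close>

lemma window:
  assumes c: "comparator z z' t0 t1 \<kappa>" and t: "t0 \<le> t1" and r: "0 < r" and \<kappa>: "0 \<le> \<kappa>"
  shows "err t1 \<le> exp ((c_rate + r) * (t1 - t0)) * (4 * err t0 + 6 * (c_approx * h ^ (2 * q + 2))
     + 2 * (((22 + 2 * \<mu>) * (c_approx * h ^ (2 * q + 2)) + \<kappa> / r) / (c_rate + r)))"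
proof -
  let ?A = "c_approx * h ^ (2 * q + 2)"
  let ?B = "(22 + 2 * \<mu>) * ?A + \<kappa> / r"
  let ?e = "exp ((c_rate + r) * (t1 - t0))"
  have A0: "0 \<le> ?A" using c_nonneg h_pos by simp
  have B0: "0 \<le> ?B" using A0 mu r \<kappa> by simp
  have g: "energy z t1 \<le> ?e * (energy z t0 + ?B / (c_rate + r))"
    by (rule gronwall[OF energy_DERIV[OF c]])
       (use energy_ineq[OF c _ r] B0 r t c_rate_ge in \<open>auto simp: c_rate_def\<close>)
  have e1: "1 \<le> ?e" using r t c_rate_ge by simp
  have "err t1 \<le> 2 * energy z t1 + 2 * ?A" by (rule energy_err(2)[OF c]) (use t in simp)
  also have "\<dots> \<le> 2 * (?e * (energy z t0 + ?B / (c_rate + r))) + ?e * (2 * ?A)"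
  proof -
    have "0 \<le> 2 * ?A" using A0 by simp
    from mult_right_mono[OF e1 this] g show ?thesis by linarith
  qed
  also have "\<dots> = ?e * (2 * energy z t0 + 2 * (?B / (c_rate + r)) + 2 * ?A)" by (simp only: algebra_simps)
  also have "\<dots> \<le> ?e * (4 * err t0 + 6 * ?A + 2 * (?B / (c_rate + r)))"
  proof (rule mult_left_mono)
    have "energy z t0 \<le> 2 * err t0 + 2 * ?A" by (rule energy_err(1)[OF c]) (use t in simp)
    then show "2 * energy z t0 + 2 * (?B / (c_rate + r)) + 2 * ?A \<le> 4 * err t0 + 6 * ?A + 2 * (?B / (c_rate + r))" by linarith
  qed simp
  finally show ?thesis .
qed

subsection \<open>Differences in time\<close>

lemma JS0_sub: "JS k {0..T} g \<Longrightarrow> {s..t} \<subseteq> {0..T} \<Longrightarrow> JS 0 {s..t} g"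
proof -
  assume g: "JS k {0..T} g" and sub: "{s..t} \<subseteq> {0..T}"
  have "JS 0 {0..T} g" by (rule JS_le[OF g]) simp
  then show ?thesis by (rule JS_comp_time[where \<phi> = "\<lambda>t. t"]) (use sub in auto)
qed

lemma brk_mean_value:
  assumes "JS 0 {t0..t1} G" "JS 0 {t0..t1} G'"
    and "\<And>t x. t \<in> {t0..t1} \<Longrightarrow> ((\<lambda>t. G t x) has_real_derivative G' t x) (at t within {t0..t1})"
    and "\<And>t. t \<in> {t0..t1} \<Longrightarrow> brk (\<lambda>K x. (G' t x)\<^sup>2) \<le> B" and "t0 \<le> t1"
  shows "brk (\<lambda>K x. (G t1 x - G t0 x)\<^sup>2) \<le> (t1 - t0)\<^sup>2 * B"
  using assms unfolding brk_def by (rule L2_mean_value)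

lemma v_diff:
  assumes t: "0 \<le> t" "t \<le> s" "s \<le> T" and js: "length js \<le> q + 1"
  shows "brk (\<lambda>K x. (pds js (v s) x - pds js (v t) x)\<^sup>2) \<le> (s - t)\<^sup>2 * S\<^sup>2"
proof (rule brk_mean_value)
  have sub: "{t..s} \<subseteq> {0..T}" using t by auto
  have 1: "JS 0 {0..T} (\<lambda>t. pds js (v t))" by (rule JS_pds[OF v_JS]) (use js in simp)
  show "JS 0 {t..s} (\<lambda>t. pds js (v t))" by (rule JS0_sub[OF 1 sub])
  have 2: "JS 0 {0..T} (\<lambda>t. pds js (acc t))" by (rule JS_pds[OF acc_JS]) (use js in simp)
  show "JS 0 {t..s} (\<lambda>t. pds js (acc t))" by (rule JS0_sub[OF 2 sub])
  show "((\<lambda>t. pds js (v t) x) has_real_derivative pds js (acc r) x) (at r within {t..s})" if "r \<in> {t..s}" for r x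
    using DERIV_subset[OF pds_v_DERIV[OF _ js] sub] that sub by blast
  show "brk (\<lambda>K x. (pds js (acc r) x)\<^sup>2) \<le> S\<^sup>2" if "r \<in> {t..s}" for r
    by (rule Sa) (use that t js in auto)
qed (rule t)

text \<open>Subtracting s F'(t) from F(s) leaves the derivative F'(s) - F'(t), so the mean value
  estimate measures how far the difference quotient is from F'(t). It is used for derivatives of u
  and for v.\<close>

lemma average:
  assumes F: "JS 0 {t..t + r} F" and F': "JS 0 {t..t + r} F'" and r: "r > 0"
    and d: "\<And>s x. s \<in> {t..t + r} \<Longrightarrow> ((\<lambda>t. F t x) has_real_derivative F' s x) (at s within {t..t + r})"
    and B: "\<And>s. s \<in> {t..t + r} \<Longrightarrow> brk (\<lambda>K x. (F' s x - F' t x)\<^sup>2) \<le> B"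
  shows "brk (\<lambda>K x. (F' t x - (F (t + r) x - F t x) / r)\<^sup>2) \<le> B"
proof -
  have cF': "continuous_on UNIV (F' t)" using JS_cont_x[OF F'] r by simp
  have "brk (\<lambda>K x. ((F (t + r) x - (t + r) * F' t x) - (F t x - t * F' t x))\<^sup>2) \<le> (t + r - t)\<^sup>2 * B"
  proof (rule brk_mean_value[where G = "\<lambda>s x. F s x - s * F' t x" and G' = "\<lambda>s x. F' s x - F' t x"])
    have c: "continuous_on ({t..t + r} \<times> UNIV) (\<lambda>p. F' t (snd p))"
      by (rule continuous_on_compose2[OF cF']) (auto intro!: continuous_intros)
    show "JS 0 {t..t + r} (\<lambda>s x. F s x - s * F' t x)" "JS 0 {t..t + r} (\<lambda>s x. F' s x - F' t x)"
      using F F' unfolding JS.simps split_beta by (auto intro!: continuous_intros c)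
    show "((\<lambda>s. F s x - s * F' t x) has_real_derivative F' s x - F' t x) (at s within {t..t + r})" if "s \<in> {t..t + r}" for s x
      by (auto intro!: derivative_eq_intros d[OF that])
  qed (use B r in auto)
  moreover have "(F (t + r) x - (t + r) * F' t x) - (F t x - t * F' t x) = - r * (F' t x - (F (t + r) x - F t x) / r)" for x
    using r by (simp add: field_simps)
  ultimately have "r\<^sup>2 * brk (\<lambda>K x. (F' t x - (F (t + r) x - F t x) / r)\<^sup>2) \<le> r\<^sup>2 * B"
    by (simp add: power_mult_distrib brk_cmult)
  then show ?thesis using r by simp
qed

definition c_acc :: real where
  "c_acc = 2 * ((5 + M) * S)\<^sup>2 * vol + 2 * (\<mu> * S)\<^sup>2"

text \<open>The equation expresses u_tt + \<mu> u_t through \<Delta>w, u and f(u), which are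
  Lipschitz in time because derivatives of u_t up to order 4 are bounded. The damping term is split
  off and treated in L^2, where the bound of u_tt controls it. In 5 + M the 4 counts the at most
  four terms of \<Delta>w, each a fourth derivative of u.\<close>

lemma acc_diff:
  assumes t: "0 \<le> t" "t \<le> s" "s \<le> T" and r: "s - t \<le> r"
  shows "brk (\<lambda>K x. (acc s x - acc t x)\<^sup>2) \<le> c_acc * r\<^sup>2"
proof -
  have tT: "t \<in> {0..T}" "s \<in> {0..T}" and sub: "{t..s} \<subseteq> {0..T}" using t by auto
  have c: "pcont (\<lambda>K. acc s)" "pcont (\<lambda>K. acc t)" "pcont (\<lambda>K. v s)" "pcont (\<lambda>K. v t)" using acc_cont v_cont tT by auto
  have r2: "(s - t)\<^sup>2 \<le> r\<^sup>2" using t r by (intro power_mono) auto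
  have uL: "\<bar>pds is (u s) x - pds is (u t) x\<bar> \<le> (s - t) * S" if "length is \<le> 2 * q + 4" "x \<in> cbox a b" for "is" x
  proof (rule real_mean_value[OF _ _ t(2)])
    show "((\<lambda>t. pds is (u t) x) has_real_derivative pds is (v y) x) (at y within {t..s})" if "y \<in> {t..s}" for y
      using DERIV_subset[OF pds_u_DERIV[OF _ \<open>length is \<le> 2 * q + 4\<close>] sub] that sub by blast
    show "\<bar>pds is (v y) x\<bar> \<le> S" if "y \<in> {t..s}" for y using Sv that sub \<open>length is \<le> 2 * q + 4\<close> \<open>x \<in> cbox a b\<close> by blast
  qed
  have wL: "\<bar>lap (w s) x - lap (w t) x\<bar> \<le> 4 * ((s - t) * S)" if x: "x \<in> cbox a b" for x
  proof -
    have e: "lap (w y) x = (\<Sum>i\<in>UNIV. \<Sum>j\<in>UNIV. pds [i, i, j, j] (u y) x)" if y: "y \<in> {0..T}" for y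
    proof -
      have "pds [i, i] (lap (u y)) = (\<lambda>x. \<Sum>j\<in>UNIV. pds ([i, i] @ [j, j]) (u y) x)" for i
        by (rule pds_lap[of 4]) (use JS_le[OF JS_static[OF u_JS y]] in \<open>simp_all add: eval_nat_numeral del: JS.simps\<close>)
      then show ?thesis unfolding lap_pds[of "w y"] by simp
    qed
    have "\<bar>lap (w s) x - lap (w t) x\<bar> = \<bar>\<Sum>i\<in>UNIV. \<Sum>j\<in>UNIV. pds [i, i, j, j] (u s) x - pds [i, i, j, j] (u t) x\<bar>"
      unfolding e[OF tT(1)] e[OF tT(2)] by (simp add: sum_subtractf)
    also have "\<dots> \<le> (\<Sum>i\<in>UNIV. \<Sum>j\<in>UNIV. \<bar>pds [i, i, j, j] (u s) x - pds [i, i, j, j] (u t) x\<bar>)"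
      by (rule order_trans[OF sum_abs sum_mono[OF sum_abs]])
    also have "\<dots> \<le> 2 * (2 * ((s - t) * S))"
      using S0 t q1 by (intro sum_UNIV_le uL x) auto
    finally show ?thesis by simp
  qed
  have "brk (\<lambda>K x. (acc s x - acc t x)\<^sup>2) = brk (\<lambda>K x. ((acc s x - acc t x + \<mu> * (v s x - v t x)) + (- \<mu>) * (v s x - v t x))\<^sup>2)"
    by simp
  also have "\<dots> \<le> 2 * brk (\<lambda>K x. (acc s x - acc t x + \<mu> * (v s x - v t x))\<^sup>2) + 2 * brk (\<lambda>K x. ((- \<mu>) * (v s x - v t x))\<^sup>2)"
    by (rule brk_sq_add) (intro pcont_intros c)+
  also have "brk (\<lambda>K x. (acc s x - acc t x + \<mu> * (v s x - v t x))\<^sup>2) \<le> ((5 + M) * S * (s - t))\<^sup>2 * vol"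
  proof (rule brk_sq_sup)
    fix K x assume "K \<in> \<T>" "x \<in> cbox (fst K) (snd K)"
    then have x: "x \<in> cbox a b" using cbox_subset by blast
    have 1: "\<bar>u s x - u t x\<bar> \<le> (s - t) * S" using uL[of "[]", OF _ x] by simp
    have "M * \<bar>u s x - u t x\<bar> \<le> M * ((s - t) * S)" by (rule mult_left_mono[OF 1 M0])
    then have 2: "\<bar>f (u s x) - f (u t x)\<bar> \<le> M * ((s - t) * S)" using f_lipschitz[of "u s x" "u t x"] by linarith
    have "acc s x - acc t x + \<mu> * (v s x - v t x) = - (lap (w s) x - lap (w t) x) - (u s x - u t x) - (f (u s x) - f (u t x))"
      unfolding pde[OF tT(1)] pde[OF tT(2)] right_diff_distrib by simp
    moreover have "\<bar>- p - q - r\<bar> \<le> \<bar>p\<bar> + \<bar>q\<bar> + \<bar>r\<bar>" for p q r :: real by linarith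
    ultimately have "\<bar>acc s x - acc t x + \<mu> * (v s x - v t x)\<bar> \<le> 4 * ((s - t) * S) + (s - t) * S + M * ((s - t) * S)"
      using 1 2 wL[OF x] by (smt (verit))
    also have "\<dots> = (5 + M) * S * (s - t)" by (simp only: algebra_simps)
    finally show "\<bar>acc s x - acc t x + \<mu> * (v s x - v t x)\<bar> \<le> (5 + M) * S * (s - t)" .
  qed (intro pcont_intros c)
  also have "brk (\<lambda>K x. ((- \<mu>) * (v s x - v t x))\<^sup>2) \<le> \<mu>\<^sup>2 * ((s - t)\<^sup>2 * S\<^sup>2)"
    using v_diff[OF t, of "[]"] by (simp add: power_mult_distrib brk_cmult mult_left_mono)
  also have "2 * (((5 + M) * S * (s - t))\<^sup>2 * vol) + 2 * (\<mu>\<^sup>2 * ((s - t)\<^sup>2 * S\<^sup>2)) = c_acc * (s - t)\<^sup>2"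
    unfolding c_acc_def power_mult_distrib by (simp only: algebra_simps)
  also have "\<dots> \<le> c_acc * r\<^sup>2" by (rule mult_left_mono[OF r2]) (simp add: c_acc_def)
  finally show ?thesis by simp
qed

lemma vt_periodic: "t \<in> {0..T} \<Longrightarrow> periodic a b (v t)"
  unfolding periodic_def
proof (intro allI)
  fix x :: "real ^ 'n" and i assume t: "t \<in> {0..T}"
  let ?y = "x + (b $ i - a $ i) *\<^sub>R axis i 1"
  have e: "u s ?y = u s x" if "s \<in> {0..T}" for s using v_periodic[OF that] unfolding periodic_def by blast
  have "((\<lambda>s. u s x) has_vector_derivative v t ?y) (at t within {0..T})"
    by (rule has_vector_derivative_transform[OF t _ u_DERIV[OF t, of ?y, unfolded has_real_derivative_iff_has_vector_derivative]]) (simp add: e)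
  moreover have "((\<lambda>s. u s x) has_vector_derivative v t x) (at t within {0..T})"
    using u_DERIV[OF t] by (simp add: has_real_derivative_iff_has_vector_derivative)
  ultimately show "v t ?y = v t x" by (rule vector_derivative_unique_within[OF at_within_bot[OF t]])
qed

text \<open>With z frozen, z_t vanishes and the residual is u_tt up to sign: bounded, not small. On
  a window of length at most \<tau> the derivatives of v up to order q + 1 move by at most \<tau> S
  in L^2.\<close>

lemma comparator_const:
  assumes t: "0 \<le> t0" "t1 \<le> T" "t0 \<le> t1" "t1 \<le> t0 + \<tau>"
  shows "comparator (\<lambda>_. v t0) (\<lambda>_ x. 0) t0 t1 (2 * S\<^sup>2)"
  unfolding comparator_def
proof (intro conjI ballI allI impI)
  have t0: "t0 \<in> {0..T}" using t by simp
  have v4: "CS (2 * q + 4) (v t0)" by (rule JS_static[OF v_JS t0])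
  show "JS (2 * q + 4) {t0..t1} (\<lambda>_. v t0)" by (rule CS_JS[OF v4])
  fix s assume s: "s \<in> {t0..t1}"
  then have sT: "s \<in> {0..T}" using t by auto
  show "periodic a b (v t0)" by (rule vt_periodic[OF t0])
  show "((\<lambda>s. v t0 x) has_real_derivative 0) (at s within {t0..t1})" for x by simp
  show "\<bar>pds is (v t0) x\<bar> \<le> S" if "length is \<le> 2 * q + 4" "x \<in> cbox a b" for "is" x by (rule Sv[OF t0 that])
  show "brk (\<lambda>K x. (pds js (v s) x - pds js (v t0) x)\<^sup>2) \<le> S\<^sup>2 * h ^ (2 * q + 2)" if js: "length js \<le> q + 1" for js
  proof -
    have "(s - t0)\<^sup>2 \<le> \<tau>\<^sup>2" using s t by (intro power_mono) auto
    then have "(s - t0)\<^sup>2 * S\<^sup>2 \<le> \<tau>\<^sup>2 * S\<^sup>2" by (rule mult_right_mono) simp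
    moreover have "brk (\<lambda>K x. (pds js (v s) x - pds js (v t0) x)\<^sup>2) \<le> (s - t0)\<^sup>2 * S\<^sup>2"
      by (rule v_diff) (use s t js in auto)
    ultimately show ?thesis unfolding h_sq by (simp add: mult.commute)
  qed
  show "brk (\<lambda>K x. (tensor_radau True q K (\<lambda>x. 0) x - acc s x)\<^sup>2) \<le> 2 * S\<^sup>2"
  proof -
    let ?Z = "\<lambda>K. tensor_radau True q K (\<lambda>x. 0)"
    have c: "pcont ?Z" by (rule tensor_cont) simp
    have "brk (\<lambda>K x. (?Z K x - 0)\<^sup>2) \<le> ((24 + 192 * H ^ (2 * q + 2)) * 0\<^sup>2 * vol) * h ^ (2 * q + 2)"
      by (rule tensor_nsq) (simp_all add: pds_zero)
    moreover have "brk (\<lambda>K x. (?Z K x - acc s x)\<^sup>2) \<le> 2 * brk (\<lambda>K x. (?Z K x - 0)\<^sup>2) + 2 * brk (\<lambda>K x. (0 - acc s x)\<^sup>2)"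
      by (rule brk_sq_tri[OF c _ acc_cont[OF sT]]) (rule pcont_intros)
    ultimately show ?thesis using Sa[OF sT, of "[]"] by simp
  qed
qed (use t in auto)

definition c_diff :: real where
  "c_diff = 2 * (24 * S\<^sup>2 + 768 * S\<^sup>2 * vol) + 2 * c_acc"

lemma shift_DERIV:
  assumes t1: "t1 + r \<le> T" "0 \<le> r" and t: "t \<in> {0..t1}"
    and d: "\<And>t. t \<in> {0..T} \<Longrightarrow> (F has_real_derivative F' t) (at t within {0..T})"
  shows "((\<lambda>t. (F (t + r) - F t) / r) has_real_derivative (F' (t + r) - F' t) / r) (at t within {0..t1})"
proof -
  have s: "(\<lambda>t. t + r) ` {0..t1} \<subseteq> {0..T}" "{0..t1} \<subseteq> {0..T}" using t1 by auto
  have tT: "t + r \<in> {0..T}" "t \<in> {0..T}" using t t1 by auto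
  have "((\<lambda>t. t + r) has_real_derivative 1) (at t within {0..t1})" by (auto intro!: derivative_eq_intros)
  from DERIV_image_chain[OF DERIV_subset[OF d[OF tT(1)] s(1)] this]
  have 1: "((\<lambda>t. F (t + r)) has_real_derivative F' (t + r)) (at t within {0..t1})" by (simp add: o_def)
  show ?thesis by (rule DERIV_cdivide[OF DERIV_diff[OF 1 DERIV_subset[OF d[OF tT(2)] s(2)]]])
qed

text \<open>z and z_t are mean slopes of u and v over an interval of length \<tau>, so they inherit
  the pointwise bounds of u_t and the L^2 bounds of u_tt. Only the mixed derivatives of z_t of order
  2q + 2 are estimated crudely, by 2 S / \<tau>.\<close>

lemma comparator_diff:
  assumes t: "t1 + \<tau> \<le> T"
  shows "comparator (\<lambda>t x. (u (t + \<tau>) x - u t x) / \<tau>) (\<lambda>t x. (v (t + \<tau>) x - v t x) / \<tau>) 0 t1 (c_diff * h ^ (2 * q + 2))"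
  unfolding comparator_def
proof (intro conjI ballI allI impI)
  have tp: "\<tau> > 0" by (rule tau_pos)
  have js: "JS k {0..t1} (\<lambda>t x. (g (t + \<tau>) x - g t x) / \<tau>)" if g: "JS k {0..T} g" for k and g :: "real \<Rightarrow> real ^ 'n \<Rightarrow> real"
  proof -
    have "JS k {0..t1} (\<lambda>t. g (t + \<tau>))" "JS k {0..t1} g"
      by (rule JS_comp_time[OF g, where \<phi> = "\<lambda>t. t + \<tau>"] JS_comp_time[OF g, where \<phi> = "\<lambda>t. t"]; use t tp in \<open>auto intro!: continuous_intros simp del: power_Suc\<close>)+
    from JS_lin[OF this, of "1 / \<tau>" "- (1 / \<tau>)"] show ?thesis by (simp add: diff_divide_distrib)
  qed
  show "JS (2 * q + 4) {0..t1} (\<lambda>t x. (u (t + \<tau>) x - u t x) / \<tau>)" by (rule js[OF JS_le[OF u_JS]]) simp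
  show "JS 2 {0..t1} (\<lambda>t x. (v (t + \<tau>) x - v t x) / \<tau>)" by (rule js[OF JS_le[OF v_JS]]) simp
  fix s assume s: "s \<in> {0..t1}"
  then have sT: "s \<in> {0..T}" "s + \<tau> \<in> {0..T}" and sub: "{s..s + \<tau>} \<subseteq> {0..T}" using t tp by (auto simp del: power_Suc)
  have pq: "pds is (\<lambda>x. (g (s + \<tau>) x - g s x) / \<tau>) = (\<lambda>x. (pds is (g (s + \<tau>)) x - pds is (g s) x) / \<tau>)"
    if "JS k {0..T} g" "length is \<le> k" for k "is" and g :: "real \<Rightarrow> real ^ 'n \<Rightarrow> real"
  proof -
    have "(\<lambda>x. (g (s + \<tau>) x - g s x) / \<tau>) = (\<lambda>x. (1 / \<tau>) * g (s + \<tau>) x + (- (1 / \<tau>)) * g s x)" by (simp add: diff_divide_distrib)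
    then show ?thesis
      using pds_lin[OF JS_static[OF that(1) sT(2)] JS_static[OF that(1) sT(1)] that(2), of "1 / \<tau>" "- (1 / \<tau>)"]
      by (simp add: diff_divide_distrib)
  qed
  show "periodic a b (\<lambda>x. (u (s + \<tau>) x - u s x) / \<tau>)"
    using v_periodic[OF sT(1)] v_periodic[OF sT(2)] unfolding periodic_def by simp
  show "((\<lambda>s. (u (s + \<tau>) x - u s x) / \<tau>) has_real_derivative (v (s + \<tau>) x - v s x) / \<tau>) (at s within {0..t1})" for x
    by (rule shift_DERIV[OF t less_imp_le[OF tp] s u_DERIV])
  show "\<bar>pds is (\<lambda>x. (u (s + \<tau>) x - u s x) / \<tau>) x\<bar> \<le> S" if l: "length is \<le> 2 * q + 4" and x: "x \<in> cbox a b" for "is" x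
  proof -
    have "\<bar>pds is (u (s + \<tau>)) x - pds is (u s) x\<bar> \<le> (s + \<tau> - s) * S"
    proof (rule real_mean_value)
      show "((\<lambda>t. pds is (u t) x) has_real_derivative pds is (v y) x) (at y within {s..s + \<tau>})" if "y \<in> {s..s + \<tau>}" for y
        using DERIV_subset[OF pds_u_DERIV[OF _ l] sub] that sub by blast
      show "\<bar>pds is (v y) x\<bar> \<le> S" if "y \<in> {s..s + \<tau>}" for y using Sv that sub l x by blast
    qed (use tp in simp)
    moreover have "pds is (\<lambda>x. (u (s + \<tau>) x - u s x) / \<tau>) = (\<lambda>x. (pds is (u (s + \<tau>)) x - pds is (u s) x) / \<tau>)"
      by (rule pq[OF u_JS]) (use l in simp)
    ultimately show ?thesis using tp by (simp add: pos_divide_le_eq mult.commute del: power_Suc)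
  qed
  have av: "brk (\<lambda>K x. (G' s x - (G (s + \<tau>) x - G s x) / \<tau>)\<^sup>2) \<le> B"
    if "JS k {0..T} G" "JS k {0..T} G'" "\<And>t x. t \<in> {0..T} \<Longrightarrow> ((\<lambda>t. G t x) has_real_derivative G' t x) (at t within {0..T})"
      "\<And>y. s \<le> y \<Longrightarrow> y \<le> s + \<tau> \<Longrightarrow> brk (\<lambda>K x. (G' y x - G' s x)\<^sup>2) \<le> B" for k G G' B
  proof (rule average)
    show "((\<lambda>t. G t x) has_real_derivative G' y x) (at y within {s..s + \<tau>})" if "y \<in> {s..s + \<tau>}" for y x
      using DERIV_subset[OF \<open>\<And>t x. t \<in> {0..T} \<Longrightarrow> ((\<lambda>t. G t x) has_real_derivative G' t x) (at t within {0..T})\<close> sub] that sub by blast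
  qed (use JS0_sub[OF that(1) sub] JS0_sub[OF that(2) sub] tp that(4) in auto)
  show "brk (\<lambda>K x. (pds js (v s) x - pds js (\<lambda>x. (u (s + \<tau>) x - u s x) / \<tau>) x)\<^sup>2) \<le> S\<^sup>2 * h ^ (2 * q + 2)" if l: "length js \<le> q + 1" for js
  proof -
    have p: "pds js (\<lambda>x. (u (s + \<tau>) x - u s x) / \<tau>) = (\<lambda>x. (pds js (u (s + \<tau>)) x - pds js (u s) x) / \<tau>)"
      by (rule pq[OF u_JS]) (use l in simp)
    show ?thesis unfolding p
    proof (rule av[of 0 "\<lambda>t. pds js (u t)" "\<lambda>t. pds js (v t)"])
      show "JS 0 {0..T} (\<lambda>t. pds js (u t))" by (rule JS_pds[OF u_JS]) (use l in simp)
      show "JS 0 {0..T} (\<lambda>t. pds js (v t))" by (rule JS_pds[OF v_JS]) (use l in simp)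
      show "((\<lambda>t. pds js (u t) x) has_real_derivative pds js (v t) x) (at t within {0..T})" if "t \<in> {0..T}" for t x
        by (rule pds_u_DERIV[OF that]) (use l in simp)
      fix y assume y: "s \<le> y" "y \<le> s + \<tau>"
      have "(y - s)\<^sup>2 \<le> \<tau>\<^sup>2" using y by (intro power_mono) auto
      then have "(y - s)\<^sup>2 * S\<^sup>2 \<le> \<tau>\<^sup>2 * S\<^sup>2" by (rule mult_right_mono) simp
      moreover have "brk (\<lambda>K x. (pds js (v y) x - pds js (v s) x)\<^sup>2) \<le> (y - s)\<^sup>2 * S\<^sup>2"
        by (rule v_diff) (use y sT l in auto)
      ultimately show "brk (\<lambda>K x. (pds js (v y) x - pds js (v s) x)\<^sup>2) \<le> S\<^sup>2 * h ^ (2 * q + 2)"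
        unfolding h_sq by (simp add: mult.commute)
    qed
  qed
  let ?z = "\<lambda>x. (v (s + \<tau>) x - v s x) / \<tau>"
  have scale: "1 / c\<^sup>2 * P \<le> B" if "P \<le> (s + c - s)\<^sup>2 * B" "c > 0" for c P B :: real
    using that by (simp add: pos_divide_le_eq mult.commute)
  have zCS: "CS (2 * q + 2) ?z" by (rule JS_static[OF js[OF JS_le[OF v_JS]] s]) simp
  have 1: "brk (\<lambda>K x. (acc s x - ?z x)\<^sup>2) \<le> c_acc * h ^ (2 * q + 2)"
  proof (rule av[of 0 v acc])
    show "JS 0 {0..T} v" "JS 0 {0..T} acc" by (rule JS_le[OF v_JS] JS_le[OF acc_JS]; simp)+
    show "brk (\<lambda>K x. (acc y x - acc s x)\<^sup>2) \<le> c_acc * h ^ (2 * q + 2)" if "s \<le> y" "y \<le> s + \<tau>" for y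
      unfolding h_sq[symmetric] by (rule acc_diff) (use that sT in auto)
  qed (rule v_DERIV)
  have 2: "brk (\<lambda>K x. (tensor_radau True q K ?z x - ?z x)\<^sup>2) \<le> 24 * S\<^sup>2 * h ^ (2 * q + 2) + 192 * (2 * S / \<tau>)\<^sup>2 * vol * (h ^ (2 * q + 2))\<^sup>2"
  proof (rule tensor_nsq_general[OF zCS])
    show "brk (\<lambda>K x. (pds (replicate (Suc q) j) ?z x)\<^sup>2) \<le> S\<^sup>2" for j
    proof -
      have p: "pds (replicate (Suc q) j) ?z = (\<lambda>x. (pds (replicate (Suc q) j) (v (s + \<tau>)) x - pds (replicate (Suc q) j) (v s) x) / \<tau>)"
        by (rule pq[OF v_JS]) simp
      have "brk (\<lambda>K x. (pds (replicate (Suc q) j) (v (s + \<tau>)) x - pds (replicate (Suc q) j) (v s) x)\<^sup>2) \<le> (s + \<tau> - s)\<^sup>2 * S\<^sup>2"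
        by (rule v_diff) (use sT tp in auto)
      from scale[OF this tp] show ?thesis unfolding p power_divide
        using brk_cmult[of "1 / \<tau>\<^sup>2"] by simp
    qed
    show "\<bar>pds is ?z x\<bar> \<le> 2 * S / \<tau>" if "length is = 2 * q + 2" "x \<in> cbox a b" for "is" x
    proof -
      have p: "pds is ?z = (\<lambda>x. (pds is (v (s + \<tau>)) x - pds is (v s) x) / \<tau>)"
        by (rule pq[OF v_JS]) (use that in simp)
      have "\<bar>pds is (v (s + \<tau>)) x - pds is (v s) x\<bar> \<le> 2 * S"
        using Sv[OF sT(1), of "is" x] Sv[OF sT(2), of "is" x] that by simp
      then show ?thesis unfolding p using tp by (simp add: abs_divide divide_right_mono del: power_Suc)
    qed
  qed simp
  \<comment> \<open>The balance that fixes \<tau>: the square of h^(2q+2) / \<tau> is again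
    h^(2q+2).\<close>
  have "(2 * S / \<tau>)\<^sup>2 * (h ^ (2 * q + 2))\<^sup>2 = 4 * S\<^sup>2 * h ^ (2 * q + 2)"
    unfolding h_sq[symmetric] using tp by (simp add: power_divide power2_eq_square del: power_Suc)
  then have "192 * (2 * S / \<tau>)\<^sup>2 * vol * (h ^ (2 * q + 2))\<^sup>2 = 768 * S\<^sup>2 * vol * h ^ (2 * q + 2)"
    by (simp add: mult_ac del: power_Suc)
  then have 3: "brk (\<lambda>K x. (tensor_radau True q K ?z x - ?z x)\<^sup>2) \<le> (24 * S\<^sup>2 + 768 * S\<^sup>2 * vol) * h ^ (2 * q + 2)"
    using 2 unfolding distrib_right by linarith
  have "brk (\<lambda>K x. (tensor_radau True q K ?z x - acc s x)\<^sup>2) \<le> 2 * brk (\<lambda>K x. (tensor_radau True q K ?z x - ?z x)\<^sup>2) + 2 * brk (\<lambda>K x. (?z x - acc s x)\<^sup>2)"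
    by (rule brk_sq_tri[OF tensor_cont[OF JS_le[OF zCS]] pcont_fun[OF CS_continuous[OF zCS]] acc_cont[OF sT(1)]]) simp
  also have "brk (\<lambda>K x. (?z x - acc s x)\<^sup>2) = brk (\<lambda>K x. (acc s x - ?z x)\<^sup>2)" by (simp only: power2_commute)
  also have "2 * brk (\<lambda>K x. (tensor_radau True q K ?z x - ?z x)\<^sup>2) + 2 * brk (\<lambda>K x. (acc s x - ?z x)\<^sup>2)
      \<le> 2 * ((24 * S\<^sup>2 + 768 * S\<^sup>2 * vol) * h ^ (2 * q + 2)) + 2 * (c_acc * h ^ (2 * q + 2))" using 1 3 by linarith
  also have "\<dots> = c_diff * h ^ (2 * q + 2)" unfolding c_diff_def by (simp only: distrib_right mult.assoc)
  finally show "brk (\<lambda>K x. (tensor_radau True q K ?z x - acc s x)\<^sup>2) \<le> c_diff * h ^ (2 * q + 2)" .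
qed (use t tau_pos in auto)

end

section \<open>Combination of the two comparison functions and the final constants\<close>

context dg_error
begin

lemma err_nonneg: "t \<in> {0..T} \<Longrightarrow> err t \<ge> 0"
  unfolding err_def by (intro add_nonneg_nonneg qd_nonneg brk_nonneg pcont_intros v_cont w_cont pcs_cont)

definition c_step :: real where
  "c_step = (50 + 4 * \<mu>) * c_approx + 2 * c_diff + 4 * S\<^sup>2"

lemma c_diff0: "c_diff \<ge> 0" by (simp add: c_diff_def c_acc_def)

lemma c_step0: "c_step \<ge> 0"
  unfolding c_step_def using c_nonneg c_diff0 mu by simp

text \<open>The weight is r = 1, since the residual is already of order h^(2q+2). The factor 3 gives
  the estimate the same shape as \<open>step_const\<close>.\<close>

lemma step_diff:
  assumes t: "t1 + \<tau> \<le> T" "0 \<le> t1"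
  shows "err t1 \<le> 3 * exp ((c_rate + 1) * t1) * (4 * err 0 + c_step * h ^ (2 * q + 2))"
proof -
  let ?\<eta> = "h ^ (2 * q + 2)" let ?A = "c_approx * ?\<eta>"
  let ?B = "(22 + 2 * \<mu>) * ?A + c_diff * ?\<eta> / 1"
  have e0: "0 \<le> ?\<eta>" using h_pos by simp
  have A0: "0 \<le> ?A" "0 \<le> c_diff * ?\<eta>" using c_nonneg c_diff0 e0 by simp_all
  have B0: "0 \<le> ?B" using A0 mu by simp
  have "?B / (c_rate + 1) \<le> ?B / 1" by (rule divide_left_mono[OF _ B0]) (use c_rate_ge in auto)
  then have l: "4 * err 0 + 6 * ?A + 2 * (?B / (c_rate + 1)) \<le> 4 * err 0 + c_step * ?\<eta>"
  proof -
    have "c_step * ?\<eta> = 6 * ?A + 2 * ?B + 4 * S\<^sup>2 * ?\<eta>" by (simp add: c_step_def algebra_simps)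
    moreover have "0 \<le> 4 * S\<^sup>2 * ?\<eta>" using e0 by simp
    ultimately show ?thesis using \<open>?B / (c_rate + 1) \<le> ?B / 1\<close> by linarith
  qed
  have T0: "0 \<le> 4 * err 0 + c_step * ?\<eta>"
    using err_nonneg[of 0] T c_step0 e0 by (intro add_nonneg_nonneg mult_nonneg_nonneg) auto
  have "err t1 \<le> exp ((c_rate + 1) * (t1 - 0)) * (4 * err 0 + 6 * ?A + 2 * (?B / (c_rate + 1)))"
    by (rule window[OF comparator_diff[OF t(1)] t(2)]) (use A0 in auto)
  also have "\<dots> \<le> exp ((c_rate + 1) * (t1 - 0)) * (4 * err 0 + c_step * ?\<eta>)" by (rule mult_left_mono[OF l]) simp
  also have "\<dots> \<le> 3 * exp ((c_rate + 1) * t1) * (4 * err 0 + c_step * ?\<eta>)" by (rule mult_right_mono[OF _ T0]) simp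
  finally show ?thesis .
qed

text \<open>For r = 1 / \<tau> the residual contributes 2 S^2 / r / (c_rate + r), which is at most 2
  S^2 \<tau>^2, and the additional growth during a time of at most \<tau> is at most exp 1 \<le>
  3.\<close>

lemma step_const:
  assumes t: "0 \<le> t0" "t1 \<le> T" "t0 \<le> t1" "t1 \<le> t0 + \<tau>"
  shows "err t1 \<le> 3 * exp ((c_rate + 1) * (t1 - t0)) * (4 * err t0 + c_step * h ^ (2 * q + 2))"
proof -
  let ?\<eta> = "h ^ (2 * q + 2)" let ?A = "c_approx * ?\<eta>"
  let ?B = "(22 + 2 * \<mu>) * ?A" let ?r = "1 / \<tau>"
  have e0: "0 \<le> ?\<eta>" using h_pos by simp
  have tp: "0 < \<tau>" by (rule tau_pos)
  have rp: "0 < ?r" using tp by simp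
  have A0: "0 \<le> ?A" "0 \<le> c_diff * ?\<eta>" using c_nonneg c_diff0 e0 by simp_all
  have B0: "0 \<le> ?B" using A0 mu by simp
  have 1: "?B / (c_rate + ?r) \<le> ?B / 1" 
  proof (rule divide_left_mono[OF _ B0])
    show "1 \<le> c_rate + ?r" using c_rate_ge rp by linarith
    then have "0 < c_rate + ?r" by (rule less_le_trans[OF zero_less_one])
    then show "0 < (c_rate + ?r) * 1" by (simp only: mult_1_right)
  qed
  have "2 * S\<^sup>2 / ?r / (c_rate + ?r) \<le> 2 * S\<^sup>2 / ?r / ?r"
  proof (rule divide_left_mono)
    show le: "?r \<le> c_rate + ?r" using c_rate_ge by linarith
    show "0 < (c_rate + ?r) * ?r" by (rule mult_pos_pos[OF less_le_trans[OF rp le] rp])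
  qed (use tp in \<open>simp del: power_Suc\<close>)
  also have "\<dots> = 2 * S\<^sup>2 * ?\<eta>" unfolding h_sq[symmetric] by (simp add: power2_eq_square)
  finally have 2: "2 * S\<^sup>2 / ?r / (c_rate + ?r) \<le> 2 * S\<^sup>2 * ?\<eta>" .
  have l: "4 * err t0 + 6 * ?A + 2 * ((?B + 2 * S\<^sup>2 / ?r) / (c_rate + ?r)) \<le> 4 * err t0 + c_step * ?\<eta>"
  proof -
    have "c_step * ?\<eta> = 6 * ?A + 2 * ?B + 2 * (c_diff * ?\<eta>) + 2 * (2 * S\<^sup>2 * ?\<eta>)" by (simp add: c_step_def algebra_simps)
    then show ?thesis using 1 2 A0(2) unfolding add_divide_distrib distrib_left by linarith
  qed
  have T0: "0 \<le> 4 * err t0 + c_step * ?\<eta>"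
    using err_nonneg[of t0] t c_step0 e0 by (intro add_nonneg_nonneg mult_nonneg_nonneg) auto
  have "(c_rate + ?r) * (t1 - t0) \<le> 1 + (c_rate + 1) * (t1 - t0)"
  proof -
    have "?r * (t1 - t0) \<le> 1" using t tp by (simp add: pos_divide_le_eq del: power_Suc)
    moreover have "x + y \<le> 1 + (x + z)" if "y \<le> 1" "0 \<le> z" for x y z :: real using that by linarith
    ultimately show ?thesis using t(3) unfolding distrib_right mult_1 by simp
  qed
  then have "exp ((c_rate + ?r) * (t1 - t0)) \<le> exp (1 + (c_rate + 1) * (t1 - t0))" by simp
  also have "\<dots> \<le> 3 * exp ((c_rate + 1) * (t1 - t0))"
    unfolding exp_add by (intro mult_right_mono exp_le) simp
  finally have e: "exp ((c_rate + ?r) * (t1 - t0)) \<le> 3 * exp ((c_rate + 1) * (t1 - t0))" .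
  have "err t1 \<le> exp ((c_rate + ?r) * (t1 - t0)) * (4 * err t0 + 6 * ?A + 2 * ((?B + 2 * S\<^sup>2 / ?r) / (c_rate + ?r)))"
    by (rule window[OF comparator_const[OF t] t(3) rp]) simp
  also have "\<dots> \<le> exp ((c_rate + ?r) * (t1 - t0)) * (4 * err t0 + c_step * ?\<eta>)" by (rule mult_left_mono[OF l]) simp
  also have "\<dots> \<le> 3 * exp ((c_rate + 1) * (t1 - t0)) * (4 * err t0 + c_step * ?\<eta>)" by (rule mult_right_mono[OF e T0])
  finally show ?thesis .
qed

lemma err_bound:
  assumes t: "t \<in> {0..T}"
  shows "err t \<le> exp ((c_rate + 1) * t) * (144 * err 0 + 39 * (c_step * h ^ (2 * q + 2)))"
proof -
  let ?k = "c_step * h ^ (2 * q + 2)" let ?e = "\<lambda>t. exp ((c_rate + 1) * t)"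
  have k0: "0 \<le> ?k" using c_step0 h_pos by simp
  have e0: "0 \<le> err 0" using err_nonneg[of 0] T by simp
  have one: "?e t * (3 * (4 * err 0 + ?k)) \<le> ?e t * (144 * err 0 + 39 * ?k)" 
  proof (rule mult_left_mono)
    show "3 * (4 * err 0 + ?k) \<le> 144 * err 0 + 39 * ?k"
    proof -
      have "3 * (4 * x + y) \<le> 144 * x + 39 * y" if "0 \<le> x" "0 \<le> y" for x y :: real using that by simp
      then show ?thesis using e0 k0 .
    qed
  qed simp
  consider "t + \<tau> \<le> T" | "t \<le> \<tau>" | "T < t + \<tau>" "\<tau> < t" by linarith
  then show ?thesis
  proof cases
    case 1
    have "err t \<le> 3 * ?e t * (4 * err 0 + ?k)" by (rule step_diff[OF 1]) (use t in simp)
    also have "\<dots> = ?e t * (3 * (4 * err 0 + ?k))" by (simp only: mult_ac)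
    finally show ?thesis using one by (rule order_trans)
  next
    case 2
    have "err t \<le> 3 * exp ((c_rate + 1) * (t - 0)) * (4 * err 0 + ?k)" by (rule step_const) (use t 2 in auto)
    also have "\<dots> = ?e t * (3 * (4 * err 0 + ?k))" by (simp only: mult_ac diff_zero)
    finally show ?thesis using one by (rule order_trans)
  next
    case 3
    define s where "s = T - \<tau>"
    have s: "s + \<tau> \<le> T" "0 \<le> s" "s \<le> t" "t \<le> s + \<tau>" using 3 t tau_pos by (auto simp: s_def)
    have e1: "1 \<le> ?e s" using s c_rate_ge by simp
    have "err t \<le> 3 * ?e (t - s) * (4 * err s + ?k)" by (rule step_const) (use s t in auto)
    also have "\<dots> \<le> 3 * ?e (t - s) * (?e s * (48 * err 0 + 13 * ?k))"
    proof (rule mult_left_mono)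
      have "4 * err s \<le> 4 * (3 * ?e s * (4 * err 0 + ?k))" by (rule mult_left_mono[OF step_diff[OF s(1,2)]]) simp
      also have "\<dots> = ?e s * (12 * (4 * err 0 + ?k))" by (simp add: algebra_simps)
      finally have "4 * err s \<le> ?e s * (12 * (4 * err 0 + ?k))" .
      moreover have "1 * ?k \<le> ?e s * ?k" by (rule mult_right_mono[OF e1 k0])
      moreover have "?e s * (48 * err 0 + 13 * ?k) = ?e s * (12 * (4 * err 0 + ?k)) + ?e s * ?k" by (simp add: algebra_simps)
      ultimately show "4 * err s + ?k \<le> ?e s * (48 * err 0 + 13 * ?k)" by linarith
    qed simp
    also have "\<dots> = (?e (t - s) * ?e s) * (144 * err 0 + 39 * ?k)" by (simp only: algebra_simps)
    also have "?e (t - s) * ?e s = ?e t" unfolding exp_add[symmetric] by (simp add: algebra_simps)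
    finally show ?thesis .
  qed
qed

lemma u_taylor:
  assumes t: "t \<in> {0..T}"
  obtains p where "\<And>K. K \<in> \<T> \<Longrightarrow> p K \<in> Qpoly q"
    "brk (\<lambda>K x. (u t x - p K x)\<^sup>2) \<le> c_taylor * h ^ (2 * q + 2)" "qd (\<lambda>K x. (u t x - p K x)\<^sup>2) \<le> c_taylor * h ^ (2 * q + 2)"
proof -
  have "CS (2 * q + 1) (u t)" by (rule JS_le[OF JS_static[OF u_JS t]]) simp
  then show thesis using taylor_sq[of "u t"] Su[OF t] q1 that by auto
qed

text \<open>For v and w this is the projection error. The L^2 projection of u is at least as close
  to the Taylor polynomial as u is; the difference of these two is a polynomial on each element, so
  this L^2 bound is also a bound at the nodes, as \<open>err\<close> requires.\<close>

lemma initial_error: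
  assumes P: "is_L2_projection a b \<T> q (u 0) (uh 0)"
    and v0: "\<And>K x. K \<in> \<T> \<Longrightarrow> x \<in> cell K \<Longrightarrow> vh 0 x = tensor_radau True q K (v 0) x"
    and w0: "\<And>K x. K \<in> \<T> \<Longrightarrow> x \<in> cell K \<Longrightarrow> wh 0 x = tensor_radau False q K (w 0) x"
  shows "err 0 \<le> (4 * c_taylor + 2 * c_tensor) * h ^ (2 * q + 2)"
proof -
  have t: "0 \<in> {0..T}" using T by simp
  note k = u_cont[OF t] v_cont[OF t] w_cont[OF t] pcs_cont[OF t] tensor_cont[OF CS2_v[OF t], of True] tensor_cont[OF CS2_w[OF t], of False]
  have eq: "brk (\<lambda>K x. (g x - pc gh 0 K x)\<^sup>2) = brk (\<lambda>K x. (R K x - g x)\<^sup>2)"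
    if d: "disc gh" and e: "\<And>K x. K \<in> \<T> \<Longrightarrow> x \<in> cell K \<Longrightarrow> gh 0 x = R K x" and c: "pcont (\<lambda>K. g)" "pcont (pc gh 0)" "pcont R" for g gh R
  proof -
    have "(\<Sum>K\<in>\<T>. LINT x:cell K|lebesgue. (g x - gh 0 x)\<^sup>2) = brk (\<lambda>K x. (g x - pc gh 0 K x)\<^sup>2)"
      by (rule brk_cell) (simp_all add: pc_disc(2)[OF d t] pcont_intros c)
    moreover have "(\<Sum>K\<in>\<T>. LINT x:cell K|lebesgue. (g x - gh 0 x)\<^sup>2) = brk (\<lambda>K x. (R K x - g x)\<^sup>2)"
      by (rule brk_cell) (simp_all add: e power2_commute pcont_intros c)
    ultimately show ?thesis by simp
  qed
  have ev: "brk (\<lambda>K x. (v 0 x - V 0 K x)\<^sup>2) \<le> c_tensor * h ^ (2 * q + 2)"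
  proof -
    have "brk (\<lambda>K x. (v 0 x - V 0 K x)\<^sup>2) = brk (\<lambda>K x. (tensor_radau True q K (v 0) x - v 0 x)\<^sup>2)"
      by (rule eq[OF disc_sol(2) v0 k(2,5,9)])
    also have "\<dots> \<le> c_tensor * h ^ (2 * q + 2)"
      unfolding c_tensor_def by (rule tensor_nsq[OF JS_le[OF JS_static[OF v_JS t]] Sv[OF t]]) auto
    finally show ?thesis .
  qed
  have ew: "brk (\<lambda>K x. (w 0 x - W 0 K x)\<^sup>2) \<le> c_tensor * h ^ (2 * q + 2)"
  proof -
    have "brk (\<lambda>K x. (w 0 x - W 0 K x)\<^sup>2) = brk (\<lambda>K x. (\<xi> 0 K x - w 0 x)\<^sup>2)"
      by (rule eq[OF disc_sol(3) w0 k(3,6,10)])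
    then show ?thesis using xi_error[OF t] by simp
  qed
  obtain p where p: "\<And>K. K \<in> \<T> \<Longrightarrow> p K \<in> Qpoly q"
    and b: "brk (\<lambda>K x. (u 0 x - p K x)\<^sup>2) \<le> c_taylor * h ^ (2 * q + 2)" and d: "qd (\<lambda>K x. (u 0 x - p K x)\<^sup>2) \<le> c_taylor * h ^ (2 * q + 2)"
    using u_taylor[OF t] by blast
  define r where "r K x = p K x - U 0 K x" for K x
  have r: "r K \<in> Qpoly q" if "K \<in> \<T>" for K unfolding r_def by (intro Qpoly_diff p pcs t that)
  have cp: "pcont p" by (rule pcont_Qpoly[OF p])
  have cr: "pcont r" by (rule pcont_Qpoly[OF r])
  have orth: "ip (\<lambda>K x. U 0 K x - u 0 x) r = 0"
  proof -
    have "(\<Sum>K\<in>\<T>. LINT x:cell K|lebesgue. (uh 0 x - u 0 x) * glue r x) = brk (\<lambda>K x. (U 0 K x - u 0 x) * r K x)"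
      by (rule brk_cell) (simp_all add: pc_disc(2)[OF disc_sol(1) t] glue_cell pcont_intros k cr)
    then show ?thesis using P glue_Vh[OF r] unfolding is_L2_projection_def ip_def by auto
  qed
  have "brk (\<lambda>K x. (r K x)\<^sup>2) = ip (\<lambda>K x. (p K x - u 0 x) - (U 0 K x - u 0 x)) r"
    unfolding ip_def r_def by (simp add: power2_eq_square)
  also have "\<dots> = ip (\<lambda>K x. p K x - u 0 x) r" using orth by (simp add: ip_diff pcont_intros k cp cr)
  finally have "2 * brk (\<lambda>K x. (r K x)\<^sup>2) \<le> brk (\<lambda>K x. (p K x - u 0 x)\<^sup>2) + brk (\<lambda>K x. (r K x)\<^sup>2)"
    using ip_young[of "\<lambda>K x. p K x - u 0 x" r] by (simp add: pcont_intros k cp cr)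
  then have rb: "brk (\<lambda>K x. (p K x - U 0 K x)\<^sup>2) \<le> brk (\<lambda>K x. (u 0 x - p K x)\<^sup>2)"
    unfolding r_def power2_commute[of "u 0 _"] by simp
  have lin: "y \<le> e \<Longrightarrow> z \<le> 4 * e" if "z \<le> 2 * x + 2 * y" "x \<le> e" for x y z e :: real
    using that by linarith
  have "qd (\<lambda>K x. (p K x - U 0 K x)\<^sup>2) = brk (\<lambda>K x. (p K x - U 0 K x)\<^sup>2)"
    by (rule qd_sq) (intro Qpoly_diff p pcs t)
  then have "qd (\<lambda>K x. (u 0 x - U 0 K x)\<^sup>2) \<le> 4 * (c_taylor * h ^ (2 * q + 2))"
    using lin[OF qd_sq_tri[of "\<lambda>K. u 0" "U 0" p] d] rb b by simp
  then have "err 0 \<le> 4 * (c_taylor * h ^ (2 * q + 2)) + c_tensor * h ^ (2 * q + 2) + c_tensor * h ^ (2 * q + 2)"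
    unfolding err_def by (intro add_mono ev ew)
  also have "\<dots> = (4 * c_taylor + 2 * c_tensor) * h ^ (2 * q + 2)" by (simp add: algebra_simps)
  finally show ?thesis .
qed

text \<open>576 = 4 * 144 and 156 = 4 * 39, with the numbers of \<open>err_bound\<close>. The factor
  4 and the summand 6 \<open>c_taylor\<close> come from passing from the nodal norm of u - u_h to
  the L^2 norm through a Taylor polynomial.\<close>

definition c_final :: real where
  "c_final = 576 * (4 * c_taylor + 2 * c_tensor) + 156 * c_step + 6 * c_taylor"

theorem error_estimate:
  assumes t: "t \<in> {0..T}" and P: "is_L2_projection a b \<T> q (u 0) (uh 0)"
    and v0: "\<And>K x. K \<in> \<T> \<Longrightarrow> x \<in> cell K \<Longrightarrow> vh 0 x = tensor_radau True q K (v 0) x"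
    and w0: "\<And>K x. K \<in> \<T> \<Longrightarrow> x \<in> cell K \<Longrightarrow> wh 0 x = tensor_radau False q K (w 0) x"
  shows "(L2_norm_h \<T> (\<lambda>x. u t x - uh t x))\<^sup>2 + (L2_norm_h \<T> (\<lambda>x. v t x - vh t x))\<^sup>2 + (L2_norm_h \<T> (\<lambda>x. w t x - wh t x))\<^sup>2
    \<le> c_final * exp ((c_rate + 1) * t) * h ^ (2 * (q + 1))"
proof -
  let ?\<eta> = "h ^ (2 * q + 2)" let ?e = "exp ((c_rate + 1) * t)"
  note k = u_cont[OF t] v_cont[OF t] w_cont[OF t] pcs_cont[OF t]
  have n: "(L2_norm_h \<T> (\<lambda>x. u t x - uh t x))\<^sup>2 = brk (\<lambda>K x. (u t x - U t K x)\<^sup>2)"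
    "(L2_norm_h \<T> (\<lambda>x. v t x - vh t x))\<^sup>2 = brk (\<lambda>K x. (v t x - V t K x)\<^sup>2)"
    "(L2_norm_h \<T> (\<lambda>x. w t x - wh t x))\<^sup>2 = brk (\<lambda>K x. (w t x - W t K x)\<^sup>2)"
    by (rule L2_norm_h_sq; simp add: pc_disc(2)[OF disc_sol(1) t] pc_disc(2)[OF disc_sol(2) t] pc_disc(2)[OF disc_sol(3) t] pcont_intros k)+
  obtain p where p: "\<And>K. K \<in> \<T> \<Longrightarrow> p K \<in> Qpoly q"
    and b: "brk (\<lambda>K x. (u t x - p K x)\<^sup>2) \<le> c_taylor * ?\<eta>" and d: "qd (\<lambda>K x. (u t x - p K x)\<^sup>2) \<le> c_taylor * ?\<eta>"
    using u_taylor[OF t] by blast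
  have cp: "pcont p" by (rule pcont_Qpoly[OF p])
  have 1: "brk (\<lambda>K x. (u t x - U t K x)\<^sup>2) \<le> 2 * brk (\<lambda>K x. (u t x - p K x)\<^sup>2) + 2 * brk (\<lambda>K x. (p K x - U t K x)\<^sup>2)"
    by (rule brk_sq_tri[OF k(1) cp k(4)])
  have 2: "brk (\<lambda>K x. (p K x - U t K x)\<^sup>2) = qd (\<lambda>K x. (p K x - U t K x)\<^sup>2)"
    by (rule qd_sq[symmetric]) (intro Qpoly_diff p pcs t)
  have 3: "qd (\<lambda>K x. (p K x - U t K x)\<^sup>2) \<le> 2 * qd (\<lambda>K x. (u t x - p K x)\<^sup>2) + 2 * qd (\<lambda>K x. (u t x - U t K x)\<^sup>2)"
    using qd_sq_tri[of p "U t" "\<lambda>K. u t"] by (simp add: power2_commute[of "u t _" "p _ _"])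
  have nn: "0 \<le> brk (\<lambda>K x. (v t x - V t K x)\<^sup>2)" "0 \<le> brk (\<lambda>K x. (w t x - W t K x)\<^sup>2)"
    by (intro brk_nonneg pcont_intros k)+
  have tot: "brk (\<lambda>K x. (u t x - U t K x)\<^sup>2) + brk (\<lambda>K x. (v t x - V t K x)\<^sup>2) + brk (\<lambda>K x. (w t x - W t K x)\<^sup>2)
      \<le> 4 * err t + 6 * (c_taylor * ?\<eta>)"
    unfolding err_def using 1 2 3 b d nn by argo
  have e0: "0 \<le> c_taylor * ?\<eta>" using c_taylor0 h_pos by simp
  have "1 \<le> ?e" using t c_rate_ge by simp
  from mult_right_mono[OF this e0] have 4: "c_taylor * ?\<eta> \<le> ?e * (c_taylor * ?\<eta>)" by simp
  have "err t \<le> ?e * (144 * ((4 * c_taylor + 2 * c_tensor) * ?\<eta>) + 39 * (c_step * ?\<eta>))"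
    by (rule order_trans[OF err_bound[OF t]]) (use initial_error[OF P v0 w0] in \<open>simp del: power_Suc\<close>)
  then have "4 * err t + 6 * (c_taylor * ?\<eta>) \<le> 4 * (?e * (144 * ((4 * c_taylor + 2 * c_tensor) * ?\<eta>) + 39 * (c_step * ?\<eta>))) + 6 * (?e * (c_taylor * ?\<eta>))"
    using 4 by linarith
  also have "\<dots> = c_final * ?e * h ^ (2 * (q + 1))" unfolding c_final_def by (simp add: algebra_simps)
  finally show ?thesis unfolding n using tot by (rule order_trans[rotated])
qed

end

lemma mesh_of_cartesian:
  assumes "cartesian_mesh a b \<T>"
  obtains N X where "mesh a b \<T> N X"
  using assms unfolding cartesian_mesh_def mesh_def by blast

theorem theorem2:
  fixes a b :: "real ^ 'n::finite"
    and q :: nat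
    and \<mu> L M C\<^sub>Q \<rho> Nu Nv Nut Nvt Nwt Nv' Nw' :: real
  assumes "CARD('n) \<in> {1, 2}"
    and "\<forall>i. a $ i < b $ i"
    and "q \<ge> 1"
    and "\<mu> \<ge> 0"
  shows "\<exists>C\<^sub>0 C\<^sub>1 :: real. \<forall>T f u v w \<T> m X \<omega> uh vh wh.
    T > 0 \<longrightarrow>
    nonlinearity L M f \<longrightarrow>
    smooth_solution a b T \<mu> f q u \<longrightarrow>
    v = dt T u \<longrightarrow>
    w = (\<lambda>t. lap (u t)) \<longrightarrow>
    cartesian_mesh a b \<T> \<longrightarrow>
    shape_regular \<rho> \<T> \<longrightarrow>
    Linf_le T (broken_H \<T> (q + 1)) (H_norm \<T> (q + 1)) u Nu \<longrightarrow>
    Linf_le T (broken_H \<T> (q + 1)) (H_norm \<T> (q + 1)) v Nv \<longrightarrow>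
    Linf_le T (broken_H \<T> (q + 1)) (H_norm \<T> (q + 1)) (dt T u) Nut \<longrightarrow>
    Linf_le T (broken_H \<T> (q + 1)) (H_norm \<T> (q + 1)) (dt T v) Nvt \<longrightarrow>
    Linf_le T (broken_H \<T> (q + 1)) (H_norm \<T> (q + 1)) (dt T w) Nwt \<longrightarrow>
    Linf_le T (broken_Winf \<T> (2 * q + 4)) (Winf_norm \<T> (2 * q + 4)) v Nv' \<longrightarrow>
    Linf_le T (broken_Winf \<T> (2 * q + 4)) (Winf_norm \<T> (2 * q + 4)) w Nw' \<longrightarrow>
    quadrature_assumption a b \<T> q C\<^sub>Q m X \<omega> \<longrightarrow>
    dg_scheme a b T \<mu> f \<T> q m X \<omega> uh vh wh \<longrightarrow>
    is_L2_projection a b \<T> q (u 0) (uh 0) \<longrightarrow>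
    (\<forall>K\<in>\<T>. \<forall>x\<in>cell K. vh 0 x = tensor_radau True q K (v 0) x) \<longrightarrow>
    (\<forall>K\<in>\<T>. \<forall>x\<in>cell K. wh 0 x = tensor_radau False q K (w 0) x) \<longrightarrow>
    (\<forall>t\<in>{0..T}.
       (L2_norm_h \<T> (\<lambda>x. u t x - uh t x))\<^sup>2 + (L2_norm_h \<T> (\<lambda>x. v t x - vh t x))\<^sup>2
         + (L2_norm_h \<T> (\<lambda>x. w t x - wh t x))\<^sup>2
       \<le> C\<^sub>0 * exp (C\<^sub>1 * t) * mesh_size \<T> ^ (2 * (q + 1)))"
proof -
  \<comment> \<open>\<open>Nvt\<close> gives the L^2 bounds of u_tt, \<open>Nv'\<close> and
    \<open>Nw'\<close> the pointwise bounds of v and w, and the last summand those of u recovered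
    from its Laplacian. Absolute values make the sum an upper bound for each of them.\<close>
  define S where "S = \<bar>Nvt\<bar> + \<bar>Nv'\<bar> + \<bar>Nw'\<bar> + \<bar>sup_const a b \<bar>Nw'\<bar>\<bar>"
  have S: "0 \<le> S" "Nv' \<le> S" "Nw' \<le> S" "sup_const a b \<bar>Nw'\<bar> \<le> S" "\<bar>Nvt\<bar> \<le> S"
    unfolding S_def by linarith+
  show ?thesis
  \<comment> \<open>Both witnesses are functions of the data fixed before the quantifiers:
    \<open>T\<close>, \<open>f\<close>, the mesh, the quadrature rule and the solutions are not
    among their arguments.\<close>
  proof (rule exI[of _ "dg_error.c_final a b q \<mu> M C\<^sub>Q S"], rule exI[of _ "dg_error.c_rate \<mu> M + 1"], intro allI impI ballI)
    fix T f u v w \<T> m X \<omega> uh vh wh t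
    assume T: "T > 0" and nl: "nonlinearity L M f" and sol: "smooth_solution a b T \<mu> f q u"
      and v: "v = dt T u" and w: "w = (\<lambda>t. lap (u t))" and cm: "cartesian_mesh a b \<T>"
      and Nvt: "Linf_le T (broken_H \<T> (q + 1)) (H_norm \<T> (q + 1)) (dt T v) Nvt"
      and Nv': "Linf_le T (broken_Winf \<T> (2 * q + 4)) (Winf_norm \<T> (2 * q + 4)) v Nv'"
      and Nw': "Linf_le T (broken_Winf \<T> (2 * q + 4)) (Winf_norm \<T> (2 * q + 4)) w Nw'"
      and qa: "quadrature_assumption a b \<T> q C\<^sub>Q m X \<omega>" and sch: "dg_scheme a b T \<mu> f \<T> q m X \<omega> uh vh wh"
      and P: "is_L2_projection a b \<T> q (u 0) (uh 0)"
      and v0: "\<forall>K\<in>\<T>. \<forall>x\<in>cell K. vh 0 x = tensor_radau True q K (v 0) x"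
      and w0: "\<forall>K\<in>\<T>. \<forall>x\<in>cell K. wh 0 x = tensor_radau False q K (w 0) x"
      and t: "t \<in> {0..T}"
    obtain N Y where "mesh a b \<T> N Y" using mesh_of_cartesian[OF cm] .
    then interpret mesh a b \<T> N Y .
    have JS: "JS (2 * q + 6) {0..T} u" "JS (2 * q + 4) {0..T} v" "JS (q + 1) {0..T} (dt T v)"
      using sol unfolding smooth_solution_def v by (blast intro: spatial_C_JS)+
    have wJS: "JS (2 * q + 4) {0..T} w"
      unfolding w by (rule JS_lap) (use JS(1) in \<open>simp add: eval_nat_numeral del: JS.simps\<close>)
    have Sv: "\<bar>pds is (v t) x\<bar> \<le> S" if "t \<in> {0..T}" "length is \<le> 2 * q + 4" "x \<in> cbox a b" for t "is" x
      using Winf_bound[OF T JS(2) Nv' that] S by linarith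
    have Sw': "\<bar>pds is (w t) x\<bar> \<le> Nw'" if "t \<in> {0..T}" "length is \<le> 2 * q + 4" "x \<in> cbox a b" for t "is" x
      by (rule Winf_bound[OF T wJS Nw' that])
    have Su: "\<bar>pds is (u t) x\<bar> \<le> S" if i: "t \<in> {0..T}" "2 \<le> length is" "length is \<le> 2 * q + 1" "x \<in> cbox a b" for t "is" x
    proof -
      have "\<bar>pds is (u t) x\<bar> \<le> sup_const a b \<bar>Nw'\<bar>"
      proof (rule sup_bound_laplacian[OF assms(1) ab abs_ge_zero _ _ _ i(2,3,4)])
        show "CS (2 * q + 1 + 3) (u t)" by (rule JS_le[OF JS_static[OF JS(1) i(1)]]) simp
        show "periodic a b (u t)" using sol i(1) unfolding smooth_solution_def by blast
        show "\<bar>pds is (lap (u t)) x\<bar> \<le> \<bar>Nw'\<bar>" if "length is \<le> 2 * q + 1" "x \<in> cbox a b" for "is" x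
          using Sw'[OF i(1) _ that(2), of "is"] that(1) unfolding w by simp
      qed
      then show ?thesis using S(4) by linarith
    qed
    have Sa: "brk (\<lambda>K x. (pds js (dt T v t) x)\<^sup>2) \<le> S\<^sup>2" if "t \<in> {0..T}" "length js \<le> q + 1" for t js
    proof -
      have "brk (\<lambda>K x. (pds js (dt T v t) x)\<^sup>2) \<le> Nvt\<^sup>2" unfolding brk_def by (rule H_bound[OF T JS(3) Nvt that])
      also have "\<dots> \<le> S\<^sup>2" using power_mono[OF S(5), of 2] by simp
      finally show ?thesis .
    qed
    interpret dg_error a b \<T> N Y q T \<mu> M L C\<^sub>Q f m X \<omega> uh vh wh u S
    proof
      show "q \<ge> 1" "CARD('n) \<in> {1, 2}" "T > 0" "\<mu> \<ge> 0" by fact+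
      show "nonlinearity L M f" "quadrature_assumption a b \<T> q C\<^sub>Q m X \<omega>" "dg_scheme a b T \<mu> f \<T> q m X \<omega> uh vh wh"
        "smooth_solution a b T \<mu> f q u" by fact+
      show "\<bar>pds is (lap (u t)) x\<bar> \<le> S" if "t \<in> {0..T}" "length is \<le> 2 * q + 4" "x \<in> cbox a b" for t "is" x
        using Sw'[OF that] S(3) unfolding w by linarith
    qed (use S(1) Sv Su Sa v in auto)
    show "(L2_norm_h \<T> (\<lambda>x. u t x - uh t x))\<^sup>2 + (L2_norm_h \<T> (\<lambda>x. v t x - vh t x))\<^sup>2
         + (L2_norm_h \<T> (\<lambda>x. w t x - wh t x))\<^sup>2
       \<le> c_final * exp ((c_rate + 1) * t) * mesh_size \<T> ^ (2 * (q + 1))"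
      unfolding v w by (rule error_estimate[OF t P]) (use v0 w0 in \<open>simp_all add: v w\<close>)
  qed
qed

end
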